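(* Let $p,q$ be odd prime numbers, let $r\geq 1$ and assume that $q^r$ divides $p-1$. The number of isomorphism classes of noncommutative and noncocommutative Hopf algebras $A$ fitting into a cocentral extension $k\to\mathcal{O}(\mathbb{Z}_p^2)\to A\to k\mathbb{Z}_{q^r}\to k$ is precisely $\frac{1}{2}\left(\sum_{i=1}^r (q^i+q^{i-1})\right)=\frac{(q+1)(q^r-1)}{2(q-1)}$.
   Context: The base field $k$ is algebraically closed of characteristic zero. For a finite group $H$, $\mathcal{O}(H)$ is the Hopf algebra of functions $H\to k$, and $k\Gamma$ is the group algebra of $\Gamma$. A Hopf algebra map $p:A\to L$ is cocentral if $p(a_{(1)})\otimes a_{(2)}=p(a_{(2)})\otimes a_{(1)}$ for all $a\in A$. A finite-dimensional Hopf algebra $A$ fits into a cocentral extension $k\to\mathcal{O}(H)\to A\to k\mathbb{Z}_m\to k$ if there exist an injective Hopf algebra map $i:\mathcal{O}(H)\to A$ and a surjective cocentral Hopf algebra map $\pi:A\to k\mathbb{Z}_m$ with $\pi\circ i=\varepsilon(-)1$ and $i(\mathcal{O}(H))=\{a\in A : (\mathrm{id}\otimes \pi)\Delta(a)=a\otimes 1\}$. *)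

theory Defs
  imports "HOL-Algebra.Elementary_Groups" "HOL-Computational_Algebra.Polynomial"
    "HOL-Computational_Algebra.Primes"
begin

section \<open>Coordinate spaces and tensor products\<close>

text \<open>
  A finite-dimensional vector space over the field \<open>'k\<close> is represented by the space of all
  functions \<open>'i \<Rightarrow> 'k\<close> that vanish outside a finite index set \<open>X\<close>.  The tensor product of the
  spaces on \<open>X\<close> and \<open>Y\<close> is the space on \<open>X \<times> Y\<close>.  Linear maps are HOL functions
  of which only the values on that space are relevant.
\<close>

definition fspace :: "'i set \<Rightarrow> ('i \<Rightarrow> 'k::field) set" where
  "fspace X = {a. \<forall>i. i \<notin> X \<longrightarrow> a i = 0}"

definition linear_map ::
  "'i set \<Rightarrow> 'j set \<Rightarrow> (('i \<Rightarrow> 'k::field) \<Rightarrow> ('j \<Rightarrow> 'k)) \<Rightarrow> bool" where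
  "linear_map X Y f \<longleftrightarrow>
     (\<forall>a\<in>fspace X. f a \<in> fspace Y) \<and>
     (\<forall>a\<in>fspace X. \<forall>b\<in>fspace X. f (\<lambda>i. a i + b i) = (\<lambda>j. f a j + f b j)) \<and>
     (\<forall>c. \<forall>a\<in>fspace X. f (\<lambda>i. c * a i) = (\<lambda>j. c * f a j))"

definition linear_form :: "'i set \<Rightarrow> (('i \<Rightarrow> 'k::field) \<Rightarrow> 'k) \<Rightarrow> bool" where
  "linear_form X f \<longleftrightarrow>
     (\<forall>a\<in>fspace X. \<forall>b\<in>fspace X. f (\<lambda>i. a i + b i) = f a + f b) \<and>
     (\<forall>c. \<forall>a\<in>fspace X. f (\<lambda>i. c * a i) = c * f a)"

definition basis_vec :: "'i \<Rightarrow> 'i \<Rightarrow> 'k::field" where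
  "basis_vec i = (\<lambda>j. if j = i then 1 else 0)"

definition tens :: "('i \<Rightarrow> 'k::field) \<Rightarrow> ('j \<Rightarrow> 'k) \<Rightarrow> 'i \<times> 'j \<Rightarrow> 'k" (infixr \<open>\<otimes>\<^sub>k\<close> 75) where
  "a \<otimes>\<^sub>k b = (\<lambda>(i, j). a i * b j)"

text \<open>
  \<open>tens_map X Y f g\<close> is the linear map \<open>f \<otimes> g\<close> on the tensor product of the spaces on \<open>X\<close>
  and \<open>Y\<close>: the coefficient of \<open>t\<close> at \<open>(x, y)\<close> multiplies \<open>f e\<^sub>x \<otimes> g e\<^sub>y\<close>.
\<close>

definition tens_map ::
  "'i set \<Rightarrow> 'j set \<Rightarrow> (('i \<Rightarrow> 'k::field) \<Rightarrow> ('m \<Rightarrow> 'k)) \<Rightarrow> (('j \<Rightarrow> 'k) \<Rightarrow> ('n \<Rightarrow> 'k))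
     \<Rightarrow> ('i \<times> 'j \<Rightarrow> 'k) \<Rightarrow> ('m \<times> 'n \<Rightarrow> 'k)" where
  "tens_map X Y f g t =
     (\<lambda>z. \<Sum>x\<in>X. \<Sum>y\<in>Y. t (x, y) * (f (basis_vec x) \<otimes>\<^sub>k g (basis_vec y)) z)"

definition tens_flip :: "('i \<times> 'j \<Rightarrow> 'k) \<Rightarrow> ('j \<times> 'i \<Rightarrow> 'k)" where
  "tens_flip t = (\<lambda>(i, j). t (j, i))"

definition tens_assoc :: "(('i \<times> 'j) \<times> 'l \<Rightarrow> 'k) \<Rightarrow> ('i \<times> ('j \<times> 'l) \<Rightarrow> 'k)" where
  "tens_assoc t = (\<lambda>(i, (j, l)). t ((i, j), l))"

text \<open>\<open>a \<otimes> b \<otimes> c \<otimes> d \<mapsto> a \<otimes> c \<otimes> b \<otimes> d\<close>\<close>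

definition tens_mid_flip ::
  "(('i \<times> 'j) \<times> ('l \<times> 'm) \<Rightarrow> 'k) \<Rightarrow> (('i \<times> 'l) \<times> ('j \<times> 'm) \<Rightarrow> 'k)" where
  "tens_mid_flip t = (\<lambda>((i, l), (j, m)). t ((i, j), (l, m)))"

section \<open>Finite-dimensional Hopf algebras\<close>

text \<open>The multiplication is a linear map defined on the tensor square.\<close>

record ('i, 'k) hopf_data =
  index :: "'i set"
  hmult :: "('i \<times> 'i \<Rightarrow> 'k) \<Rightarrow> ('i \<Rightarrow> 'k)"
  hunit :: "'i \<Rightarrow> 'k"
  hcomult :: "('i \<Rightarrow> 'k) \<Rightarrow> ('i \<times> 'i \<Rightarrow> 'k)"
  hcounit :: "('i \<Rightarrow> 'k) \<Rightarrow> 'k"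

definition hspace :: "('i, 'k::field) hopf_data \<Rightarrow> ('i \<Rightarrow> 'k) set" where
  "hspace A = fspace (index A)"

locale fd_algebra =
  fixes A :: "('i, 'k::field) hopf_data"
  assumes finite_index: "finite (index A)"
    and mult_linear: "linear_map (index A \<times> index A) (index A) (hmult A)"
    and unit_closed: "hunit A \<in> hspace A"
    and mult_assoc: "\<lbrakk>a \<in> hspace A; b \<in> hspace A; c \<in> hspace A\<rbrakk> \<Longrightarrow>
      hmult A (hmult A (a \<otimes>\<^sub>k b) \<otimes>\<^sub>k c) = hmult A (a \<otimes>\<^sub>k hmult A (b \<otimes>\<^sub>k c))"
    and mult_unit_left: "a \<in> hspace A \<Longrightarrow> hmult A (hunit A \<otimes>\<^sub>k a) = a"
    and mult_unit_right: "a \<in> hspace A \<Longrightarrow> hmult A (a \<otimes>\<^sub>k hunit A) = a"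

locale fd_coalgebra =
  fixes A :: "('i, 'k::field) hopf_data"
  assumes finite_index: "finite (index A)"
    and comult_linear: "linear_map (index A) (index A \<times> index A) (hcomult A)"
    and counit_linear: "linear_form (index A) (hcounit A)"
    and comult_coassoc: "a \<in> hspace A \<Longrightarrow>
      tens_assoc (tens_map (index A) (index A) (hcomult A) (\<lambda>b. b) (hcomult A a))
      = tens_map (index A) (index A) (\<lambda>b. b) (hcomult A) (hcomult A a)"
    and comult_counit_left: "a \<in> hspace A \<Longrightarrow>
      (\<lambda>j. \<Sum>i\<in>index A. hcounit A (basis_vec i) * hcomult A a (i, j)) = a"
    and comult_counit_right: "a \<in> hspace A \<Longrightarrow>
      (\<lambda>i. \<Sum>j\<in>index A. hcomult A a (i, j) * hcounit A (basis_vec j)) = a"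

locale fd_bialgebra = fd_algebra A + fd_coalgebra A for A :: "('i, 'k::field) hopf_data" +
  assumes comult_mult: "\<lbrakk>a \<in> hspace A; b \<in> hspace A\<rbrakk> \<Longrightarrow>
      hcomult A (hmult A (a \<otimes>\<^sub>k b))
      = tens_map (index A \<times> index A) (index A \<times> index A) (hmult A) (hmult A)
          (tens_mid_flip (hcomult A a \<otimes>\<^sub>k hcomult A b))"
    and comult_unit: "hcomult A (hunit A) = hunit A \<otimes>\<^sub>k hunit A"
    and counit_mult: "\<lbrakk>a \<in> hspace A; b \<in> hspace A\<rbrakk> \<Longrightarrow>
      hcounit A (hmult A (a \<otimes>\<^sub>k b)) = hcounit A a * hcounit A b"
    and counit_unit: "hcounit A (hunit A) = 1"

definition is_antipode ::
  "('i, 'k::field) hopf_data \<Rightarrow> (('i \<Rightarrow> 'k) \<Rightarrow> ('i \<Rightarrow> 'k)) \<Rightarrow> bool" where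
  "is_antipode A S \<longleftrightarrow> linear_map (index A) (index A) S \<and>
     (\<forall>a\<in>hspace A.
        hmult A (tens_map (index A) (index A) S (\<lambda>b. b) (hcomult A a))
          = (\<lambda>i. hcounit A a * hunit A i) \<and>
        hmult A (tens_map (index A) (index A) (\<lambda>b. b) S (hcomult A a))
          = (\<lambda>i. hcounit A a * hunit A i))"

text \<open>
  The antipode of a bialgebra is unique if it exists, and bialgebra maps between Hopf algebras
  commute with the antipodes; hence it is not part of the data.
\<close>

locale fd_hopf_algebra = fd_bialgebra A for A :: "('i, 'k::field) hopf_data" +
  assumes antipode_exists: "\<exists>S. is_antipode A S"

definition hopf_commutative :: "('i, 'k::field) hopf_data \<Rightarrow> bool" where
  "hopf_commutative A \<longleftrightarrow>
     (\<forall>a\<in>hspace A. \<forall>b\<in>hspace A. hmult A (a \<otimes>\<^sub>k b) = hmult A (b \<otimes>\<^sub>k a))"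

definition hopf_cocommutative :: "('i, 'k::field) hopf_data \<Rightarrow> bool" where
  "hopf_cocommutative A \<longleftrightarrow> (\<forall>a\<in>hspace A. tens_flip (hcomult A a) = hcomult A a)"

definition hopf_map ::
  "('i, 'k::field) hopf_data \<Rightarrow> ('j, 'k) hopf_data \<Rightarrow> (('i \<Rightarrow> 'k) \<Rightarrow> ('j \<Rightarrow> 'k)) \<Rightarrow> bool" where
  "hopf_map A B f \<longleftrightarrow> linear_map (index A) (index B) f \<and>
     (\<forall>a\<in>hspace A. \<forall>b\<in>hspace A. f (hmult A (a \<otimes>\<^sub>k b)) = hmult B (f a \<otimes>\<^sub>k f b)) \<and>
     f (hunit A) = hunit B \<and>
     (\<forall>a\<in>hspace A. hcomult B (f a) = tens_map (index A) (index A) f f (hcomult A a)) \<and>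
     (\<forall>a\<in>hspace A. hcounit B (f a) = hcounit A a)"

text \<open>
  Isomorphism, as a relation between Hopf algebras with bases indexed by the same type.  Every
  finite-dimensional Hopf algebra has an isomorphic copy with a basis indexed by a finite set of
  natural numbers, so for \<open>'i = nat\<close> the classes of this relation are the isomorphism classes of
  all finite-dimensional Hopf algebras over \<open>'k\<close>.
\<close>

definition hopf_iso_rel :: "(('i, 'k::field) hopf_data \<times> ('i, 'k) hopf_data) set" where
  "hopf_iso_rel = {(A, B). fd_hopf_algebra A \<and> fd_hopf_algebra B \<and>
     (\<exists>f. hopf_map A B f \<and> bij_betw f (hspace A) (hspace B))}"

section \<open>Function algebras and group algebras of finite groups\<close>

definition fun_hopf :: "('g, 'm) monoid_scheme \<Rightarrow> ('g, 'k::field) hopf_data" where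
  "fun_hopf H = \<lparr> index = carrier H,
     hmult = (\<lambda>t x. t (x, x)),
     hunit = (\<lambda>x. if x \<in> carrier H then 1 else 0),
     hcomult = (\<lambda>a (x, y). if x \<in> carrier H \<and> y \<in> carrier H then a (x \<otimes>\<^bsub>H\<^esub> y) else 0),
     hcounit = (\<lambda>a. a \<one>\<^bsub>H\<^esub>) \<rparr>"

text \<open>In the group algebra the function \<open>a\<close> stands for the formal sum of the \<open>a x\<close> times \<open>x\<close>.\<close>

definition group_hopf :: "('g, 'm) monoid_scheme \<Rightarrow> ('g, 'k::field) hopf_data" where
  "group_hopf G = \<lparr> index = carrier G,
     hmult = (\<lambda>t z. \<Sum>(x, y)\<in>{(x, y) \<in> carrier G \<times> carrier G. x \<otimes>\<^bsub>G\<^esub> y = z}. t (x, y)),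
     hunit = basis_vec \<one>\<^bsub>G\<^esub>,
     hcomult = (\<lambda>a (x, y). if x = y then a x else 0),
     hcounit = (\<lambda>a. \<Sum>x\<in>carrier G. a x) \<rparr>"

section \<open>Cocentral extensions\<close>

definition cocentral ::
  "('i, 'k::field) hopf_data \<Rightarrow> ('j, 'k) hopf_data \<Rightarrow> (('i \<Rightarrow> 'k) \<Rightarrow> ('j \<Rightarrow> 'k)) \<Rightarrow> bool" where
  "cocentral A L p \<longleftrightarrow> (\<forall>a\<in>hspace A.
     tens_map (index A) (index A) p (\<lambda>b. b) (hcomult A a)
     = tens_map (index A) (index A) p (\<lambda>b. b) (tens_flip (hcomult A a)))"

definition cocentral_extension ::
  "('i, 'k::field) hopf_data \<Rightarrow> ('j, 'k) hopf_data \<Rightarrow> ('l, 'k) hopf_data \<Rightarrow> bool" where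
  "cocentral_extension B A L \<longleftrightarrow> (\<exists>i \<pi>.
     hopf_map B A i \<and> inj_on i (hspace B) \<and>
     hopf_map A L \<pi> \<and> \<pi> ` hspace A = hspace L \<and> cocentral A L \<pi> \<and>
     (\<forall>b\<in>hspace B. \<pi> (i b) = (\<lambda>j. hcounit B b * hunit L j)) \<and>
     i ` hspace B = {a \<in> hspace A.
       tens_map (index A) (index A) (\<lambda>b. b) \<pi> (hcomult A a) = a \<otimes>\<^sub>k hunit L})"

end

theory Submission
  imports Defs "HOL-Library.Function_Algebras" "HOL-Number_Theory.Number_Theory" "HOL-Library.Countable"
begin

text \<open>
  Cocentrality turns the surjection onto \<open>k\<int>\<^sub>m\<close> with \<open>m = q\<^sup>r\<close> into a Hopf algebra grading of \<open>A\<close> by \<open>\<int>\<^sub>m\<close> whose degree 0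
  part is \<open>\<O>(\<int>\<^sub>p\<^sup>2)\<close>. The grading is strong and the degree 0 part is commutative and semisimple, so degree 1 contains
  an invertible element \<open>u\<close>. Conjugation by \<open>u\<close> is an automorphism \<open>\<alpha>\<close> of \<open>\<int>\<^sub>p\<^sup>2\<close> with \<open>\<alpha>\<^sup>m = 1\<close>, and
  \<open>\<Delta>(u) = \<sigma> (u \<otimes> u)\<close> for a two-cocycle \<open>\<sigma>\<close> on \<open>\<int>\<^sub>p\<^sup>2\<close> that is not symmetric when \<open>A\<close> is not cocommutative.
  As \<open>q\<^sup>r\<close> divides \<open>p - 1\<close>, \<open>\<alpha>\<close> can be diagonalised to \<open>diag(\<gamma>\<^sup>i, \<gamma>\<^sup>j)\<close> with \<open>\<gamma>\<close> of order \<open>m\<close> modulo \<open>p\<close>; rescaling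
  \<open>u\<close> makes \<open>\<sigma>\<close> the standard bicharacter and \<open>u\<^sup>m = 1\<close>. The coproduct of \<open>u\<^sup>m\<close> shows that this is consistent precisely
  when \<open>\<gamma>\<^bsup>i + j\<^esup> \<noteq> 1\<close>, which already implies that \<open>A\<close> is noncommutative.

  Hence isomorphism classes correspond to pairs \<open>(i, j)\<close> modulo \<open>m\<close> with \<open>i + j \<noteq> 0\<close>, up to exchanging
  the entries and multiplying both by a unit (another generator of \<open>\<int>\<^sub>m\<close>). Such a class is represented by
  \<open>(q\<^sup>s, q\<^sup>s c)\<close> with \<open>s < r\<close> and \<open>c \<noteq> - 1\<close> modulo \<open>n = q\<^bsup>r - s\<^esup>\<close>, where only \<open>c\<close> and \<open>c\<^bsup>- 1\<^esup>\<close> are identified. The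
  fixed points of this involution are \<open>c = 1\<close> and the \<open>n / q\<close> non-units, which gives
  \<open>((n - 1) + (n / q + 1)) / 2\<close> classes for each \<open>s\<close>.
\<close>

section \<open>Coordinate vectors and tensors\<close>

text \<open>An isomorphism of Hopf algebras need not respect the extension, so the classification
  hinges on recovering the grading from \<open>A\<close> alone. Cocentral characters do this: on
  degree 0 such a character is evaluation at a point x, cocentrality tested on u gives \<sigma>(x,y)
  = \<sigma>(y,x) for all y, and nondegeneracy of the bicharacter forces x = 1. Hence cocentral
  characters act by scalars on each degree, degree 0 is common to all gradings, and two frames
  differ by an automorphism of the group and a power of u prime to m. The condition on i + j comes
  from multiplying the bicharacter along orbits of \<alpha>: the exponent in the coproduct of u^m is
  a geometric sum of powers of \<gamma>^(i+j), which is 0 modulo p unless \<gamma>^(i+j) = 1, when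
  it is m. The element u is assembled from corners e_x A_1 e_y of degree 1, using that the corners
  of degree 0 are lines or zero. One root \<omega> serves for all algebras, because scaling one
  coordinate of the group commutes with diagonal actions and turns any nontrivial p-th root of unity
  into any other.\<close>

definition smul :: "'k::field \<Rightarrow> ('i \<Rightarrow> 'k) \<Rightarrow> 'i \<Rightarrow> 'k" (infixr \<open>\<bullet>\<close> 75) where
  "c \<bullet> a = (\<lambda>i. c * a i)"

text \<open>Truncation to the coordinate space of \<open>X\<close>. A map that is linear only on
  \<open>fspace X\<close> becomes additive on all functions when composed with it, so that
  \<open>additive_sum\<close> applies without side conditions.\<close>

definition restr :: "'i set \<Rightarrow> ('i \<Rightarrow> 'k::field) \<Rightarrow> 'i \<Rightarrow> 'k" where
  "restr X a = (\<lambda>i. if i \<in> X then a i else 0)"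

text \<open>A linear form is stored as the vector of its values on the basis, so that forms can be
  added, scaled and summed like vectors.\<close>

definition pairing :: "'i set \<Rightarrow> ('i \<Rightarrow> 'k::field) \<Rightarrow> ('i \<Rightarrow> 'k) \<Rightarrow> 'k" where
  "pairing X \<phi> a = (\<Sum>i\<in>X. \<phi> i * a i)"

text \<open>The map id \<otimes> \<phi>; its mirror image \<open>slice_left\<close> is \<phi>
  \<otimes> id.\<close>

definition slice_right :: "'j set \<Rightarrow> ('j \<Rightarrow> 'k::field) \<Rightarrow> ('i \<times> 'j \<Rightarrow> 'k) \<Rightarrow> 'i \<Rightarrow> 'k" where
  "slice_right Y \<phi> t = (\<lambda>i. \<Sum>j\<in>Y. t (i, j) * \<phi> j)"

definition slice_left :: "'i set \<Rightarrow> ('i \<Rightarrow> 'k::field) \<Rightarrow> ('i \<times> 'j \<Rightarrow> 'k) \<Rightarrow> 'j \<Rightarrow> 'k" where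
  "slice_left X \<phi> t = (\<lambda>j. \<Sum>i\<in>X. \<phi> i * t (i, j))"

lemma sum_fun_apply: "(\<Sum>x\<in>I. f x) i = (\<Sum>x\<in>I. f x i)"
  by (induction I rule: infinite_finite_induct) auto

lemma additive_sum:
  assumes "h 0 = 0" "\<And>a b. h (a + b) = h a + h b"
  shows "h (\<Sum>x\<in>I. f x) = (\<Sum>x\<in>I. h (f x))"
  using sum_comp_morphism[of h f I] assms by (simp add: comp_def)

lemma smul_apply: "(c \<bullet> a) i = c * a i"
  by (simp add: smul_def)

lemma smul_simps [simp]:
  "c \<bullet> (a + b) = c \<bullet> a + c \<bullet> b" "(c + d) \<bullet> a = c \<bullet> a + d \<bullet> a"
  "0 \<bullet> a = 0" "c \<bullet> 0 = 0" "1 \<bullet> a = a" "c \<bullet> d \<bullet> a = (c * d) \<bullet> a"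
  by (auto simp: smul_def fun_eq_iff algebra_simps)

lemma smul_sum: "c \<bullet> (\<Sum>x\<in>I. f x) = (\<Sum>x\<in>I. c \<bullet> f x)"
  by (auto simp: fun_eq_iff smul_apply sum_fun_apply sum_distrib_left)

lemma sum_smul: "(\<Sum>x\<in>I. f x) \<bullet> a = (\<Sum>x\<in>I. f x \<bullet> a)"
  by (auto simp: fun_eq_iff smul_apply sum_fun_apply sum_distrib_right)

lemma smul_eq_0_iff [simp]: "c \<bullet> a = 0 \<longleftrightarrow> c = 0 \<or> a = 0"
  by (auto simp: fun_eq_iff smul_apply)

lemma fspace_closed [simp, intro]:
  "0 \<in> fspace X" "a \<in> fspace X \<Longrightarrow> b \<in> fspace X \<Longrightarrow> a + b \<in> fspace X"
  "a \<in> fspace X \<Longrightarrow> c \<bullet> a \<in> fspace X" "restr X a \<in> fspace X"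
  "i \<in> X \<Longrightarrow> basis_vec i \<in> fspace X"
  "a \<in> fspace X \<Longrightarrow> b \<in> fspace Y \<Longrightarrow> a \<otimes>\<^sub>k b \<in> fspace (X \<times> Y)"
  by (auto simp: fspace_def smul_def restr_def basis_vec_def tens_def)

lemma fspace_sum [simp, intro]: "(\<And>x. x \<in> I \<Longrightarrow> f x \<in> fspace X) \<Longrightarrow> (\<Sum>x\<in>I. f x) \<in> fspace X"
  by (induction I rule: infinite_finite_induct) auto

lemma restr_id [simp]: "a \<in> fspace X \<Longrightarrow> restr X a = a"
  by (auto simp: restr_def fspace_def)

lemma restr_simps [simp]:
  "restr X (a + b) = restr X a + restr X b" "restr X (c \<bullet> a) = c \<bullet> restr X a" "restr X 0 = 0"
  by (auto simp: restr_def smul_def fun_eq_iff)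

lemma tens_simps [simp]:
  "(a + b) \<otimes>\<^sub>k c = a \<otimes>\<^sub>k c + b \<otimes>\<^sub>k c" "c \<otimes>\<^sub>k (a + b) = c \<otimes>\<^sub>k a + c \<otimes>\<^sub>k b"
  "(x \<bullet> a) \<otimes>\<^sub>k c = x \<bullet> (a \<otimes>\<^sub>k c)" "c \<otimes>\<^sub>k (x \<bullet> a) = x \<bullet> (c \<otimes>\<^sub>k a)"
  "0 \<otimes>\<^sub>k c = 0" "c \<otimes>\<^sub>k 0 = 0"
  by (auto simp: tens_def smul_def fun_eq_iff algebra_simps)

lemma tens_sum_left: "(\<Sum>x\<in>I. f x) \<otimes>\<^sub>k c = (\<Sum>x\<in>I. f x \<otimes>\<^sub>k c)"
  by (rule additive_sum[of "\<lambda>a. a \<otimes>\<^sub>k c"]) simp_all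

lemma tens_sum_right: "c \<otimes>\<^sub>k (\<Sum>x\<in>I. f x) = (\<Sum>x\<in>I. c \<otimes>\<^sub>k f x)"
  by (rule additive_sum[of "\<lambda>a. c \<otimes>\<^sub>k a"]) simp_all

lemma tens_eq_0_iff: "a \<otimes>\<^sub>k b = 0 \<longleftrightarrow> a = 0 \<or> b = 0"
  by (auto simp: tens_def fun_eq_iff)

lemma tens_apply: "(a \<otimes>\<^sub>k b) (i, j) = a i * b j"
  by (simp add: tens_def)

lemma tens_basis_vec: "basis_vec x \<otimes>\<^sub>k basis_vec y = basis_vec (x, y)"
  by (auto simp: tens_def basis_vec_def fun_eq_iff)

lemma basis_expansion:
  assumes "finite X" "a \<in> fspace X" shows "a = (\<Sum>x\<in>X. a x \<bullet> basis_vec x)"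
proof
  fix i
  have "(\<Sum>x\<in>X. a x \<bullet> basis_vec x) i = (\<Sum>x\<in>X. if x = i then a x else 0)"
    unfolding sum_fun_apply by (intro sum.cong) (auto simp: smul_apply basis_vec_def)
  also have "\<dots> = a i" using assms by (simp add: fspace_def)
  finally show "a i = (\<Sum>x\<in>X. a x \<bullet> basis_vec x) i" ..
qed

lemma tensor_expansion:
  assumes "finite X" "finite Y" "t \<in> fspace (X \<times> Y)"
  shows "t = (\<Sum>x\<in>X. \<Sum>y\<in>Y. t (x, y) \<bullet> (basis_vec x \<otimes>\<^sub>k basis_vec y))"
proof -
  have "t = (\<Sum>z\<in>X \<times> Y. t z \<bullet> basis_vec z)" by (rule basis_expansion) (use assms in auto)
  also have "\<dots> = (\<Sum>x\<in>X. \<Sum>y\<in>Y. t (x, y) \<bullet> (basis_vec x \<otimes>\<^sub>k basis_vec y))"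
    unfolding sum.cartesian_product by (intro sum.cong refl) (auto simp: tens_basis_vec)
  finally show ?thesis .
qed

lemma pairing_simps [simp]:
  "pairing X \<phi> (a + b) = pairing X \<phi> a + pairing X \<phi> b" "pairing X \<phi> (c \<bullet> a) = c * pairing X \<phi> a"
  "pairing X \<phi> 0 = 0" "pairing X (\<phi> + \<psi>) a = pairing X \<phi> a + pairing X \<psi> a"
  "pairing X (c \<bullet> \<phi>) a = c * pairing X \<phi> a" "pairing X 0 a = 0"
  by (auto simp: pairing_def smul_def algebra_simps sum.distrib sum_distrib_left)

lemma pairing_sum: "pairing X \<phi> (\<Sum>x\<in>I. f x) = (\<Sum>x\<in>I. pairing X \<phi> (f x))"
  by (rule additive_sum[of "pairing X \<phi>"]) simp_all

lemma pairing_sum_left: "pairing X (\<Sum>x\<in>I. f x) a = (\<Sum>x\<in>I. pairing X (f x) a)"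
  by (rule additive_sum[of "\<lambda>\<phi>. pairing X \<phi> a"]) simp_all

lemma pairing_basis_vec [simp]:
  assumes "finite X" "i \<in> X" shows "pairing X \<phi> (basis_vec i) = \<phi> i" "pairing X (basis_vec i) \<phi> = \<phi> i"
proof -
  have "(\<Sum>j\<in>X. \<phi> j * basis_vec i j) = (\<Sum>j\<in>X. if j = i then \<phi> j else 0)"
    "(\<Sum>j\<in>X. basis_vec i j * \<phi> j) = (\<Sum>j\<in>X. if j = i then \<phi> j else 0)"
    by (intro sum.cong; auto simp: basis_vec_def)+
  then show "pairing X \<phi> (basis_vec i) = \<phi> i" "pairing X (basis_vec i) \<phi> = \<phi> i"
    using assms by (auto simp: pairing_def)
qed

lemma slice_simps [simp]:
  "slice_right Y \<phi> (t + s) = slice_right Y \<phi> t + slice_right Y \<phi> s"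
  "slice_right Y \<phi> (c \<bullet> t) = c \<bullet> slice_right Y \<phi> t" "slice_right Y \<phi> 0 = 0"
  "slice_left X \<psi> (t' + s') = slice_left X \<psi> t' + slice_left X \<psi> s'"
  "slice_left X \<psi> (c \<bullet> t') = c \<bullet> slice_left X \<psi> t'" "slice_left X \<psi> 0 = 0"
  "slice_right Y \<phi> (a \<otimes>\<^sub>k b) = pairing Y \<phi> b \<bullet> a" "slice_left X \<psi> (a' \<otimes>\<^sub>k b') = pairing X \<psi> a' \<bullet> b'"
  by (auto simp: slice_right_def slice_left_def pairing_def smul_def tens_def fun_eq_iff algebra_simps
      sum.distrib sum_distrib_left)

lemma slice_right_sum: "slice_right Y \<phi> (\<Sum>x\<in>I. f x) = (\<Sum>x\<in>I. slice_right Y \<phi> (f x))"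
  by (rule additive_sum[of "slice_right Y \<phi>"]) simp_all

lemma slice_left_sum: "slice_left X \<phi> (\<Sum>x\<in>I. f x) = (\<Sum>x\<in>I. slice_left X \<phi> (f x))"
  by (rule additive_sum[of "slice_left X \<phi>"]) simp_all

lemma slice_closed:
  "t \<in> fspace (X \<times> Y) \<Longrightarrow> slice_right Y \<phi> t \<in> fspace X"
  "t \<in> fspace (X \<times> Y) \<Longrightarrow> slice_left X \<psi> t \<in> fspace Y"
  by (auto simp: slice_right_def slice_left_def fspace_def)

lemma linear_map_iff:
  "linear_map X Y f \<longleftrightarrow> (\<forall>a\<in>fspace X. f a \<in> fspace Y) \<and>
     (\<forall>a\<in>fspace X. \<forall>b\<in>fspace X. f (a + b) = f a + f b) \<and>
     (\<forall>c. \<forall>a\<in>fspace X. f (c \<bullet> a) = c \<bullet> f a)"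
  by (simp add: linear_map_def plus_fun_def smul_def)

lemma linear_form_iff:
  "linear_form X f \<longleftrightarrow>
     (\<forall>a\<in>fspace X. \<forall>b\<in>fspace X. f (a + b) = f a + f b) \<and>
     (\<forall>c. \<forall>a\<in>fspace X. f (c \<bullet> a) = c * f a)"
  by (simp add: linear_form_def plus_fun_def smul_def)

lemma linear_mapD:
  assumes "linear_map X Y f"
  shows "a \<in> fspace X \<Longrightarrow> f a \<in> fspace Y"
    "a \<in> fspace X \<Longrightarrow> b \<in> fspace X \<Longrightarrow> f (a + b) = f a + f b"
    "a \<in> fspace X \<Longrightarrow> f (c \<bullet> a) = c \<bullet> f a"
    "f 0 = 0"
proof -
  show *: "a \<in> fspace X \<Longrightarrow> f (c \<bullet> a) = c \<bullet> f a" for a c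
    using assms by (simp add: linear_map_iff)
  show "f 0 = 0" using *[of 0 0] by simp
qed (use assms in \<open>simp_all add: linear_map_iff\<close>)

lemma linear_mapI:
  assumes "\<And>a. a \<in> fspace X \<Longrightarrow> f a \<in> fspace Y"
    "\<And>a b. a \<in> fspace X \<Longrightarrow> b \<in> fspace X \<Longrightarrow> f (a + b) = f a + f b"
    "\<And>a c. a \<in> fspace X \<Longrightarrow> f (c \<bullet> a) = c \<bullet> f a"
  shows "linear_map X Y f"
  using assms by (simp add: linear_map_iff)

lemma linear_map_sum:
  assumes "linear_map X Y f" "\<And>x. x \<in> I \<Longrightarrow> g x \<in> fspace X"
  shows "f (\<Sum>x\<in>I. g x) = (\<Sum>x\<in>I. f (g x))"
proof -
  have "f (restr X (\<Sum>x\<in>I. g x)) = (\<Sum>x\<in>I. f (restr X (g x)))"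
    by (rule additive_sum[of "\<lambda>a. f (restr X a)"]) (simp_all add: linear_mapD[OF assms(1)])
  then show ?thesis using assms(2) by simp
qed

lemma linear_formD:
  assumes "linear_form X f"
  shows "a \<in> fspace X \<Longrightarrow> b \<in> fspace X \<Longrightarrow> f (a + b) = f a + f b"
    "a \<in> fspace X \<Longrightarrow> f (c \<bullet> a) = c * f a"
    "f 0 = 0"
proof -
  show *: "a \<in> fspace X \<Longrightarrow> f (c \<bullet> a) = c * f a" for a c
    using assms by (simp add: linear_form_iff)
  show "f 0 = 0" using *[of 0 0] by simp
qed (use assms in \<open>simp_all add: linear_form_iff\<close>)

lemma linear_form_sum:
  assumes "linear_form X f" "\<And>x. x \<in> I \<Longrightarrow> g x \<in> fspace X"
  shows "f (\<Sum>x\<in>I. g x) = (\<Sum>x\<in>I. f (g x))"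
proof -
  have "f (restr X (\<Sum>x\<in>I. g x)) = (\<Sum>x\<in>I. f (restr X (g x)))"
    by (rule additive_sum[of "\<lambda>a. f (restr X a)"]) (simp_all add: linear_formD[OF assms(1)])
  then show ?thesis using assms(2) by simp
qed

lemma linear_map_expansion:
  assumes "linear_map X Y f" "finite X" "a \<in> fspace X"
  shows "f a = (\<Sum>x\<in>X. a x \<bullet> f (basis_vec x))"
proof -
  have "f a = f (\<Sum>x\<in>X. a x \<bullet> basis_vec x)" by (rule arg_cong[OF basis_expansion[OF assms(2,3)]])
  also have "\<dots> = (\<Sum>x\<in>X. f (a x \<bullet> basis_vec x))" by (rule linear_map_sum[OF assms(1)]) auto
  also have "\<dots> = (\<Sum>x\<in>X. a x \<bullet> f (basis_vec x))"
    by (intro sum.cong refl linear_mapD(3)[OF assms(1)]) auto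
  finally show ?thesis .
qed

lemma linear_form_pairing:
  assumes "linear_form X f" "finite X" "a \<in> fspace X"
  shows "f a = pairing X (\<lambda>x. f (basis_vec x)) a"
proof -
  have "f a = f (\<Sum>x\<in>X. a x \<bullet> basis_vec x)" by (rule arg_cong[OF basis_expansion[OF assms(2,3)]])
  also have "\<dots> = (\<Sum>x\<in>X. f (a x \<bullet> basis_vec x))" by (rule linear_form_sum[OF assms(1)]) auto
  also have "\<dots> = (\<Sum>x\<in>X. f (basis_vec x) * a x)"
    by (intro sum.cong refl) (simp add: linear_formD[OF assms(1)])
  finally show ?thesis by (simp add: pairing_def)
qed

lemma tens_map_apply:
  "tens_map X Y f g t = (\<Sum>x\<in>X. \<Sum>y\<in>Y. t (x, y) \<bullet> (f (basis_vec x) \<otimes>\<^sub>k g (basis_vec y)))"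
  by (simp add: tens_map_def fun_eq_iff sum_fun_apply smul_apply)

lemma tens_map_simps [simp]:
  "tens_map X Y f g (t + s) = tens_map X Y f g t + tens_map X Y f g s"
  "tens_map X Y f g (c \<bullet> t) = c \<bullet> tens_map X Y f g t" "tens_map X Y f g 0 = 0"
  by (simp_all add: tens_map_apply sum.distrib smul_sum smul_apply)

lemma tens_map_sum: "tens_map X Y f g (\<Sum>x\<in>I. h x) = (\<Sum>x\<in>I. tens_map X Y f g (h x))"
  by (rule additive_sum[of "tens_map X Y f g"]) simp_all

lemma tens_map_tens:
  assumes "linear_map X X' f" "linear_map Y Y' g" "finite X" "finite Y" "a \<in> fspace X" "b \<in> fspace Y"
  shows "tens_map X Y f g (a \<otimes>\<^sub>k b) = f a \<otimes>\<^sub>k g b"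
proof -
  have "f a \<otimes>\<^sub>k g b = (\<Sum>x\<in>X. a x \<bullet> f (basis_vec x)) \<otimes>\<^sub>k (\<Sum>y\<in>Y. b y \<bullet> g (basis_vec y))"
    by (intro arg_cong2[of _ _ _ _ tens] linear_map_expansion[OF assms(1,3,5)] linear_map_expansion[OF assms(2,4,6)])
  also have "\<dots> = tens_map X Y f g (a \<otimes>\<^sub>k b)"
    unfolding tens_map_apply tens_sum_left unfolding tens_sum_right
    by (simp add: tens_apply mult.commute)
  finally show ?thesis ..
qed

lemma linear_map_id: "linear_map X X (\<lambda>b. b)"
  by (auto intro!: linear_mapI)

lemma tens_map_id:
  assumes "finite X" "finite Y" "t \<in> fspace (X \<times> Y)" shows "tens_map X Y (\<lambda>b. b) (\<lambda>b. b) t = t"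
  unfolding tens_map_apply by (rule tensor_expansion[OF assms, symmetric])

section \<open>Bilinear calculus in a bialgebra\<close>

text \<open>Restricting the arguments to the index set makes these operations linear on all functions,
  so that sums can be moved without side conditions.\<close>

definition hmul :: "('i, 'k::field) hopf_data \<Rightarrow> ('i \<Rightarrow> 'k) \<Rightarrow> ('i \<Rightarrow> 'k) \<Rightarrow> 'i \<Rightarrow> 'k" where
  "hmul A a b = hmult A (restr (index A) a \<otimes>\<^sub>k restr (index A) b)"

definition hdelta :: "('i, 'k::field) hopf_data \<Rightarrow> ('i \<Rightarrow> 'k) \<Rightarrow> 'i \<times> 'i \<Rightarrow> 'k" where
  "hdelta A a = hcomult A (restr (index A) a)"

definition heps :: "('i, 'k::field) hopf_data \<Rightarrow> ('i \<Rightarrow> 'k) \<Rightarrow> 'k" where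
  "heps A a = hcounit A (restr (index A) a)"

definition hmul2 :: "('i, 'k::field) hopf_data \<Rightarrow> ('i \<times> 'i \<Rightarrow> 'k) \<Rightarrow> ('i \<times> 'i \<Rightarrow> 'k) \<Rightarrow> 'i \<times> 'i \<Rightarrow> 'k" where
  "hmul2 A t s = tens_map (index A \<times> index A) (index A \<times> index A) (hmult A) (hmult A)
     (tens_mid_flip (t \<otimes>\<^sub>k s))"

primrec hpow :: "('i, 'k::field) hopf_data \<Rightarrow> ('i \<Rightarrow> 'k) \<Rightarrow> nat \<Rightarrow> 'i \<Rightarrow> 'k" where
  "hpow A a 0 = hunit A"
| "hpow A a (Suc n) = hmul A (hpow A a n) a"

lemma tens_mid_flip_simps [simp]:
  "tens_mid_flip (t + s) = tens_mid_flip t + tens_mid_flip s"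
  "tens_mid_flip (c \<bullet> t) = c \<bullet> tens_mid_flip t" "tens_mid_flip 0 = 0"
  "tens_mid_flip ((a \<otimes>\<^sub>k b) \<otimes>\<^sub>k (c' \<otimes>\<^sub>k d)) = (a \<otimes>\<^sub>k c') \<otimes>\<^sub>k (b \<otimes>\<^sub>k d)"
  by (auto simp: tens_mid_flip_def smul_def fun_eq_iff tens_def)

lemma tens_flip_simps [simp]:
  "tens_flip (t + s) = tens_flip t + tens_flip s"
  "tens_flip (c \<bullet> t) = c \<bullet> tens_flip t" "tens_flip 0 = 0"
  "tens_flip (a \<otimes>\<^sub>k b) = b \<otimes>\<^sub>k a"
  by (auto simp: tens_flip_def smul_def fun_eq_iff tens_def)

lemma tens_flip_sum: "tens_flip (\<Sum>x\<in>I. f x) = (\<Sum>x\<in>I. tens_flip (f x))"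
  by (rule additive_sum[of "\<lambda>t. tens_flip t"]) (simp_all add: tens_flip_def fun_eq_iff)

context fd_bialgebra
begin

abbreviation X where "X \<equiv> index A"
abbreviation V where "V \<equiv> fspace (index A)"
abbreviation one (\<open>\<one>\<^sub>A\<close>) where "one \<equiv> hunit A"
abbreviation mul (infixl \<open>\<star>\<close> 78) where "a \<star> b \<equiv> hmul A a b"
abbreviation mul2 (infixl \<open>\<star>\<star>\<close> 73) where "s \<star>\<star> t \<equiv> hmul2 A s t"
abbreviation D where "D \<equiv> hdelta A"
abbreviation eps where "eps \<equiv> heps A"
abbreviation pow (infixr \<open>\<up>\<close> 80) where "a \<up> n \<equiv> hpow A a n"

lemma fin [simp, intro]: "finite (index A)"
  by (rule finite_index)

lemma finXX [simp, intro]: "finite (index A \<times> index A)"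
  by simp

lemma one_closed [simp, intro]: "\<one>\<^sub>A \<in> V"
  using unit_closed by (simp add: hspace_def)

lemma mul_closed [simp, intro]: "a \<star> b \<in> V"
  unfolding hmul_def by (rule linear_mapD(1)[OF mult_linear]) auto

lemma hmult_tens: "a \<in> V \<Longrightarrow> b \<in> V \<Longrightarrow> hmult A (a \<otimes>\<^sub>k b) = a \<star> b"
  by (simp add: hmul_def)

lemma mul_simps [simp]:
  "(a + b) \<star> c = a \<star> c + b \<star> c" "c \<star> (a + b) = c \<star> a + c \<star> b"
  "(x \<bullet> a) \<star> c = x \<bullet> (a \<star> c)" "c \<star> (x \<bullet> a) = x \<bullet> (c \<star> a)"
  "0 \<star> c = 0" "c \<star> 0 = 0"
  by (simp_all add: hmul_def linear_mapD[OF mult_linear])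

lemma mul_sum_left: "(\<Sum>x\<in>I. f x) \<star> c = (\<Sum>x\<in>I. f x \<star> c)"
  by (rule additive_sum[of "\<lambda>a. a \<star> c"]) simp_all

lemma mul_sum_right: "c \<star> (\<Sum>x\<in>I. f x) = (\<Sum>x\<in>I. c \<star> f x)"
  by (rule additive_sum[of "\<lambda>a. c \<star> a"]) simp_all

lemma mul_restr [simp]: "restr X a \<star> b = a \<star> b" "a \<star> restr X b = a \<star> b"
  by (simp_all add: hmul_def)

lemma mul_assoc: "a \<star> b \<star> c = a \<star> (b \<star> c)"
proof -
  have "restr X a \<star> restr X b \<star> restr X c = restr X a \<star> (restr X b \<star> restr X c)"
    using mult_assoc[of "restr X a" "restr X b" "restr X c"]
    by (simp add: hspace_def hmult_tens del: mul_restr)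
  then show ?thesis by simp
qed

lemma one_mul [simp]: "a \<in> V \<Longrightarrow> \<one>\<^sub>A \<star> a = a" "a \<in> V \<Longrightarrow> a \<star> \<one>\<^sub>A = a"
  using mult_unit_left[of a] mult_unit_right[of a] by (simp_all add: hspace_def hmult_tens)

lemma pow_closed [simp, intro]: "a \<up> n \<in> V"
  by (cases n) auto

lemma pow_add: "a \<up> (n + k) = a \<up> n \<star> a \<up> k"
  by (induction k) (simp_all flip: mul_assoc)

lemma pow_one [simp]: "a \<in> V \<Longrightarrow> a \<up> Suc 0 = a" "a \<in> V \<Longrightarrow> a \<up> 1 = a"
  by simp_all

lemma one_pow [simp]: "\<one>\<^sub>A \<up> n = \<one>\<^sub>A"
  by (induction n) simp_all

lemma pow_mult: "a \<up> (n * k) = (a \<up> n) \<up> k"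
  by (induction k) (simp_all add: pow_add add.commute[of n] flip: mul_assoc)

lemma pow_commute: 
  assumes "a \<star> b = b \<star> a" "b \<in> V" shows "a \<up> n \<star> b = b \<star> a \<up> n"
proof (induction n)
  case (Suc n)
  have "a \<up> Suc n \<star> b = a \<up> n \<star> b \<star> a" using assms by (simp add: mul_assoc)
  then show ?case using Suc by (simp add: mul_assoc)
qed (use assms in simp)

lemma pow_mul_distrib:
  assumes "a \<star> b = b \<star> a" "a \<in> V" shows "(a \<star> b) \<up> n = a \<up> n \<star> b \<up> n"
proof (induction n)
  case (Suc n)
  have "a \<star> b \<up> n = b \<up> n \<star> a" using pow_commute[of b a n] assms by simp
  then have "a \<up> n \<star> b \<up> n \<star> (a \<star> b) = a \<up> n \<star> a \<star> (b \<up> n \<star> b)" by (metis mul_assoc)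
  with Suc show ?case by simp
qed simp

lemma D_closed [simp, intro]: "D a \<in> fspace (X \<times> X)"
  unfolding hdelta_def by (rule linear_mapD(1)[OF comult_linear]) auto

lemma D_simps [simp]: "D (a + b) = D a + D b" "D (x \<bullet> a) = x \<bullet> D a" "D 0 = 0" "D (restr X a) = D a"
  by (simp_all add: hdelta_def linear_mapD[OF comult_linear])

lemma D_sum: "D (\<Sum>x\<in>I. f x) = (\<Sum>x\<in>I. D (f x))"
  by (rule additive_sum[of "hdelta A"]) simp_all

lemma hcomult_eq: "a \<in> V \<Longrightarrow> hcomult A a = D a"
  by (simp add: hdelta_def)

lemma eps_simps [simp]: "eps (a + b) = eps a + eps b" "eps (x \<bullet> a) = x * eps a" "eps 0 = 0"
  by (simp_all add: heps_def linear_formD[OF counit_linear])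

lemma hcounit_eq: "a \<in> V \<Longrightarrow> hcounit A a = eps a"
  by (simp add: heps_def)

lemma eps_mul [simp]: "eps (a \<star> b) = eps a * eps b"
  using counit_mult[of "restr X a" "restr X b"]
  by (simp add: hspace_def hmult_tens) (simp add: heps_def)

lemma eps_one [simp]: "eps \<one>\<^sub>A = 1"
  using counit_unit by (simp add: heps_def)

lemma mul2_simps [simp]:
  "(a + b) \<star>\<star> c = a \<star>\<star> c + b \<star>\<star> c" "c \<star>\<star> (a + b) = c \<star>\<star> a + c \<star>\<star> b"
  "(x \<bullet> a) \<star>\<star> c = x \<bullet> (a \<star>\<star> c)" "c \<star>\<star> (x \<bullet> a) = x \<bullet> (c \<star>\<star> a)"
  "0 \<star>\<star> c = 0" "c \<star>\<star> 0 = 0"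
  by (simp_all add: hmul2_def)

lemma mul2_sum_left: "(\<Sum>x\<in>I. f x) \<star>\<star> c = (\<Sum>x\<in>I. f x \<star>\<star> c)"
  by (rule additive_sum[of "\<lambda>a. a \<star>\<star> c"]) simp_all

lemma mul2_sum_right: "c \<star>\<star> (\<Sum>x\<in>I. f x) = (\<Sum>x\<in>I. c \<star>\<star> f x)"
  by (rule additive_sum[of "\<lambda>a. c \<star>\<star> a"]) simp_all

lemma mul2_tens_V:
  assumes "a \<in> V" "b \<in> V" "c \<in> V" "d \<in> V"
  shows "a \<otimes>\<^sub>k b \<star>\<star> c \<otimes>\<^sub>k d = (a \<star> c) \<otimes>\<^sub>k (b \<star> d)"
  using assms by (simp add: hmul2_def tens_map_tens[OF mult_linear mult_linear] hmult_tens)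

lemma D_mul: "D (a \<star> b) = D a \<star>\<star> D b"
  using comult_mult[of "restr X a" "restr X b"]
  by (simp add: hspace_def hmult_tens hcomult_eq hmul2_def)

lemma D_one: "D \<one>\<^sub>A = \<one>\<^sub>A \<otimes>\<^sub>k \<one>\<^sub>A"
  using comult_unit by (simp add: hcomult_eq)

lemma tensor_exp: "t \<in> fspace (X \<times> X) \<Longrightarrow>
   t = (\<Sum>x\<in>X. \<Sum>y\<in>X. t (x, y) \<bullet> (basis_vec x \<otimes>\<^sub>k basis_vec y))"
  by (rule tensor_expansion) auto

text \<open>Scalars are absorbed into the first tensor factor, so agreement on pure tensors extends
  by additivity, without homogeneity of \<open>h\<close> and \<open>h'\<close>.\<close>

lemma tensor_ext:
  fixes h h' :: "('i \<times> 'i \<Rightarrow> 'k) \<Rightarrow> 'b::comm_monoid_add"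
  assumes "t \<in> fspace (X \<times> X)" "h 0 = 0" "\<And>s t. h (s + t) = h s + h t" 
    "h' 0 = 0" "\<And>s t. h' (s + t) = h' s + h' t"
    and eq: "\<And>a b. a \<in> V \<Longrightarrow> b \<in> V \<Longrightarrow> h (a \<otimes>\<^sub>k b) = h' (a \<otimes>\<^sub>k b)"
  shows "h t = h' t"
proof -
  let ?e = "\<lambda>x y. (t (x, y) \<bullet> basis_vec x) \<otimes>\<^sub>k basis_vec y"
  have t: "t = (\<Sum>x\<in>X. \<Sum>y\<in>X. ?e x y)" using tensor_exp[OF assms(1)] by simp
  have "h t = (\<Sum>x\<in>X. \<Sum>y\<in>X. h (?e x y))"
    unfolding additive_sum[of h, OF assms(2,3), symmetric] by (rule arg_cong[OF t])
  also have "\<dots> = (\<Sum>x\<in>X. \<Sum>y\<in>X. h' (?e x y))"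
    by (intro sum.cong refl eq) auto
  also have "\<dots> = h' t"
    unfolding additive_sum[of h', OF assms(4,5), symmetric] by (rule arg_cong[OF t[symmetric]])
  finally show ?thesis .
qed

lemma mul2_assoc:
  assumes "t \<in> fspace (X \<times> X)" "s \<in> fspace (X \<times> X)" "r \<in> fspace (X \<times> X)"
  shows "t \<star>\<star> s \<star>\<star> r = t \<star>\<star> (s \<star>\<star> r)"
proof (rule tensor_ext[OF assms(1), of "\<lambda>t. t \<star>\<star> s \<star>\<star> r" "\<lambda>t. t \<star>\<star> (s \<star>\<star> r)"])
  fix a b :: "'i \<Rightarrow> 'k" assume ab: "a \<in> V" "b \<in> V"
  show "a \<otimes>\<^sub>k b \<star>\<star> s \<star>\<star> r = a \<otimes>\<^sub>k b \<star>\<star> (s \<star>\<star> r)"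
  proof (rule tensor_ext[OF assms(2), of "\<lambda>s. a \<otimes>\<^sub>k b \<star>\<star> s \<star>\<star> r" "\<lambda>s. a \<otimes>\<^sub>k b \<star>\<star> (s \<star>\<star> r)"])
    fix c d :: "'i \<Rightarrow> 'k" assume cd: "c \<in> V" "d \<in> V"
    show "a \<otimes>\<^sub>k b \<star>\<star> c \<otimes>\<^sub>k d \<star>\<star> r = a \<otimes>\<^sub>k b \<star>\<star> (c \<otimes>\<^sub>k d \<star>\<star> r)"
      by (rule tensor_ext[OF assms(3), of "\<lambda>r. a \<otimes>\<^sub>k b \<star>\<star> c \<otimes>\<^sub>k d \<star>\<star> r" "\<lambda>r. a \<otimes>\<^sub>k b \<star>\<star> (c \<otimes>\<^sub>k d \<star>\<star> r)"])
        (simp_all add: ab cd mul2_tens_V mul_assoc)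
  qed simp_all
qed simp_all

text \<open>In Sweedler notation \<open>R \<phi> a\<close> is a_1 \<phi>(a_2) and
  \<open>L \<phi> a\<close> is \<phi>(a_1) a_2, the two actions of the dual algebra. Gradings,
  characters and coordinates are all handled through them.\<close>

definition R where "R \<phi> a = slice_right X \<phi> (D a)"

definition L where "L \<phi> a = slice_left X \<phi> (D a)"

lemma RL_closed [simp, intro]: "R \<phi> a \<in> V" "L \<phi> a \<in> V"
  unfolding R_def L_def by (intro slice_closed; rule D_closed)+

lemma R_simps [simp]: "R \<phi> (a + b) = R \<phi> a + R \<phi> b" "R \<phi> (x \<bullet> a) = x \<bullet> R \<phi> a" "R \<phi> 0 = 0"
  "R \<phi> (restr X a) = R \<phi> a"
  by (simp_all add: R_def)

lemma R_sum: "R \<phi> (\<Sum>x\<in>I. f x) = (\<Sum>x\<in>I. R \<phi> (f x))"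
  by (rule additive_sum[of "R \<phi>"]) simp_all

lemma R_expansion: "R \<phi> a = (\<Sum>x\<in>X. \<Sum>y\<in>X. (D a (x, y) * \<phi> y) \<bullet> basis_vec x)"
proof -
  have "R \<phi> a = slice_right X \<phi> (\<Sum>x\<in>X. \<Sum>y\<in>X. D a (x, y) \<bullet> (basis_vec x \<otimes>\<^sub>k basis_vec y))"
    unfolding R_def by (rule arg_cong[OF tensor_exp]) simp
  then show ?thesis by (simp add: slice_right_sum)
qed

text \<open>Coassociativity read off at the triple of indices (i, j, l); the identity map in one
  tensor factor collapses one of the two sums on each side.\<close>

lemma coassoc_coord:
  assumes ijl: "i \<in> X" "j \<in> X" "l \<in> X"
  shows "(\<Sum>x\<in>X. D a (x, l) * D (basis_vec x) (i, j)) = (\<Sum>y\<in>X. D a (i, y) * D (basis_vec y) (j, l))"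
proof -
  have "(\<Sum>x\<in>X. \<Sum>y\<in>X. D a (x, y) * (D (basis_vec x) (i, j) * basis_vec y l))
      = (\<Sum>x\<in>X. \<Sum>y\<in>X. D a (x, y) * (basis_vec x i * D (basis_vec y) (j, l)))"
    using fun_cong[OF comult_coassoc[of "restr X a"], of "(i, (j, l))"]
    by (simp add: hspace_def hcomult_eq tens_assoc_def tens_map_apply sum_fun_apply smul_apply tens_apply)
  moreover have "(\<Sum>y\<in>X. D a (x, y) * (D (basis_vec x) (i, j) * basis_vec y l)) = D a (x, l) * D (basis_vec x) (i, j)" for x
  proof -
    have "(\<Sum>y\<in>X. D a (x, y) * (D (basis_vec x) (i, j) * basis_vec y l))
       = (\<Sum>y\<in>X. if y = l then D a (x, l) * D (basis_vec x) (i, j) else 0)"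
      by (intro sum.cong) (auto simp: basis_vec_def)
    then show ?thesis using ijl by simp
  qed
  moreover have "(\<Sum>x\<in>X. \<Sum>y\<in>X. D a (x, y) * (basis_vec x i * D (basis_vec y) (j, l)))
      = (\<Sum>y\<in>X. D a (i, y) * D (basis_vec y) (j, l))"
  proof -
    have "(\<Sum>x\<in>X. \<Sum>y\<in>X. D a (x, y) * (basis_vec x i * D (basis_vec y) (j, l)))
       = (\<Sum>x\<in>X. if x = i then \<Sum>y\<in>X. D a (i, y) * D (basis_vec y) (j, l) else 0)"
      by (intro sum.cong) (auto simp: basis_vec_def)
    then show ?thesis using ijl by simp
  qed
  ultimately show ?thesis by simp
qed

text \<open>Slicing the last leg of the iterated coproduct commutes with splitting off the first
  one, by coassociativity: \<open>R \<phi>\<close> is a map of left comodules.\<close>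

lemma D_R: "D (R \<phi> a) = tens_map X X (\<lambda>b. b) (R \<phi>) (D a)"
proof
  fix z :: "'i \<times> 'i"
  obtain i j where z: "z = (i, j)" by (cases z)
  have Dout: "D b (i, j) = 0" if "i \<notin> X \<or> j \<notin> X" for b
    using D_closed[of b] that unfolding fspace_def by auto
  have Rout: "R \<phi> b j = 0" if "j \<notin> X" for b
    using RL_closed(1)[of \<phi> b] that unfolding fspace_def by auto
  have lhs: "D (R \<phi> a) (i, j) = (\<Sum>l\<in>X. \<phi> l * (\<Sum>x\<in>X. D a (x, l) * D (basis_vec x) (i, j)))"
  proof -
    have "D (R \<phi> a) (i, j) = (\<Sum>x\<in>X. \<Sum>l\<in>X. \<phi> l * (D a (x, l) * D (basis_vec x) (i, j)))"
      unfolding R_expansion by (simp add: D_sum sum_fun_apply smul_apply mult_ac)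
    then show ?thesis by (subst (asm) sum.swap) (simp add: sum_distrib_left)
  qed
  have rhs: "tens_map X X (\<lambda>b. b) (R \<phi>) (D a) (i, j)
       = (\<Sum>l\<in>X. \<phi> l * (\<Sum>y\<in>X. D a (i, y) * D (basis_vec y) (j, l)))" if "i \<in> X" "j \<in> X"
  proof -
    have "tens_map X X (\<lambda>b. b) (R \<phi>) (D a) (i, j)
      = (\<Sum>x\<in>X. if x = i then \<Sum>y\<in>X. D a (i, y) * R \<phi> (basis_vec y) j else 0)"
      unfolding tens_map_apply sum_fun_apply smul_apply tens_apply
      by (intro sum.cong) (auto simp: basis_vec_def)
    also have "\<dots> = (\<Sum>y\<in>X. \<Sum>l\<in>X. \<phi> l * (D a (i, y) * D (basis_vec y) (j, l)))"
      using that by (simp add: R_def slice_right_def sum_distrib_left mult_ac)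
    finally show ?thesis by (subst (asm) sum.swap) (simp add: sum_distrib_left)
  qed
  show "D (R \<phi> a) z = tens_map X X (\<lambda>b. b) (R \<phi>) (D a) z"
  proof (cases "i \<in> X \<and> j \<in> X")
    case True then show ?thesis unfolding z lhs by (simp add: rhs coassoc_coord)
  next
    case False
    then have "tens_map X X (\<lambda>b. b) (R \<phi>) (D a) (i, j) = 0"
      unfolding tens_map_apply sum_fun_apply smul_apply tens_apply
      by (auto simp: Rout basis_vec_def intro!: sum.neutral)
    then show ?thesis using False Dout z by simp
  qed
qed

lemma L_expansion: "L \<phi> a = (\<Sum>x\<in>X. \<Sum>y\<in>X. (D a (x, y) * \<phi> x) \<bullet> basis_vec y)"
proof -
  have "L \<phi> a = slice_left X \<phi> (\<Sum>x\<in>X. \<Sum>y\<in>X. D a (x, y) \<bullet> (basis_vec x \<otimes>\<^sub>k basis_vec y))"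
    unfolding L_def by (rule arg_cong[OF tensor_exp]) simp
  then show ?thesis by (simp add: slice_left_sum)
qed

lemma D_L: "D (L \<phi> a) = tens_map X X (L \<phi>) (\<lambda>b. b) (D a)"
proof
  fix z :: "'i \<times> 'i"
  obtain i j where z: "z = (i, j)" by (cases z)
  have Dout: "D b (i, j) = 0" if "i \<notin> X \<or> j \<notin> X" for b
    using D_closed[of b] that unfolding fspace_def by auto
  have Lout: "L \<phi> b i = 0" if "i \<notin> X" for b
    using RL_closed(2)[of \<phi> b] that unfolding fspace_def by auto
  have lhs: "D (L \<phi> a) (i, j) = (\<Sum>l\<in>X. \<phi> l * (\<Sum>y\<in>X. D a (l, y) * D (basis_vec y) (i, j)))"
    unfolding L_expansion by (simp add: D_sum sum_fun_apply smul_apply mult_ac sum_distrib_left)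
  have rhs: "tens_map X X (L \<phi>) (\<lambda>b. b) (D a) (i, j)
       = (\<Sum>l\<in>X. \<phi> l * (\<Sum>x\<in>X. D a (x, j) * D (basis_vec x) (l, i)))" if "i \<in> X" "j \<in> X"
  proof -
    have "tens_map X X (L \<phi>) (\<lambda>b. b) (D a) (i, j)
      = (\<Sum>x\<in>X. \<Sum>y\<in>X. if y = j then D a (x, j) * L \<phi> (basis_vec x) i else 0)"
      unfolding tens_map_apply sum_fun_apply smul_apply tens_apply
      by (intro sum.cong) (auto simp: basis_vec_def)
    also have "\<dots> = (\<Sum>x\<in>X. \<Sum>l\<in>X. \<phi> l * (D a (x, j) * D (basis_vec x) (l, i)))"
      using that by (simp add: L_def slice_left_def sum_distrib_left mult_ac)
    finally show ?thesis by (subst (asm) sum.swap) (simp add: sum_distrib_left)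
  qed
  show "D (L \<phi> a) z = tens_map X X (L \<phi>) (\<lambda>b. b) (D a) z"
  proof (cases "i \<in> X \<and> j \<in> X")
    case True then show ?thesis unfolding z lhs by (simp add: rhs coassoc_coord)
  next
    case False
    then have "tens_map X X (L \<phi>) (\<lambda>b. b) (D a) (i, j) = 0"
      unfolding tens_map_apply sum_fun_apply smul_apply tens_apply
      by (auto simp: Lout basis_vec_def intro!: sum.neutral)
    then show ?thesis using False Dout z by simp
  qed
qed

text \<open>The form on the right is the convolution of \<open>\<phi>\<close> and
  \<open>\<psi>\<close>, so \<open>R\<close> turns convolution into composition and relations
  between forms pass to operators.\<close>

lemma R_comp: "R \<phi> (R \<psi> a) = R (\<lambda>y. pairing X \<phi> (R \<psi> (basis_vec y))) a"
  unfolding R_def[of \<phi>] D_R tens_map_apply slice_right_sum 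
  by (simp add: R_expansion)

lemma R_eps: 
  assumes "a \<in> V" "\<And>x. x \<in> X \<Longrightarrow> \<phi> x = eps (basis_vec x)" shows "R \<phi> a = a"
  using comult_counit_right[of a] assms
  by (simp add: R_def slice_right_def hspace_def hcomult_eq hcounit_eq cong: sum.cong)

end

context fd_bialgebra
begin

lemma R_cong: "(\<And>x. x \<in> X \<Longrightarrow> \<phi> x = \<psi> x) \<Longrightarrow> R \<phi> a = R \<psi> a"
  by (simp add: R_def slice_right_def)

lemma R_add_functional: "R (\<phi> + \<psi>) a = R \<phi> a + R \<psi> a" "R 0 a = 0"
  by (simp_all add: R_def slice_right_def fun_eq_iff algebra_simps sum.distrib)

lemma R_one: "R \<phi> \<one>\<^sub>A = pairing X \<phi> \<one>\<^sub>A \<bullet> \<one>\<^sub>A"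
  by (simp add: R_def D_one)

text \<open>If \<open>\<phi>\<close> splits on products into a sum of \<open>\<psi> j\<close> times
  \<open>\<chi> j\<close>, then so does its slice of a product of tensors. Together with
  \<open>D_mul\<close> this is the product rule for \<open>R \<phi>\<close>.\<close>

lemma slice_right_mul2:
  assumes \<pi>: "\<And>a b. a \<in> V \<Longrightarrow> b \<in> V \<Longrightarrow> pairing X \<phi> (a \<star> b) = (\<Sum>j\<in>J. pairing X (\<psi> j) a * pairing X (\<chi> j) b)"
    and "t \<in> fspace (X \<times> X)" "s \<in> fspace (X \<times> X)"
  shows "slice_right X \<phi> (t \<star>\<star> s) = (\<Sum>j\<in>J. slice_right X (\<psi> j) t \<star> slice_right X (\<chi> j) s)"
proof (rule tensor_ext[OF assms(2), of "\<lambda>t. slice_right X \<phi> (t \<star>\<star> s)" "\<lambda>t. \<Sum>j\<in>J. slice_right X (\<psi> j) t \<star> slice_right X (\<chi> j) s"])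
  fix a b :: "'i \<Rightarrow> 'k" assume ab: "a \<in> V" "b \<in> V"
  show "slice_right X \<phi> (a \<otimes>\<^sub>k b \<star>\<star> s) = (\<Sum>j\<in>J. slice_right X (\<psi> j) (a \<otimes>\<^sub>k b) \<star> slice_right X (\<chi> j) s)"
  proof (rule tensor_ext[OF assms(3), of "\<lambda>s. slice_right X \<phi> (a \<otimes>\<^sub>k b \<star>\<star> s)" 
        "\<lambda>s. \<Sum>j\<in>J. slice_right X (\<psi> j) (a \<otimes>\<^sub>k b) \<star> slice_right X (\<chi> j) s"])
    fix c d :: "'i \<Rightarrow> 'k" assume cd: "c \<in> V" "d \<in> V"
    show "slice_right X \<phi> (a \<otimes>\<^sub>k b \<star>\<star> c \<otimes>\<^sub>k d) = (\<Sum>j\<in>J. slice_right X (\<psi> j) (a \<otimes>\<^sub>k b) \<star> slice_right X (\<chi> j) (c \<otimes>\<^sub>k d))"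
      using ab cd by (simp add: mul2_tens_V \<pi> sum_smul mult.commute)
  qed (simp_all add: sum.distrib)
qed (simp_all add: sum.distrib)

lemma tens_map_comp:
  fixes t :: "'i \<times> 'i \<Rightarrow> 'k"
  assumes "t \<in> fspace (X \<times> X)" "linear_map X X f" "linear_map X X g"
  shows "tens_map X X f (\<lambda>b. b) (tens_map X X (\<lambda>b. b) g t) = tens_map X X f g t"
  by (rule tensor_ext[OF assms(1), of "\<lambda>t. tens_map X X f (\<lambda>b. b) (tens_map X X (\<lambda>b. b) g t)" "\<lambda>t. tens_map X X f g t"])
    (simp_all add: tens_map_tens[OF assms(2,3)] tens_map_tens[OF linear_map_id assms(3)]
      tens_map_tens[OF assms(2) linear_map_id] linear_mapD[OF assms(3)])

lemma linear_map_R: "linear_map X X (R \<phi>)"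
  by (rule linear_mapI) simp_all

end

section \<open>Cocentral gradings\<close>

text \<open>\<open>\<pi> j\<close> is the coefficient at \<open>j\<close> of the surjection onto \<open>k\<int>\<^sub>m\<close>, as a coordinate vector of a linear form.\<close>

locale cocentral_grading = fd_hopf_algebra A for A :: "('i, 'k::field) hopf_data" +
  fixes m :: nat and \<pi> :: "int \<Rightarrow> 'i \<Rightarrow> 'k"
  assumes m_pos: "m > 0"
    and pi_mod: "\<pi> (j mod int m) = \<pi> j"
    and pi_conv: "a \<in> V \<Longrightarrow> pairing X (\<pi> j) (R (\<pi> k) a) = (if j mod int m = k mod int m then pairing X (\<pi> j) a else 0)"
    and pi_sum: "a \<in> V \<Longrightarrow> (\<Sum>j\<in>{0..<int m}. pairing X (\<pi> j) a) = eps a"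
    and pi_mul: "a \<in> V \<Longrightarrow> b \<in> V \<Longrightarrow> pairing X (\<pi> l) (a \<star> b) = (\<Sum>j\<in>{0..<int m}. pairing X (\<pi> j) a * pairing X (\<pi> (l - j)) b)"
    and pi_one: "pairing X (\<pi> j) \<one>\<^sub>A = (if j mod int m = 0 then 1 else 0)"
    and pi_central: "a \<in> V \<Longrightarrow> L (\<pi> j) a = R (\<pi> j) a"
    and pi_nonzero: "\<exists>a\<in>V. pairing X (\<pi> j) a \<noteq> 0"
begin

abbreviation P where "P j \<equiv> R (\<pi> j)"

definition piece where "piece j = {a \<in> V. P j a = a}"

lemma P_mod: "j mod int m = k mod int m \<Longrightarrow> P j = P k"
  using pi_mod by metis

text \<open>By \<open>pi_conv\<close> the forms \<open>\<pi> j\<close> are orthogonal idempotents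
  for convolution, and \<open>R_comp\<close> makes the operators \<open>P j\<close> orthogonal
  projections onto the degrees.\<close>

lemma P_P: "P j (P k a) = (if j mod int m = k mod int m then P j a else 0)"
proof -
  have "P j (P k a) = R (if j mod int m = k mod int m then \<pi> j else 0) a"
    unfolding R_comp by (rule R_cong) (simp add: pi_conv)
  then show ?thesis by (simp add: R_add_functional)
qed

lemma P_sum: "a \<in> V \<Longrightarrow> (\<Sum>j\<in>{0..<int m}. P j a) = a"
proof -
  assume a: "a \<in> V"
  have "(\<Sum>j\<in>{0..<int m}. P j a) = R (\<Sum>j\<in>{0..<int m}. \<pi> j) a"
    by (rule additive_sum[of "\<lambda>\<phi>. R \<phi> a", symmetric]) (simp_all add: R_add_functional)
  also have "\<dots> = a"
    using a by (rule R_eps) (simp add: sum_fun_apply flip: pi_sum)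
  finally show ?thesis .
qed

lemma P_mul: "P l (a \<star> b) = (\<Sum>j\<in>{0..<int m}. P j a \<star> P (l - j) b)"
  unfolding R_def D_mul by (rule slice_right_mul2) (simp_all add: pi_mul)

lemma P_one: "P j \<one>\<^sub>A = (if j mod int m = 0 then \<one>\<^sub>A else 0)"
  by (simp add: R_one pi_one)

lemma P_piece: "P j a \<in> piece j"
  by (simp add: piece_def P_P)

lemma pieceD: "a \<in> piece j \<Longrightarrow> a \<in> V" "a \<in> piece j \<Longrightarrow> P j a = a"
  by (simp_all add: piece_def)

lemma P_on_piece: "a \<in> piece k \<Longrightarrow> P j a = (if j mod int m = k mod int m then a else 0)"
  by (metis P_P P_mod pieceD(2))

lemma piece_mod: "j mod int m = k mod int m \<Longrightarrow> piece j = piece k"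
  by (simp only: piece_def P_mod[of j k])

lemma piece_closed [intro]:
  "0 \<in> piece j" "a \<in> piece j \<Longrightarrow> b \<in> piece j \<Longrightarrow> a + b \<in> piece j" "a \<in> piece j \<Longrightarrow> c \<bullet> a \<in> piece j"
  by (auto simp: piece_def)

lemma piece_sum [intro]: "(\<And>x. x \<in> I \<Longrightarrow> f x \<in> piece j) \<Longrightarrow> (\<Sum>x\<in>I. f x) \<in> piece j"
  by (induction I rule: infinite_finite_induct) auto

lemma one_piece: "\<one>\<^sub>A \<in> piece 0"
  by (simp add: piece_def P_one)

lemma P_mul_left:
  assumes "a \<in> piece j" shows "P l (a \<star> b) = a \<star> P (l - j) b"
proof -
  have "P l (a \<star> b) = (\<Sum>i\<in>{0..<int m}. if i = j mod int m then a \<star> P (l - j) b else 0)"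
    unfolding P_mul
  proof (intro sum.cong refl)
    fix i assume i: "i \<in> {0..<int m}"
    have "P (l - j mod int m) = P (l - j)" by (rule P_mod) (simp add: mod_diff_right_eq)
    then show "P i a \<star> P (l - i) b = (if i = j mod int m then a \<star> P (l - j) b else 0)"
      using i P_on_piece[OF assms, of i] by auto
  qed
  also have "\<dots> = a \<star> P (l - j) b" using m_pos by simp
  finally show ?thesis .
qed

lemma piece_mul [intro]:
  assumes "a \<in> piece j" "b \<in> piece k" shows "a \<star> b \<in> piece (j + k)"
  using P_mul_left[OF assms(1), of "j + k" b] pieceD(2)[OF assms(2)] by (simp add: piece_def)

lemma piece_pow: "a \<in> piece j \<Longrightarrow> a \<up> n \<in> piece (int n * j)"
proof (induction n)
  case (Suc n)
  then have "a \<up> n \<star> a \<in> piece (int n * j + j)" by (intro piece_mul)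
  then show ?case by (simp add: algebra_simps)
qed (simp add: one_piece)

text \<open>Cocentrality makes the left and the right projection agree, so both legs of the
  coproduct of a homogeneous element have its degree: every piece is a subcoalgebra. This is why a
  cocycle describes the coproduct of a degree 1 unit.\<close>

lemma D_piece:
  assumes "a \<in> piece j" shows "D a = tens_map X X (P j) (P j) (D a)"
proof -
  have 1: "D a = tens_map X X (\<lambda>b. b) (P j) (D a)"
    using D_R[of "\<pi> j" a] pieceD[OF assms] by simp
  have "D a = tens_map X X (L (\<pi> j)) (\<lambda>b. b) (D a)"
    using D_L[of "\<pi> j" a] pieceD[OF assms] pi_central by simp
  also have "\<dots> = tens_map X X (P j) (\<lambda>b. b) (D a)"
    unfolding tens_map_apply by (intro sum.cong refl) (simp add: pi_central)
  finally show ?thesis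
    using 1 tens_map_comp[OF D_closed linear_map_R linear_map_R] by metis
qed

lemma D_piece_expansion:
  assumes "a \<in> piece j" 
  shows "D a = (\<Sum>x\<in>X. \<Sum>y\<in>X. D a (x, y) \<bullet> (P j (basis_vec x) \<otimes>\<^sub>k P j (basis_vec y)))"
  using D_piece[OF assms] unfolding tens_map_apply .

lemma eps_P: "a \<in> V \<Longrightarrow> eps (P j a) = pairing X (\<pi> j) a"
proof -
  assume a: "a \<in> V"
  have "eps (P j a) = (\<Sum>k\<in>{0..<int m}. if k = j mod int m then pairing X (\<pi> (j mod int m)) a else 0)"
    unfolding pi_sum[OF RL_closed(1), symmetric] by (intro sum.cong refl) (auto simp: pi_conv a)
  then show ?thesis using m_pos by (simp add: pi_mod)
qed

text \<open>The two homogeneous factors of each summand come from \<open>a\<^sub>1 S(a\<^sub>2) = \<epsilon>(a)\<close> for \<open>a\<close> of degree 1;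
  projecting to degree 0 replaces \<open>S(a\<^sub>2)\<close> by its component of degree \<open>- 1\<close>.\<close>

lemma strongly_graded:
  obtains f g :: "'i \<times> 'i \<Rightarrow> 'i \<Rightarrow> 'k" where "\<And>z. f z \<in> piece 1" "\<And>z. g z \<in> piece (- 1)"
    "\<one>\<^sub>A = (\<Sum>z\<in>X \<times> X. f z \<star> g z)"
proof -
  obtain S where S: "is_antipode A S" using antipode_exists by blast
  have Sl: "linear_map X X S" using S by (simp add: is_antipode_def)
  \<comment> \<open>The coefficient at 1 of \<open>a0\<close> is the counit of its degree 1
    component (\<open>eps_P\<close>); being nonzero, it can be divided out at the end.\<close>
  obtain a0 where a0: "a0 \<in> V" "pairing X (\<pi> 1) a0 \<noteq> 0" using pi_nonzero by blast
  define a where "a = P 1 a0"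
  define c where "c = eps a"
  have a: "a \<in> piece 1" by (simp add: a_def P_piece)
  have c: "c \<noteq> 0" using a0 by (simp add: c_def a_def eps_P)
  define B where "B x = P 1 (basis_vec x)" for x
  have B: "B x \<in> piece 1" "B x \<in> V" for x by (simp_all add: B_def P_piece)
  have SB: "S (B x) \<in> V" for x using linear_mapD(1)[OF Sl B(2)] .
  have "hmult A (tens_map X X (\<lambda>b. b) S (D a)) = c \<bullet> \<one>\<^sub>A"
    using S a by (simp add: is_antipode_def hspace_def hcomult_eq hcounit_eq pieceD c_def smul_def)
  also have "tens_map X X (\<lambda>b. b) S (D a) = tens_map X X (\<lambda>b. b) S (\<Sum>x\<in>X. \<Sum>y\<in>X. D a (x, y) \<bullet> (B x \<otimes>\<^sub>k B y))"
    unfolding B_def by (rule arg_cong[OF D_piece_expansion[OF a]])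
  also have "\<dots> = (\<Sum>x\<in>X. \<Sum>y\<in>X. D a (x, y) \<bullet> (B x \<otimes>\<^sub>k S (B y)))"
    using B by (simp add: tens_map_sum tens_map_tens[OF linear_map_id Sl])
  also have "hmult A \<dots> = (\<Sum>x\<in>X. \<Sum>y\<in>X. D a (x, y) \<bullet> (B x \<star> S (B y)))"
    using B SB by (simp add: linear_map_sum[OF mult_linear] linear_mapD(3)[OF mult_linear] hmult_tens)
  finally have eq: "(\<Sum>x\<in>X. \<Sum>y\<in>X. D a (x, y) \<bullet> (B x \<star> S (B y))) = c \<bullet> \<one>\<^sub>A" .
  have "P 0 (\<Sum>x\<in>X. \<Sum>y\<in>X. D a (x, y) \<bullet> (B x \<star> S (B y))) = P 0 (c \<bullet> \<one>\<^sub>A)"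
    by (rule arg_cong[OF eq])
  then have "(\<Sum>x\<in>X. \<Sum>y\<in>X. D a (x, y) \<bullet> (B x \<star> P (- 1) (S (B y)))) = c \<bullet> \<one>\<^sub>A"
    by (simp add: R_sum P_mul_left[OF B(1)] P_one)
  then have "(1 / c) \<bullet> (\<Sum>x\<in>X. \<Sum>y\<in>X. D a (x, y) \<bullet> (B x \<star> P (- 1) (S (B y)))) = \<one>\<^sub>A"
    using c by simp
  then have "\<one>\<^sub>A = (\<Sum>z\<in>X \<times> X. ((D a z / c) \<bullet> B (fst z)) \<star> P (- 1) (S (B (snd z))))"
    by (simp add: smul_sum sum.cartesian_product case_prod_beta)
  then show ?thesis
    by (rule that[of "\<lambda>z. (D a z / c) \<bullet> B (fst z)" "\<lambda>z. P (- 1) (S (B (snd z)))", rotated 2]) (auto intro!: B P_piece)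
qed

end

text \<open>\<open>e x\<close> is the image in \<open>A\<close> of the indicator function of \<open>x \<in> G\<close>.\<close>

locale pre_frame = cocentral_grading A m \<pi> + group G
  for A :: "('i, 'k::field) hopf_data" and m \<pi> and G :: "('g, 'x) monoid_scheme" (structure) +
  fixes e :: "'g \<Rightarrow> 'i \<Rightarrow> 'k"
  assumes finG [simp, intro]: "finite (carrier G)"
    and e_piece: "x \<in> carrier G \<Longrightarrow> e x \<in> piece 0"
    and e_mul: "x \<in> carrier G \<Longrightarrow> y \<in> carrier G \<Longrightarrow> e x \<star> e y = (if x = y then e x else 0)"
    and e_sum: "(\<Sum>x\<in>carrier G. e x) = \<one>\<^sub>A"
    and e_nz: "x \<in> carrier G \<Longrightarrow> e x \<noteq> 0"
    and e_D: "x \<in> carrier G \<Longrightarrow> D (e x) = (\<Sum>y\<in>carrier G. e y \<otimes>\<^sub>k e (inv y \<otimes> x))"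
    and e_eps: "x \<in> carrier G \<Longrightarrow> eps (e x) = (if x = \<one> then 1 else 0)"
    and e_span: "a \<in> piece 0 \<Longrightarrow> \<exists>c. a = (\<Sum>x\<in>carrier G. c x \<bullet> e x)"
begin

lemma e_V [simp, intro]: "x \<in> carrier G \<Longrightarrow> e x \<in> V"
  using e_piece pieceD by blast

definition E where "E c = (\<Sum>x\<in>carrier G. c x \<bullet> e x)"

lemma E_V [simp, intro]: "E c \<in> V"
  by (simp add: E_def)

lemma E_piece: "E c \<in> piece 0"
  unfolding E_def by (intro piece_sum piece_closed e_piece)

lemma E_mul_e: "y \<in> carrier G \<Longrightarrow> E c \<star> e y = c y \<bullet> e y"
proof -
  assume y: "y \<in> carrier G"
  have "E c \<star> e y = (\<Sum>x\<in>carrier G. if x = y then c x \<bullet> e x else 0)"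
    unfolding E_def mul_sum_left by (intro sum.cong refl) (use y in \<open>auto simp: e_mul\<close>)
  then show ?thesis using y by simp
qed

lemma e_mul_E: "y \<in> carrier G \<Longrightarrow> e y \<star> E c = c y \<bullet> e y"
proof -
  assume y: "y \<in> carrier G"
  have "e y \<star> E c = (\<Sum>x\<in>carrier G. if x = y then c x \<bullet> e x else 0)"
    unfolding E_def mul_sum_right by (intro sum.cong refl) (use y in \<open>auto simp: e_mul\<close>)
  then show ?thesis using y by simp
qed

lemma piece_0_E: "a \<in> piece 0 \<Longrightarrow> \<exists>c. a = E c"
  unfolding E_def by (rule e_span)

lemma E_mul_E: "E c \<star> E d = E (\<lambda>x. c x * d x)"
  by (subst (2) E_def) (simp add: mul_sum_right E_mul_e, simp add: E_def mult.commute)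

lemma E_one: "E (\<lambda>x. 1) = \<one>\<^sub>A"
  by (simp add: E_def e_sum)

lemma E_cong: "(\<And>x. x \<in> carrier G \<Longrightarrow> c x = d x) \<Longrightarrow> E c = E d"
  unfolding E_def by (intro sum.cong) auto

lemma E_eq_iff: "E c = E d \<longleftrightarrow> (\<forall>x\<in>carrier G. c x = d x)"
proof
  assume eq: "E c = E d"
  show "\<forall>x\<in>carrier G. c x = d x"
  proof
    fix x assume x: "x \<in> carrier G"
    have "c x \<bullet> e x = d x \<bullet> e x" using eq E_mul_e[OF x] by metis
    then have "(c x - d x) \<bullet> e x = 0" by (auto simp: fun_eq_iff smul_apply algebra_simps)
    then show "c x = d x" using e_nz[OF x] by simp
  qed
qed (auto intro: E_cong)

text \<open>Degree 0 is spanned by orthogonal idempotents, so its corners between distinct points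
  vanish and the diagonal ones are lines.\<close>

lemma corner:
  assumes "a \<in> piece 0" "x \<in> carrier G" "y \<in> carrier G"
  shows "\<exists>c. e x \<star> a \<star> e y = (if x = y then c \<bullet> e x else 0)"
proof -
  obtain c where "a = E c" using piece_0_E assms by blast
  then have "e x \<star> a \<star> e y = (if x = y then c x \<bullet> e x else 0)"
    using assms by (simp add: e_mul_E e_mul)
  then show ?thesis by blast
qed

text \<open>Inserting both decompositions of the unit, from the strong grading and from the
  idempotents, into \<open>e x\<close> leaves some nonzero term in a one-dimensional corner. Up to a
  scalar its two halves are inverse to each other between the corners at \<open>x\<close> and
  \<open>y\<close>.\<close>

lemma corner_unit:
  assumes x: "x \<in> carrier G"
  shows "\<exists>y U W. y \<in> carrier G \<and> U \<in> piece 1 \<and> W \<in> piece (- 1) \<and> U = e x \<star> U \<and> U = U \<star> e y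
    \<and> W = e y \<star> W \<and> W = W \<star> e x \<and> U \<star> W = e x \<and> W \<star> U = e y"
proof -
  obtain f g :: "'i \<times> 'i \<Rightarrow> 'i \<Rightarrow> 'k" where fg: "\<And>z. f z \<in> piece 1" "\<And>z. g z \<in> piece (- 1)"
    and one: "\<one>\<^sub>A = (\<Sum>z\<in>X \<times> X. f z \<star> g z)" using strongly_graded by blast
  have "e x = e x \<star> (\<Sum>z\<in>X \<times> X. f z \<star> (\<Sum>y\<in>carrier G. e y) \<star> g z) \<star> e x"
    using x by (simp add: e_sum pieceD(1)[OF fg(1)] e_mul flip: one)
  also have "\<dots> = (\<Sum>z\<in>X \<times> X. \<Sum>y\<in>carrier G. e x \<star> (f z \<star> e y \<star> g z) \<star> e x)"
    by (simp add: mul_sum_left mul_sum_right)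
  finally obtain z y where zy: "y \<in> carrier G" "e x \<star> (f z \<star> e y \<star> g z) \<star> e x \<noteq> 0"
    using e_nz[OF x] by (metis (no_types, lifting) sum.neutral)
  have "f z \<star> e y \<star> g z \<in> piece (1 + 0 + - 1)"
    by (intro piece_mul fg e_piece zy)
  then have "f z \<star> e y \<star> g z \<in> piece 0" by simp
  from corner[OF this x x] obtain c where c: "e x \<star> (f z \<star> e y \<star> g z) \<star> e x = c \<bullet> e x" by auto
  have c0: "c \<noteq> 0" using c zy by auto
  define U where "U = (1 / c) \<bullet> (e x \<star> f z \<star> e y)"
  define W where "W = e y \<star> g z \<star> e x"
  have "e x \<star> f z \<star> e y \<in> piece (0 + 1 + 0)" "W \<in> piece (0 + - 1 + 0)"
    unfolding W_def by (intro piece_mul fg e_piece zy x)+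
  then have UW: "U \<in> piece 1" "W \<in> piece (- 1)" by (auto simp: U_def)
  have idem: "e x \<star> (e x \<star> a) = e x \<star> a" "a \<star> e x \<star> e x = a \<star> e x" "e y \<star> (e y \<star> a) = e y \<star> a" "a \<star> e y \<star> e y = a \<star> e y" for a
    using x zy by (simp_all add: e_mul mul_assoc flip: mul_assoc[of "e _" "e _"])
  have 1: "U = e x \<star> U" "U = U \<star> e y" "W = e y \<star> W" "W = W \<star> e x"
    by (simp_all add: U_def W_def idem mul_assoc[of _ _ "e _"]) (simp_all add: idem flip: mul_assoc)
  have 2: "U \<star> W = e x"
  proof -
    have "U \<star> W = (1 / c) \<bullet> (e x \<star> (f z \<star> e y \<star> g z) \<star> e x)"
      unfolding U_def W_def by (simp add: mul_assoc idem)
    then show ?thesis using c c0 by simp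
  qed
  have "W \<star> U \<in> piece (- 1 + 1)" by (intro piece_mul UW)
  then have "W \<star> U \<in> piece 0" by simp
  from corner[OF this zy(1) zy(1)] obtain d where "e y \<star> (W \<star> U) \<star> e y = d \<bullet> e y" by auto
  then have d: "W \<star> U = d \<bullet> e y" using 1 by (metis mul_assoc)
  \<comment> \<open>So far \<open>W \<star> U\<close> is only a multiple \<open>d\<close> of
    \<open>e y\<close>; since U = U W U and U is nonzero, d = 1.\<close>
  have "U = U \<star> (W \<star> U)" using 1 2 by (metis mul_assoc)
  then have "U = d \<bullet> U" using d 1 by simp
  then have "(1 - d) \<bullet> U = 0" by (auto simp: fun_eq_iff smul_apply algebra_simps)
  moreover have "U \<noteq> 0" using 2 e_nz[OF x] by auto
  ultimately have "d = 1" by simp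
  then show ?thesis using zy UW 1 2 d by auto
qed

end

text \<open>\<open>\<alpha>\<close> records how conjugation by \<open>u\<close> moves the
  idempotents. It enters as a self-map of the carrier; its multiplicativity is derived from the
  coproduct of \<open>u\<close> in \<open>\<alpha>_hom\<close>.\<close>

locale hopf_frame = pre_frame A m \<pi> G e
  for A :: "('i, 'k::field) hopf_data" and m \<pi> and G :: "('g, 'x) monoid_scheme" (structure) and e +
  fixes u v :: "'i \<Rightarrow> 'k" and \<alpha> :: "'g \<Rightarrow> 'g"
  assumes u_piece: "u \<in> piece 1" and v_V [simp, intro]: "v \<in> V"
    and uv: "u \<star> v = \<one>\<^sub>A" and vu: "v \<star> u = \<one>\<^sub>A"
    and \<alpha>_closed [simp, intro]: "x \<in> carrier G \<Longrightarrow> \<alpha> x \<in> carrier G"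
    and e_u: "x \<in> carrier G \<Longrightarrow> e x \<star> u = u \<star> e (\<alpha> x)"

text \<open>The corner units are added up. If two points had the same target, \<open>U x\<close>
  would factor through a vanishing degree 0 corner; hence the targets form a permutation of the
  group and the sum of the units is invertible.\<close>

theorem (in pre_frame) frame_exists: "\<exists>u v \<alpha>. hopf_frame A m \<pi> G e u v \<alpha>"
proof -
  obtain al U W where al: "\<And>x. x \<in> carrier G \<Longrightarrow> al x \<in> carrier G" 
    and UW: "\<And>x. x \<in> carrier G \<Longrightarrow> U x \<in> piece 1" "\<And>x. x \<in> carrier G \<Longrightarrow> W x \<in> piece (- 1)"
    and U: "\<And>x. x \<in> carrier G \<Longrightarrow> U x = e x \<star> U x" "\<And>x. x \<in> carrier G \<Longrightarrow> U x = U x \<star> e (al x)"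
    and W: "\<And>x. x \<in> carrier G \<Longrightarrow> W x = e (al x) \<star> W x" "\<And>x. x \<in> carrier G \<Longrightarrow> W x = W x \<star> e x"
    and prod: "\<And>x. x \<in> carrier G \<Longrightarrow> U x \<star> W x = e x" "\<And>x. x \<in> carrier G \<Longrightarrow> W x \<star> U x = e (al x)"
  proof -
    define Q where "Q x y U W \<longleftrightarrow> y \<in> carrier G \<and> U \<in> piece 1 \<and> W \<in> piece (- 1) \<and> U = e x \<star> U \<and> U = U \<star> e y
      \<and> W = e y \<star> W \<and> W = W \<star> e x \<and> U \<star> W = e x \<and> W \<star> U = e y" for x y U W
    have "\<forall>x\<in>carrier G. \<exists>y U W. Q x y U W" unfolding Q_def using corner_unit by blast
    then have "\<exists>al U W. \<forall>x\<in>carrier G. Q x (al x) (U x) (W x)" by metis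
    then obtain al U W where "\<forall>x\<in>carrier G. Q x (al x) (U x) (W x)" by blast
    then show ?thesis unfolding Q_def by (intro that[of al U W]) simp_all
  qed
  have inj: "inj_on al (carrier G)"
  proof (rule inj_onI, rule ccontr)
    fix x x' assume xx: "x \<in> carrier G" "x' \<in> carrier G" "al x = al x'" "x \<noteq> x'"
    have "U x \<star> W x' \<in> piece (1 + - 1)" by (intro piece_mul UW xx)
    then have "e x \<star> (U x \<star> W x') \<star> e x' = 0" using corner[of "U x \<star> W x'" x x'] xx by auto
    then have "U x \<star> W x' = 0" using U(1) W(2) xx by (metis mul_assoc)
    then have "U x = 0" using U(2) prod(2) xx by (metis mul_assoc mul_simps(5))
    then show False using prod(1) e_nz xx by (metis mul_simps(5))
  qed
  then have bij: "bij_betw al (carrier G) (carrier G)"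
    using al by (simp add: bij_betw_def endo_inj_surj image_subset_iff)
  have 1: "U x \<star> W x' = (if x = x' then e x else 0)" if "x \<in> carrier G" "x' \<in> carrier G" for x x'
  proof -
    have "U x \<star> W x' = U x \<star> (e (al x) \<star> e (al x')) \<star> W x'"
      using U(2) W(1) that by (metis mul_assoc)
    then show ?thesis using that al inj prod(1) U(2) by (auto simp: e_mul inj_on_eq_iff)
  qed
  have 2: "W x \<star> U x' = (if x = x' then e (al x) else 0)" if "x \<in> carrier G" "x' \<in> carrier G" for x x'
  proof -
    have "W x \<star> U x' = W x \<star> (e x \<star> e x') \<star> U x'"
      using U(1) W(2) that by (metis mul_assoc)
    then show ?thesis using that prod(2) W(2) by (auto simp: e_mul)
  qed
  define u where "u = (\<Sum>x\<in>carrier G. U x)"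
  define v where "v = (\<Sum>x\<in>carrier G. W x)"
  have u: "u \<in> piece 1" unfolding u_def by (intro piece_sum UW)
  have v: "v \<in> V" unfolding v_def by (intro fspace_sum pieceD(1)[OF UW(2)])
  have uv: "u \<star> v = \<one>\<^sub>A"
    unfolding u_def v_def mul_sum_left unfolding mul_sum_right by (simp add: 1 e_sum)
  have "v \<star> u = (\<Sum>x\<in>carrier G. e (al x))"
    unfolding u_def v_def mul_sum_left unfolding mul_sum_right by (simp add: 2)
  also have "\<dots> = \<one>\<^sub>A" using sum.reindex_bij_betw[OF bij, of e] e_sum by simp
  finally have vu: "v \<star> u = \<one>\<^sub>A" .
  have eu: "e x \<star> u = u \<star> e (al x)" if x: "x \<in> carrier G" for x
  proof -
    have "e x \<star> u = (\<Sum>y\<in>carrier G. if y = x then U x else 0)"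
      unfolding u_def mul_sum_right
    proof (intro sum.cong refl)
      fix y assume y: "y \<in> carrier G"
      have "e x \<star> U y = (e x \<star> e y) \<star> U y" using U(1)[OF y] by (simp add: mul_assoc)
      then show "e x \<star> U y = (if y = x then U x else 0)" using x y U(1) by (auto simp: e_mul)
    qed
    moreover have "u \<star> e (al x) = (\<Sum>y\<in>carrier G. if y = x then U x else 0)"
      unfolding u_def mul_sum_left
    proof (intro sum.cong refl)
      fix y assume y: "y \<in> carrier G"
      have "U y \<star> e (al x) = U y \<star> (e (al y) \<star> e (al x))" using U(2)[OF y] by (metis mul_assoc)
      then show "U y \<star> e (al x) = (if y = x then U x else 0)" 
        using x y U(2) al inj by (auto simp: e_mul inj_on_eq_iff)
    qed
    ultimately show ?thesis by simp
  qed
  have "hopf_frame A m \<pi> G e u v al"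
    by unfold_locales (use u v uv vu al eu in auto)
  then show ?thesis by blast
qed

section \<open>Coordinates with respect to a frame\<close>

context hopf_frame
begin

lemma u_V [simp, intro]: "u \<in> V"
  using u_piece pieceD by blast

text \<open>The degree 0 component of u v = 1 is \<open>u\<close> times the degree -1 component of
  \<open>v\<close>, and the inverse of \<open>u\<close> is unique.\<close>

lemma v_piece: "v \<in> piece (- 1)"
proof -
  have "u \<star> P (- 1) v = \<one>\<^sub>A"
    using P_mul_left[OF u_piece, of 0 v] uv by (simp add: P_one)
  then have "v \<star> (u \<star> P (- 1) v) = v" by simp
  then have "P (- 1) v = v" by (simp add: vu flip: mul_assoc)
  then show ?thesis using P_piece by metis
qed

lemma e_eqD: "x \<in> carrier G \<Longrightarrow> y \<in> carrier G \<Longrightarrow> e x = e y \<Longrightarrow> x = y"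
  using e_mul e_nz by metis

lemma \<alpha>_pow_closed [simp, intro]: "x \<in> carrier G \<Longrightarrow> (\<alpha> ^^ n) x \<in> carrier G"
  by (induction n) auto

lemma e_u_pow: "x \<in> carrier G \<Longrightarrow> e x \<star> u \<up> n = u \<up> n \<star> e ((\<alpha> ^^ n) x)"
proof (induction n)
  case (Suc n)
  have "e x \<star> u \<up> Suc n = u \<up> n \<star> (e ((\<alpha> ^^ n) x) \<star> u)"
    using Suc by (simp flip: mul_assoc)
  also have "\<dots> = u \<up> n \<star> (u \<star> e (\<alpha> ((\<alpha> ^^ n) x)))"
    using e_u[of "(\<alpha> ^^ n) x"] Suc.prems by simp
  finally show ?case by (simp add: mul_assoc)
qed simp

lemma uv_pow: "u \<up> n \<star> v \<up> n = \<one>\<^sub>A" "v \<up> n \<star> u \<up> n = \<one>\<^sub>A"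
proof -
  have "(u \<star> v) \<up> n = u \<up> n \<star> v \<up> n" "(v \<star> u) \<up> n = v \<up> n \<star> u \<up> n"
    by (rule pow_mul_distrib; simp add: uv vu)+
  then show "u \<up> n \<star> v \<up> n = \<one>\<^sub>A" "v \<up> n \<star> u \<up> n = \<one>\<^sub>A"
    unfolding uv vu one_pow by simp_all
qed

lemma u_pow_piece: "u \<up> n \<in> piece (int n)" "v \<up> n \<in> piece (- int n)"
  using piece_pow[OF u_piece, of n] piece_pow[OF v_piece, of n] by simp_all

lemma E_zero: "E (\<lambda>_. 0) = 0"
  by (simp add: E_def)

lemma E_add: "E c + E d = E (\<lambda>x. c x + d x)"
  by (simp add: E_def sum.distrib)

lemma E_smul: "c \<bullet> E d = E (\<lambda>x. c * d x)"
  by (simp add: E_def smul_sum)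

text \<open>Dividing by the n-th power of \<open>u\<close> moves the degree \<open>n\<close>
  component to degree 0, where the idempotents provide coordinates. The choice is determined on
  \<open>carrier G\<close> only, so later facts about \<open>coef\<close> assume a point of the
  group.\<close>

definition coef :: "nat \<Rightarrow> ('i \<Rightarrow> 'k) \<Rightarrow> 'g \<Rightarrow> 'k" where
  "coef n a = (SOME c. P (int n) a \<star> v \<up> n = E c)"

lemma coef: "P (int n) a \<star> v \<up> n = E (coef n a)"
proof -
  have "P (int n) a \<star> v \<up> n \<in> piece (int n + - int n)"
    by (intro piece_mul P_piece u_pow_piece)
  then have "\<exists>c. P (int n) a \<star> v \<up> n = E c" by (intro piece_0_E) simp
  then show ?thesis unfolding coef_def by (rule someI_ex)
qed

lemma P_eq_E: "P (int n) a = E (coef n a) \<star> u \<up> n"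
  unfolding coef[symmetric] by (simp add: mul_assoc uv_pow)

lemma coef_unique: "P (int n) a = E c \<star> u \<up> n \<Longrightarrow> x \<in> carrier G \<Longrightarrow> coef n a x = c x"
proof -
  assume "P (int n) a = E c \<star> u \<up> n" and x: "x \<in> carrier G"
  then have "P (int n) a \<star> v \<up> n = E c" by (simp add: mul_assoc uv_pow)
  then show ?thesis using x by (auto simp: coef E_eq_iff)
qed

lemma coef_add: "x \<in> carrier G \<Longrightarrow> coef n (a + b) x = coef n a x + coef n b x"
  by (rule coef_unique[of n "a + b" "\<lambda>x. coef n a x + coef n b x"]) (simp_all add: P_eq_E flip: E_add)

lemma coef_smul: "x \<in> carrier G \<Longrightarrow> coef n (c \<bullet> a) x = c * coef n a x"
  by (rule coef_unique[of n "c \<bullet> a" "\<lambda>x. c * coef n a x"]) (simp_all add: P_eq_E flip: E_smul)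

definition bas where "bas x n = e x \<star> u \<up> n"

lemma bas_V [simp, intro]: "bas x n \<in> V"
  by (simp add: bas_def)

lemma bas_piece: "x \<in> carrier G \<Longrightarrow> bas x n \<in> piece (int n)"
  unfolding bas_def using piece_mul[OF e_piece u_pow_piece(1)] by fastforce

lemma E_u_pow: "E c \<star> u \<up> n = (\<Sum>x\<in>carrier G. c x \<bullet> bas x n)"
  by (simp add: E_def bas_def mul_sum_left)

lemma piece_E: "a \<in> piece (int n) \<Longrightarrow> \<exists>c. a = E c \<star> u \<up> n"
  using P_eq_E[of n a] pieceD(2) by metis

lemma sum_int_nat: "(\<Sum>j\<in>{0..<int m}. f j) = (\<Sum>n<m. f (int n))"
  by (rule sum.reindex_bij_witness[of _ int nat]) auto

lemma basis_expansion_frame: 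
  assumes "a \<in> V" shows "a = (\<Sum>n<m. \<Sum>x\<in>carrier G. coef n a x \<bullet> bas x n)"
  using P_sum[OF assms] by (simp add: sum_int_nat P_eq_E E_u_pow)

lemma coef_bas:
  assumes "x \<in> carrier G" "y \<in> carrier G" "n < m" "k < m"
  shows "coef n (bas y k) x = (if n = k \<and> x = y then 1 else 0)"
proof (rule coef_unique[OF _ assms(1)])
  have "E (\<lambda>x. if n = k \<and> x = y then 1 else 0) = (if n = k then e y else 0)"
  proof -
    have "E (\<lambda>x. if n = k \<and> x = y then 1 else 0) = (\<Sum>x\<in>carrier G. if x = y then (if n = k then e y else 0) else 0)"
      unfolding E_def by (intro sum.cong refl) auto
    then show ?thesis using assms by simp
  qed
  then show "P (int n) (bas y k) = E (\<lambda>x. if n = k \<and> x = y then 1 else 0) \<star> u \<up> n"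
    using assms by (subst P_on_piece[OF bas_piece[OF assms(2)]]) (auto simp: bas_def)
qed

lemma u_pow_m: "\<exists>c. u \<up> m = E c"
proof -
  have "piece (int m) = piece 0" by (rule piece_mod) simp
  then show ?thesis using u_pow_piece(1)[of m] piece_0_E by blast
qed

text \<open>The m-th power of \<open>u\<close> has degree 0 and therefore commutes with every
  idempotent.\<close>

lemma \<alpha>_pow_m: "x \<in> carrier G \<Longrightarrow> (\<alpha> ^^ m) x = x"
proof -
  assume x: "x \<in> carrier G"
  obtain c where c: "u \<up> m = E c" using u_pow_m by blast
  have "u \<up> m \<star> e ((\<alpha> ^^ m) x) = u \<up> m \<star> e x"
    using e_u_pow[OF x, of m] x by (simp add: c e_mul_E E_mul_e)
  then have "v \<up> m \<star> u \<up> m \<star> e ((\<alpha> ^^ m) x) = v \<up> m \<star> u \<up> m \<star> e x" by (simp add: mul_assoc)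
  then show ?thesis using x e_eqD[of "(\<alpha> ^^ m) x" x] by (simp add: uv_pow)
qed

lemma u_pow_eq_if_cong:
  assumes "u \<up> m = \<one>\<^sub>A" "n mod m = k mod m" shows "u \<up> n = u \<up> k"
proof -
  have *: "u \<up> n = u \<up> (n mod m)" for n
  proof -
    have "u \<up> n = u \<up> (m * (n div m) + n mod m)" by simp
    then show ?thesis unfolding pow_add pow_mult by (simp add: assms)
  qed
  show ?thesis using *[of n] *[of k] assms by simp
qed

lemma bas_mul: "x \<in> carrier G \<Longrightarrow> y \<in> carrier G \<Longrightarrow> bas x n \<star> bas y k = (if y = (\<alpha> ^^ n) x then bas x (n + k) else 0)"
proof -
  assume xy: "x \<in> carrier G" "y \<in> carrier G"
  have "bas x n \<star> bas y k = u \<up> n \<star> (e ((\<alpha> ^^ n) x) \<star> e y) \<star> u \<up> k"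
    unfolding bas_def e_u_pow[OF xy(1)] by (simp add: mul_assoc)
  also have "\<dots> = (if y = (\<alpha> ^^ n) x then bas x (n + k) else 0)"
    using xy by (auto simp: e_mul bas_def pow_add e_u_pow mul_assoc simp flip: mul_assoc[of "e _" "u \<up> n"])
  finally show ?thesis .
qed

lemma bas_nz: "x \<in> carrier G \<Longrightarrow> bas x n \<noteq> 0"
proof
  assume x: "x \<in> carrier G" and "bas x n = 0"
  then have "bas x n \<star> v \<up> n = 0" by simp
  then show False using x e_nz by (simp add: bas_def mul_assoc uv_pow)
qed

lemma e_bas: "x \<in> carrier G \<Longrightarrow> y \<in> carrier G \<Longrightarrow> e x \<star> bas y n = (if x = y then bas x n else 0)"
  by (auto simp: bas_def e_mul simp flip: mul_assoc)

lemma D_piece_frame: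
  assumes "a \<in> piece (int n)"
  shows "\<exists>\<sigma>. D a = (\<Sum>y\<in>carrier G. \<Sum>z\<in>carrier G. \<sigma> y z \<bullet> (bas y n \<otimes>\<^sub>k bas z n))"
proof -
  have "D a = (\<Sum>x\<in>X. \<Sum>x'\<in>X. \<Sum>z\<in>carrier G. \<Sum>y\<in>carrier G.
      (D a (x, x') * (coef n (basis_vec x') z * coef n (basis_vec x) y)) \<bullet> (bas y n \<otimes>\<^sub>k bas z n))"
    using D_piece_expansion[OF assms]
    by (simp add: P_eq_E E_u_pow tens_sum_left tens_sum_right smul_sum)
  also have "\<dots> = (\<Sum>z\<in>carrier G. \<Sum>y\<in>carrier G. \<Sum>x\<in>X. \<Sum>x'\<in>X.
      (D a (x, x') * (coef n (basis_vec x') z * coef n (basis_vec x) y)) \<bullet> (bas y n \<otimes>\<^sub>k bas z n))"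
    by (subst (2) sum.swap, subst sum.swap, subst (3) sum.swap, subst (2) sum.swap) simp
  also have "\<dots> = (\<Sum>y\<in>carrier G. \<Sum>z\<in>carrier G. (\<Sum>x\<in>X. \<Sum>x'\<in>X.
      (D a (x, x') * (coef n (basis_vec x') z * coef n (basis_vec x) y))) \<bullet> (bas y n \<otimes>\<^sub>k bas z n))"
    by (subst sum.swap) (simp add: sum_smul)
  finally show ?thesis by (intro exI)
qed

text \<open>Multiplication by \<open>e x \<otimes>\<^sub>k e x'\<close> isolates a single
  coefficient; coefficients of coproducts are compared in this way throughout.\<close>

lemma tens_e_bas:
  assumes "x \<in> carrier G" "x' \<in> carrier G"
  shows "e x \<otimes>\<^sub>k e x' \<star>\<star> (\<Sum>y\<in>carrier G. \<Sum>z\<in>carrier G. \<sigma> y z \<bullet> (bas y n \<otimes>\<^sub>k bas z n)) = \<sigma> x x' \<bullet> (bas x n \<otimes>\<^sub>k bas x' n)"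
proof -
  have "e x \<otimes>\<^sub>k e x' \<star>\<star> (\<Sum>y\<in>carrier G. \<Sum>z\<in>carrier G. \<sigma> y z \<bullet> (bas y n \<otimes>\<^sub>k bas z n))
    = (\<Sum>y\<in>carrier G. \<Sum>z\<in>carrier G. if z = x' then (if y = x then \<sigma> x x' \<bullet> (bas x n \<otimes>\<^sub>k bas x' n) else 0) else 0)"
    unfolding mul2_sum_right by (intro sum.cong refl) (use assms in \<open>auto simp: mul2_tens_V e_bas\<close>)
  then show ?thesis using assms by simp
qed

lemma tens_bas_eqD:
  assumes "(\<Sum>y\<in>carrier G. \<Sum>z\<in>carrier G. \<sigma> y z \<bullet> (bas y n \<otimes>\<^sub>k bas z n)) = (\<Sum>y\<in>carrier G. \<Sum>z\<in>carrier G. \<tau> y z \<bullet> (bas y n \<otimes>\<^sub>k bas z n))"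
    "x \<in> carrier G" "x' \<in> carrier G"
  shows "\<sigma> x x' = \<tau> x x'"
proof -
  have "\<sigma> x x' \<bullet> (bas x n \<otimes>\<^sub>k bas x' n) = \<tau> x x' \<bullet> (bas x n \<otimes>\<^sub>k bas x' n)"
    using tens_e_bas[OF assms(2,3), of \<sigma> n] tens_e_bas[OF assms(2,3), of \<tau> n] assms(1) by simp
  then have "(\<sigma> x x' - \<tau> x x') \<bullet> (bas x n \<otimes>\<^sub>k bas x' n) = 0"
    by (auto simp: fun_eq_iff smul_apply algebra_simps)
  then show ?thesis using bas_nz assms by (simp add: tens_eq_0_iff)
qed

lemma D_E: "D (E c) = (\<Sum>y\<in>carrier G. \<Sum>z\<in>carrier G. c (y \<otimes> z) \<bullet> (e y \<otimes>\<^sub>k e z))"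
proof -
  have "D (E c) = (\<Sum>x\<in>carrier G. \<Sum>y\<in>carrier G. c x \<bullet> (e y \<otimes>\<^sub>k e (inv y \<otimes> x)))"
    by (simp add: E_def D_sum e_D smul_sum)
  also have "\<dots> = (\<Sum>y\<in>carrier G. \<Sum>x\<in>carrier G. c x \<bullet> (e y \<otimes>\<^sub>k e (inv y \<otimes> x)))"
    by (rule sum.swap)
  also have "\<dots> = (\<Sum>y\<in>carrier G. \<Sum>z\<in>carrier G. c (y \<otimes> z) \<bullet> (e y \<otimes>\<^sub>k e z))"
  proof (rule sum.cong[OF refl])
    fix y assume y: "y \<in> carrier G"
    show "(\<Sum>x\<in>carrier G. c x \<bullet> (e y \<otimes>\<^sub>k e (inv y \<otimes> x))) = (\<Sum>z\<in>carrier G. c (y \<otimes> z) \<bullet> (e y \<otimes>\<^sub>k e z))"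
      by (rule sum.reindex_bij_witness[of _ "\<lambda>z. y \<otimes> z" "\<lambda>x. inv y \<otimes> x"]) (use y in \<open>auto simp flip: m_assoc\<close>)
  qed
  finally show ?thesis .
qed

end

text \<open>\<open>\<sigma>\<close> is just the coefficient table of the coproduct of
  \<open>u\<close>. That it has no zeros on the group and satisfies the cocycle identity follows
  from the bialgebra axioms.\<close>

locale cocycle_frame = hopf_frame A m \<pi> G e u v \<alpha>
  for A :: "('i, 'k::field) hopf_data" and m \<pi> and G :: "('g, 'x) monoid_scheme" (structure) and e u v \<alpha> +
  fixes \<sigma> :: "'g \<Rightarrow> 'g \<Rightarrow> 'k"
  assumes D_u: "D u = (\<Sum>y\<in>carrier G. \<Sum>z\<in>carrier G. \<sigma> y z \<bullet> (bas y 1 \<otimes>\<^sub>k bas z 1))"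

lemma (in hopf_frame) cocycle_exists: "\<exists>\<sigma>. cocycle_frame A m \<pi> G e u v \<alpha> \<sigma>"
proof -
  obtain \<sigma> where "D u = (\<Sum>y\<in>carrier G. \<Sum>z\<in>carrier G. \<sigma> y z \<bullet> (bas y 1 \<otimes>\<^sub>k bas z 1))"
    using D_piece_frame[of u 1] u_piece by auto
  then have "cocycle_frame A m \<pi> G e u v \<alpha> \<sigma>" by unfold_locales
  then show ?thesis by blast
qed

context cocycle_frame
begin

text \<open>\<open>D u\<close> is invertible with inverse \<open>D v\<close>, so no tensor
  \<open>e y \<otimes>\<^sub>k e z\<close> can annihilate it.\<close>

lemma \<sigma>_nz: "y \<in> carrier G \<Longrightarrow> z \<in> carrier G \<Longrightarrow> \<sigma> y z \<noteq> 0"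
proof
  assume yz: "y \<in> carrier G" "z \<in> carrier G" "\<sigma> y z = 0"
  then have "e y \<otimes>\<^sub>k e z \<star>\<star> D u = 0" by (simp add: D_u tens_e_bas)
  then have "e y \<otimes>\<^sub>k e z \<star>\<star> (D u \<star>\<star> D v) = 0"
    using yz mul2_assoc[of "e y \<otimes>\<^sub>k e z" "D u" "D v"] by simp
  then have "e y \<otimes>\<^sub>k e z = 0"
    using yz by (simp add: uv D_one mul2_tens_V flip: D_mul)
  then show False using e_nz yz by (simp add: tens_eq_0_iff)
qed

text \<open>Apply the coproduct to \<open>e x \<star> u = u \<star> e (\<alpha> x)\<close> for
  \<open>x = y \<otimes> z\<close> and cut by \<open>e y \<otimes>\<^sub>k e z\<close>. The left
  side keeps the nonzero coefficient \<open>\<sigma> y z\<close>; the right side vanishes unless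
  \<open>\<alpha> x\<close> is the product of the images.\<close>

lemma \<alpha>_hom: "y \<in> carrier G \<Longrightarrow> z \<in> carrier G \<Longrightarrow> \<alpha> (y \<otimes> z) = \<alpha> y \<otimes> \<alpha> z"
proof -
  assume yz: "y \<in> carrier G" "z \<in> carrier G"
  let ?x = "y \<otimes> z"
  have D1: "D (e ?x \<star> u) = D u \<star>\<star> D (e (\<alpha> ?x))" using yz by (simp add: e_u D_mul)
  have "e y \<otimes>\<^sub>k e z \<star>\<star> D (e ?x) = e y \<otimes>\<^sub>k e z"
  proof -
    have "e y \<otimes>\<^sub>k e z \<star>\<star> D (e ?x) = (\<Sum>w\<in>carrier G. if w = y then e y \<otimes>\<^sub>k e z else 0)"
      using yz unfolding e_D[OF m_closed[OF yz]] mul2_sum_right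
      by (intro sum.cong refl) (auto simp: mul2_tens_V e_mul simp flip: m_assoc)
    then show ?thesis using yz by simp
  qed
  then have "e y \<otimes>\<^sub>k e z \<star>\<star> D (e ?x \<star> u) = \<sigma> y z \<bullet> (bas y 1 \<otimes>\<^sub>k bas z 1)"
    using yz mul2_assoc[of "e y \<otimes>\<^sub>k e z" "D (e ?x)" "D u"] by (simp add: D_mul) (simp add: D_u tens_e_bas)
  moreover have "e y \<otimes>\<^sub>k e z \<star>\<star> D (e ?x \<star> u) = \<sigma> y z \<bullet> (bas y 1 \<otimes>\<^sub>k bas z 1) \<star>\<star> D (e (\<alpha> ?x))"
    using yz mul2_assoc[of "e y \<otimes>\<^sub>k e z" "D u" "D (e (\<alpha> ?x))"] D1 by (simp add: D_u tens_e_bas)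
  moreover have "\<dots> = 0" if ne: "\<alpha> ?x \<noteq> \<alpha> y \<otimes> \<alpha> z"
  proof -
    have "bas y 1 \<otimes>\<^sub>k bas z 1 \<star>\<star> D (e (\<alpha> ?x)) = (\<Sum>w\<in>carrier G. 0)"
      unfolding e_D[OF \<alpha>_closed[OF m_closed[OF yz]]] mul2_sum_right
    proof (intro sum.cong refl)
      fix w assume w: "w \<in> carrier G"
      have "bas y 1 \<star> e w = u \<star> (e (\<alpha> y) \<star> e w)" "bas z 1 \<star> e (inv w \<otimes> \<alpha> ?x) = u \<star> (e (\<alpha> z) \<star> e (inv w \<otimes> \<alpha> ?x))"
        using yz by (simp_all add: bas_def e_u mul_assoc)
      moreover have "\<not> (\<alpha> y = w \<and> \<alpha> z = inv w \<otimes> \<alpha> ?x)"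
        using ne w yz by (metis \<alpha>_closed inv_solve_left m_closed)
      ultimately show "bas y 1 \<otimes>\<^sub>k bas z 1 \<star>\<star> e w \<otimes>\<^sub>k e (inv w \<otimes> \<alpha> ?x) = 0"
        using w yz by (auto simp: mul2_tens_V e_mul)
    qed
    then show ?thesis by simp
  qed
  ultimately show ?thesis using \<sigma>_nz[OF yz] bas_nz yz by (auto simp: tens_eq_0_iff)
qed

text \<open>The cocycle of the n-th power of \<open>u\<close>: moving the idempotents past one
  factor \<open>u\<close> applies \<open>\<alpha>\<close> to both arguments.\<close>

definition \<sigma>p where "\<sigma>p n y z = (\<Prod>i<n. \<sigma> ((\<alpha> ^^ i) y) ((\<alpha> ^^ i) z))"

lemma D_u_pow: "D (u \<up> n) = (\<Sum>y\<in>carrier G. \<Sum>z\<in>carrier G. \<sigma>p n y z \<bullet> (bas y n \<otimes>\<^sub>k bas z n))"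
proof (induction n)
  case 0
  show ?case using D_E[of "\<lambda>_. 1"] by (simp add: E_one \<sigma>p_def bas_def)
next
  case (Suc n)
  have *: "bas y n \<otimes>\<^sub>k bas z n \<star>\<star> D u = \<sigma> ((\<alpha> ^^ n) y) ((\<alpha> ^^ n) z) \<bullet> (bas y (Suc n) \<otimes>\<^sub>k bas z (Suc n))"
    if yz: "y \<in> carrier G" "z \<in> carrier G" for y z
  proof -
    have "bas y n \<otimes>\<^sub>k bas z n \<star>\<star> D u = (\<Sum>y'\<in>carrier G. \<Sum>z'\<in>carrier G. if z' = (\<alpha> ^^ n) z then
      (if y' = (\<alpha> ^^ n) y then \<sigma> ((\<alpha> ^^ n) y) ((\<alpha> ^^ n) z) \<bullet> (bas y (Suc n) \<otimes>\<^sub>k bas z (Suc n)) else 0) else 0)"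
      unfolding D_u mul2_sum_right by (intro sum.cong refl) (use yz in \<open>auto simp: mul2_tens_V bas_mul\<close>)
    then show ?thesis using yz by simp
  qed
  show ?case
    by (simp add: D_mul Suc mul2_sum_left * \<sigma>p_def mult.commute)
qed

lemma D_bas:
  assumes x: "x \<in> carrier G"
  shows "D (bas x n) = (\<Sum>y\<in>carrier G. \<sigma>p n y (inv y \<otimes> x) \<bullet> (bas y n \<otimes>\<^sub>k bas (inv y \<otimes> x) n))"
  unfolding bas_def[of x] D_mul e_D[OF x] mul2_sum_left
  by (intro sum.cong refl) (simp add: D_u_pow tens_e_bas x)

text \<open>Coassociativity for \<open>u\<close> with the third leg evaluated at the coordinate of
  \<open>bas x 1\<close>: both computations of \<open>D (R \<psi> u)\<close> expand in the same
  basis, and their coefficients are the two sides.\<close>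

lemma \<sigma>_cocycle:
  assumes "x \<in> carrier G" "y \<in> carrier G" "z \<in> carrier G"
  shows "\<sigma> (y \<otimes> z) x * \<sigma> y z = \<sigma> y (z \<otimes> x) * \<sigma> z x"
proof -
  define \<psi> where "\<psi> i = coef 1 (basis_vec i) x" for i
  have lin: "linear_form X (\<lambda>a. coef 1 a x)"
    using assms by (simp add: linear_form_iff coef_add coef_smul)
  have \<psi>: "pairing X \<psi> a = coef 1 a x" if "a \<in> V" for a
    using linear_form_pairing[OF lin fin that] unfolding \<psi>_def by simp
  have coef1: "coef 1 (bas w 1) x = (if w = x then 1 else 0)" if "w \<in> carrier G" for w
  proof (rule coef_unique[OF _ assms(1)])
    have "E (\<lambda>x. if w = x then 1 else 0) = (\<Sum>x\<in>carrier G. if x = w then e w else 0)"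
      unfolding E_def by (intro sum.cong refl) auto
    then show "P (int 1) (bas w 1) = E (\<lambda>x. if w = x then 1 else 0) \<star> u \<up> 1"
      using that P_on_piece[OF bas_piece[OF that, of 1], of 1] by (simp add: bas_def)
  qed
  have R1: "R \<psi> (bas w 1) = \<sigma> (w \<otimes> inv x) x \<bullet> bas (w \<otimes> inv x) 1" if w: "w \<in> carrier G" for w
  proof -
    have "R \<psi> (bas w 1) = (\<Sum>y\<in>carrier G. if y = w \<otimes> inv x then \<sigma> (w \<otimes> inv x) x \<bullet> bas (w \<otimes> inv x) 1 else 0)"
      unfolding R_def D_bas[OF w] slice_right_sum
    proof (intro sum.cong refl)
      fix y assume y: "y \<in> carrier G"
      have "inv y \<otimes> w = x \<longleftrightarrow> y = w \<otimes> inv x"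
        using assms w y by (metis inv_solve_left inv_solve_right')
      then show "slice_right X \<psi> (\<sigma>p 1 y (inv y \<otimes> w) \<bullet> (bas y 1 \<otimes>\<^sub>k bas (inv y \<otimes> w) 1)) = (if y = w \<otimes> inv x then \<sigma> (w \<otimes> inv x) x \<bullet> bas (w \<otimes> inv x) 1 else 0)"
        using assms w y by (auto simp: \<psi> coef1[unfolded One_nat_def] \<sigma>p_def)
    qed
    then show ?thesis using assms w by simp
  qed
  have R2: "R \<psi> u = (\<Sum>y\<in>carrier G. \<sigma> y x \<bullet> bas y 1)"
  proof -
    have "R \<psi> u = (\<Sum>y\<in>carrier G. \<Sum>z\<in>carrier G. if z = x then \<sigma> y x \<bullet> bas y 1 else 0)"
      unfolding R_def D_u slice_right_sum by (intro sum.cong refl) (auto simp: \<psi> coef1[unfolded One_nat_def] assms)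
    then show ?thesis using assms by simp
  qed
  have "D (R \<psi> u) = (\<Sum>w\<in>carrier G. \<Sum>y\<in>carrier G. (\<sigma> w x * \<sigma> y (inv y \<otimes> w)) \<bullet> (bas y 1 \<otimes>\<^sub>k bas (inv y \<otimes> w) 1))"
    unfolding R2 D_sum by (simp add: D_bas smul_sum \<sigma>p_def)
  also have "\<dots> = (\<Sum>y\<in>carrier G. \<Sum>w\<in>carrier G. (\<sigma> w x * \<sigma> y (inv y \<otimes> w)) \<bullet> (bas y 1 \<otimes>\<^sub>k bas (inv y \<otimes> w) 1))"
    by (rule sum.swap)
  also have "\<dots> = (\<Sum>y\<in>carrier G. \<Sum>z\<in>carrier G. (\<sigma> (y \<otimes> z) x * \<sigma> y z) \<bullet> (bas y 1 \<otimes>\<^sub>k bas z 1))"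
  proof (rule sum.cong[OF refl])
    fix y assume y: "y \<in> carrier G"
    show "(\<Sum>w\<in>carrier G. (\<sigma> w x * \<sigma> y (inv y \<otimes> w)) \<bullet> (bas y 1 \<otimes>\<^sub>k bas (inv y \<otimes> w) 1)) = (\<Sum>z\<in>carrier G. (\<sigma> (y \<otimes> z) x * \<sigma> y z) \<bullet> (bas y 1 \<otimes>\<^sub>k bas z 1))"
      by (rule sum.reindex_bij_witness[of _ "\<lambda>z. y \<otimes> z" "\<lambda>x. inv y \<otimes> x"]) (use y in \<open>auto simp flip: m_assoc\<close>)
  qed
  finally have lhs: "D (R \<psi> u) = (\<Sum>y\<in>carrier G. \<Sum>z\<in>carrier G. (\<sigma> (y \<otimes> z) x * \<sigma> y z) \<bullet> (bas y 1 \<otimes>\<^sub>k bas z 1))" .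
  have "D (R \<psi> u) = (\<Sum>y\<in>carrier G. \<Sum>w\<in>carrier G. (\<sigma> y w * \<sigma> (w \<otimes> inv x) x) \<bullet> (bas y 1 \<otimes>\<^sub>k bas (w \<otimes> inv x) 1))"
    unfolding D_R D_u tens_map_sum by (simp add: tens_map_tens[OF linear_map_id linear_map_R] R1[unfolded One_nat_def])
  also have "\<dots> = (\<Sum>y\<in>carrier G. \<Sum>z\<in>carrier G. (\<sigma> y (z \<otimes> x) * \<sigma> z x) \<bullet> (bas y 1 \<otimes>\<^sub>k bas z 1))"
  proof (rule sum.cong[OF refl])
    fix y assume y: "y \<in> carrier G"
    show "(\<Sum>w\<in>carrier G. (\<sigma> y w * \<sigma> (w \<otimes> inv x) x) \<bullet> (bas y 1 \<otimes>\<^sub>k bas (w \<otimes> inv x) 1)) = (\<Sum>z\<in>carrier G. (\<sigma> y (z \<otimes> x) * \<sigma> z x) \<bullet> (bas y 1 \<otimes>\<^sub>k bas z 1))"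
      by (rule sum.reindex_bij_witness[of _ "\<lambda>z. z \<otimes> x" "\<lambda>w. w \<otimes> inv x"]) (use y assms in \<open>auto simp: m_assoc\<close>)
  qed
  finally show ?thesis
    unfolding lhs by (rule tens_bas_eqD[OF _ assms(2,3)])
qed

text \<open>Multiplying \<open>u\<close> by \<open>E c\<close> changes \<open>\<sigma>\<close> by a
  coboundary; the action \<open>\<alpha>\<close> stays because \<open>E c\<close> commutes with the
  idempotents.\<close>

lemma rescale:
  assumes nz: "\<And>x. x \<in> carrier G \<Longrightarrow> c x \<noteq> 0"
  shows "cocycle_frame A m \<pi> G e (E c \<star> u) (v \<star> E (\<lambda>x. 1 / c x)) \<alpha> (\<lambda>y z. c (y \<otimes> z) * \<sigma> y z / (c y * c z))"
proof -
  let ?u = "E c \<star> u" and ?v = "v \<star> E (\<lambda>x. 1 / c x)"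
  have cc: "E c \<star> E (\<lambda>x. 1 / c x) = \<one>\<^sub>A" "E (\<lambda>x. 1 / c x) \<star> E c = \<one>\<^sub>A"
    unfolding E_mul_E E_one[symmetric] by (rule E_cong; use nz in simp)+
  have up: "?u \<in> piece 1" using piece_mul[OF E_piece u_piece] by simp
  have uv': "?u \<star> ?v = \<one>\<^sub>A" "?v \<star> ?u = \<one>\<^sub>A"
  proof -
    have "?u \<star> ?v = E c \<star> (u \<star> v) \<star> E (\<lambda>x. 1 / c x)" by (simp add: mul_assoc)
    then show "?u \<star> ?v = \<one>\<^sub>A" by (simp add: uv cc)
    have "?v \<star> ?u = v \<star> (E (\<lambda>x. 1 / c x) \<star> E c) \<star> u" by (simp add: mul_assoc)
    then show "?v \<star> ?u = \<one>\<^sub>A" by (simp add: vu cc)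
  qed
  have eu: "e x \<star> ?u = ?u \<star> e (\<alpha> x)" if "x \<in> carrier G" for x
  proof -
    have "e x \<star> ?u = c x \<bullet> (e x \<star> u)" using that by (simp add: e_mul_E flip: mul_assoc)
    moreover have "?u \<star> e (\<alpha> x) = E c \<star> e x \<star> u" using that by (simp add: e_u mul_assoc)
    ultimately show ?thesis using that by (simp add: E_mul_e)
  qed
  interpret F: hopf_frame A m \<pi> G e ?u ?v \<alpha>
    by unfold_locales (use up uv' eu in auto)
  have bas': "F.bas y 1 = c y \<bullet> bas y 1" if "y \<in> carrier G" for y
    using that by (simp add: F.bas_def bas_def e_mul_E flip: mul_assoc)
  show ?thesis
  proof unfold_locales
    have "D ?u = (\<Sum>y\<in>carrier G. \<Sum>z\<in>carrier G. c (y \<otimes> z) \<bullet> (e y \<otimes>\<^sub>k e z \<star>\<star> D u))"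
      by (simp add: D_mul D_E mul2_sum_left)
    also have "\<dots> = (\<Sum>y\<in>carrier G. \<Sum>z\<in>carrier G. (c (y \<otimes> z) * \<sigma> y z) \<bullet> (bas y 1 \<otimes>\<^sub>k bas z 1))"
      by (intro sum.cong refl) (simp add: D_u tens_e_bas)
    also have "\<dots> = (\<Sum>y\<in>carrier G. \<Sum>z\<in>carrier G. (c (y \<otimes> z) * \<sigma> y z / (c y * c z)) \<bullet> (F.bas y 1 \<otimes>\<^sub>k F.bas z 1))"
      by (intro sum.cong refl) (simp add: bas'[unfolded One_nat_def] nz)
    finally show "D ?u = (\<Sum>y\<in>carrier G. \<Sum>z\<in>carrier G. (c (y \<otimes> z) * \<sigma> y z / (c y * c z)) \<bullet> (F.bas y 1 \<otimes>\<^sub>k F.bas z 1))" .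
  qed
qed

end

text \<open>Serves for every change of coordinates on the group: passing to eigenvectors, exchanging
  the two coordinates and rescaling one of them.\<close>

lemma (in hopf_frame) reparametrise:
  fixes G' :: "('h, 'y) monoid_scheme"
  assumes "group G'" and bij: "bij_betw \<phi> (carrier G') (carrier G)"
    and hom: "\<And>x y. x \<in> carrier G' \<Longrightarrow> y \<in> carrier G' \<Longrightarrow> \<phi> (x \<otimes>\<^bsub>G'\<^esub> y) = \<phi> x \<otimes> \<phi> y"
    and \<beta>: "\<And>x. x \<in> carrier G' \<Longrightarrow> \<beta> x \<in> carrier G'" "\<And>x. x \<in> carrier G' \<Longrightarrow> \<phi> (\<beta> x) = \<alpha> (\<phi> x)"
  shows "hopf_frame A m \<pi> G' (\<lambda>x. e (\<phi> x)) u v \<beta>"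
proof -
  interpret G': group G' by fact
  have cl: "\<phi> x \<in> carrier G" if "x \<in> carrier G'" for x using bij that by (auto simp: bij_betw_def)
  have inj: "\<phi> x = \<phi> y \<longleftrightarrow> x = y" if "x \<in> carrier G'" "y \<in> carrier G'" for x y
    using bij that by (auto simp: bij_betw_def inj_on_eq_iff)
  have one: "\<phi> \<one>\<^bsub>G'\<^esub> = \<one>"
  proof -
    have "\<phi> \<one>\<^bsub>G'\<^esub> \<otimes> \<phi> \<one>\<^bsub>G'\<^esub> = \<phi> \<one>\<^bsub>G'\<^esub>" using hom[of "\<one>\<^bsub>G'\<^esub>" "\<one>\<^bsub>G'\<^esub>"] by simp
    then show ?thesis by (simp add: cl)
  qed
  have inv: "\<phi> (inv\<^bsub>G'\<^esub> x) = inv (\<phi> x)" if "x \<in> carrier G'" for x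
  proof -
    have "\<phi> (inv\<^bsub>G'\<^esub> x) \<otimes> \<phi> x = \<one>" using hom[of "inv\<^bsub>G'\<^esub> x" x] that one by simp
    then show ?thesis using that cl by (metis G'.inv_closed inv_equality)
  qed
  show ?thesis
  proof unfold_locales
    show "finite (carrier G')" using bij bij_betw_finite by blast
    show "(\<Sum>x\<in>carrier G'. e (\<phi> x)) = \<one>\<^sub>A" using sum.reindex_bij_betw[OF bij, of e] e_sum by simp
    fix x assume x: "x \<in> carrier G'"
    show "e (\<phi> x) \<in> piece 0" "e (\<phi> x) \<noteq> 0" using e_piece e_nz cl x by auto
    show "e (\<phi> x) \<star> e (\<phi> y) = (if x = y then e (\<phi> x) else 0)" if "y \<in> carrier G'" for y
      using that x by (simp add: e_mul cl inj)
    show "eps (e (\<phi> x)) = (if x = \<one>\<^bsub>G'\<^esub> then 1 else 0)"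
      using x inj[OF x G'.one_closed] by (simp add: e_eps cl one)
    show "D (e (\<phi> x)) = (\<Sum>y\<in>carrier G'. e (\<phi> y) \<otimes>\<^sub>k e (\<phi> (inv\<^bsub>G'\<^esub> y \<otimes>\<^bsub>G'\<^esub> x)))"
      using x sum.reindex_bij_betw[OF bij, of "\<lambda>y. e y \<otimes>\<^sub>k e (inv y \<otimes> \<phi> x)"]
      by (simp add: e_D cl hom inv)
    show "e (\<phi> x) \<star> u = u \<star> e (\<phi> (\<beta> x))" using x by (simp add: \<beta> e_u cl)
    show "\<beta> x \<in> carrier G'" using \<beta> x by simp
  next
    fix a assume "a \<in> piece 0"
    then obtain c where "a = (\<Sum>x\<in>carrier G. c x \<bullet> e x)" using e_span by blast
    then have "a = (\<Sum>x\<in>carrier G'. c (\<phi> x) \<bullet> e (\<phi> x))"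
      using sum.reindex_bij_betw[OF bij, of "\<lambda>x. c x \<bullet> e x"] by simp
    then show "\<exists>c. a = (\<Sum>x\<in>carrier G'. c x \<bullet> e (\<phi> x))" by (rule exI[of _ "\<lambda>x. c (\<phi> x)"])
  qed (auto simp: u_piece uv vu)
qed

text \<open>Multiplication by \<open>k\<close> permutes the residues modulo \<open>m\<close>, so
  relabelling the degrees gives another cocentral grading, in which the k-th power of
  \<open>u\<close> has degree 1.\<close>

lemma (in hopf_frame) change_generator:
  assumes k: "coprime k m"
  shows "hopf_frame A m (\<lambda>j. \<pi> (int k * j)) G e (u \<up> k) (v \<up> k) (\<alpha> ^^ k)"
proof -
  have cong: "int k * i mod int m = int k * j mod int m \<longleftrightarrow> i mod int m = j mod int m" for i j
  proof -
    have "coprime (int k) (int m)" using k by simp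
    then show ?thesis using cong_mult_lcancel[of "int k" "int m" i j] by (simp add: cong_def)
  qed
  have bij: "bij_betw (\<lambda>j. int k * j mod int m) {0..<int m} {0..<int m}"
  proof -
    have "inj_on (\<lambda>j. int k * j mod int m) {0..<int m}"
      by (rule inj_onI) (simp add: cong)
    moreover have "(\<lambda>j. int k * j mod int m) ` {0..<int m} \<subseteq> {0..<int m}" using m_pos by auto
    ultimately show ?thesis by (simp add: bij_betw_def endo_inj_surj)
  qed
  have pm: "\<pi> i = \<pi> j" if "i mod int m = j mod int m" for i j using that pi_mod by metis
  interpret C: cocentral_grading A m "\<lambda>j. \<pi> (int k * j)"
  proof unfold_locales
    show "m > 0" by (rule m_pos)
    fix j l :: int and a b :: "'i \<Rightarrow> 'k"
    show "\<pi> (int k * (j mod int m)) = \<pi> (int k * j)" by (rule pm) (simp add: mod_mult_right_eq)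
    show "pairing X (\<pi> (int k * j)) \<one>\<^sub>A = (if j mod int m = 0 then 1 else 0)"
      using cong[of j 0] by (simp add: pi_one)
    show "\<exists>a\<in>V. pairing X (\<pi> (int k * j)) a \<noteq> 0" by (rule pi_nonzero)
    assume a: "a \<in> V"
    show "pairing X (\<pi> (int k * j)) (P (int k * l) a) = (if j mod int m = l mod int m then pairing X (\<pi> (int k * j)) a else 0)"
      using a by (simp add: pi_conv cong)
    show "L (\<pi> (int k * j)) a = P (int k * j) a" using a by (rule pi_central)
    show "(\<Sum>j\<in>{0..<int m}. pairing X (\<pi> (int k * j)) a) = eps a"
      using a sum.reindex_bij_betw[OF bij, of "\<lambda>j. pairing X (\<pi> j) a"] by (simp add: pi_sum pi_mod)
    assume b: "b \<in> V"
    have "\<pi> (int k * j - int k * i mod int m) = \<pi> (int k * (j - i))" for i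
      by (rule pm) (simp add: mod_diff_right_eq algebra_simps)
    then show "pairing X (\<pi> (int k * j)) (a \<star> b) = (\<Sum>i\<in>{0..<int m}. pairing X (\<pi> (int k * i)) a * pairing X (\<pi> (int k * (j - i))) b)"
      using a b sum.reindex_bij_betw[OF bij, of "\<lambda>i. pairing X (\<pi> i) a * pairing X (\<pi> (int k * j - i)) b"]
      by (simp add: pi_mul pi_mod)
  qed
  have pc: "C.piece j = piece (int k * j)" for j by (simp add: C.piece_def piece_def)
  show ?thesis
    by unfold_locales
      (use e_mul e_sum e_nz e_D e_eps e_span e_piece u_pow_piece e_u_pow uv_pow in \<open>simp_all add: pc\<close>)
qed

text \<open>The grading forms read off the coefficients of \<open>p\<close> at residues. To be
  coinvariant is to be fixed by the projection to degree 0, so the description of the image of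
  \<open>i\<close> identifies degree 0 with the function algebra.\<close>

lemma pre_frame_of_extension:
  fixes A :: "('i, 'k::field) hopf_data" and G :: "('g, 'x) monoid_scheme" and m :: nat
    and i :: "('g \<Rightarrow> 'k) \<Rightarrow> 'i \<Rightarrow> 'k" and p :: "('i \<Rightarrow> 'k) \<Rightarrow> int \<Rightarrow> 'k"
  defines "F \<equiv> fun_hopf G" and "Z \<equiv> group_hopf (integer_mod_group m)"
  assumes A: "fd_hopf_algebra A" and G: "group G" "finite (carrier G)" and m: "m > 0"
    and i: "hopf_map F A i" "inj_on i (hspace F)"
    and p: "hopf_map A Z p" "p ` hspace A = hspace Z" "cocentral A Z p"
    and im: "i ` hspace F = {a \<in> hspace A. tens_map (index A) (index A) (\<lambda>b. b) p (hcomult A a) = a \<otimes>\<^sub>k hunit Z}"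
  shows "pre_frame A m (\<lambda>j x. p (basis_vec x) (j mod int m)) G (\<lambda>x. i (basis_vec x))"
proof -
  interpret fd_hopf_algebra A by (rule A)
  interpret group G by (rule G)
  define \<pi> where "\<pi> j x = p (basis_vec x) (j mod int m)" for j x
  define e where "e x = i (basis_vec x)" for x
  have cZ: "carrier (integer_mod_group m) = {0..<int m}" using m by (simp add: carrier_integer_mod_group)
  have pl: "linear_map X {0..<int m} p" using p by (simp add: hopf_map_def Z_def group_hopf_def cZ)
  have il: "linear_map (carrier G) X i" using i by (simp add: hopf_map_def F_def fun_hopf_def)
  have iF: "index F = carrier G" by (simp add: F_def fun_hopf_def)
  have hF: "hspace F = fspace (carrier G)" by (simp add: hspace_def F_def fun_hopf_def)
  have hZ: "hspace Z = fspace {0..<int m}" by (simp add: hspace_def Z_def group_hopf_def cZ)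
  have hA: "hspace A = V" by (simp add: hspace_def)
  have jm: "j mod int m \<in> {0..<int m}" for j using m by simp
  have pair: "pairing X (\<pi> j) a = p a (j mod int m)" if "a \<in> V" for a j
  proof -
    have "linear_form X (\<lambda>a. p a (j mod int m))"
      using pl by (simp add: linear_form_iff linear_mapD smul_apply)
    from linear_form_pairing[OF this fin that] show ?thesis unfolding \<pi>_def by simp
  qed
  have pout: "p a j = 0" if "a \<in> V" "j \<notin> {0..<int m}" for a j
    using linear_mapD(1)[OF pl that(1)] that(2) by (simp add: fspace_def)
  have Rp: "R (\<pi> k) a y = (\<Sum>x\<in>X. D a (y, x) * p (basis_vec x) (k mod int m))" for a k y
    by (simp add: R_def slice_right_def \<pi>_def)
  \<comment> \<open>The coaction (id \<otimes> p) \<Delta> lists the homogeneous components: its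
    coefficient at \<open>j\<close> is the projection to degree \<open>j\<close>.\<close>
  have idp: "tens_map X X (\<lambda>b. b) p (D a) (y, j) = (if j \<in> {0..<int m} then R (\<pi> j) a y else 0)" if "a \<in> V" for a y j
  proof (cases "y \<in> X")
    case True
    have "tens_map X X (\<lambda>b. b) p (D a) (y, j) = (\<Sum>x\<in>X. if x = y then \<Sum>x'\<in>X. D a (y, x') * p (basis_vec x') j else 0)"
      unfolding tens_map_apply sum_fun_apply smul_apply tens_apply
      by (intro sum.cong refl) (auto simp: basis_vec_def)
    also have "\<dots> = (\<Sum>x'\<in>X. D a (y, x') * p (basis_vec x') j)" using True by simp
    finally show ?thesis using pout by (auto simp: Rp)
  next
    case False
    then have "R (\<pi> j) a y = 0" using RL_closed(1)[of "\<pi> j" a] by (simp add: fspace_def)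
    moreover have "tens_map X X (\<lambda>b. b) p (D a) (y, j) = 0"
      unfolding tens_map_apply sum_fun_apply smul_apply tens_apply
      using False by (auto simp: basis_vec_def intro!: sum.neutral)
    ultimately show ?thesis by simp
  qed
  interpret cg: cocentral_grading A m \<pi>
  proof unfold_locales
    show "m > 0" by (rule m)
    fix j k l :: int and a b :: "'i \<Rightarrow> 'k"
    show "\<pi> (j mod int m) = \<pi> j" by (simp add: \<pi>_def fun_eq_iff)
    have "p \<one>\<^sub>A = basis_vec 0" using p by (simp add: hopf_map_def Z_def group_hopf_def)
    then show "pairing X (\<pi> j) \<one>\<^sub>A = (if j mod int m = 0 then 1 else 0)"
      by (simp add: pair basis_vec_def)
    show "\<exists>a\<in>V. pairing X (\<pi> j) a \<noteq> 0"
    proof -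
      have "basis_vec (j mod int m) \<in> p ` V" using p hA jm by (simp add: hZ)
      then obtain a where "a \<in> V" "p a = basis_vec (j mod int m)" by auto
      then show ?thesis by (intro bexI[of _ a]) (simp_all add: pair basis_vec_def)
    qed
    assume a: "a \<in> V"
    have "hcomult Z (p a) = tens_map X X p p (D a)"
      using p a by (simp add: hopf_map_def hA hcomult_eq)
    then have "hcomult Z (p a) (j mod int m, k mod int m) = tens_map X X p p (D a) (j mod int m, k mod int m)" by simp
    also have "hcomult Z (p a) (j mod int m, k mod int m) = (if j mod int m = k mod int m then p a (j mod int m) else 0)"
      by (simp add: Z_def group_hopf_def)
    also have "tens_map X X p p (D a) (j mod int m, k mod int m) = pairing X (\<pi> j) (R (\<pi> k) a)"
      unfolding tens_map_apply sum_fun_apply smul_apply tens_apply pairing_def Rp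
      by (simp add: \<pi>_def sum_distrib_left mult_ac)
    finally have conv: "(if j mod int m = k mod int m then p a (j mod int m) else 0) = pairing X (\<pi> j) (R (\<pi> k) a)" .
    show "pairing X (\<pi> j) (R (\<pi> k) a) = (if j mod int m = k mod int m then pairing X (\<pi> j) a else 0)"
      unfolding conv[symmetric] by (simp add: pair[OF a])
    have "hcounit Z (p a) = hcounit A a" using p a by (simp add: hopf_map_def hA)
    then show "(\<Sum>j\<in>{0..<int m}. pairing X (\<pi> j) a) = eps a"
      using a by (simp add: pair Z_def group_hopf_def cZ hcounit_eq)
    have "tens_map X X p (\<lambda>b. b) (D a) = tens_map X X p (\<lambda>b. b) (tens_flip (D a))"
      using p a by (simp add: cocentral_def hA hcomult_eq)
    then have *: "tens_map X X p (\<lambda>b. b) (D a) (j mod int m, y) = tens_map X X p (\<lambda>b. b) (tens_flip (D a)) (j mod int m, y)" for y by simp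
    have **: "tens_map X X p (\<lambda>b. b) t (j mod int m, y) = (\<Sum>x\<in>X. t (x, y) * p (basis_vec x) (j mod int m))" if "y \<in> X" for t y
    proof -
      have "tens_map X X p (\<lambda>b. b) t (j mod int m, y) = (\<Sum>x\<in>X. \<Sum>x'\<in>X. if x' = y then t (x, y) * p (basis_vec x) (j mod int m) else 0)"
        unfolding tens_map_apply sum_fun_apply smul_apply tens_apply
        by (intro sum.cong refl) (auto simp: basis_vec_def)
      then show ?thesis using that by simp
    qed
    show "L (\<pi> j) a = R (\<pi> j) a"
    proof
      fix y
      show "L (\<pi> j) a y = R (\<pi> j) a y"
      proof (cases "y \<in> X")
        case True
        then have "(\<Sum>x\<in>X. D a (x, y) * p (basis_vec x) (j mod int m)) = (\<Sum>x\<in>X. tens_flip (D a) (x, y) * p (basis_vec x) (j mod int m))"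
          using *[of y] by (simp only: **[OF True])
        then show ?thesis by (simp add: L_def R_def slice_left_def slice_right_def \<pi>_def tens_flip_def mult_ac)
      next
        case False
        then show ?thesis using RL_closed[of "\<pi> j" a] by (simp add: fspace_def)
      qed
    qed
    assume b: "b \<in> V"
    have "p (a \<star> b) = hmult Z (p a \<otimes>\<^sub>k p b)"
      using p a b by (simp add: hopf_map_def hA flip: hmult_tens)
    then have "p (a \<star> b) (l mod int m) = (\<Sum>(x, y)\<in>{(x, y) \<in> {0..<int m} \<times> {0..<int m}. (x + y) mod int m = l mod int m}. p a x * p b y)"
      by (simp add: Z_def group_hopf_def cZ) (rule sum.cong; auto simp: tens_apply)
    also have "\<dots> = (\<Sum>j\<in>{0..<int m}. p a j * p b ((l - j) mod int m))"
    proof (rule sum.reindex_bij_witness[of _ "\<lambda>j. (j, (l - j) mod int m)" fst], goal_cases)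
      case (1 z)
      then obtain x y where z: "z = (x, y)" "x \<in> {0..<int m}" "y \<in> {0..<int m}" "(x + y) mod int m = l mod int m" by auto
      then have "int m dvd (x + y) - l" by (simp add: mod_eq_dvd_iff)
      then have "(l - x) mod int m = y mod int m" by (simp add: mod_eq_dvd_iff dvd_diff_commute algebra_simps)
      then show ?case using z by simp
    next
      case (5 z)
      then obtain x y where z: "z = (x, y)" "x \<in> {0..<int m}" "y \<in> {0..<int m}" "(x + y) mod int m = l mod int m" by auto
      then have "int m dvd (x + y) - l" by (simp add: mod_eq_dvd_iff)
      then have "(l - x) mod int m = y mod int m" by (simp add: mod_eq_dvd_iff dvd_diff_commute algebra_simps)
      then show ?case using z by simp
    qed (use m in \<open>auto simp: mod_add_right_eq\<close>)
    finally show "pairing X (\<pi> l) (a \<star> b) = (\<Sum>j\<in>{0..<int m}. pairing X (\<pi> j) a * pairing X (\<pi> (l - j)) b)"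
      using a b by (simp add: pair)
  qed
  have eV: "e x \<in> V" if "x \<in> carrier G" for x
    unfolding e_def by (rule linear_mapD(1)[OF il]) (use that in auto)
  have piece0: "a \<in> cg.piece 0 \<longleftrightarrow> a \<in> i ` fspace (carrier G)" for a
  proof
    assume a: "a \<in> cg.piece 0"
    then have aV: "a \<in> V" by (rule cg.pieceD)
    have "tens_map X X (\<lambda>b. b) p (hcomult A a) = a \<otimes>\<^sub>k hunit Z"
    proof
      fix z show "tens_map X X (\<lambda>b. b) p (hcomult A a) z = (a \<otimes>\<^sub>k hunit Z) z"
        using a m by (cases z) (auto simp: hcomult_eq aV idp tens_apply Z_def group_hopf_def basis_vec_def cg.P_on_piece[OF a])
    qed
    then show "a \<in> i ` fspace (carrier G)" using im aV by (simp add: hF hA)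
  next
    assume "a \<in> i ` fspace (carrier G)"
    then have a: "a \<in> V" "tens_map X X (\<lambda>b. b) p (D a) = a \<otimes>\<^sub>k hunit Z"
      using im by (auto simp: hF hA hcomult_eq)
    have "R (\<pi> 0) a = a"
    proof
      fix y show "R (\<pi> 0) a y = a y"
        using fun_cong[OF a(2), of "(y, 0)"] m by (simp add: idp a(1) tens_apply Z_def group_hopf_def basis_vec_def)
    qed
    then show "a \<in> cg.piece 0" using a by (simp add: cg.piece_def)
  qed
  have "pre_frame A m \<pi> G e"
  proof unfold_locales
    show "finite (carrier G)" by (rule G)
    have unitF: "hunit F = (\<Sum>x\<in>carrier G. basis_vec x)"
    proof
      fix y have "(\<Sum>x\<in>carrier G. basis_vec x) y = (\<Sum>x\<in>carrier G. if x = y then 1 else 0)"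
        unfolding sum_fun_apply by (intro sum.cong) (auto simp: basis_vec_def)
      then show "hunit F y = (\<Sum>x\<in>carrier G. basis_vec x) y" using G by (auto simp: F_def fun_hopf_def)
    qed
    have "\<one>\<^sub>A = i (hunit F)" using i by (simp add: hopf_map_def)
    also have "\<dots> = (\<Sum>x\<in>carrier G. e x)"
      unfolding unitF e_def by (rule linear_map_sum[OF il]) auto
    finally show "(\<Sum>x\<in>carrier G. e x) = \<one>\<^sub>A" ..
    fix x assume x: "x \<in> carrier G"
    show "e x \<in> cg.piece 0" using x by (auto simp: piece0 e_def)
    show "e x \<noteq> 0"
    proof
      assume "e x = 0"
      then have "i (basis_vec x) = i 0" by (simp add: e_def linear_mapD(4)[OF il])
      then have "basis_vec x = (0 :: 'g \<Rightarrow> 'k)" using i(2) x by (auto simp: hF dest: inj_onD)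
      then have "basis_vec x x = (0 :: 'k)" by simp
      then show False by (simp add: basis_vec_def)
    qed
    show "e x \<star> e y = (if x = y then e x else 0)" if y: "y \<in> carrier G" for y
    proof -
      have "e x \<star> e y = hmult A (i (basis_vec x) \<otimes>\<^sub>k i (basis_vec y))"
        using eV x y by (simp add: hmult_tens flip: e_def)
      also have "\<dots> = i (hmult F (basis_vec x \<otimes>\<^sub>k basis_vec y))"
        using i(1) x y by (simp add: hopf_map_def hF)
      also have "hmult F (basis_vec x \<otimes>\<^sub>k basis_vec y) = (if x = y then basis_vec x else (0 :: 'g \<Rightarrow> 'k))"
        by (auto simp: F_def fun_hopf_def tens_def basis_vec_def fun_eq_iff)
      finally show ?thesis by (cases "x = y") (simp_all only: simp_thms e_def linear_mapD(4)[OF il] if_True if_False)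
    qed
    have "eps (e x) = hcounit F (basis_vec x)"
      using i(1) x eV[OF x] by (simp add: hopf_map_def hF hcounit_eq flip: e_def) (simp add: e_def flip: hcounit_eq)
    then show "eps (e x) = (if x = \<one>\<^bsub>G\<^esub> then 1 else 0)"
      by (auto simp: F_def fun_hopf_def basis_vec_def)
    have "D (e x) = tens_map (carrier G) (carrier G) i i (hcomult F (basis_vec x))"
      using i(1) x eV[OF x] iF by (simp add: hopf_map_def hF e_def flip: hcomult_eq)
    also have "\<dots> = (\<Sum>y\<in>carrier G. \<Sum>z\<in>carrier G. if z = inv\<^bsub>G\<^esub> y \<otimes>\<^bsub>G\<^esub> x then e y \<otimes>\<^sub>k e (inv\<^bsub>G\<^esub> y \<otimes>\<^bsub>G\<^esub> x) else 0)"
      unfolding tens_map_apply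
    proof (intro sum.cong refl)
      fix y z assume yz: "y \<in> carrier G" "z \<in> carrier G"
      have "y \<otimes>\<^bsub>G\<^esub> z = x \<longleftrightarrow> z = inv\<^bsub>G\<^esub> y \<otimes>\<^bsub>G\<^esub> x" using x yz by (metis inv_solve_left)
      then show "hcomult F (basis_vec x) (y, z) \<bullet> (i (basis_vec y) \<otimes>\<^sub>k i (basis_vec z)) = (if z = inv\<^bsub>G\<^esub> y \<otimes>\<^bsub>G\<^esub> x then e y \<otimes>\<^sub>k e (inv\<^bsub>G\<^esub> y \<otimes>\<^bsub>G\<^esub> x) else 0)"
        using yz by (auto simp: F_def fun_hopf_def basis_vec_def[of x] e_def)
    qed
    also have "\<dots> = (\<Sum>y\<in>carrier G. e y \<otimes>\<^sub>k e (inv\<^bsub>G\<^esub> y \<otimes>\<^bsub>G\<^esub> x))" using x G by simp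
    finally show "D (e x) = (\<Sum>y\<in>carrier G. e y \<otimes>\<^sub>k e (inv\<^bsub>G\<^esub> y \<otimes>\<^bsub>G\<^esub> x))" .
  next
    fix a assume "a \<in> cg.piece 0"
    then obtain b where b: "b \<in> fspace (carrier G)" "a = i b" by (auto simp: piece0)
    have "i b = (\<Sum>x\<in>carrier G. b x \<bullet> e x)"
      unfolding e_def by (rule linear_map_expansion[OF il G(2) b(1)])
    then show "\<exists>c. a = (\<Sum>x\<in>carrier G. c x \<bullet> e x)" using b by auto
  qed
  then show ?thesis unfolding \<pi>_def e_def .
qed

section \<open>Hopf algebras with the same structure constants\<close>

lemma (in hopf_frame) frame_ext:
  fixes h h' :: "('i \<Rightarrow> 'k) \<Rightarrow> ('z \<Rightarrow> 'k)"
  assumes "\<And>a b. h (a + b) = h a + h b" "\<And>c a. h (c \<bullet> a) = c \<bullet> h a"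
    and "\<And>a b. h' (a + b) = h' a + h' b" "\<And>c a. h' (c \<bullet> a) = c \<bullet> h' a"
    and eq: "\<And>x n. x \<in> carrier G \<Longrightarrow> n < m \<Longrightarrow> h (bas x n) = h' (bas x n)" and a: "a \<in> V"
  shows "h a = h' a"
proof -
  have "h (0 \<bullet> 0) = 0 \<bullet> h 0" "h' (0 \<bullet> 0) = 0 \<bullet> h' 0" by (rule assms)+
  then have 0: "h 0 = 0" "h' 0 = 0" by simp_all
  let ?s = "\<Sum>n<m. \<Sum>x\<in>carrier G. coef n a x \<bullet> bas x n"
  have "h a = h ?s" by (rule arg_cong[OF basis_expansion_frame[OF a]])
  also have "\<dots> = h' ?s"
    by (simp add: additive_sum[of h, OF 0(1) assms(1)] additive_sum[of h', OF 0(2) assms(3)] assms(2,4) eq)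
  also have "\<dots> = h' a" by (rule arg_cong[OF basis_expansion_frame[OF a, symmetric]])
  finally show ?thesis .
qed

text \<open>The right counit axiom for \<open>u\<close>, compared coefficientwise. It determines the
  counit of \<open>u\<close> from \<open>\<sigma>\<close>, so algebras with equal cocycles have
  matching counits.\<close>

lemma (in cocycle_frame) eps_u: "y \<in> carrier G \<Longrightarrow> \<sigma> y \<one> * eps u = 1"
proof -
  assume y: "y \<in> carrier G"
  define \<phi> where "\<phi> x = eps (basis_vec x)" for x
  have lin: "linear_form X eps" by (simp add: linear_form_iff)
  have \<phi>: "pairing X \<phi> a = eps a" if "a \<in> V" for a
    using linear_form_pairing[OF lin fin that] unfolding \<phi>_def by simp
  have "u = R \<phi> u" by (rule R_eps[symmetric]) (simp_all add: \<phi>_def)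
  also have "\<dots> = (\<Sum>y\<in>carrier G. \<Sum>z\<in>carrier G. if z = \<one> then (\<sigma> y \<one> * eps u) \<bullet> bas y 1 else 0)"
    unfolding R_def D_u slice_right_sum by (intro sum.cong refl) (auto simp: \<phi> bas_def e_eps)
  finally have u: "u = (\<Sum>y\<in>carrier G. (\<sigma> y \<one> * eps u) \<bullet> bas y 1)" by simp
  have "bas y 1 = e y \<star> (\<Sum>y\<in>carrier G. (\<sigma> y \<one> * eps u) \<bullet> bas y 1)"
    unfolding u[symmetric] by (simp add: bas_def)
  also have "\<dots> = (\<Sum>z\<in>carrier G. if z = y then (\<sigma> y \<one> * eps u) \<bullet> bas y 1 else 0)"
    unfolding mul_sum_right by (intro sum.cong refl) (use y in \<open>auto simp: e_bas\<close>)
  finally have "bas y 1 = (\<sigma> y \<one> * eps u) \<bullet> bas y 1" using y by simp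
  then have "(\<sigma> y \<one> * eps u - 1) \<bullet> bas y 1 = 0" by (auto simp: fun_eq_iff smul_apply algebra_simps)
  then show ?thesis using bas_nz[OF y] by simp
qed

lemma (in fd_bialgebra) eps_pow: "eps (a \<up> n) = eps a ^ n"
  by (induction n) simp_all

text \<open>Once the m-th power of \<open>u\<close> is 1, all structure constants in the basis
  \<open>bas x n\<close> with n < m are expressed by the group, \<open>\<alpha>\<close> and
  \<open>\<sigma>\<close>; matching the two bases is then an isomorphism.\<close>

theorem hopf_iso_of_frames:
  fixes A :: "('i, 'k::field) hopf_data" and B :: "('j, 'k) hopf_data" and G :: "('g, 'x) monoid_scheme"
  assumes A: "cocycle_frame A m \<pi> G e u v \<alpha> \<sigma>" "hpow A u m = hunit A"
    and B: "cocycle_frame B m \<pi>' G e' u' v' \<alpha> \<sigma>" "hpow B u' m = hunit B"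
  shows "\<exists>f. hopf_map A B f \<and> bij_betw f (hspace A) (hspace B)"
proof -
  interpret A: cocycle_frame A m \<pi> G e u v \<alpha> \<sigma> by (rule A)
  interpret B: cocycle_frame B m \<pi>' G e' u' v' \<alpha> \<sigma> by (rule B)
  define f where "f a = (\<Sum>n<m. \<Sum>x\<in>carrier G. A.coef n a x \<bullet> B.bas x n)" for a
  define g where "g a = (\<Sum>n<m. \<Sum>x\<in>carrier G. B.coef n a x \<bullet> A.bas x n)" for a
  have f_add: "f (a + b) = f a + f b" and f_smul: "f (c \<bullet> a) = c \<bullet> f a" for a b c
    by (simp_all add: f_def A.coef_add A.coef_smul sum.distrib smul_sum)
  have g_add: "g (a + b) = g a + g b" and g_smul: "g (c \<bullet> a) = c \<bullet> g a" for a b c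
    by (simp_all add: g_def B.coef_add B.coef_smul sum.distrib smul_sum)
  have fV: "f a \<in> fspace (index B)" and gV: "g b \<in> fspace (index A)" for a b
    unfolding f_def g_def by auto
  have f_bas: "f (A.bas y k) = B.bas y k" if "y \<in> carrier G" "k < m" for y k
  proof -
    have "f (A.bas y k) = (\<Sum>n<m. \<Sum>x\<in>carrier G. if x = y then (if n = k then B.bas y k else 0) else 0)"
      unfolding f_def by (intro sum.cong refl) (use that in \<open>auto simp: A.coef_bas\<close>)
    then show ?thesis using that by simp
  qed
  have g_bas: "g (B.bas y k) = A.bas y k" if "y \<in> carrier G" "k < m" for y k
  proof -
    have "g (B.bas y k) = (\<Sum>n<m. \<Sum>x\<in>carrier G. if x = y then (if n = k then A.bas y k else 0) else 0)"
      unfolding g_def by (intro sum.cong refl) (use that in \<open>auto simp: B.coef_bas\<close>)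
    then show ?thesis using that by simp
  qed
  have gf: "g (f a) = a" if "a \<in> A.V" for a
    by (rule A.frame_ext[of "\<lambda>a. g (f a)" "\<lambda>a. a", OF _ _ _ _ _ that]) (simp_all add: f_add f_smul g_add g_smul f_bas g_bas)
  have fg: "f (g a) = a" if "a \<in> B.V" for a
    by (rule B.frame_ext[of "\<lambda>a. f (g a)" "\<lambda>a. a", OF _ _ _ _ _ that]) (simp_all add: f_add f_smul g_add g_smul f_bas g_bas)
  have bij: "bij_betw f (hspace A) (hspace B)"
    by (rule bij_betw_byWitness[of _ g]) (auto simp: hspace_def gf fg fV gV)
  have lin: "linear_map A.X B.X f" by (rule linear_mapI) (simp_all add: fV f_add f_smul)
  \<comment> \<open>Products and coproducts are computed for arbitrary exponents, whereas the bases
    stop at \<open>m\<close>; the m-th power being 1 bridges the two.\<close>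
  have mod: "A.bas x n = A.bas x (n mod m)" "B.bas x n = B.bas x (n mod m)" for x n
    using A.u_pow_eq_if_cong[OF A(2), of n "n mod m"] B.u_pow_eq_if_cong[OF B(2), of n "n mod m"]
    by (simp_all add: A.bas_def B.bas_def)
  have f_bas': "f (A.bas x n) = B.bas x n" if "x \<in> carrier G" for x n
    using f_bas[OF that, of "n mod m"] A.m_pos by (simp flip: mod)
  have f0: "f 0 = 0" using f_smul[of 0 0] by simp
  have mult: "f (hmul A a b) = hmul B (f a) (f b)" if a: "a \<in> A.V" and b: "b \<in> A.V" for a b
  proof (rule A.frame_ext[of "\<lambda>a. f (hmul A a b)" "\<lambda>a. hmul B (f a) (f b)", OF _ _ _ _ _ a])
    fix x n assume x: "x \<in> carrier G"
    show "f (hmul A (A.bas x n) b) = hmul B (f (A.bas x n)) (f b)"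
      by (rule A.frame_ext[of "\<lambda>b. f (hmul A (A.bas x n) b)" "\<lambda>b. hmul B (f (A.bas x n)) (f b)", OF _ _ _ _ _ b])
        (simp_all add: f_add f_smul x f_bas' A.bas_mul B.bas_mul f0)
  qed (simp_all add: f_add f_smul)
  have comult: "hdelta B (f a) = tens_map A.X A.X f f (hdelta A a)" if a: "a \<in> A.V" for a
  proof (rule A.frame_ext[of "\<lambda>a. hdelta B (f a)" "\<lambda>a. tens_map A.X A.X f f (hdelta A a)", OF _ _ _ _ _ a])
    fix x n assume x: "x \<in> carrier G"
    show "hdelta B (f (A.bas x n)) = tens_map A.X A.X f f (hdelta A (A.bas x n))"
      using x by (simp add: f_bas' A.D_bas B.D_bas tens_map_sum tens_map_tens[OF lin lin])
  qed (simp_all add: f_add f_smul)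
  have "eps_eq": "heps A u = heps B u'"
    using A.eps_u[of "\<one>\<^bsub>G\<^esub>"] B.eps_u[of "\<one>\<^bsub>G\<^esub>"] by (metis A.one_closed mult_cancel_left zero_neq_one mult_zero_left)
  have counit: "heps B (f a) = heps A a" if a: "a \<in> A.V" for a
  proof -
    \<comment> \<open>\<open>frame_ext\<close> compares maps into function spaces; a scalar is
      therefore treated as a function on the one-point type.\<close>
    have "(\<lambda>_::unit. heps B (f a)) = (\<lambda>_. heps A a)"
      by (rule A.frame_ext[of "\<lambda>a (_::unit). heps B (f a)" "\<lambda>a _. heps A a", OF _ _ _ _ _ a])
        (simp_all add: f_add f_smul fun_eq_iff smul_apply f_bas' A.bas_def B.bas_def A.e_eps B.e_eps A.eps_pow B.eps_pow eps_eq flip: A.bas_def B.bas_def, simp add: A.bas_def B.bas_def A.e_eps B.e_eps A.eps_pow B.eps_pow eps_eq)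
    then show ?thesis by (simp add: fun_eq_iff)
  qed
  have unit: "f (hunit A) = hunit B"
  proof -
    have "f (hunit A) = f (\<Sum>x\<in>carrier G. A.bas x 0)" by (simp add: A.bas_def A.e_sum)
    also have "\<dots> = (\<Sum>x\<in>carrier G. f (A.bas x 0))" by (rule additive_sum[of f, OF f0 f_add])
    also have "\<dots> = hunit B" by (simp add: f_bas') (simp add: B.bas_def B.e_sum)
    finally show ?thesis .
  qed
  have "hopf_map A B f"
    unfolding hopf_map_def using lin mult unit comult counit fV
    by (simp add: hspace_def A.hmult_tens B.hmult_tens A.hcomult_eq B.hcomult_eq A.hcounit_eq B.hcounit_eq)
  with bij show ?thesis by blast
qed

section \<open>Isomorphisms\<close>

lemma hopf_map_comp:
  assumes A: "fd_hopf_algebra A" and B: "fd_hopf_algebra B" and f: "hopf_map A B f" and g: "hopf_map B C g"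
  shows "hopf_map A C (\<lambda>a. g (f a))"
proof -
  interpret A: fd_hopf_algebra A by (rule A)
  interpret B: fd_hopf_algebra B by (rule B)
  have fl: "linear_map (index A) (index B) f" and gl: "linear_map (index B) (index C) g"
    using f g by (simp_all add: hopf_map_def)
  have fV: "f a \<in> hspace B" if "a \<in> hspace A" for a
    using linear_mapD(1)[OF fl] that by (simp add: hspace_def)
  have "linear_map (index A) (index C) (\<lambda>a. g (f a))"
    by (rule linear_mapI) (simp_all add: linear_mapD[OF fl] linear_mapD[OF gl])
  moreover have "hcomult C (g (f a)) = tens_map (index A) (index A) (\<lambda>a. g (f a)) (\<lambda>a. g (f a)) (hcomult A a)" if a: "a \<in> hspace A" for a
  proof -
    have "hcomult C (g (f a)) = tens_map (index B) (index B) g g (tens_map (index A) (index A) f f (hcomult A a))"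
      using f g a fV by (simp add: hopf_map_def)
    also have "\<dots> = tens_map (index A) (index A) (\<lambda>a. g (f a)) (\<lambda>a. g (f a)) (hcomult A a)"
      by (simp add: tens_map_apply[of "index A" "index A"] tens_map_sum
          tens_map_tens[OF gl gl] linear_mapD(1)[OF fl])
    finally show ?thesis .
  qed
  ultimately show ?thesis
    using f g fV by (simp add: hopf_map_def)
qed

lemma hopf_map_inverse:
  fixes A :: "('i, 'k::field) hopf_data" and B :: "('j, 'k) hopf_data"
  assumes A: "fd_hopf_algebra A" and B: "fd_hopf_algebra B" and f: "hopf_map A B f"
    and bij: "bij_betw f (hspace A) (hspace B)"
  shows "hopf_map B A (inv_into (hspace A) f)"
proof -
  interpret A: fd_hopf_algebra A by (rule A)
  interpret B: fd_hopf_algebra B by (rule B)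
  define g where "g = inv_into (hspace A) f"
  have hs: "hspace A = fspace (index A)" "hspace B = fspace (index B)" by (simp_all add: hspace_def)
  have fl: "linear_map (index A) (index B) f" using f by (simp add: hopf_map_def)
  have gf: "g (f a) = a" if "a \<in> A.V" for a
    using bij_betw_inv_into_left[OF bij] that by (simp add: g_def hs)
  have fg: "f (g b) = b" if "b \<in> B.V" for b
    using bij_betw_inv_into_right[OF bij] that by (simp add: g_def hs)
  have gV: "g b \<in> A.V" if "b \<in> B.V" for b
    using bij_betw_inv_into[OF bij] that by (auto simp: g_def hs bij_betw_def)
  have ex: "\<exists>a\<in>A.V. b = f a" if "b \<in> B.V" for b using fg[OF that] gV[OF that] by metis
  have fV: "f a \<in> B.V" if "a \<in> A.V" for a by (rule linear_mapD(1)[OF fl that])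
  have lin: "linear_map (index B) (index A) g"
  proof (rule linear_mapI)
    fix b b' :: "'j \<Rightarrow> 'k" and c assume "b \<in> B.V" 
    then obtain a where a: "a \<in> A.V" "b = f a" using ex by blast
    show "g b \<in> A.V" using a by (simp add: gf)
    show "g (c \<bullet> b) = c \<bullet> g b" using a by (simp add: gf flip: linear_mapD(3)[OF fl])
    assume "b' \<in> B.V"
    then obtain a' where a': "a' \<in> A.V" "b' = f a'" using ex by blast
    show "g (b + b') = g b + g b'" using a a' by (simp add: gf flip: linear_mapD(2)[OF fl])
  qed
  have inv2: "tens_map (index B) (index B) g g (tens_map (index A) (index A) f f t) = t" if "t \<in> fspace (index A \<times> index A)" for t
    by (rule A.tensor_ext[OF that, of "\<lambda>t. tens_map (index B) (index B) g g (tens_map (index A) (index A) f f t)" "\<lambda>t. t"])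
      (simp_all add: tens_map_tens[OF fl fl] tens_map_tens[OF lin lin] fV gf)
  have "hopf_map B A g"
    unfolding hopf_map_def hs
  proof (intro conjI ballI lin)
    fix b :: "'j \<Rightarrow> 'k" assume "b \<in> B.V"
    then obtain a where a: "a \<in> A.V" "b = f a" using ex by blast
    show "hcomult A (g b) = tens_map (index B) (index B) g g (hcomult B b)"
    proof -
      have "hcomult B b = tens_map (index A) (index A) f f (hcomult A a)" using f a by (simp add: hopf_map_def hs)
      then show ?thesis using a by (simp add: gf A.hcomult_eq inv2)
    qed
    show "hcounit A (g b) = hcounit B b" using f a by (simp add: hopf_map_def hs gf)
    fix b' :: "'j \<Rightarrow> 'k" assume "b' \<in> B.V"
    then obtain a' where a': "a' \<in> A.V" "b' = f a'" using ex by blast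
    have "f (hmult A (a \<otimes>\<^sub>k a')) = hmult B (b \<otimes>\<^sub>k b')" using f a a' by (simp add: hopf_map_def hs)
    then have "g (hmult B (b \<otimes>\<^sub>k b')) = hmult A (a \<otimes>\<^sub>k a')"
      using gf[of "hmult A (a \<otimes>\<^sub>k a')"] a a' by (simp add: A.hmult_tens)
    then show "g (hmult B (b \<otimes>\<^sub>k b')) = hmult A (g b \<otimes>\<^sub>k g b')" using a a' by (simp add: gf)
  next
    show "g (hunit B) = hunit A" using f gf[of "hunit A"] by (simp add: hopf_map_def)
  qed
  then show ?thesis by (simp add: g_def)
qed

text \<open>Besides the images of \<open>e\<close>, \<open>u\<close> and \<open>v\<close>, a grading
  of \<open>B\<close> is required: its forms are those of \<open>A\<close> composed with the inverse
  isomorphism.\<close>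

lemma (in cocycle_frame) transport:
  fixes B :: "('j, 'k) hopf_data"
  assumes B: "fd_hopf_algebra B" and f: "hopf_map A B f" and bij: "bij_betw f (hspace A) (hspace B)"
  shows "(\<exists>\<pi>'. cocycle_frame B m \<pi>' G (\<lambda>x. f (e x)) (f u) (f v) \<alpha> \<sigma>) \<and> hpow B (f u) n = f (u \<up> n)"
proof -
  interpret B: fd_hopf_algebra B by (rule B)
  define g where "g = inv_into (hspace A) f"
  have hs: "hspace A = fspace (index A)" "hspace B = fspace (index B)" by (simp_all add: hspace_def)
  have g: "hopf_map B A g" unfolding g_def by (rule hopf_map_inverse[OF _ B f bij]) unfold_locales
  have fl: "linear_map (index A) (index B) f" and gl: "linear_map (index B) (index A) g"
    using f g by (simp_all add: hopf_map_def)
  have gf: "g (f a) = a" if "a \<in> V" for a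
    using bij_betw_inv_into_left[OF bij] that by (simp add: g_def hs)
  have fg: "f (g b) = b" if "b \<in> B.V" for b
    using bij_betw_inv_into_right[OF bij] that by (simp add: g_def hs)
  have gV: "g b \<in> V" if "b \<in> B.V" for b by (rule linear_mapD(1)[OF gl that])
  have fV [simp]: "f a \<in> B.V" if "a \<in> V" for a by (rule linear_mapD(1)[OF fl that])
  have ex: "\<exists>a\<in>V. b = f a" if "b \<in> B.V" for b using fg[OF that] gV[OF that] by metis
  have f_mul: "f (a \<star> b) = hmul B (f a) (f b)" if "a \<in> V" "b \<in> V" for a b
    using f that by (simp add: hopf_map_def hs hmult_tens B.hmult_tens)
  have f_D: "hdelta B (f a) = tens_map X X f f (D a)" if "a \<in> V" for a
    using f that by (simp add: hopf_map_def hs hcomult_eq B.hcomult_eq)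
  have f_eps: "heps B (f a) = eps a" if "a \<in> V" for a
    using f that by (simp add: hopf_map_def hs hcounit_eq B.hcounit_eq)
  have f_one: "f \<one>\<^sub>A = hunit B" using f by (simp add: hopf_map_def)
  have f_zero: "f a = 0 \<longleftrightarrow> a = 0" if "a \<in> V" for a
    using gf[OF that] gf[of 0] linear_mapD(4)[OF fl] by auto
  have f_tens: "tens_map X X f f (a \<otimes>\<^sub>k b) = f a \<otimes>\<^sub>k f b" if "a \<in> V" "b \<in> V" for a b
    using that by (simp add: tens_map_tens[OF fl fl])
  have pw: "hpow B (f u) n = f (u \<up> n)" for n
    by (induction n) (simp_all add: f_one f_mul)
  define \<pi>' where "\<pi>' j i = pairing X (\<pi> j) (g (basis_vec i))" for j i
  have pair: "pairing (index B) (\<pi>' j) (f a) = pairing X (\<pi> j) a" if a: "a \<in> V" for a j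
  proof -
    have "linear_form (index B) (\<lambda>b. pairing X (\<pi> j) (g b))"
      by (simp add: linear_form_iff linear_mapD[OF gl])
    from linear_form_pairing[OF this B.fin fV[OF a]] show ?thesis
      unfolding \<pi>'_def using a by (simp add: gf)
  qed
  have RR: "B.R (\<pi>' j) (f a) = f (P j a)" if "a \<in> V" for a j
  proof -
    have "slice_right (index B) (\<pi>' j) (tens_map X X f f (D a)) = f (restr X (slice_right X (\<pi> j) (D a)))"
      by (rule tensor_ext[OF D_closed, of "\<lambda>t. slice_right (index B) (\<pi>' j) (tens_map X X f f t)" "\<lambda>t. f (restr X (slice_right X (\<pi> j) t))"])
        (simp_all add: f_tens pair linear_mapD[OF fl])
    then show ?thesis using that by (simp add: B.R_def R_def f_D slice_closed[OF D_closed])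
  qed
  have LL: "B.L (\<pi>' j) (f a) = f (L (\<pi> j) a)" if "a \<in> V" for a j
  proof -
    have "slice_left (index B) (\<pi>' j) (tens_map X X f f (D a)) = f (restr X (slice_left X (\<pi> j) (D a)))"
      by (rule tensor_ext[OF D_closed, of "\<lambda>t. slice_left (index B) (\<pi>' j) (tens_map X X f f t)" "\<lambda>t. f (restr X (slice_left X (\<pi> j) t))"])
        (simp_all add: f_tens pair linear_mapD[OF fl])
    then show ?thesis using that by (simp add: B.L_def L_def f_D slice_closed[OF D_closed])
  qed
  interpret C: cocentral_grading B m \<pi>'
  proof unfold_locales
    show "m > 0" by (rule m_pos)
    fix j l :: int and a b :: "'j \<Rightarrow> 'k"
    show "\<pi>' (j mod int m) = \<pi>' j" by (simp add: \<pi>'_def pi_mod fun_eq_iff)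
    show "pairing (index B) (\<pi>' j) (hunit B) = (if j mod int m = 0 then 1 else 0)"
      by (simp add: pair pi_one flip: f_one)
    show "\<exists>a\<in>B.V. pairing (index B) (\<pi>' j) a \<noteq> 0"
      using pi_nonzero[of j] by (metis pair fV)
    assume "a \<in> B.V" then obtain a' where a: "a' \<in> V" "a = f a'" using ex by blast
    show "pairing (index B) (\<pi>' j) (B.R (\<pi>' l) a) = (if j mod int m = l mod int m then pairing (index B) (\<pi>' j) a else 0)"
      using a by (simp add: RR pair pi_conv)
    show "(\<Sum>j\<in>{0..<int m}. pairing (index B) (\<pi>' j) a) = heps B a"
      using a by (simp add: pair pi_sum f_eps)
    show "B.L (\<pi>' j) a = B.R (\<pi>' j) a" using a by (simp add: LL RR pi_central)
    assume "b \<in> B.V" then obtain b' where b: "b' \<in> V" "b = f b'" using ex by blast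
    show "pairing (index B) (\<pi>' l) (hmul B a b) = (\<Sum>j\<in>{0..<int m}. pairing (index B) (\<pi>' j) a * pairing (index B) (\<pi>' (l - j)) b)"
      using a b by (simp add: pair pi_mul flip: f_mul)
  qed
  have pc: "f a \<in> C.piece j \<longleftrightarrow> a \<in> piece j" if a: "a \<in> V" for a j
    using a by (simp add: C.piece_def piece_def RR) (metis gf RL_closed(1))
  interpret F: hopf_frame B m \<pi>' G "\<lambda>x. f (e x)" "f u" "f v" \<alpha>
  proof unfold_locales
    show "finite (carrier G)" by simp
    have "(\<Sum>x\<in>carrier G. f (e x)) = f (\<Sum>x\<in>carrier G. e x)"
      by (rule linear_map_sum[OF fl, symmetric]) simp
    then show "(\<Sum>x\<in>carrier G. f (e x)) = hunit B" by (simp add: e_sum f_one)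
    show "f u \<in> C.piece 1" by (simp add: pc u_piece)
    show "f v \<in> B.V" by simp
    show "hmul B (f u) (f v) = hunit B" "hmul B (f v) (f u) = hunit B" 
      by (simp_all add: uv vu f_one flip: f_mul)
    fix x assume x: "x \<in> carrier G"
    show "f (e x) \<in> C.piece 0" "f (e x) \<noteq> 0" using x by (simp_all add: pc e_piece f_zero e_nz)
    show "hmul B (f (e x)) (f (e y)) = (if x = y then f (e x) else 0)" if "y \<in> carrier G" for y
    proof -
      have "hmul B (f (e x)) (f (e y)) = f (e x \<star> e y)" using x that by (simp add: f_mul)
      then show ?thesis using x that linear_mapD(4)[OF fl] by (cases "x = y") (simp_all only: simp_thms e_mul if_True if_False)
    qed
    show "heps B (f (e x)) = (if x = \<one> then 1 else 0)" using x by (simp add: f_eps e_eps)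
    show "hdelta B (f (e x)) = (\<Sum>y\<in>carrier G. f (e y) \<otimes>\<^sub>k f (e (inv y \<otimes> x)))"
      using x by (simp add: f_D e_D tens_map_sum f_tens)
    show "hmul B (f (e x)) (f u) = hmul B (f u) (f (e (\<alpha> x)))" using x by (simp add: e_u flip: f_mul)
    show "\<alpha> x \<in> carrier G" using x by simp
  next
    fix a assume a: "a \<in> C.piece 0"
    then obtain a' where a': "a' \<in> V" "a = f a'" using ex C.pieceD by blast
    then obtain c where "a' = (\<Sum>x\<in>carrier G. c x \<bullet> e x)" using e_span pc a by blast
    then have "a = f (\<Sum>x\<in>carrier G. c x \<bullet> e x)" using a' by simp
    also have "\<dots> = (\<Sum>x\<in>carrier G. c x \<bullet> f (e x))"
      by (subst linear_map_sum[OF fl]) (simp_all add: linear_mapD(3)[OF fl])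
    finally show "\<exists>c. a = (\<Sum>x\<in>carrier G. c x \<bullet> f (e x))" by blast
  qed
  have bas': "F.bas y 1 = f (bas y 1)" if "y \<in> carrier G" for y
    using that by (simp add: F.bas_def bas_def f_mul pw)
  have "cocycle_frame B m \<pi>' G (\<lambda>x. f (e x)) (f u) (f v) \<alpha> \<sigma>"
  proof unfold_locales
    show "hdelta B (f u) = (\<Sum>y\<in>carrier G. \<Sum>z\<in>carrier G. \<sigma> y z \<bullet> (F.bas y 1 \<otimes>\<^sub>k F.bas z 1))"
      by (simp add: f_D D_u tens_map_sum f_tens bas'[unfolded One_nat_def])
  qed
  then show ?thesis using pw by blast
qed

section \<open>Cocentral characters and uniqueness of the frame\<close>

context fd_bialgebra
begin

lemma L_add_functional: "L (\<phi> + \<psi>) a = L \<phi> a + L \<psi> a" "L 0 a = 0"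
  by (simp_all add: L_def slice_left_def fun_eq_iff algebra_simps sum.distrib)

lemma R_L_smul_functional: "R (c \<bullet> \<phi>) a = c \<bullet> R \<phi> a" "L (c \<bullet> \<phi>) a = c \<bullet> L \<phi> a"
  by (simp_all add: R_def L_def slice_left_def slice_right_def smul_def fun_eq_iff sum_distrib_left mult_ac)

lemma R_mul_character:
  assumes "\<And>a b. a \<in> V \<Longrightarrow> b \<in> V \<Longrightarrow> pairing X \<chi> (a \<star> b) = pairing X \<chi> a * pairing X \<chi> b"
  shows "R \<chi> (a \<star> b) = R \<chi> a \<star> R \<chi> b"
  unfolding R_def D_mul
  using slice_right_mul2[where \<phi> = \<chi> and J = "{()}" and \<psi> = "\<lambda>_. \<chi>" and \<chi> = "\<lambda>_. \<chi>", OF _ D_closed D_closed] assms by simp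

end

text \<open>Integer powers taken through the residue of the exponent: for an element with m-th power
  1 this is a homomorphism from the integers that needs no inverses.\<close>

definition cpow :: "nat \<Rightarrow> 'a::monoid_mult \<Rightarrow> int \<Rightarrow> 'a" where "cpow m \<zeta> j = \<zeta> ^ nat (j mod int m)"

lemma cpow_mod: "cpow m \<zeta> (j mod int m) = cpow m \<zeta> j"
  by (simp add: cpow_def)

lemma cpow_0 [simp]: "cpow m \<zeta> 0 = 1"
  by (simp add: cpow_def)

lemma cpow_nat:
  assumes "\<zeta> ^ m = 1" shows "cpow m \<zeta> (int n) = \<zeta> ^ n"
proof -
  have "\<zeta> ^ n = \<zeta> ^ (m * (n div m) + n mod m)" by simp
  also have "\<dots> = \<zeta> ^ (n mod m)" unfolding power_add power_mult using assms by simp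
  finally show ?thesis by (simp add: cpow_def nat_mod_distrib)
qed

lemma cpow_cong: "j mod int m = k mod int m \<Longrightarrow> cpow m \<zeta> j = cpow m \<zeta> k"
  by (simp add: cpow_def)

lemma cpow_add:
  assumes "\<zeta> ^ m = 1" "m > 0" shows "cpow m \<zeta> (j + k) = cpow m \<zeta> j * cpow m \<zeta> k"
proof -
  have "cpow m \<zeta> (j + k) = cpow m \<zeta> (int (nat (j mod int m) + nat (k mod int m)))"
    by (rule cpow_cong) (use assms in \<open>simp add: mod_simps\<close>)
  then show ?thesis unfolding cpow_nat[OF assms(1)] power_add by (simp add: cpow_def)
qed

lemma cpow_mult:
  assumes "\<zeta> ^ m = 1" "m > 0" shows "cpow m \<zeta> (int n * j) = cpow m \<zeta> j ^ n"
  by (induction n) (simp_all add: cpow_add[OF assms] algebra_simps)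

context cocentral_grading
begin

abbreviation zpow where "zpow \<equiv> cpow m"

text \<open>For an m-th root of unity this is the map onto k\<int>_m followed by the algebra map
  that sends the generator to \<open>\<zeta>\<close>.\<close>

definition character :: "'k \<Rightarrow> 'i \<Rightarrow> 'k" where "character \<zeta> = (\<Sum>j\<in>{0..<int m}. zpow \<zeta> j \<bullet> \<pi> j)"

lemma sum_shift:
  fixes f :: "int \<Rightarrow> 'z::comm_monoid_add"
  assumes "\<And>j. f (j mod int m) = f j"
  shows "(\<Sum>l\<in>{0..<int m}. f (l - j)) = (\<Sum>l\<in>{0..<int m}. f l)"
  by (rule sum.reindex_bij_witness[of _ "\<lambda>l. (l + j) mod int m" "\<lambda>l. (l - j) mod int m"])
    (use m_pos in \<open>simp_all add: assms mod_simps\<close>)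

context
  fixes \<zeta> :: 'k assumes \<zeta>: "\<zeta> ^ m = 1"
begin

lemma pairing_character: "pairing X (character \<zeta>) a = (\<Sum>j\<in>{0..<int m}. zpow \<zeta> j * pairing X (\<pi> j) a)"
  by (simp add: character_def pairing_sum_left)

lemma character_mul:
  assumes "a \<in> V" "b \<in> V"
  shows "pairing X (character \<zeta>) (a \<star> b) = pairing X (character \<zeta>) a * pairing X (character \<zeta>) b"
proof -
  have "pairing X (character \<zeta>) (a \<star> b) = (\<Sum>l\<in>{0..<int m}. \<Sum>j\<in>{0..<int m}. zpow \<zeta> l * (pairing X (\<pi> j) a * pairing X (\<pi> (l - j)) b))"
    using assms by (simp add: pairing_character pi_mul sum_distrib_left)
  also have "\<dots> = (\<Sum>j\<in>{0..<int m}. \<Sum>l\<in>{0..<int m}. zpow \<zeta> l * (pairing X (\<pi> j) a * pairing X (\<pi> (l - j)) b))"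
    by (rule sum.swap)
  also have "\<dots> = (\<Sum>j\<in>{0..<int m}. zpow \<zeta> j * pairing X (\<pi> j) a * pairing X (character \<zeta>) b)"
  proof (rule sum.cong[OF refl])
    fix j
    have "(\<Sum>l\<in>{0..<int m}. zpow \<zeta> (l - j) * pairing X (\<pi> (l - j)) b) = pairing X (character \<zeta>) b"
      unfolding pairing_character by (rule sum_shift[of "\<lambda>l. zpow \<zeta> l * pairing X (\<pi> l) b"]) (simp add: cpow_mod pi_mod)
    moreover have "(\<Sum>l\<in>{0..<int m}. zpow \<zeta> l * (pairing X (\<pi> j) a * pairing X (\<pi> (l - j)) b))
       = (\<Sum>l\<in>{0..<int m}. zpow \<zeta> j * pairing X (\<pi> j) a * (zpow \<zeta> (l - j) * pairing X (\<pi> (l - j)) b))"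
    proof (rule sum.cong[OF refl])
      fix l
      have "zpow \<zeta> l = zpow \<zeta> j * zpow \<zeta> (l - j)" using cpow_add[OF \<zeta> m_pos, of j "l - j"] by simp
      then show "zpow \<zeta> l * (pairing X (\<pi> j) a * pairing X (\<pi> (l - j)) b) = zpow \<zeta> j * pairing X (\<pi> j) a * (zpow \<zeta> (l - j) * pairing X (\<pi> (l - j)) b)"
        by simp
    qed
    ultimately show "(\<Sum>l\<in>{0..<int m}. zpow \<zeta> l * (pairing X (\<pi> j) a * pairing X (\<pi> (l - j)) b)) = zpow \<zeta> j * pairing X (\<pi> j) a * pairing X (character \<zeta>) b"
      by (simp only: sum_distrib_left[symmetric])
  qed
  finally show ?thesis
    by (simp only: sum_distrib_right[symmetric] pairing_character[symmetric])
qed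

lemma character_one: "pairing X (character \<zeta>) \<one>\<^sub>A = 1"
proof -
  have "pairing X (character \<zeta>) \<one>\<^sub>A = (\<Sum>j\<in>{0..<int m}. if j = 0 then 1 else 0)"
    unfolding pairing_character by (intro sum.cong refl) (auto simp: pi_one cpow_def)
  then show ?thesis using m_pos by simp
qed

lemma R_character: "R (character \<zeta>) a = (\<Sum>j\<in>{0..<int m}. zpow \<zeta> j \<bullet> P j a)"
  unfolding character_def
  by (subst additive_sum[of "\<lambda>\<phi>. R \<phi> a"]) (simp_all add: R_add_functional R_L_smul_functional)

lemma L_character: "a \<in> V \<Longrightarrow> L (character \<zeta>) a = R (character \<zeta>) a"
  unfolding R_character unfolding character_def
  by (subst additive_sum[of "\<lambda>\<phi>. L \<phi> a"]) (simp_all add: L_add_functional R_L_smul_functional pi_central)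

text \<open>The character acts on degree \<open>j\<close> by the scalar \<zeta>^j; for primitive
  \<open>\<zeta>\<close> the grading is its eigenspace decomposition.\<close>

lemma P_R_character: "P j (R (character \<zeta>) a) = zpow \<zeta> j \<bullet> P j a"
proof -
  have "P j (R (character \<zeta>) a) = (\<Sum>i\<in>{0..<int m}. if i = j mod int m then zpow \<zeta> j \<bullet> P j a else 0)"
    unfolding R_character R_sum by (intro sum.cong refl) (auto simp: P_P cpow_mod)
  then show ?thesis using m_pos by simp
qed

lemma R_character_piece: "a \<in> piece j \<Longrightarrow> R (character \<zeta>) a = zpow \<zeta> j \<bullet> a"
proof -
  assume a: "a \<in> piece j"
  have "R (character \<zeta>) a = (\<Sum>i\<in>{0..<int m}. if i = j mod int m then zpow \<zeta> j \<bullet> a else 0)"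
    unfolding R_character by (intro sum.cong refl) (auto simp: P_on_piece[OF a] cpow_mod)
  then show ?thesis using m_pos by simp
qed

end
end

text \<open>\<open>\<sigma>_nondegenerate\<close> says that the alternating pairing \<sigma>(x,y) /
  \<sigma>(y,x) has trivial radical; this is what makes the grading canonical.\<close>

locale normal_frame = cocycle_frame A m \<pi> G e u v \<alpha> \<sigma>
  for A :: "('i, 'k::field) hopf_data" and m \<pi> and G :: "('g, 'x) monoid_scheme" (structure) and e u v \<alpha> \<sigma> +
  assumes u_m: "u \<up> m = \<one>\<^sub>A"
    and \<sigma>_one: "y \<in> carrier G \<Longrightarrow> \<sigma> y \<one> = 1"
    and \<sigma>_nondegenerate: "x \<in> carrier G \<Longrightarrow> (\<And>y. y \<in> carrier G \<Longrightarrow> \<sigma> x y = \<sigma> y x) \<Longrightarrow> x = \<one>"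
begin

text \<open>On degree 0 an algebra map to the field is evaluation at a point \<open>x0\<close>.
  Comparing the two slices of \<open>D u\<close> shows that \<open>x0\<close> pairs symmetrically
  with every point, hence is the identity. Then \<open>R \<chi>\<close> fixes degree 0 and
  multiplies \<open>u\<close> by its value \<xi> there.\<close>

lemma central_character:
  assumes mul: "\<And>a b. a \<in> V \<Longrightarrow> b \<in> V \<Longrightarrow> pairing X \<chi> (a \<star> b) = pairing X \<chi> a * pairing X \<chi> b"
    and one: "pairing X \<chi> \<one>\<^sub>A = 1" and cen: "\<And>a. a \<in> V \<Longrightarrow> L \<chi> a = R \<chi> a"
  shows "\<exists>\<xi>. \<xi> ^ m = 1 \<and> (\<forall>n. \<forall>a\<in>piece (int n). R \<chi> a = \<xi> ^ n \<bullet> a)"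
proof -
  let ?c = "pairing X \<chi>"
  define \<xi> where "\<xi> = ?c u"
  have "?c u * ?c v = 1" using mul[of u v] by (simp add: uv one)
  then have \<xi>0: "\<xi> \<noteq> 0" by (auto simp: \<xi>_def)
  have "(\<Sum>x\<in>carrier G. ?c (e x)) = 1" using one by (simp add: pairing_sum flip: e_sum)
  then obtain x0 where x0: "x0 \<in> carrier G" "?c (e x0) \<noteq> 0" by (metis sum.neutral zero_neq_one)
  \<comment> \<open>Values on idempotents are 0 or 1, and orthogonality leaves a single point with
    value 1.\<close>
  have "?c (e x0) * ?c (e x0) = ?c (e x0)" using mul[of "e x0" "e x0"] x0 by (simp add: e_mul)
  then have x01: "?c (e x0) = 1" using x0 by simp
  have ce: "?c (e x) = (if x = x0 then 1 else 0)" if "x \<in> carrier G" for x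
    using mul[of "e x" "e x0"] x0 that x01 by (auto simp: e_mul)
  have cb: "?c (bas x 1) = (if x = x0 then \<xi> else 0)" if "x \<in> carrier G" for x
    using that by (simp add: bas_def mul ce \<xi>_def)
  have Ru: "R \<chi> u = (\<Sum>y\<in>carrier G. (\<xi> * \<sigma> y x0) \<bullet> bas y 1)"
  proof -
    have "R \<chi> u = (\<Sum>y\<in>carrier G. \<Sum>z\<in>carrier G. if z = x0 then (\<xi> * \<sigma> y x0) \<bullet> bas y 1 else 0)"
      unfolding R_def D_u slice_right_sum by (intro sum.cong refl) (auto simp: cb[unfolded One_nat_def] mult.commute)
    then show ?thesis using x0 by simp
  qed
  have Lu: "L \<chi> u = (\<Sum>z\<in>carrier G. (\<xi> * \<sigma> x0 z) \<bullet> bas z 1)"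
  proof -
    have "L \<chi> u = (\<Sum>y\<in>carrier G. if y = x0 then (\<Sum>z\<in>carrier G. (\<xi> * \<sigma> x0 z) \<bullet> bas z 1) else 0)"
      unfolding L_def D_u slice_left_sum by (intro sum.cong refl) (auto simp: cb[unfolded One_nat_def] mult.commute)
    then show ?thesis using x0 by simp
  qed
  have "\<sigma> x0 y = \<sigma> y x0" if y: "y \<in> carrier G" for y
  proof -
    have "E (\<lambda>z. \<xi> * \<sigma> x0 z) \<star> u = E (\<lambda>z. \<xi> * \<sigma> z x0) \<star> u"
      using cen[of u] E_u_pow[of _ 1] by (simp add: Ru Lu)
    then have "E (\<lambda>z. \<xi> * \<sigma> x0 z) \<star> u \<star> v = E (\<lambda>z. \<xi> * \<sigma> z x0) \<star> u \<star> v" by simp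
    then have "E (\<lambda>z. \<xi> * \<sigma> x0 z) = E (\<lambda>z. \<xi> * \<sigma> z x0)" by (simp add: mul_assoc uv)
    then have "\<xi> * \<sigma> x0 y = \<xi> * \<sigma> y x0" using y unfolding E_eq_iff by blast
    then show ?thesis using \<xi>0 by simp
  qed
  then have "x0 = \<one>" using \<sigma>_nondegenerate x0 by blast
  note ce = ce[unfolded this] and Ru = Ru[unfolded this]
  have Ru': "R \<chi> u = \<xi> \<bullet> u"
  proof -
    have "R \<chi> u = \<xi> \<bullet> (E (\<lambda>_. 1) \<star> u \<up> 1)" unfolding E_u_pow by (simp add: Ru \<sigma>_one smul_sum)
    then show ?thesis by (simp add: E_one)
  qed
  have Re: "R \<chi> (e x) = e x" if x: "x \<in> carrier G" for x
  proof -
    have "R \<chi> (e x) = (\<Sum>y\<in>carrier G. if y = x then e x else 0)"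
      unfolding R_def e_D[OF x] slice_right_sum
    proof (intro sum.cong refl)
      fix y assume y: "y \<in> carrier G"
      have "inv y \<otimes> x = \<one> \<longleftrightarrow> y = x" using x y by (metis inv_closed inv_equality inv_inv l_inv)
      then show "slice_right X \<chi> (e y \<otimes>\<^sub>k e (inv y \<otimes> x)) = (if y = x then e x else 0)"
        using x y by (simp add: ce)
    qed
    then show ?thesis using x by simp
  qed
  have RE: "R \<chi> (E c) = E c" for c by (simp add: E_def R_sum Re)
  have Rp: "R \<chi> (u \<up> n) = \<xi> ^ n \<bullet> u \<up> n" for n
    by (induction n) (simp_all add: R_mul_character[OF mul] Ru' R_one one mult.commute)
  have "?c (u \<up> n) = \<xi> ^ n" for n by (induction n) (simp_all add: one mul \<xi>_def)
  from this[of m] have "\<xi> ^ m = 1" by (simp add: u_m one)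
  moreover have "R \<chi> a = \<xi> ^ n \<bullet> a" if "a \<in> piece (int n)" for a n
    using piece_E[OF that] by (auto simp: R_mul_character[OF mul] RE Rp)
  ultimately show ?thesis by blast
qed

text \<open>Recovers the group law from the idempotents and the coproduct; it shows in
  \<open>frame_unique\<close> that a bijection between two systems of idempotents is
  multiplicative.\<close>

lemma tens_e_D_e:
  assumes "x \<in> carrier G" "y \<in> carrier G" "z \<in> carrier G"
  shows "e y \<otimes>\<^sub>k e z \<star>\<star> D (e x) = (if y \<otimes> z = x then e y \<otimes>\<^sub>k e z else 0)"
proof -
  have ex: "e x = E (\<lambda>w. if w = x then 1 else 0)"
  proof -
    have "E (\<lambda>w. if w = x then 1 else 0) = (\<Sum>w\<in>carrier G. if w = x then e x else 0)"
      unfolding E_def by (intro sum.cong refl) auto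
    then show ?thesis using assms by simp
  qed
  have "D (e x) = (\<Sum>y\<in>carrier G. \<Sum>z\<in>carrier G. (if y \<otimes> z = x then 1 else 0) \<bullet> (bas y 0 \<otimes>\<^sub>k bas z 0))"
    by (simp add: ex D_E) (simp add: bas_def)
  then have "e y \<otimes>\<^sub>k e z \<star>\<star> D (e x) = (if y \<otimes> z = x then 1 else 0) \<bullet> (bas y 0 \<otimes>\<^sub>k bas z 0)"
    using assms tens_e_bas[of y z "\<lambda>y z. if y \<otimes> z = x then 1 else 0" 0] by simp
  then show ?thesis using assms by (simp add: bas_def)
qed

end

text \<open>The character of the second grading at a primitive \<open>\<zeta>\<close> is cocentral,
  hence fixes \<open>piece 0\<close> pointwise; its eigenspace for the eigenvalue 1 is degree 0 of
  the second grading.\<close>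

lemma (in normal_frame) piece_0_subset:
  fixes \<zeta> :: 'k
  assumes G': "cocentral_grading A m \<pi>'" and \<zeta>: "\<zeta> ^ m = 1" "\<And>j. \<zeta> ^ j = 1 \<longleftrightarrow> m dvd j"
  shows "piece 0 \<subseteq> cocentral_grading.piece A \<pi>' 0"
proof
  interpret C: cocentral_grading A m \<pi>' by (rule G')
  obtain \<xi> where \<xi>: "\<And>n a. a \<in> piece (int n) \<Longrightarrow> R (C.character \<zeta>) a = \<xi> ^ n \<bullet> a"
    using central_character[OF C.character_mul[OF \<zeta>(1)] C.character_one[OF \<zeta>(1)] C.L_character[OF \<zeta>(1)]] by blast
  fix a assume a: "a \<in> piece 0"
  then have aV: "a \<in> V" by (rule pieceD)
  have Ra: "R (C.character \<zeta>) a = a" using \<xi>[of a 0] a by simp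
  have "C.P j a = 0" if j: "j \<in> {0..<int m}" "j \<noteq> 0" for j
  proof -
    have "C.P j a = C.zpow \<zeta> j \<bullet> C.P j a" using C.P_R_character[OF \<zeta>(1), of j a] Ra by simp
    then have "(C.zpow \<zeta> j - 1) \<bullet> C.P j a = 0" by (auto simp: fun_eq_iff smul_apply algebra_simps)
    moreover have "C.zpow \<zeta> j \<noteq> 1"
      using j \<zeta>(2)[of "nat j"] nat_dvd_not_less[of "nat j" m] by (auto simp: cpow_def nat_less_iff)
    ultimately show ?thesis by simp
  qed
  then have "(\<Sum>j\<in>{0..<int m}. C.P j a) = (\<Sum>j\<in>{0..<int m}. if j = 0 then C.P 0 a else 0)"
    by (intro sum.cong refl) auto
  then have "C.P 0 a = a" using C.P_sum[OF aV] m_pos by simp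
  then show "a \<in> C.piece 0" using aV by (simp add: C.piece_def)
qed

text \<open>The character of the second grading acts by \<xi>^n on degree n of the first and by
  \<open>\<zeta>\<close> on \<open>u'\<close>. So \<open>u'\<close> is homogeneous for the first
  grading too, in a degree \<open>k\<close> with \<xi>^k = \<zeta>. Since degree 0 is common, the
  idempotents of the two frames agree up to a permutation \<open>\<phi>\<close>, and
  \<open>u'\<close> acts on them like the k-th power of \<open>u\<close>.\<close>

theorem (in normal_frame) frame_unique:
  fixes \<zeta> :: 'k
  assumes F': "normal_frame A m \<pi>' G e' u' v' \<alpha>' \<sigma>'" and \<zeta>: "\<zeta> ^ m = 1" "\<And>j. \<zeta> ^ j = 1 \<longleftrightarrow> m dvd j"
  shows "\<exists>k \<phi>. coprime k m \<and> bij_betw \<phi> (carrier G) (carrier G)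
    \<and> (\<forall>x\<in>carrier G. \<forall>y\<in>carrier G. \<phi> (x \<otimes> y) = \<phi> x \<otimes> \<phi> y)
    \<and> (\<forall>x\<in>carrier G. \<phi> (\<alpha>' x) = (\<alpha> ^^ k) (\<phi> x))"
proof -
  interpret F: normal_frame A m \<pi>' G e' u' v' \<alpha>' \<sigma>' by (rule F')
  have p0: "piece 0 = F.piece 0"
    using piece_0_subset[OF F.cocentral_grading_axioms \<zeta>] F.piece_0_subset[OF cocentral_grading_axioms \<zeta>] by blast
  obtain \<xi> where \<xi>m: "\<xi> ^ m = 1" and \<xi>: "\<And>n a. a \<in> piece (int n) \<Longrightarrow> R (F.character \<zeta>) a = \<xi> ^ n \<bullet> a"
    using central_character[OF F.character_mul[OF \<zeta>(1)] F.character_one[OF \<zeta>(1)] F.L_character[OF \<zeta>(1)]] by blast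
  have u'0: "u' \<noteq> 0"
  proof
    assume "u' = 0"
    then have "\<one>\<^sub>A = 0" using F.uv by simp
    then have "e \<one> = 0" using one_mul(1)[of "e \<one>"] by simp
    then show False using e_nz by simp
  qed
  have z1: "F.zpow \<zeta> 1 = \<zeta>" using cpow_nat[OF \<zeta>(1), of 1] by simp
  have Ru': "R (F.character \<zeta>) u' = \<zeta> \<bullet> u'" using F.R_character_piece[OF \<zeta>(1) F.u_piece] z1 by simp
  have ev: "\<xi> ^ n = \<zeta>" if nz: "P (int n) u' \<noteq> 0" for n
  proof -
    have "P (int n) (R (F.character \<zeta>) u') = \<xi> ^ n \<bullet> P (int n) u'"
    proof -
      have "R (F.character \<zeta>) u' = (\<Sum>j<m. R (F.character \<zeta>) (P (int j) u'))"
        using P_sum[of u'] by (simp add: sum_int_nat flip: R_sum)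
      also have "\<dots> = (\<Sum>j<m. \<xi> ^ j \<bullet> P (int j) u')" by (intro sum.cong refl \<xi> P_piece)
      finally have "P (int n) (R (F.character \<zeta>) u') = (\<Sum>j<m. if j = n mod m then \<xi> ^ (n mod m) \<bullet> P (int n) u' else 0)"
        by (simp only: R_sum) (intro sum.cong refl, auto simp: P_P simp flip: zmod_int)
      moreover have "\<xi> ^ (n mod m) = \<xi> ^ n"
      proof -
        have "\<xi> ^ n = \<xi> ^ (m * (n div m) + n mod m)" by simp
        then show ?thesis unfolding power_add power_mult using \<xi>m by simp
      qed
      ultimately show ?thesis using m_pos by simp
    qed
    then have "(\<xi> ^ n - \<zeta>) \<bullet> P (int n) u' = 0" by (auto simp: Ru' fun_eq_iff smul_apply algebra_simps)
    then show ?thesis using nz by simp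
  qed
  have "\<exists>n<m. P (int n) u' \<noteq> 0"
    using P_sum[of u'] u'0 by (auto simp: sum_int_nat intro: ccontr)
  then obtain k where k: "k < m" "P (int k) u' \<noteq> 0" by blast
  have \<xi>k: "\<xi> ^ k = \<zeta>" by (rule ev[OF k(2)])
  have \<xi>_prim: "m dvd j" if "\<xi> ^ j = 1" for j
  proof -
    have "\<zeta> ^ j = 1" unfolding \<xi>k[symmetric] using that by (metis power_mult mult.commute power_one)
    then show ?thesis by (simp add: \<zeta>)
  qed
  have cop: "coprime k m"
  proof -
    define d where "d = gcd k m"
    obtain k' m' where km: "k = d * k'" "m = d * m'" unfolding d_def by (meson dvdE gcd_dvd1 gcd_dvd2)
    \<comment> \<open>With d = gcd k m the primitive root \<zeta> = \<xi>^k already satisfies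
      \<zeta>^(m/d) = 1, which forces d = 1.\<close>
    have "\<zeta> ^ m' = (\<xi> ^ m) ^ k'" unfolding \<xi>k[symmetric] power_mult[symmetric] using km by (simp add: mult_ac)
    then have "m dvd m'" using \<xi>m \<zeta>(2)[of m'] by simp
    then have "d * m' \<le> 1 * m'" using km m_pos by (auto dest: dvd_imp_le)
    moreover have "m' > 0" "d > 0" using km m_pos by auto
    ultimately have "d \<le> 1" by (simp only: mult_le_cancel2)
    with \<open>d > 0\<close> have "d = 1" by simp
    then show ?thesis unfolding coprime_iff_gcd_eq_1 d_def .
  qed
  have other: "P (int n) u' = 0" if "n < m" "n \<noteq> k" for n
  proof (rule ccontr)
    assume "P (int n) u' \<noteq> 0"
    then have eq: "\<xi> ^ n = \<xi> ^ k" using ev \<xi>k by simp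
    have nz: "\<xi> \<noteq> 0" using \<xi>m m_pos by (auto simp: zero_power)
    \<comment> \<open>\<open>max\<close> and \<open>min\<close> treat both orders of
      \<open>n\<close> and \<open>k\<close> at once; their difference is positive and smaller than
      \<open>m\<close>.\<close>
    have "m dvd max n k - min n k"
    proof (rule \<xi>_prim)
      have "\<xi> ^ (max n k) = \<xi> ^ (min n k)" using eq by (auto simp: max_def min_def)
      moreover have "\<xi> ^ (max n k) = \<xi> ^ (min n k) * \<xi> ^ (max n k - min n k)" by (simp flip: power_add)
      ultimately show "\<xi> ^ (max n k - min n k) = 1" using nz by simp
    qed
    then have "m \<le> max n k - min n k" using that by (intro dvd_imp_le) (auto simp: max_def min_def)
    then show False using that k by (auto simp: max_def min_def split: if_splits)
  qed
  have "u' = (\<Sum>n<m. if n = k then P (int k) u' else 0)"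
  proof -
    have "(\<Sum>n<m. P (int n) u') = (\<Sum>n<m. if n = k then P (int k) u' else 0)"
      by (intro sum.cong refl) (use other in auto)
    then show ?thesis using P_sum[of u'] by (simp add: sum_int_nat)
  qed
  then have "u' = P (int k) u'" using k by simp
  then have "u' \<in> piece (int k)" using P_piece by metis
  then obtain c where c: "u' = E c \<star> u \<up> k" using piece_E by blast
  have e_u': "e y \<star> u' = u' \<star> e ((\<alpha> ^^ k) y)" if y: "y \<in> carrier G" for y
  proof -
    have "e y \<star> u' = E c \<star> e y \<star> u \<up> k" unfolding c by (simp add: e_mul_E E_mul_e y flip: mul_assoc)
    then show ?thesis by (simp add: c e_u_pow y mul_assoc)
  qed
  have "\<forall>x\<in>carrier G. \<exists>d. e' x = E d"
    using F.e_piece by (auto simp: p0[symmetric] intro: piece_0_E)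
  then obtain d where d: "\<And>x. x \<in> carrier G \<Longrightarrow> e' x = E (d x)" by metis
  \<comment> \<open>In coordinates the new idempotents take the values 0 and 1 and have disjoint
    supports. There are as many of them as points, so every support is a single point.\<close>
  have dd: "d x z * d y z = (if x = y then d x z else 0)" if "x \<in> carrier G" "y \<in> carrier G" "z \<in> carrier G" for x y z
  proof -
    have "E (\<lambda>z. d x z * d y z) = E (\<lambda>z. if x = y then d x z else 0)"
      using F.e_mul[OF that(1,2)] d that by (auto simp: E_mul_E E_zero)
    then show ?thesis using that(3) unfolding E_eq_iff by blast
  qed
  have "\<forall>x\<in>carrier G. \<exists>y\<in>carrier G. d x y \<noteq> 0"
  proof (intro ballI, rule ccontr)
    fix x assume x: "x \<in> carrier G" "\<not> (\<exists>y\<in>carrier G. d x y \<noteq> 0)"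
    then have "E (d x) = E (\<lambda>_. 0)" by (intro E_cong) auto
    then show False using F.e_nz x d by (simp add: E_zero)
  qed
  then obtain \<phi> where \<phi>: "\<And>x. x \<in> carrier G \<Longrightarrow> \<phi> x \<in> carrier G" "\<And>x. x \<in> carrier G \<Longrightarrow> d x (\<phi> x) \<noteq> 0" by metis
  have inj: "inj_on \<phi> (carrier G)"
    by (rule inj_onI) (metis dd \<phi> mult_eq_0_iff)
  then have bij: "bij_betw \<phi> (carrier G) (carrier G)" using \<phi> by (simp add: bij_betw_def endo_inj_surj image_subset_iff)
  have e': "e' x = e (\<phi> x)" if x: "x \<in> carrier G" for x
  proof -
    have "d x y = (if y = \<phi> x then 1 else 0)" if y: "y \<in> carrier G" for y
    proof -
      obtain z where z: "z \<in> carrier G" "y = \<phi> z" using bij y by (auto simp: bij_betw_def)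
      have "d x y = 0" if "z \<noteq> x" using dd[OF x z(1) y] \<phi>(2)[OF z(1)] z that by auto
      moreover have "d x y = 1" if "z = x" using dd[OF x x y] \<phi>(2)[OF x] z that by auto
      moreover have "y = \<phi> x \<longleftrightarrow> z = x" using inj x z by (auto simp: inj_on_eq_iff)
      ultimately show ?thesis by auto
    qed
    then have "E (d x) = (\<Sum>y\<in>carrier G. if y = \<phi> x then e y else 0)"
      unfolding E_def by (intro sum.cong refl) auto
    then show ?thesis using d x \<phi> by simp
  qed
  have hom: "\<phi> (x \<otimes> y) = \<phi> x \<otimes> \<phi> y" if xy: "x \<in> carrier G" "y \<in> carrier G" for x y
  proof (rule ccontr)
    assume ne: "\<phi> (x \<otimes> y) \<noteq> \<phi> x \<otimes> \<phi> y"
    have "e' x \<otimes>\<^sub>k e' y \<star>\<star> D (e' (x \<otimes> y)) = e' x \<otimes>\<^sub>k e' y" using xy by (simp add: F.tens_e_D_e)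
    moreover have "\<dots> \<noteq> 0" using xy F.e_nz by (simp add: tens_eq_0_iff)
    ultimately show False using xy ne tens_e_D_e[of "\<phi> (x \<otimes> y)" "\<phi> x" "\<phi> y"] by (simp add: e' \<phi>)
  qed
  have comm: "\<phi> (\<alpha>' x) = (\<alpha> ^^ k) (\<phi> x)" if x: "x \<in> carrier G" for x
  proof -
    have "u' \<star> e (\<phi> (\<alpha>' x)) = u' \<star> e ((\<alpha> ^^ k) (\<phi> x))"
      using F.e_u[OF x] x by (simp add: e' e_u' \<phi>)
    then have "v' \<star> u' \<star> e (\<phi> (\<alpha>' x)) = v' \<star> u' \<star> e ((\<alpha> ^^ k) (\<phi> x))" by (simp add: mul_assoc)
    then have "e (\<phi> (\<alpha>' x)) = e ((\<alpha> ^^ k) (\<phi> x))" using x \<phi> by (simp add: F.vu)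
    then show ?thesis using x \<phi> by (intro e_eqD) auto
  qed
  show ?thesis using cop bij hom comm by blast
qed

section \<open>Roots of unity\<close>

lemma power_gcd_eq_1:
  fixes x :: "'a::field"
  assumes "x ^ a = 1" "x ^ b = 1" shows "x ^ gcd a b = 1"
proof (cases "a = 0")
  case False
  then obtain s t where "a * s = b * t + gcd a b" using bezout_nat by blast
  then have "(x ^ a) ^ s = (x ^ b) ^ t * x ^ gcd a b" by (metis power_add power_mult)
  then show ?thesis using assms by simp
qed (use assms in simp)

text \<open>A root of 1 + X + ... + X^(p-1); it is not 1 because the value at 1 is p, which is
  nonzero in characteristic 0.\<close>

lemma primitive_root_prime:
  assumes "prime p" shows "\<exists>\<omega>::'k::{alg_closed_field, field_char_0}. \<omega> \<noteq> 1 \<and> \<omega> ^ p = 1"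
proof -
  have p: "p > 1" using assms prime_gt_1_nat by blast
  obtain \<omega> :: 'k where \<omega>: "(\<Sum>k\<le>p - 1. 1 * \<omega> ^ k) = 0" using alg_closed[of "p - 1" "\<lambda>_. 1 :: 'k"] p by auto
  have "{..p - 1} = {..<p}" using p by auto
  then have s: "(\<Sum>k<p. \<omega> ^ k) = 0" using \<omega> by simp
  have "\<omega> ^ p - 1 = (\<omega> - 1) * (\<Sum>k<p. \<omega> ^ k)" by (rule power_diff_1_eq)
  then have "\<omega> ^ p = 1" using s by simp
  moreover have "\<omega> \<noteq> 1" using s p by auto
  ultimately show ?thesis by blast
qed

lemma prime_root_dvd_iff:
  fixes \<omega> :: "'k::field"
  assumes "prime p" "\<omega> \<noteq> 1" "\<omega> ^ p = 1" shows "\<omega> ^ j = 1 \<longleftrightarrow> p dvd j"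
proof
  assume "\<omega> ^ j = 1"
  then have "\<omega> ^ gcd p j = 1" using assms by (intro power_gcd_eq_1)
  moreover have "gcd p j = 1 \<or> p dvd j" using assms(1) by (metis coprime_iff_gcd_eq_1 prime_imp_coprime)
  ultimately show "p dvd j" using assms by auto
qed (use assms in \<open>auto simp: power_mult\<close>)

text \<open>A q^(r-1)-th root of a primitive q-th root of unity: its order divides q^r but not
  q^(r-1).\<close>

lemma primitive_root_prime_power:
  assumes q: "prime q" and r: "r \<ge> 1"
  shows "\<exists>\<zeta>::'k::{alg_closed_field, field_char_0}. \<zeta> ^ (q ^ r) = 1 \<and> (\<forall>j. \<zeta> ^ j = 1 \<longleftrightarrow> q ^ r dvd j)"
proof -
  obtain \<omega> :: 'k where \<omega>: "\<omega> \<noteq> 1" "\<omega> ^ q = 1" using primitive_root_prime[OF q] by blast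
  obtain \<zeta> where \<zeta>: "\<zeta> ^ (q ^ (r - 1)) = \<omega>" using nth_root_exists[of "q ^ (r - 1)" \<omega>] q prime_gt_0_nat by auto
  have qr: "q ^ r = q ^ (r - 1) * q" using r by (cases r) auto
  have 1: "\<zeta> ^ (q ^ r) = 1" unfolding qr power_mult using \<zeta> \<omega> by simp
  have "q ^ r dvd j" if j: "\<zeta> ^ j = 1" for j
  proof -
    have g: "\<zeta> ^ gcd (q ^ r) j = 1" by (rule power_gcd_eq_1[OF 1 j])
    obtain s where s: "s \<le> r" "gcd (q ^ r) j = q ^ s" using divides_primepow_nat[OF q] by (metis gcd_dvd1)
    have "s = r"
    proof (rule ccontr)
      assume "s \<noteq> r"
      then have "q ^ (r - 1) = q ^ s * q ^ (r - 1 - s)" using s by (simp flip: power_add)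
      then have "\<zeta> ^ (q ^ (r - 1)) = 1" using g s by (simp add: power_mult)
      then show False using \<zeta> \<omega> by simp
    qed
    then show ?thesis using s by (metis gcd_dvd2)
  qed
  moreover have "\<zeta> ^ j = 1" if "q ^ r dvd j" for j using that 1 by (auto simp: power_mult)
  ultimately show ?thesis using 1 by blast
qed

text \<open>The first p powers of \<open>\<omega>\<close> are distinct, and X^p - 1 has at most p
  roots.\<close>

lemma root_of_unity_powers:
  fixes \<omega> \<omega>' :: "'k::field"
  assumes p: "prime p" and \<omega>: "\<omega> \<noteq> 1" "\<omega> ^ p = 1" and \<omega>': "\<omega>' ^ p = 1"
  shows "\<exists>c<p. \<omega>' = \<omega> ^ c"
proof -
  have p1: "p > 1" using p prime_gt_1_nat by blast
  have \<omega>0: "\<omega> \<noteq> 0" using \<omega> p1 by (auto simp: zero_power)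
  have inj: "inj_on (\<lambda>c. \<omega> ^ c) {..<p}"
  proof (rule linorder_inj_onI')
    fix i j assume ij: "i \<in> {..<p}" "j \<in> {..<p}" "i < j"
    show "\<omega> ^ i \<noteq> \<omega> ^ j"
    proof
      assume "\<omega> ^ i = \<omega> ^ j"
      also have "\<omega> ^ j = \<omega> ^ i * \<omega> ^ (j - i)" using ij by (simp flip: power_add)
      finally have "\<omega> ^ (j - i) = 1" using \<omega>0 by simp
      then have "p dvd j - i" using prime_root_dvd_iff[OF p \<omega>] by simp
      then show False using ij by (auto dest: dvd_imp_le)
    qed
  qed
  define P where "P = Polynomial.monom (1::'k) p + [:- 1:]"
  have deg: "degree P = p" unfolding P_def using p1 by (subst degree_add_eq_left) (auto simp: degree_monom_eq)
  have P0: "P \<noteq> 0" using deg p1 by auto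
  have roots: "{x. poly P x = 0} = {x. x ^ p = 1}" by (auto simp: P_def poly_monom)
  have "(\<lambda>c. \<omega> ^ c) ` {..<p} \<subseteq> {x. x ^ p = 1}" using \<omega> by (auto simp: mult.commute simp flip: power_mult) (metis power_mult power_one mult.commute)
  moreover have "card {x. poly P x = 0} \<le> p" using card_poly_roots_bound[OF P0] deg by simp
  moreover have "finite {x. poly P x = 0}" by (rule poly_roots_finite[OF P0])
  moreover have "card ((\<lambda>c. \<omega> ^ c) ` {..<p}) = p" using inj by (simp add: card_image)
  ultimately have "(\<lambda>c. \<omega> ^ c) ` {..<p} = {x. x ^ p = 1}" unfolding roots by (intro card_seteq) auto
  then show ?thesis using \<omega>' by blast
qed

section \<open>Two-cocycles on the group of order p squared\<close>

abbreviation (input) Zp2 :: "nat \<Rightarrow> (int \<times> int) monoid" where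
  "Zp2 p \<equiv> integer_mod_group p \<times>\<times> integer_mod_group p"

lemma group_Zp2: "group (Zp2 p)"
  by (intro DirProd_group) simp_all

lemma carrier_Zp2: "p > 0 \<Longrightarrow> carrier (Zp2 p) = {0..<int p} \<times> {0..<int p}"
  by (simp add: carrier_integer_mod_group)

lemma mult_Zp2: "x \<otimes>\<^bsub>Zp2 p\<^esub> y = ((fst x + fst y) mod int p, (snd x + snd y) mod int p)"
  by (simp add: mult_DirProd')

text \<open>The second coordinate of \<open>y\<close> meets the first of \<open>z\<close> because
  the factor arises from moving T^(snd y) past S^(fst z) in a central extension.\<close>

definition bichar :: "nat \<Rightarrow> 'k::field \<Rightarrow> int \<times> int \<Rightarrow> int \<times> int \<Rightarrow> 'k" where
  "bichar p \<omega> y z = cpow p \<omega> (snd y * fst z)"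

text \<open>A cocycle describes a central extension by the multiplicative group of the field; lifts \<open>S\<close>, \<open>T\<close> of the
  standard generators with \<open>S\<^sup>p = T\<^sup>p = 1\<close> satisfy \<open>T S = \<omega> S T\<close>, and the products \<open>S\<^sup>i T\<^sup>j\<close> give the rescaling.\<close>

lemma cocycle_Zp2:
  fixes \<sigma> :: "int \<times> int \<Rightarrow> int \<times> int \<Rightarrow> 'k::alg_closed_field"
  assumes p: "prime p"
    and nz: "\<And>x y. x \<in> carrier (Zp2 p) \<Longrightarrow> y \<in> carrier (Zp2 p) \<Longrightarrow> \<sigma> x y \<noteq> 0"
    and coc: "\<And>x y z. x \<in> carrier (Zp2 p) \<Longrightarrow> y \<in> carrier (Zp2 p) \<Longrightarrow> z \<in> carrier (Zp2 p) \<Longrightarrow>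
      \<sigma> (y \<otimes>\<^bsub>Zp2 p\<^esub> z) x * \<sigma> y z = \<sigma> y (z \<otimes>\<^bsub>Zp2 p\<^esub> x) * \<sigma> z x"
  shows "\<exists>c \<omega>. \<omega> ^ p = 1 \<and> (\<forall>y\<in>carrier (Zp2 p). c y \<noteq> 0) \<and>
    (\<forall>y\<in>carrier (Zp2 p). \<forall>z\<in>carrier (Zp2 p). c (y \<otimes>\<^bsub>Zp2 p\<^esub> z) * \<sigma> y z / (c y * c z) = bichar p \<omega> y z)"
proof -
  let ?G = "carrier (Zp2 p)"
  interpret G: group "Zp2 p" by (rule group_Zp2)
  have p1: "p > 1" using p prime_gt_1_nat by blast
  \<comment> \<open>The central extension defined by \<open>\<sigma>\<close>: \<open>mlt\<close> is
    its product, \<open>sc\<close> multiplies by scalars, and \<open>C\<close> below singles out the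
    elements with nonzero scalar part.\<close>
  define mlt where "mlt a b = (fst a * fst b * \<sigma> (snd a) (snd b), snd a \<otimes>\<^bsub>Zp2 p\<^esub> snd b)" for a b :: "'k \<times> (int \<times> int)"
  define sc where "sc d a = (d * fst a, snd a)" for d :: 'k and a :: "'k \<times> (int \<times> int)"
  \<comment> \<open>The cocycle need not be normalised, so the neutral element carries the factor 1
    / \<sigma>(1,1).\<close>
  define o1 where "o1 = (1 / \<sigma> \<one>\<^bsub>Zp2 p\<^esub> \<one>\<^bsub>Zp2 p\<^esub>, \<one>\<^bsub>Zp2 p\<^esub>)"
  define C where "C = {a :: 'k \<times> (int \<times> int). fst a \<noteq> 0 \<and> snd a \<in> ?G}"
  have C_mlt: "mlt a b \<in> C" if "a \<in> C" "b \<in> C" for a b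
    using that G.m_closed[of "snd a" "snd b"] unfolding C_def mlt_def by (simp del: mult_DirProd add: nz mem_Times_iff)
  have C_sc: "sc d a \<in> C" if "a \<in> C" "d \<noteq> 0" for d a using that by (simp add: C_def sc_def)
  have C_o: "o1 \<in> C" using nz[of "\<one>\<^bsub>Zp2 p\<^esub>" "\<one>\<^bsub>Zp2 p\<^esub>"] G.one_closed unfolding C_def o1_def by simp
  have assoc: "mlt (mlt a b) c = mlt a (mlt b c)" if "a \<in> C" "b \<in> C" "c \<in> C" for a b c
  proof -
    have G3: "snd a \<in> ?G" "snd b \<in> ?G" "snd c \<in> ?G" using that by (simp_all add: C_def)
    show ?thesis unfolding mlt_def
      using coc[OF G3(3,1,2)] G.m_assoc[OF G3] by (simp del: mult_DirProd add: mult_ac)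
  qed
  \<comment> \<open>The cocycle identity with two trivial arguments: a cocycle is constant where one
    argument is the identity. This makes \<open>o1\<close> two-sided neutral.\<close>
  have s1: "\<sigma> \<one>\<^bsub>Zp2 p\<^esub> x = \<sigma> \<one>\<^bsub>Zp2 p\<^esub> \<one>\<^bsub>Zp2 p\<^esub>" "\<sigma> x \<one>\<^bsub>Zp2 p\<^esub> = \<sigma> \<one>\<^bsub>Zp2 p\<^esub> \<one>\<^bsub>Zp2 p\<^esub>" if x: "x \<in> ?G" for x
  proof -
    have "\<sigma> \<one>\<^bsub>Zp2 p\<^esub> x * \<sigma> \<one>\<^bsub>Zp2 p\<^esub> \<one>\<^bsub>Zp2 p\<^esub> = \<sigma> \<one>\<^bsub>Zp2 p\<^esub> x * \<sigma> \<one>\<^bsub>Zp2 p\<^esub> x"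
      using coc[OF x G.one_closed G.one_closed] x by (simp only: G.l_one G.r_one G.one_closed)
    then show "\<sigma> \<one>\<^bsub>Zp2 p\<^esub> x = \<sigma> \<one>\<^bsub>Zp2 p\<^esub> \<one>\<^bsub>Zp2 p\<^esub>" using nz[OF G.one_closed x] by simp
    have "\<sigma> x \<one>\<^bsub>Zp2 p\<^esub> * \<sigma> x \<one>\<^bsub>Zp2 p\<^esub> = \<sigma> x \<one>\<^bsub>Zp2 p\<^esub> * \<sigma> \<one>\<^bsub>Zp2 p\<^esub> \<one>\<^bsub>Zp2 p\<^esub>"
      using coc[OF G.one_closed x G.one_closed] x by (simp only: G.l_one G.r_one G.one_closed)
    then show "\<sigma> x \<one>\<^bsub>Zp2 p\<^esub> = \<sigma> \<one>\<^bsub>Zp2 p\<^esub> \<one>\<^bsub>Zp2 p\<^esub>" using nz[OF x G.one_closed] by simp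
  qed
  have one: "mlt o1 a = a" "mlt a o1 = a" if "a \<in> C" for a
  proof -
    have "snd a \<in> ?G" using that by (simp add: C_def)
    then show "mlt o1 a = a" "mlt a o1 = a"
      unfolding mlt_def o1_def using s1[of "snd a"] nz[of "\<one>\<^bsub>Zp2 p\<^esub>" "\<one>\<^bsub>Zp2 p\<^esub>"] G.l_one[of "snd a"] G.r_one[of "snd a"] G.one_closed
      by (simp_all del: mult_DirProd one_DirProd add: prod_eq_iff)
  qed
  have sc_mlt: "mlt (sc d a) b = sc d (mlt a b)" "mlt a (sc d b) = sc d (mlt a b)" for d a b
    by (simp_all add: mlt_def sc_def)
  have sc_sc: "sc d (sc d' a) = sc (d * d') a" "sc 1 a = a" for d d' a by (simp_all add: sc_def)
  define pw where "pw a n = ((\<lambda>b. mlt b a) ^^ n) o1" for a n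
  have pw0: "pw a 0 = o1" and pwS: "pw a (Suc n) = mlt (pw a n) a" for a n by (simp_all add: pw_def)
  have C_pw: "pw a n \<in> C" if "a \<in> C" for a n by (induction n) (use that in \<open>simp_all add: pw0 pwS C_o C_mlt\<close>)
  have pw_add: "pw a (n + k) = mlt (pw a n) (pw a k)" if "a \<in> C" for a n k
    by (induction k) (use that in \<open>simp_all add: pw0 pwS C_pw one assoc\<close>)
  have pw_mult: "pw a (n * k) = pw (pw a n) k" if "a \<in> C" for a n k
    by (induction k) (use that in \<open>simp_all add: pw0 pwS pw_add C_pw add.commute[of n]\<close>)
  have pw_o: "pw o1 n = o1" for n by (induction n) (simp_all add: pw0 pwS one C_o)
  have pw_sc: "pw (sc d a) n = sc (d ^ n) (pw a n)" for d a n
    by (induction n) (simp_all add: pw0 pwS sc_mlt sc_sc mult.commute)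
  have pw_mod: "pw a n = pw a (n mod p)" if "a \<in> C" "pw a p = o1" for a n
  proof -
    have "pw a n = pw a (p * (n div p) + n mod p)" by simp
    also have "\<dots> = pw a (n mod p)" unfolding pw_add[OF that(1)] pw_mult[OF that(1)] using that by (simp add: pw_o one C_pw)
    finally show ?thesis .
  qed
  \<comment> \<open>The p-th power of any lift is the scalar \<open>d\<close>; a p-th root of 1 / d
    corrects the lift. Here algebraic closedness is used.\<close>
  have gen: "\<exists>S\<in>C. snd S = x \<and> pw S p = o1" if x: "x \<in> ?G" and xp: "snd (pw (1, x) p) = \<one>\<^bsub>Zp2 p\<^esub>" for x
  proof -
    have xC: "(1, x) \<in> C" using x by (simp add: C_def)
    define d where "d = fst (pw (1, x) p) * \<sigma> \<one>\<^bsub>Zp2 p\<^esub> \<one>\<^bsub>Zp2 p\<^esub>"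
    have s0: "\<sigma> \<one>\<^bsub>Zp2 p\<^esub> \<one>\<^bsub>Zp2 p\<^esub> \<noteq> 0" by (intro nz G.one_closed)
    then have d0: "d \<noteq> 0" using C_pw[OF xC, of p] unfolding d_def C_def by simp
    have d: "pw (1, x) p = sc d o1" using xp s0 by (simp add: d_def sc_def o1_def prod_eq_iff)
    obtain c where c: "c ^ p = 1 / d" using nth_root_exists[of p "1 / d"] p1 by auto
    then have c0: "c \<noteq> 0" using d0 p1 by (auto simp: zero_power)
    have "pw (sc c (1, x)) p = o1" unfolding pw_sc d sc_sc c using d0 by (simp add: sc_sc)
    then show ?thesis using C_sc[OF xC c0] by (intro bexI[of _ "sc c (1, x)"]) (simp_all add: sc_def)
  qed
  have sp1: "snd (pw (1, (1, 0)) n) = (int n mod int p, 0)" for n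
    by (induction n) (simp_all add: pw0 pwS o1_def mlt_def mult_Zp2 mod_simps add.commute del: mult_DirProd)
  have sp2: "snd (pw (1, (0, 1)) n) = (0, int n mod int p)" for n
    by (induction n) (simp_all add: pw0 pwS o1_def mlt_def mult_Zp2 mod_simps add.commute del: mult_DirProd)
  obtain S where S: "S \<in> C" "snd S = (1, 0)" "pw S p = o1" using gen[of "(1, 0)"] p1 sp1[of p] by (auto simp: carrier_Zp2)
  obtain T where T: "T \<in> C" "snd T = (0, 1)" "pw T p = o1" using gen[of "(0, 1)"] p1 sp2[of p] by (auto simp: carrier_Zp2)
  have sndS: "snd (pw S n) = (int n mod int p, 0)" for n
    by (induction n) (simp_all add: S pw0 pwS o1_def mlt_def mult_Zp2 mod_simps add.commute del: mult_DirProd)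
  have sndT: "snd (pw T n) = (0, int n mod int p)" for n
    by (induction n) (simp_all add: T pw0 pwS o1_def mlt_def mult_Zp2 mod_simps add.commute del: mult_DirProd)
  define \<omega> where "\<omega> = fst (mlt T S) / fst (mlt S T)"
  have fST: "fst (mlt S T) \<noteq> 0" using C_mlt[OF S(1) T(1)] by (simp add: C_def)
  have TS: "mlt T S = sc \<omega> (mlt S T)" using fST by (simp add: \<omega>_def sc_def prod_eq_iff) (simp add: mlt_def S T mult_Zp2 del: mult_DirProd)
  have TSn: "mlt T (pw S n) = sc (\<omega> ^ n) (mlt (pw S n) T)" for n
  proof (induction n)
    case 0 show ?case using T by (simp add: pw0 one sc_sc)
  next
    case (Suc n)
    have "mlt T (pw S (Suc n)) = mlt (mlt T (pw S n)) S" by (simp add: pwS assoc C_pw S T)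
    also have "\<dots> = sc (\<omega> ^ n) (mlt (pw S n) (mlt T S))" by (simp add: Suc sc_mlt assoc C_pw S T)
    also have "\<dots> = sc (\<omega> ^ Suc n) (mlt (mlt (pw S n) S) T)" unfolding TS by (simp add: sc_mlt sc_sc assoc C_pw S T mult.commute)
    finally show ?case by (simp add: pwS)
  qed
  have TnSk: "mlt (pw T n) (pw S k) = sc (\<omega> ^ (n * k)) (mlt (pw S k) (pw T n))" for n k
  proof (induction n)
    case 0 show ?case using S by (simp add: pw0 one sc_sc C_pw)
  next
    case (Suc n)
    have "mlt (pw T (Suc n)) (pw S k) = mlt (pw T n) (mlt T (pw S k))" by (simp add: pwS assoc C_pw S T)
    also have "\<dots> = sc (\<omega> ^ k) (mlt (mlt (pw T n) (pw S k)) T)" by (simp add: TSn sc_mlt assoc C_pw S T)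
    also have "\<dots> = sc (\<omega> ^ (Suc n * k)) (mlt (pw S k) (mlt (pw T n) T))" 
      by (simp add: Suc sc_mlt sc_sc assoc C_pw S T power_add)
    finally show ?case by (simp add: pwS)
  qed
  \<comment> \<open>Moving \<open>T\<close> past the p-th power of \<open>S\<close>, which is
    neutral, produces the factor \<omega>^p.\<close>
  have \<omega>p: "\<omega> ^ p = 1"
  proof -
    have "T = sc (\<omega> ^ p) T" using TSn[of p] T S by (simp add: one)
    then have "fst T = \<omega> ^ p * fst T" by (metis sc_def fst_conv)
    moreover have "fst T \<noteq> 0" using T by (simp add: C_def)
    ultimately show ?thesis by simp
  qed
  define B where "B x = mlt (pw S (nat (fst x))) (pw T (nat (snd x)))" for x
  have BC: "B x \<in> C" for x by (simp add: B_def C_mlt C_pw S T)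
  have sndB: "snd (B x) = x" if "x \<in> ?G" for x
    using that p1 by (auto simp: B_def mlt_def sndS sndT mult_Zp2 carrier_integer_mod_group simp del: mult_DirProd)
  have BB: "mlt (B y) (B z) = sc (bichar p \<omega> y z) (B (y \<otimes>\<^bsub>Zp2 p\<^esub> z))" if yz: "y \<in> ?G" "z \<in> ?G" for y z
  proof -
    obtain i j k l where ijkl: "y = (int i, int j)" "z = (int k, int l)"
    proof -
      have "y = (int (nat (fst y)), int (nat (snd y)))" "z = (int (nat (fst z)), int (nat (snd z)))"
        using yz p1 by (auto simp: carrier_integer_mod_group)
      then show ?thesis using that by blast
    qed
    have "mlt (B y) (B z) = mlt (mlt (pw S i) (mlt (pw T j) (pw S k))) (pw T l)"
      by (simp add: B_def ijkl assoc C_mlt C_pw S T)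
    also have "\<dots> = sc (\<omega> ^ (j * k)) (mlt (mlt (pw S i) (pw S k)) (mlt (pw T j) (pw T l)))"
      by (simp add: TnSk sc_mlt assoc C_mlt C_pw S T)
    also have "\<dots> = sc (\<omega> ^ (j * k)) (mlt (pw S (i + k)) (pw T (j + l)))" by (simp add: pw_add S T)
    also have "\<dots> = sc (\<omega> ^ (j * k)) (mlt (pw S ((i + k) mod p)) (pw T ((j + l) mod p)))"
      using pw_mod[OF S(1,3), of "i + k"] pw_mod[OF T(1,3), of "j + l"] by simp
    also have "\<dots> = sc (\<omega> ^ (j * k)) (B (y \<otimes>\<^bsub>Zp2 p\<^esub> z))"
      by (simp add: B_def ijkl mult_Zp2 nat_mod_distrib nat_add_distrib del: mult_DirProd flip: of_nat_add zmod_int)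
    also have "\<omega> ^ (j * k) = bichar p \<omega> y z" 
      unfolding bichar_def ijkl using cpow_nat[OF \<omega>p, of "j * k"] by simp
    finally show ?thesis .
  qed
  \<comment> \<open>The scalar parts of the lifts \<open>B x\<close> give the coboundary that
    replaces \<open>\<sigma>\<close> by the structure constants of these lifts.\<close>
  define c where "c x = 1 / fst (B x)" for x
  have "c (y \<otimes>\<^bsub>Zp2 p\<^esub> z) * \<sigma> y z / (c y * c z) = bichar p \<omega> y z" if yz: "y \<in> ?G" "z \<in> ?G" for y z
  proof -
    have "fst (mlt (B y) (B z)) = bichar p \<omega> y z * fst (B (y \<otimes>\<^bsub>Zp2 p\<^esub> z))" unfolding BB[OF yz] sc_def by simp
    then have "fst (B y) * fst (B z) * \<sigma> y z = bichar p \<omega> y z * fst (B (y \<otimes>\<^bsub>Zp2 p\<^esub> z))"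
      unfolding mlt_def using sndB yz by simp
    moreover have "fst (B x) \<noteq> 0" for x using BC[of x] by (simp add: C_def)
    ultimately show ?thesis unfolding c_def by (simp add: field_simps)
  qed
  moreover have "c y \<noteq> 0" for y using BC[of y] by (simp add: c_def C_def)
  ultimately show ?thesis using \<omega>p by blast
qed


section \<open>Normal form of a frame\<close>

lemma (in cocycle_frame) cocycle_frame_cong:
  assumes "\<And>y z. y \<in> carrier G \<Longrightarrow> z \<in> carrier G \<Longrightarrow> \<sigma>' y z = \<sigma> y z"
  shows "cocycle_frame A m \<pi> G e u v \<alpha> \<sigma>'"
  by unfold_locales (simp add: D_u assms)

lemma (in cocycle_frame) reparametrise_cocycle:
  fixes G' :: "('h, 'y) monoid_scheme"
  assumes "group G'" and bij: "bij_betw \<phi> (carrier G') (carrier G)"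
    and hom: "\<And>x y. x \<in> carrier G' \<Longrightarrow> y \<in> carrier G' \<Longrightarrow> \<phi> (x \<otimes>\<^bsub>G'\<^esub> y) = \<phi> x \<otimes> \<phi> y"
    and \<beta>: "\<And>x. x \<in> carrier G' \<Longrightarrow> \<beta> x \<in> carrier G'" "\<And>x. x \<in> carrier G' \<Longrightarrow> \<phi> (\<beta> x) = \<alpha> (\<phi> x)"
  shows "cocycle_frame A m \<pi> G' (\<lambda>x. e (\<phi> x)) u v \<beta> (\<lambda>y z. \<sigma> (\<phi> y) (\<phi> z))"
proof -
  interpret F: hopf_frame A m \<pi> G' "\<lambda>x. e (\<phi> x)" u v \<beta>
    by (rule reparametrise[OF assms])
  have b: "F.bas y 1 = bas (\<phi> y) 1" for y by (simp add: F.bas_def bas_def)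
  show ?thesis
  proof unfold_locales
    have "D u = (\<Sum>y\<in>carrier G'. \<Sum>z\<in>carrier G. \<sigma> (\<phi> y) z \<bullet> (bas (\<phi> y) 1 \<otimes>\<^sub>k bas z 1))"
      unfolding D_u by (rule sum.reindex_bij_betw[OF bij, symmetric])
    also have "\<dots> = (\<Sum>y\<in>carrier G'. \<Sum>z\<in>carrier G'. \<sigma> (\<phi> y) (\<phi> z) \<bullet> (bas (\<phi> y) 1 \<otimes>\<^sub>k bas (\<phi> z) 1))"
      by (intro sum.cong[OF refl] sum.reindex_bij_betw[OF bij, symmetric])
    finally show "D u = (\<Sum>y\<in>carrier G'. \<Sum>z\<in>carrier G'. \<sigma> (\<phi> y) (\<phi> z) \<bullet> (F.bas y 1 \<otimes>\<^sub>k F.bas z 1))"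
      unfolding b .
  qed
qed

text \<open>Symmetry passes from \<open>\<sigma>\<close> to the cocycles of all powers of
  \<open>u\<close>, and in a commutative group the substitution of inv y x for y exchanges the two
  legs in the coproduct of \<open>bas x n\<close>.\<close>

lemma (in cocycle_frame) cocommutative_if_symmetric:
  assumes comm: "\<And>x y. x \<in> carrier G \<Longrightarrow> y \<in> carrier G \<Longrightarrow> x \<otimes> y = y \<otimes> x"
    and sym: "\<And>x y. x \<in> carrier G \<Longrightarrow> y \<in> carrier G \<Longrightarrow> \<sigma> x y = \<sigma> y x"
  shows "hopf_cocommutative A"
  unfolding hopf_cocommutative_def hspace_def
proof
  fix a :: "'i \<Rightarrow> 'k" assume a: "a \<in> V"
  have "tens_flip (D a) = D a"
  proof (rule frame_ext[of "\<lambda>a. tens_flip (D a)" "\<lambda>a. D a", OF _ _ _ _ _ a])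
    fix x n assume x: "x \<in> carrier G"
    have inv: "inv (inv y \<otimes> x) \<otimes> x = y" if y: "y \<in> carrier G" for y
    proof -
      have "(inv y \<otimes> x) \<otimes> y = x" using x y comm[of "inv y \<otimes> x" y] by (simp flip: m_assoc)
      then show ?thesis using x y by (metis inv_closed inv_solve_left m_closed)
    qed
    have s: "\<sigma>p n y z = \<sigma>p n z y" if "y \<in> carrier G" "z \<in> carrier G" for y z
      unfolding \<sigma>p_def by (intro prod.cong refl sym \<alpha>_pow_closed that)
    have "tens_flip (D (bas x n)) = (\<Sum>y\<in>carrier G. \<sigma>p n y (inv y \<otimes> x) \<bullet> (bas (inv y \<otimes> x) n \<otimes>\<^sub>k bas y n))"
      by (simp add: D_bas[OF x] tens_flip_sum)
    also have "\<dots> = D (bas x n)"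
      unfolding D_bas[OF x]
      by (rule sum.reindex_bij_witness[of _ "\<lambda>y. inv y \<otimes> x" "\<lambda>y. inv y \<otimes> x"]) (use x in \<open>simp_all add: inv s\<close>)
    finally show "tens_flip (D (bas x n)) = D (bas x n)" .
  qed simp_all
  then show "tens_flip (hcomult A a) = hcomult A a" using a by (simp add: hcomult_eq)
qed

text \<open>Parametrised by exponents instead of eigenvalues, so that classes become pairs of
  residues modulo \<open>m\<close> and taking powers of the action multiplies both
  exponents.\<close>

definition diag_act :: "nat \<Rightarrow> int \<Rightarrow> nat \<Rightarrow> nat \<Rightarrow> int \<times> int \<Rightarrow> int \<times> int" where
  "diag_act p \<gamma> i j x = (\<gamma> ^ i * fst x mod int p, \<gamma> ^ j * snd x mod int p)"

text \<open>\<open>\<gamma>\<close> has multiplicative order exactly \<open>m\<close> modulo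
  \<open>p\<close>, and \<open>\<omega>\<close> is the fixed p-th root of unity of all normal forms.
  Coprimality allows division by \<open>m\<close> modulo \<open>p\<close>.\<close>

locale odd_data =
  fixes p m :: nat and \<gamma> :: int and \<omega> :: "'k::{alg_closed_field, field_char_0}"
  assumes p: "prime p" and m0: "m > 0" and cop: "coprime m p"
    and \<gamma>: "\<And>k. \<gamma> ^ k mod int p = 1 \<longleftrightarrow> m dvd k"
    and \<omega>: "\<omega> \<noteq> 1" "\<omega> ^ p = 1"
begin

abbreviation G where "G \<equiv> Zp2 p"

lemma p_gt_1: "p > 1" using p prime_gt_1_nat by blast

lemma p_pos [simp]: "p > 0" using p_gt_1 by simp

lemma carrier_G: "x \<in> carrier G \<longleftrightarrow> 0 \<le> fst x \<and> fst x < int p \<and> 0 \<le> snd x \<and> snd x < int p"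
  using p_gt_1 by (cases x) (auto simp: carrier_integer_mod_group)

lemma diag_closed: "diag_act p \<gamma> i j x \<in> carrier G"
  unfolding carrier_G by (simp add: diag_act_def)

lemma diag_pow: "x \<in> carrier G \<Longrightarrow> (diag_act p \<gamma> i j ^^ n) x = diag_act p \<gamma> (i * n) (j * n) x"
proof (induction n)
  case 0 then show ?case unfolding carrier_G by (cases x) (simp add: diag_act_def)
next
  case (Suc n)
  then show ?case by (simp add: diag_act_def power_add mod_mult_right_eq mult.assoc)
qed

lemma cpow_\<omega>_eq_1: "cpow p \<omega> k = 1 \<longleftrightarrow> int p dvd k"
proof -
  have "cpow p \<omega> k = 1 \<longleftrightarrow> p dvd nat (k mod int p)" unfolding cpow_def by (rule prime_root_dvd_iff[OF p \<omega>])
  also have "\<dots> \<longleftrightarrow> int p dvd k mod int p"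
    using int_dvd_int_iff[of p "nat (k mod int p)"] by simp
  finally show ?thesis by (simp add: dvd_mod_iff)
qed

lemma bichar_one: "bichar p \<omega>' y \<one>\<^bsub>G\<^esub> = 1"
  by (simp add: bichar_def)

text \<open>Testing symmetry against the two generators makes both coordinates of \<open>x\<close>
  divisible by p.\<close>

lemma bichar_nondegenerate:
  assumes x: "x \<in> carrier G" and sym: "\<And>y. y \<in> carrier G \<Longrightarrow> bichar p \<omega> x y = bichar p \<omega> y x"
  shows "x = \<one>\<^bsub>G\<^esub>"
proof -
  have "bichar p \<omega> x (1, 0) = bichar p \<omega> (1, 0) x" "bichar p \<omega> x (0, 1) = bichar p \<omega> (0, 1) x"
    using p_gt_1 by (intro sym; unfold carrier_G; simp)+
  then have "cpow p \<omega> (snd x) = 1" "cpow p \<omega> (fst x) = 1" by (simp_all add: bichar_def)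
  then show ?thesis using x unfolding carrier_G cpow_\<omega>_eq_1 by (cases x) (auto dest: zdvd_imp_le simp: order_le_less)
qed

lemma normal_frameI:
  assumes "cocycle_frame A m \<pi> G e u v \<alpha> (bichar p \<omega>)" "hpow A u m = hunit A"
  shows "normal_frame A m \<pi> G e u v \<alpha> (bichar p \<omega>)"
proof -
  interpret cocycle_frame A m \<pi> G e u v \<alpha> "bichar p \<omega>" by (rule assms)
  show ?thesis by unfold_locales (use assms bichar_one bichar_nondegenerate in auto)
qed

text \<open>Geometric series: the product of the sum with \<gamma>^n - 1 is \<gamma>^(n m) - 1,
  which is divisible by \<open>p\<close>, while \<gamma>^n - 1 is not.\<close>

lemma sum_pow_dvd:
  assumes "\<not> m dvd n" shows "int p dvd (\<Sum>k<m. \<gamma> ^ (n * k))"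
proof -
  have "\<gamma> ^ (n * m) mod int p = 1" using \<gamma> by simp
  then have 1: "int p dvd \<gamma> ^ (n * m) - 1" using p_gt_1 by (simp add: mod_eq_dvd_iff[symmetric])
  have "\<gamma> ^ (n * m) - 1 = (\<gamma> ^ n - 1) * (\<Sum>k<m. \<gamma> ^ (n * k))"
    using power_diff_1_eq[of "\<gamma> ^ n" m] by (simp add: power_mult)
  moreover have "\<not> int p dvd \<gamma> ^ n - 1"
  proof
    assume "int p dvd \<gamma> ^ n - 1"
    then have "\<gamma> ^ n mod int p = 1 mod int p" by (simp add: mod_eq_dvd_iff)
    then show False using assms \<gamma> p_gt_1 by simp
  qed
  moreover have "prime (int p)" using p by simp
  ultimately show ?thesis using 1 by (metis prime_dvd_mult_iff)
qed

lemma sum_pow_cong: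
  assumes "m dvd n" shows "[(\<Sum>k<m. \<gamma> ^ (n * k)) = int m] (mod int p)"
proof -
  have "[(\<Sum>k<m. \<gamma> ^ (n * k)) = (\<Sum>k<m. 1)] (mod int p)"
    by (rule cong_sum) (use \<gamma> assms p_gt_1 in \<open>simp add: cong_def\<close>)
  then show ?thesis by simp
qed

text \<open>All constraints come from the m-th power of the unit, which is \<open>E \<chi>\<close>
  in degree 0. Commutativity of the group forces the product of the bicharacter along an orbit to be
  trivial, which excludes that m divides i + j. Then \<open>\<chi>\<close> is a character with p-th
  power 1, and passing to a suitable power of the unit removes it.\<close>

lemma normalise:
  assumes F: "hopf_frame A m \<pi> G e u v (diag_act p \<gamma> i j)" and nc: "\<not> hopf_cocommutative A"
  shows "\<not> m dvd i + j \<and> (\<exists>e u v. normal_frame A m \<pi> G e u v (diag_act p \<gamma> i j) (bichar p \<omega>))"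
proof -
  let ?d = "diag_act p \<gamma> i j"
  have "\<exists>\<omega>1 u v. \<omega>1 ^ p = 1 \<and> cocycle_frame A m \<pi> G e u v ?d (bichar p \<omega>1)"
  proof -
    interpret F0: hopf_frame A m \<pi> G e u v ?d by (rule F)
    obtain \<sigma> where "cocycle_frame A m \<pi> G e u v ?d \<sigma>" using F0.cocycle_exists by blast
    then interpret F1: cocycle_frame A m \<pi> G e u v ?d \<sigma> .
    obtain c \<omega>1 where \<omega>1: "\<omega>1 ^ p = 1" and c: "\<And>y. y \<in> carrier G \<Longrightarrow> c y \<noteq> 0"
      "\<And>y z. y \<in> carrier G \<Longrightarrow> z \<in> carrier G \<Longrightarrow> c (y \<otimes>\<^bsub>G\<^esub> z) * \<sigma> y z / (c y * c z) = bichar p \<omega>1 y z"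
      using cocycle_Zp2[OF p F1.\<sigma>_nz F1.\<sigma>_cocycle] by blast
    show ?thesis
      using \<omega>1 cocycle_frame.cocycle_frame_cong[OF F1.rescale[OF c(1)], where \<sigma>' = "bichar p \<omega>1"] c(2) by fastforce
  qed
  then obtain \<omega>1 u1 v1 where \<omega>1: "\<omega>1 ^ p = 1" and F2: "cocycle_frame A m \<pi> G e u1 v1 ?d (bichar p \<omega>1)" by blast
  interpret F2: cocycle_frame A m \<pi> G e u1 v1 ?d "bichar p \<omega>1" by (rule F2)
  have \<omega>1_ne: "\<omega>1 \<noteq> 1"
  proof
    assume "\<omega>1 = 1"
    then have "hopf_cocommutative A"
      by (intro F2.cocommutative_if_symmetric) (auto simp: mult_Zp2 add.commute bichar_def cpow_def simp del: mult_DirProd)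
    then show False using nc by simp
  qed
  obtain \<chi> where \<chi>: "hpow A u1 m = F2.E \<chi>" using F2.u_pow_m by blast
  have \<chi>0: "\<chi> x \<noteq> 0" if x: "x \<in> carrier G" for x
  proof
    assume "\<chi> x = 0"
    then have "F2.mul (F2.mul (e x) (hpow A u1 m)) (hpow A v1 m) = 0" using x by (simp add: \<chi> F2.e_mul_E)
    then show False using x F2.e_nz by (simp add: F2.mul_assoc F2.uv_pow)
  qed
  have \<chi>\<sigma>: "\<chi> (y \<otimes>\<^bsub>G\<^esub> z) = F2.\<sigma>p m y z * \<chi> y * \<chi> z" if yz: "y \<in> carrier G" "z \<in> carrier G" for y z
  proof (rule F2.tens_bas_eqD[of "\<lambda>y z. \<chi> (y \<otimes>\<^bsub>G\<^esub> z)" 0 "\<lambda>y z. F2.\<sigma>p m y z * \<chi> y * \<chi> z", OF _ yz])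
    have "F2.bas y m = \<chi> y \<bullet> e y" if "y \<in> carrier G" for y
      using that by (simp add: F2.bas_def \<chi> F2.e_mul_E)
    then have "F2.D (F2.E \<chi>) = (\<Sum>y\<in>carrier G. \<Sum>z\<in>carrier G. (F2.\<sigma>p m y z * \<chi> y * \<chi> z) \<bullet> (e y \<otimes>\<^sub>k e z))"
      unfolding \<chi>[symmetric] F2.D_u_pow by (intro sum.cong refl) (simp add: mult_ac)
    moreover have "F2.bas y 0 = e y" if "y \<in> carrier G" for y using that by (simp add: F2.bas_def)
    ultimately show "(\<Sum>y\<in>carrier G. \<Sum>z\<in>carrier G. \<chi> (y \<otimes>\<^bsub>G\<^esub> z) \<bullet> (F2.bas y 0 \<otimes>\<^sub>k F2.bas z 0))
       = (\<Sum>y\<in>carrier G. \<Sum>z\<in>carrier G. (F2.\<sigma>p m y z * \<chi> y * \<chi> z) \<bullet> (F2.bas y 0 \<otimes>\<^sub>k F2.bas z 0))"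
      unfolding F2.D_E by (simp cong: sum.cong)
  qed
  \<comment> \<open>Along the orbit the second coordinate of \<open>y\<close> is scaled by
    \<gamma>^j and the first of \<open>z\<close> by \<gamma>^i, so the exponents of the bicharacter
    add up to a geometric sum.\<close>
  define N where "N = (\<Sum>k<m. \<gamma> ^ ((i + j) * k))"
  have \<sigma>p: "F2.\<sigma>p m y z = cpow p \<omega>1 (N * (snd y * fst z))" if yz: "y \<in> carrier G" "z \<in> carrier G" for y z
  proof -
    have "F2.\<sigma>p n y z = cpow p \<omega>1 ((\<Sum>k<n. \<gamma> ^ ((i + j) * k)) * (snd y * fst z))" for n
    proof (induction n)
      case (Suc n)
      have "bichar p \<omega>1 ((?d ^^ n) y) ((?d ^^ n) z) = cpow p \<omega>1 (\<gamma> ^ ((i + j) * n) * (snd y * fst z))"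
        unfolding bichar_def diag_pow[OF yz(1)] diag_pow[OF yz(2)]
        by (rule cpow_cong) (simp only: diag_act_def fst_conv snd_conv mod_mult_eq, simp add: power_add algebra_simps)
      then show ?case using Suc by (simp add: F2.\<sigma>p_def cpow_add[OF \<omega>1] distrib_right)
    qed (simp add: F2.\<sigma>p_def)
    then show ?thesis by (simp add: N_def)
  qed
  have gens: "(1, 0) \<in> carrier G" "(0, 1) \<in> carrier G" using p_gt_1 by (simp_all add: carrier_G del: carrier_DirProd)
  have comm: "x \<otimes>\<^bsub>G\<^esub> y = y \<otimes>\<^bsub>G\<^esub> x" for x y by (simp add: mult_Zp2 add.commute del: mult_DirProd)
  \<comment> \<open>\<open>\<chi>\<close> takes the same value on the product of the generators in
    either order; the cocycle of the m-th power does not, unless \<omega>1^N = 1.\<close>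
  have "F2.\<sigma>p m (0, 1) (1, 0) * (\<chi> (0, 1) * \<chi> (1, 0)) = F2.\<sigma>p m (1, 0) (0, 1) * (\<chi> (0, 1) * \<chi> (1, 0))"
    using \<chi>\<sigma>[OF gens] \<chi>\<sigma>[OF gens(2,1)] comm[of "(1, 0)" "(0, 1)"] by (simp only: mult_ac)
  then have "F2.\<sigma>p m (0, 1) (1, 0) = F2.\<sigma>p m (1, 0) (0, 1)" using \<chi>0[OF gens(1)] \<chi>0[OF gens(2)] by simp
  then have "cpow p \<omega>1 N = 1" unfolding \<sigma>p[OF gens] \<sigma>p[OF gens(2,1)] by simp
  then have "p dvd nat (N mod int p)" unfolding cpow_def using prime_root_dvd_iff[OF p \<omega>1_ne \<omega>1] by simp
  then have N: "int p dvd N" using int_dvd_int_iff[of p "nat (N mod int p)"] by (simp add: dvd_mod_iff)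
  have ij: "\<not> m dvd i + j"
  proof
    assume "m dvd i + j"
    from sum_pow_cong[OF this] have "[N = int m] (mod int p)" by (simp add: N_def)
    then have "int p dvd int m" using N by (metis cong_dvd_iff)
    then have "p dvd m" by simp
    then have "p = 1" using coprime_common_divisor_nat[OF cop \<open>p dvd m\<close> dvd_refl] by simp
    then show False using p_gt_1 by simp
  qed
  have \<sigma>p1: "F2.\<sigma>p m y z = 1" if "y \<in> carrier G" "z \<in> carrier G" for y z
  proof -
    have "cpow p \<omega>1 (N * (snd y * fst z)) = cpow p \<omega>1 0" using N by (intro cpow_cong) auto
    then show ?thesis using that by (simp add: \<sigma>p)
  qed
  have \<chi>m: "\<chi> (y \<otimes>\<^bsub>G\<^esub> z) = \<chi> y * \<chi> z" if "y \<in> carrier G" "z \<in> carrier G" for y z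
    using \<chi>\<sigma>[OF that] \<sigma>p1[OF that] by simp
  have \<chi>1: "\<chi> \<one>\<^bsub>G\<^esub> = 1" using \<chi>m[OF F2.one_closed F2.one_closed] \<chi>0[OF F2.one_closed] F2.l_one[OF F2.one_closed] by simp
  have \<chi>p: "\<chi> x ^ p = 1" if x: "x \<in> carrier G" for x
  proof -
    have "\<chi> (int n * fst x mod int p, int n * snd x mod int p) = \<chi> x ^ n" for n
    proof (induction n)
      case 0 then show ?case using \<chi>1 by simp
    next
      case (Suc n)
      have "(int n * fst x mod int p, int n * snd x mod int p) \<in> carrier G" by (simp add: carrier_G del: carrier_DirProd)
      from \<chi>m[OF this x] show ?case
        by (simp add: Suc mult_Zp2 mod_simps algebra_simps del: mult_DirProd)
    qed
    from this[of p] show ?thesis using \<chi>1 by simp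
  qed
  \<comment> \<open>\<open>m\<close> is invertible modulo \<open>p\<close>; if m x = 1 modulo p,
    then t = x (p - 1) satisfies m t = -1.\<close>
  have "\<exists>t. p dvd m * t + 1"
  proof -
    obtain x where "[m * x = Suc 0] (mod p)" using cong_solve_coprime_nat[OF cop] by blast
    then have "[m * x * (p - 1) + 1 = Suc 0 * (p - 1) + 1] (mod p)" by (intro cong_add cong_mult cong_refl)
    then have "p dvd m * (x * (p - 1)) + 1" using p_gt_1 cong_dvd_iff[of "m * x * (p - 1) + 1" p p] by (simp add: mult.assoc)
    then show ?thesis by blast
  qed
  then obtain t where t: "p dvd m * t + 1" by blast
  \<comment> \<open>As \<open>E \<chi>\<close> is the m-th power of \<open>u1\<close>, this is u1^(m
    t + 1), and its m-th power is the image of \<chi>^(m t + 1) = 1.\<close>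
  define u2 where "u2 = F2.mul (F2.E (\<lambda>x. \<chi> x ^ t)) u1"
  have E_pow: "hpow A (F2.E \<chi>) n = F2.E (\<lambda>x. \<chi> x ^ n)" for n
    by (induction n) (simp_all add: F2.E_one F2.E_mul_E mult.commute)
  have "hpow A u2 m = hpow A (hpow A u1 (m * t + 1)) m"
    by (simp add: u2_def F2.pow_mult \<chi> E_pow)
  also have "\<dots> = hpow A (hpow A u1 m) (m * t + 1)" by (metis F2.pow_mult mult.commute)
  also have "\<dots> = F2.E (\<lambda>x. 1)" unfolding \<chi> E_pow
  proof (rule F2.E_cong)
    fix x assume x: "x \<in> carrier G"
    obtain s where "m * t + 1 = p * s" using t by auto
    then show "\<chi> x ^ (m * t + 1) = 1" using \<chi>p[OF x] by (simp only: power_mult power_one)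
  qed
  finally have u2m: "hpow A u2 m = hunit A" by (simp add: F2.E_one)
  have "\<exists>v. cocycle_frame A m \<pi> G e u2 v ?d (bichar p \<omega>1)"
  proof -
    \<comment> \<open>\<chi>^t is multiplicative on the group, so its coboundary is trivial and the
      bicharacter is kept.\<close>
    have "\<chi> x ^ t \<noteq> 0" if "x \<in> carrier G" for x using \<chi>0[OF that] by simp
    then have "cocycle_frame A m \<pi> G e u2 (F2.mul v1 (F2.E (\<lambda>x. 1 / \<chi> x ^ t))) ?d (bichar p \<omega>1)"
      unfolding u2_def
      by (intro cocycle_frame.cocycle_frame_cong[OF F2.rescale[of "\<lambda>x. \<chi> x ^ t"]])
        (simp_all add: \<chi>m power_mult_distrib del: mult_DirProd carrier_DirProd)
    then show ?thesis by blast
  qed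
  then obtain v2 where F3: "cocycle_frame A m \<pi> G e u2 v2 ?d (bichar p \<omega>1)" by blast
  obtain c1 where c1: "c1 < p" "\<omega> = \<omega>1 ^ c1" using root_of_unity_powers[OF p \<omega>1_ne \<omega>1 \<omega>(2)] by blast
  have "c1 \<noteq> 0" using c1 \<omega> by (cases c1) auto
  then have "\<not> p dvd c1" using c1 by (auto dest: dvd_imp_le)
  \<comment> \<open>Multiplying the second coordinate by \<open>c1\<close> commutes with every
    diagonal action and turns \<open>\<omega>1\<close> into \<omega>1^c1 = \<omega>.\<close>
  define \<phi> where "\<phi> x = (fst x, int c1 * snd x mod int p)" for x :: "int \<times> int"
  have "inj_on \<phi> (carrier G)"
  proof (rule inj_onI)
    fix x y assume xy: "x \<in> carrier G" "y \<in> carrier G" "\<phi> x = \<phi> y"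
    then have "int p dvd int c1 * (snd x - snd y)" by (simp add: \<phi>_def mod_eq_dvd_iff right_diff_distrib)
    moreover have "prime (int p)" "\<not> int p dvd int c1" using p \<open>\<not> p dvd c1\<close> by simp_all
    ultimately have "int p dvd snd x - snd y" by (metis prime_dvd_mult_iff)
    then have "snd x mod int p = snd y mod int p" by (simp add: mod_eq_dvd_iff)
    then show "x = y" using xy unfolding carrier_G by (simp add: \<phi>_def prod_eq_iff)
  qed
  moreover have "\<phi> ` carrier G \<subseteq> carrier G" by (auto simp: \<phi>_def carrier_G simp del: carrier_DirProd)
  ultimately have bij: "bij_betw \<phi> (carrier G) (carrier G)" by (simp add: bij_betw_def endo_inj_surj del: carrier_DirProd)
  have "cocycle_frame A m \<pi> G (\<lambda>x. e (\<phi> x)) u2 v2 ?d (\<lambda>y z. bichar p \<omega>1 (\<phi> y) (\<phi> z))"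
  proof (rule cocycle_frame.reparametrise_cocycle[OF F3 group_Zp2 bij])
    show "\<phi> (x \<otimes>\<^bsub>G\<^esub> y) = \<phi> x \<otimes>\<^bsub>G\<^esub> \<phi> y" if "x \<in> carrier G" "y \<in> carrier G" for x y
      using that unfolding carrier_G by (simp add: \<phi>_def mult_Zp2 mod_simps algebra_simps del: mult_DirProd)
    show "?d x \<in> carrier G" for x by (rule diag_closed)
    show "\<phi> (?d x) = ?d (\<phi> x)" for x by (simp add: \<phi>_def diag_act_def mod_simps algebra_simps)
  qed
  then have "cocycle_frame A m \<pi> G (\<lambda>x. e (\<phi> x)) u2 v2 ?d (bichar p \<omega>)"
  proof (rule cocycle_frame.cocycle_frame_cong)
    fix y z :: "int \<times> int"
    have "cpow p \<omega>1 (int c1 * (snd y * fst z)) = cpow p \<omega> (snd y * fst z)"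
      unfolding cpow_mult[OF \<omega>1 p_pos] c1(2) by (simp add: cpow_def mult.commute flip: power_mult)
    moreover have "cpow p \<omega>1 (int c1 * snd y mod int p * fst z) = cpow p \<omega>1 (int c1 * (snd y * fst z))"
      by (rule cpow_cong) (simp add: mod_simps mult_ac)
    ultimately show "bichar p \<omega> y z = bichar p \<omega>1 (\<phi> y) (\<phi> z)" by (simp add: bichar_def \<phi>_def)
  qed
  from normal_frameI[OF this u2m] show ?thesis using ij by blast
qed

end

lemma mod_lin: "(a * (x mod n) + b * (y mod n)) mod n = (a * x + b * y) mod (n :: int)"
  by (rule mod_add_cong; rule mod_mult_right_eq)

lemma (in hopf_frame) action_cong:
  assumes "\<And>x. x \<in> carrier G \<Longrightarrow> \<beta> x = \<alpha> x"
  shows "hopf_frame A m \<pi> G e u v \<beta>"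
proof -
  have "hopf_frame A m \<pi> G (\<lambda>x. e (id x)) u v \<beta>"
  proof (rule reparametrise)
    show "bij_betw id (carrier G) (carrier G)" by (rule bij_betw_id)
  qed (use assms in \<open>auto simp: is_group\<close>)
  then show ?thesis by simp
qed

section \<open>Diagonalisation of the action and the invariants of an algebra\<close>

context odd_data
begin

lemma prime_int_p: "prime (int p)" using p by simp

lemma hom_matrix:
  assumes cl: "\<And>x. x \<in> carrier G \<Longrightarrow> f x \<in> carrier G"
    and hom: "\<And>x y. x \<in> carrier G \<Longrightarrow> y \<in> carrier G \<Longrightarrow> f (x \<otimes>\<^bsub>G\<^esub> y) = f x \<otimes>\<^bsub>G\<^esub> f y"
  obtains a b c d where "\<And>x. x \<in> carrier G \<Longrightarrow>
    f x = ((a * fst x + b * snd x) mod int p, (c * fst x + d * snd x) mod int p)"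
proof -
  interpret G: group G by (rule group_Zp2)
  have f1: "f \<one>\<^bsub>G\<^esub> = \<one>\<^bsub>G\<^esub>"
  proof -
    have "f \<one>\<^bsub>G\<^esub> \<otimes>\<^bsub>G\<^esub> f \<one>\<^bsub>G\<^esub> = f \<one>\<^bsub>G\<^esub>" using hom[OF G.one_closed G.one_closed] by (simp only: G.l_one[OF G.one_closed])
    then show ?thesis using cl[OF G.one_closed] G.l_cancel_one' by metis
  qed
  have cl': "(int n mod int p, 0) \<in> carrier G" "(0, int n mod int p) \<in> carrier G" for n
    unfolding carrier_G by simp_all
  have gens: "(1, 0) \<in> carrier G" "(0, 1) \<in> carrier G" unfolding carrier_G using p_gt_1 by simp_all
  have e1: "f (int n mod int p, 0) = (fst (f (1, 0)) * int n mod int p, snd (f (1, 0)) * int n mod int p)" for n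
  proof (induction n)
    case (Suc n)
    have "(int (Suc n) mod int p, 0) = (int n mod int p, 0) \<otimes>\<^bsub>G\<^esub> (1, 0)"
      by (simp add: mult_Zp2 mod_simps add.commute del: mult_DirProd)
    then show ?case using hom[OF cl'(1) gens(1), of n] Suc by (simp add: mult_Zp2 mod_simps algebra_simps del: mult_DirProd)
  qed (use f1 in simp)
  have e2: "f (0, int n mod int p) = (fst (f (0, 1)) * int n mod int p, snd (f (0, 1)) * int n mod int p)" for n
  proof (induction n)
    case (Suc n)
    have "(0, int (Suc n) mod int p) = (0, int n mod int p) \<otimes>\<^bsub>G\<^esub> (0, 1)"
      by (simp add: mult_Zp2 mod_simps add.commute del: mult_DirProd)
    then show ?case using hom[OF cl'(2) gens(2), of n] Suc by (simp add: mult_Zp2 mod_simps algebra_simps del: mult_DirProd)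
  qed (use f1 in simp)
  have "f x = ((fst (f (1, 0)) * fst x + fst (f (0, 1)) * snd x) mod int p, (snd (f (1, 0)) * fst x + snd (f (0, 1)) * snd x) mod int p)"
    if x: "x \<in> carrier G" for x
  proof -
    have x': "int (nat (fst x)) = fst x" "int (nat (snd x)) = snd x" "fst x mod int p = fst x" "snd x mod int p = snd x"
      using x unfolding carrier_G by simp_all
    have "x = (int (nat (fst x)) mod int p, 0) \<otimes>\<^bsub>G\<^esub> (0, int (nat (snd x)) mod int p)"
      by (simp add: x' mult_Zp2 del: mult_DirProd int_nat_eq)
    then have "f x = f (int (nat (fst x)) mod int p, 0) \<otimes>\<^bsub>G\<^esub> f (0, int (nat (snd x)) mod int p)"
      using hom[OF cl'] by metis
    then show ?thesis unfolding e1 e2 unfolding x' by (simp add: mult_Zp2 mod_simps del: mult_DirProd)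
  qed
  then show ?thesis by (rule that)
qed

text \<open>The weights \<gamma>^(i (m - k)) stand for \<gamma>^(- i k), and \<open>F\<close>
  returns to its first value after \<open>m\<close> steps modulo p. Shifting the summation index
  therefore multiplies the sum by \<gamma>^i.\<close>

lemma weighted_shift:
  fixes F :: "nat \<Rightarrow> int"
  assumes F: "[F m = F 0] (mod int p)"
  shows "[(\<Sum>k<m. \<gamma> ^ (i * (m - k)) * F (Suc k)) = \<gamma> ^ i * (\<Sum>k<m. \<gamma> ^ (i * (m - k)) * F k)] (mod int p)"
proof -
  define W where "W k = \<gamma> ^ (i * (m - k)) * F k" for k
  have "(\<Sum>k<m. \<gamma> ^ (i * (m - k)) * F (Suc k)) = (\<Sum>k<m. \<gamma> ^ i * W (Suc k))"
  proof (rule sum.cong[OF refl])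
    fix k assume "k \<in> {..<m}"
    then have "m - k = Suc (m - Suc k)" by auto
    then show "\<gamma> ^ (i * (m - k)) * F (Suc k) = \<gamma> ^ i * W (Suc k)" by (simp add: W_def power_add)
  qed
  also have "\<dots> = \<gamma> ^ i * ((\<Sum>k<m. W k) + W m - W 0)"
    using sum.lessThan_Suc_shift[of W m] sum.lessThan_Suc[of W m] by (simp add: sum_distrib_left[symmetric])
  also have "[\<gamma> ^ i * ((\<Sum>k<m. W k) + W m - W 0) = \<gamma> ^ i * ((\<Sum>k<m. W k) + F 0 - 1 * F 0)] (mod int p)"
  proof (intro cong_mult cong_refl cong_diff cong_add)
    show "[W m = F 0] (mod int p)" using F by (simp add: W_def)
    have "[\<gamma> ^ (i * m) = 1] (mod int p)" using \<gamma>[of "i * m"] p_gt_1 by (simp add: cong_def)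
    then show "[W 0 = 1 * F 0] (mod int p)" unfolding W_def by (intro cong_mult cong_refl) simp
  qed
  finally show ?thesis by (simp add: W_def)
qed

text \<open>Orthogonality of the characters of \<int>_m with values modulo p: summing over
  \<open>i\<close> kills every term with k > 0.\<close>

lemma weighted_sum:
  fixes F :: "nat \<Rightarrow> int"
  shows "[(\<Sum>i<m. \<Sum>k<m. \<gamma> ^ (i * (m - k)) * F k) = int m * F 0] (mod int p)"
proof -
  have "(\<Sum>i<m. \<Sum>k<m. \<gamma> ^ (i * (m - k)) * F k) = (\<Sum>k<m. (\<Sum>i<m. \<gamma> ^ ((m - k) * i)) * F k)"
    by (subst sum.swap) (simp add: sum_distrib_left mult.commute)
  also have "[\<dots> = (\<Sum>k<m. (if k = 0 then int m else 0) * F k)] (mod int p)"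
  proof (intro cong_sum cong_mult cong_refl)
    fix k assume k: "k \<in> {..<m}"
    show "[(\<Sum>i<m. \<gamma> ^ ((m - k) * i)) = (if k = 0 then int m else 0)] (mod int p)"
    proof (cases "k = 0")
      case True then show ?thesis using sum_pow_cong[of m] by simp
    next
      case False
      then have "\<not> m dvd m - k" using k by (intro nat_dvd_not_less) auto
      from sum_pow_dvd[OF this] show ?thesis using False by (simp add: cong_0_iff)
    qed
  qed
  also have "(\<Sum>k<m. (if k = 0 then int m else 0) * F k) = (\<Sum>k<m. if k = 0 then int m * F 0 else 0)"
    by (intro sum.cong) auto
  finally show ?thesis using m0 by simp
qed

text \<open>The spectral projections of \<open>\<alpha>\<close>, whose order divides \<open>m\<close>, sum to \<open>m\<close>; bilinearity of the determinant
  then yields two eigenvectors that are independent modulo \<open>p\<close>.\<close>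

lemma diagonalise:
  assumes F: "hopf_frame A m \<pi> G e u v \<alpha>"
  shows "\<exists>\<phi> i j. i < m \<and> j < m \<and> hopf_frame A m \<pi> G (\<lambda>x. e (\<phi> x)) u v (diag_act p \<gamma> i j)"
proof -
  interpret F: hopf_frame A m \<pi> G e u v \<alpha> by (rule F)
  obtain \<sigma> where "cocycle_frame A m \<pi> G e u v \<alpha> \<sigma>" using F.cocycle_exists by blast
  then interpret F1: cocycle_frame A m \<pi> G e u v \<alpha> \<sigma> .
  obtain a b c d where mat: "\<And>x. x \<in> carrier G \<Longrightarrow> \<alpha> x = ((a * fst x + b * snd x) mod int p, (c * fst x + d * snd x) mod int p)"
    using hom_matrix[OF F.\<alpha>_closed F1.\<alpha>_hom] by blast
  \<comment> \<open>Integer lift of the matrix of \<open>\<alpha>\<close>, iterated without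
    reduction so that sums over its powers can be handled as integers.\<close>
  define M where "M x = (a * fst x + b * snd x, c * fst x + d * snd x)" for x :: "int \<times> int"
  have pow: "(\<alpha> ^^ k) x = (fst ((M ^^ k) x) mod int p, snd ((M ^^ k) x) mod int p)" if x: "x \<in> carrier G" for x k
  proof (induction k)
    case 0 then show ?case using x unfolding carrier_G by simp
  next
    case (Suc k)
    have "(\<alpha> ^^ k) x \<in> carrier G" using x by (rule F.\<alpha>_pow_closed)
    from mat[OF this] show ?case by (simp add: Suc M_def mod_lin)
  qed
  have Mm: "[fst ((M ^^ m) x) = fst x] (mod int p)" "[snd ((M ^^ m) x) = snd x] (mod int p)" if x: "x \<in> carrier G" for x
  proof -
    have "(fst ((M ^^ m) x) mod int p, snd ((M ^^ m) x) mod int p) = x" using pow[OF x, of m] F.\<alpha>_pow_m[OF x] by simp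
    then show "[fst ((M ^^ m) x) = fst x] (mod int p)" "[snd ((M ^^ m) x) = snd x] (mod int p)"
      unfolding cong_def by (metis fst_conv mod_mod_trivial, metis snd_conv mod_mod_trivial)
  qed
  \<comment> \<open>\<open>E1 i x\<close> and \<open>E2 i x\<close> are the coordinates of m times
    the projection of \<open>x\<close> to the eigenvalue \<gamma>^i.\<close>
  define E1 where "E1 i x = (\<Sum>k<m. \<gamma> ^ (i * (m - k)) * fst ((M ^^ k) x))" for i x
  define E2 where "E2 i x = (\<Sum>k<m. \<gamma> ^ (i * (m - k)) * snd ((M ^^ k) x))" for i x
  have eig: "[a * E1 i x + b * E2 i x = \<gamma> ^ i * E1 i x] (mod int p)" "[c * E1 i x + d * E2 i x = \<gamma> ^ i * E2 i x] (mod int p)"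
    if x: "x \<in> carrier G" for i x
  proof -
    have "a * E1 i x + b * E2 i x = (\<Sum>k<m. \<gamma> ^ (i * (m - k)) * fst ((M ^^ Suc k) x))"
      by (simp add: E1_def E2_def M_def sum_distrib_left algebra_simps sum.distrib)
    then show "[a * E1 i x + b * E2 i x = \<gamma> ^ i * E1 i x] (mod int p)"
      using weighted_shift[of "\<lambda>k. fst ((M ^^ k) x)" i] Mm[OF x] by (simp add: E1_def)
    have "c * E1 i x + d * E2 i x = (\<Sum>k<m. \<gamma> ^ (i * (m - k)) * snd ((M ^^ Suc k) x))"
      by (simp add: E1_def E2_def M_def sum_distrib_left algebra_simps sum.distrib)
    then show "[c * E1 i x + d * E2 i x = \<gamma> ^ i * E2 i x] (mod int p)"
      using weighted_shift[of "\<lambda>k. snd ((M ^^ k) x)" i] Mm[OF x] by (simp add: E2_def)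
  qed
  have tot: "[(\<Sum>i<m. E1 i x) = int m * fst x] (mod int p)" "[(\<Sum>i<m. E2 i x) = int m * snd x] (mod int p)" for x
    using weighted_sum[of "\<lambda>k. fst ((M ^^ k) x)"] weighted_sum[of "\<lambda>k. snd ((M ^^ k) x)"] by (simp_all add: E1_def E2_def)
  let ?x = "(1, 0) :: int \<times> int" and ?y = "(0, 1) :: int \<times> int"
  have xy: "?x \<in> carrier G" "?y \<in> carrier G" unfolding carrier_G using p_gt_1 by simp_all
  \<comment> \<open>If all these determinants vanished modulo p, so would their sum, which by
    bilinearity is m^2 times the determinant of the standard basis.\<close>
  have "\<exists>i<m. \<exists>j<m. \<not> int p dvd E1 i ?x * E2 j ?y - E2 i ?x * E1 j ?y"
  proof (rule ccontr)
    assume "\<not> ?thesis"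
    then have "int p dvd (\<Sum>i<m. \<Sum>j<m. E1 i ?x * E2 j ?y - E2 i ?x * E1 j ?y)" by (intro dvd_sum) auto
    moreover have "(\<Sum>i<m. \<Sum>j<m. E1 i ?x * E2 j ?y - E2 i ?x * E1 j ?y)
        = (\<Sum>i<m. E1 i ?x) * (\<Sum>j<m. E2 j ?y) - (\<Sum>i<m. E2 i ?x) * (\<Sum>j<m. E1 j ?y)"
      by (simp add: sum_product sum_subtractf)
    moreover have "[(\<Sum>i<m. E1 i ?x) * (\<Sum>j<m. E2 j ?y) - (\<Sum>i<m. E2 i ?x) * (\<Sum>j<m. E1 j ?y)
        = (int m * fst ?x) * (int m * snd ?y) - (int m * snd ?x) * (int m * fst ?y)] (mod int p)"
      by (intro cong_diff cong_mult tot)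
    ultimately have "int p dvd int m * int m" by (simp add: cong_dvd_iff)
    then have "p dvd m" using prime_int_p by (metis int_dvd_int_iff prime_dvd_mult_iff)
    then show False using coprime_common_divisor_nat[OF cop _ dvd_refl] p_gt_1 by simp
  qed
  then obtain i j where ij: "i < m" "j < m" and det: "\<not> int p dvd E1 i ?x * E2 j ?y - E2 i ?x * E1 j ?y" by blast
  define s1 s2 t1 t2 where "s1 = E1 i ?x" "s2 = E2 i ?x" "t1 = E1 j ?y" "t2 = E2 j ?y"
  note st = s1_s2_t1_t2_def
  define \<phi> where "\<phi> x = ((s1 * fst x + t1 * snd x) mod int p, (s2 * fst x + t2 * snd x) mod int p)" for x :: "int \<times> int"
  have \<phi>cl: "\<phi> x \<in> carrier G" for x unfolding carrier_G by (simp add: \<phi>_def)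
  have "inj_on \<phi> (carrier G)"
  proof (rule inj_onI)
    fix x y assume xy: "x \<in> carrier G" "y \<in> carrier G" "\<phi> x = \<phi> y"
    define x1 x2 where "x1 = fst x - fst y" "x2 = snd x - snd y"
    have "int p dvd (s1 * fst x + t1 * snd x) - (s1 * fst y + t1 * snd y)" "int p dvd (s2 * fst x + t2 * snd x) - (s2 * fst y + t2 * snd y)"
      using xy(3) by (simp_all add: \<phi>_def mod_eq_dvd_iff)
    then have 1: "int p dvd s1 * x1 + t1 * x2" "int p dvd s2 * x1 + t2 * x2"
      by (simp_all add: x1_x2_def algebra_simps)
    have "int p dvd t2 * (s1 * x1 + t1 * x2) - t1 * (s2 * x1 + t2 * x2)" by (intro dvd_diff dvd_mult 1)
    moreover have "int p dvd s1 * (s2 * x1 + t2 * x2) - s2 * (s1 * x1 + t1 * x2)" by (intro dvd_diff dvd_mult 1)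
    ultimately have "int p dvd (s1 * t2 - s2 * t1) * x1" "int p dvd (s1 * t2 - s2 * t1) * x2" by (simp_all add: algebra_simps)
    then have "int p dvd x1" "int p dvd x2" using det prime_int_p unfolding st by (metis prime_dvd_mult_iff)+
    then have "fst x mod int p = fst y mod int p" "snd x mod int p = snd y mod int p" unfolding x1_x2_def by (simp_all add: mod_eq_dvd_iff)
    then show "x = y" using xy(1,2) unfolding carrier_G by (simp add: prod_eq_iff)
  qed
  moreover have "\<phi> ` carrier G \<subseteq> carrier G" using \<phi>cl by blast
  ultimately have bij: "bij_betw \<phi> (carrier G) (carrier G)" by (simp add: bij_betw_def endo_inj_surj del: carrier_DirProd)
  have "hopf_frame A m \<pi> G (\<lambda>x. e (\<phi> x)) u v (diag_act p \<gamma> i j)"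
  proof (rule F.reparametrise[OF group_Zp2 bij])
    show "\<phi> (x \<otimes>\<^bsub>G\<^esub> y) = \<phi> x \<otimes>\<^bsub>G\<^esub> \<phi> y" if "x \<in> carrier G" "y \<in> carrier G" for x y
      by (simp only: \<phi>_def mult_Zp2 fst_conv snd_conv mod_lin mod_add_eq) (simp add: algebra_simps)
    show "diag_act p \<gamma> i j x \<in> carrier G" for x by (rule diag_closed)
    show "\<phi> (diag_act p \<gamma> i j x) = \<alpha> (\<phi> x)" for x
    proof -
      have "[a * (s1 * fst x + t1 * snd x) + b * (s2 * fst x + t2 * snd x) = s1 * (\<gamma> ^ i * fst x) + t1 * (\<gamma> ^ j * snd x)] (mod int p)"
      proof -
        have "[fst x * (a * s1 + b * s2) + snd x * (a * t1 + b * t2) = fst x * (\<gamma> ^ i * s1) + snd x * (\<gamma> ^ j * t1)] (mod int p)"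
          unfolding st by (intro cong_add cong_mult cong_refl eig xy)
        then show ?thesis by (simp add: algebra_simps)
      qed
      moreover have "[c * (s1 * fst x + t1 * snd x) + d * (s2 * fst x + t2 * snd x) = s2 * (\<gamma> ^ i * fst x) + t2 * (\<gamma> ^ j * snd x)] (mod int p)"
      proof -
        have "[fst x * (c * s1 + d * s2) + snd x * (c * t1 + d * t2) = fst x * (\<gamma> ^ i * s2) + snd x * (\<gamma> ^ j * t2)] (mod int p)"
          unfolding st by (intro cong_add cong_mult cong_refl eig xy)
        then show ?thesis by (simp add: algebra_simps)
      qed
      ultimately show ?thesis
        unfolding mat[OF \<phi>cl] by (simp add: \<phi>_def diag_act_def cong_def mod_lin)
    qed
  qed
  then show ?thesis using ij by blast
qed

text \<open>The exponent pairs of all normal frames of one algebra. The set is an isomorphism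
  invariant by \<open>types_transport\<close>, and \<open>types_unique\<close> limits its members to
  a single equivalence class.\<close>

definition types :: "('i, 'k) hopf_data \<Rightarrow> (nat \<times> nat) set" where
  "types A = {(i, j). \<exists>\<pi> e u v. normal_frame A m \<pi> G e u v (diag_act p \<gamma> i j) (bichar p \<omega>)}"

lemma types_normalise:
  assumes "hopf_frame A m \<pi> G e u v (diag_act p \<gamma> i j)" "\<not> hopf_cocommutative A"
  shows "(i, j) \<in> types A" "\<not> m dvd i + j"
  using normalise[OF assms] unfolding types_def by blast+

lemma typesD:
  assumes "(i, j) \<in> types A"
  obtains \<pi> e u v where "normal_frame A m \<pi> G e u v (diag_act p \<gamma> i j) (bichar p \<omega>)" "hopf_frame A m \<pi> G e u v (diag_act p \<gamma> i j)"
  using assms unfolding types_def normal_frame_def cocycle_frame_def by blast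

lemma types_not_dvd: "(i, j) \<in> types A \<Longrightarrow> \<not> hopf_cocommutative A \<Longrightarrow> \<not> m dvd i + j"
  by (meson typesD types_normalise)

text \<open>Exchanging the coordinates transposes the bicharacter, so only the underlying frame is
  carried over and \<open>types_normalise\<close> restores the standard cocycle.\<close>

lemma types_swap:
  assumes "(i, j) \<in> types A" "\<not> hopf_cocommutative A" shows "(j, i) \<in> types A"
proof -
  obtain \<pi> e u v where "hopf_frame A m \<pi> G e u v (diag_act p \<gamma> i j)" using typesD[OF assms(1)] .
  then have "hopf_frame A m \<pi> G (\<lambda>x. e (prod.swap x)) u v (diag_act p \<gamma> j i)"
  proof (rule hopf_frame.reparametrise[OF _ group_Zp2])
    show "bij_betw prod.swap (carrier G) (carrier G)"
      by (rule bij_betw_byWitness[of _ prod.swap]) auto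
    show "prod.swap (x \<otimes>\<^bsub>G\<^esub> y) = prod.swap x \<otimes>\<^bsub>G\<^esub> prod.swap y" for x y
      by (simp add: mult_Zp2 del: mult_DirProd)
  qed (rule diag_closed, simp add: diag_act_def)
  then show ?thesis using assms(2) by (rule types_normalise)
qed

text \<open>The k-th power of \<open>u\<close> has its own cocycle \<open>\<sigma>p k\<close>; again
  only the frame is kept and normalised afresh.\<close>

lemma types_power:
  assumes "(i, j) \<in> types A" "\<not> hopf_cocommutative A" "coprime k m" shows "(i * k, j * k) \<in> types A"
proof -
  obtain \<pi> e u v where F: "hopf_frame A m \<pi> G e u v (diag_act p \<gamma> i j)" using typesD[OF assms(1)] .
  have "hopf_frame A m (\<lambda>j. \<pi> (int k * j)) G e (hpow A u k) (hpow A v k) (diag_act p \<gamma> (i * k) (j * k))"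
    by (rule hopf_frame.action_cong[OF hopf_frame.change_generator[OF F assms(3)]]) (simp only: diag_pow)
  then show ?thesis using assms(2) by (rule types_normalise)
qed

lemma \<gamma>_power_cong:
  "[\<gamma> ^ i = \<gamma> ^ j] (mod int p) \<longleftrightarrow> [i = j] (mod m)"
proof -
  have nd: "\<not> int p dvd \<gamma> ^ i" for i
  proof
    assume "int p dvd \<gamma> ^ i"
    then have "int p dvd \<gamma>" using prime_int_p prime_dvd_power by blast
    then have "int p dvd \<gamma> ^ m" using m0 by (meson dvd_power dvd_trans)
    then have "\<gamma> ^ m mod int p = 0" by simp
    then show False using \<gamma>[of m] by simp
  qed
  have *: "[\<gamma> ^ i = \<gamma> ^ j] (mod int p) \<longleftrightarrow> [i = j] (mod m)" if "i \<le> j" for i j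
  proof -
    have "\<gamma> ^ j = \<gamma> ^ i * \<gamma> ^ (j - i)" using that by (simp flip: power_add)
    then have "[\<gamma> ^ j = \<gamma> ^ i] (mod int p) \<longleftrightarrow> int p dvd \<gamma> ^ i * (\<gamma> ^ (j - i) - 1)"
      by (simp add: cong_iff_dvd_diff algebra_simps)
    also have "\<dots> \<longleftrightarrow> int p dvd \<gamma> ^ (j - i) - 1" using nd prime_int_p by (simp add: prime_dvd_mult_iff)
    also have "\<dots> \<longleftrightarrow> \<gamma> ^ (j - i) mod int p = 1" using p_gt_1 by (simp add: mod_eq_dvd_iff[symmetric])
    also have "\<dots> \<longleftrightarrow> m dvd j - i" by (rule \<gamma>)
    also have "\<dots> \<longleftrightarrow> [j = i] (mod m)" using that by (simp add: cong_altdef_nat)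
    finally show ?thesis by (simp add: cong_sym_eq)
  qed
  show ?thesis using *[of i j] *[of j i] by (cases "i \<le> j") (auto simp: cong_sym_eq)
qed

lemma types_cong:
  assumes "(i, j) \<in> types A" "[i = i'] (mod m)" "[j = j'] (mod m)" shows "(i', j') \<in> types A"
proof -
  have "diag_act p \<gamma> i' j' = diag_act p \<gamma> i j"
  proof
    fix x
    have "[\<gamma> ^ i' * fst x = \<gamma> ^ i * fst x] (mod int p)" "[\<gamma> ^ j' * snd x = \<gamma> ^ j * snd x] (mod int p)"
      by (intro cong_mult cong_refl; use assms in \<open>simp add: \<gamma>_power_cong cong_sym_eq\<close>)+
    then show "diag_act p \<gamma> i' j' x = diag_act p \<gamma> i j x" by (simp add: diag_act_def cong_def)
  qed
  then show ?thesis using assms(1) by (simp add: types_def)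
qed

text \<open>\<open>frame_unique\<close> yields an invertible matrix intertwining the two diagonal
  actions. Each entry prime to \<open>p\<close> equates one new exponent with \<open>k\<close> times
  an old one. Every row and column has such an entry, so either both diagonal or both off-diagonal
  entries are prime to \<open>p\<close>.\<close>

lemma types_unique:
  fixes \<zeta> :: 'k
  assumes \<zeta>: "\<zeta> ^ m = 1" "\<And>j. \<zeta> ^ j = 1 \<longleftrightarrow> m dvd j"
    and ij: "(i, j) \<in> types A" and ij': "(i', j') \<in> types A"
  shows "\<exists>k. coprime k m \<and> ([i' = i * k] (mod m) \<and> [j' = j * k] (mod m) \<or> [i' = j * k] (mod m) \<and> [j' = i * k] (mod m))"
proof -
  obtain \<pi> e u v where F: "normal_frame A m \<pi> G e u v (diag_act p \<gamma> i j) (bichar p \<omega>)" using typesD[OF ij] .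
  obtain \<pi>' e' u' v' where F': "normal_frame A m \<pi>' G e' u' v' (diag_act p \<gamma> i' j') (bichar p \<omega>)" using typesD[OF ij'] .
  obtain k \<phi> where k: "coprime k m" and bij: "bij_betw \<phi> (carrier G) (carrier G)"
    and hom: "\<And>x y. x \<in> carrier G \<Longrightarrow> y \<in> carrier G \<Longrightarrow> \<phi> (x \<otimes>\<^bsub>G\<^esub> y) = \<phi> x \<otimes>\<^bsub>G\<^esub> \<phi> y"
    and comm: "\<And>x. x \<in> carrier G \<Longrightarrow> \<phi> (diag_act p \<gamma> i' j' x) = (diag_act p \<gamma> i j ^^ k) (\<phi> x)"
    using normal_frame.frame_unique[OF F F' \<zeta>] by blast
  have cl: "\<phi> x \<in> carrier G" if "x \<in> carrier G" for x using bij that by (auto simp: bij_betw_def simp del: carrier_DirProd)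
  obtain a b c d where mat: "\<And>x. x \<in> carrier G \<Longrightarrow> \<phi> x = ((a * fst x + b * snd x) mod int p, (c * fst x + d * snd x) mod int p)"
    using hom_matrix[OF cl hom] by blast
  have gens: "(1, 0) \<in> carrier G" "(0, 1) \<in> carrier G" "(0, 0) \<in> carrier G" unfolding carrier_G using p_gt_1 by simp_all
  have eq: "\<phi> (diag_act p \<gamma> i' j' x) = diag_act p \<gamma> (i * k) (j * k) (\<phi> x)" if "x \<in> carrier G" for x
    using comm[OF that] diag_pow[OF cl[OF that]] by simp
  have canc: "[s = t] (mod m)" if "\<gamma> ^ s * z mod int p = \<gamma> ^ t * z mod int p" "\<not> int p dvd z" for s t z
  proof -
    have "int p dvd (\<gamma> ^ s - \<gamma> ^ t) * z" using that(1) by (simp add: mod_eq_dvd_iff left_diff_distrib)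
    then have "int p dvd \<gamma> ^ s - \<gamma> ^ t" using that(2) prime_int_p by (simp add: prime_dvd_mult_iff)
    then show ?thesis by (simp add: cong_iff_dvd_diff flip: \<gamma>_power_cong)
  qed
  have r1: "\<gamma> ^ i' * a mod int p = \<gamma> ^ (i * k) * a mod int p" "\<gamma> ^ i' * c mod int p = \<gamma> ^ (j * k) * c mod int p"
    using eq[OF gens(1)] unfolding mat[OF gens(1)] mat[OF diag_closed]
    by (simp_all add: diag_act_def mod_simps mult.commute)
  have r2: "\<gamma> ^ j' * b mod int p = \<gamma> ^ (i * k) * b mod int p" "\<gamma> ^ j' * d mod int p = \<gamma> ^ (j * k) * d mod int p"
    using eq[OF gens(2)] unfolding mat[OF gens(2)] mat[OF diag_closed]
    by (simp_all add: diag_act_def mod_simps mult.commute)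
  have inj: "\<phi> x \<noteq> \<phi> y" if "x \<in> carrier G" "y \<in> carrier G" "x \<noteq> y" for x y
    using bij that by (auto simp: bij_betw_def inj_on_def simp del: carrier_DirProd)
  have nz1: "\<not> int p dvd a \<or> \<not> int p dvd c" using inj[OF gens(1,3)] by (auto simp: mat[OF gens(1)] mat[OF gens(3)])
  have nz2: "\<not> int p dvd b \<or> \<not> int p dvd d" using inj[OF gens(2,3)] by (auto simp: mat[OF gens(2)] mat[OF gens(3)])
  have sur: "\<exists>x\<in>carrier G. y = \<phi> x" if "y \<in> carrier G" for y using bij that by (auto simp: bij_betw_def simp del: carrier_DirProd)
  have nz3: "\<not> int p dvd a \<or> \<not> int p dvd b"
  proof (rule ccontr)
    assume "\<not> ?thesis"
    moreover obtain x where "x \<in> carrier G" "(1, 0) = \<phi> x" using sur[OF gens(1)] by blast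
    ultimately have "int p dvd a * fst x + b * snd x" "(a * fst x + b * snd x) mod int p = 1" by (auto simp: mat)
    then show False by simp
  qed
  have nz4: "\<not> int p dvd c \<or> \<not> int p dvd d"
  proof (rule ccontr)
    assume "\<not> ?thesis"
    moreover obtain x where "x \<in> carrier G" "(0, 1) = \<phi> x" using sur[OF gens(2)] by blast
    ultimately have "int p dvd c * fst x + d * snd x" "(c * fst x + d * snd x) mod int p = 1" by (auto simp: mat)
    then show False by simp
  qed
  show ?thesis using canc[OF r1(1)] canc[OF r1(2)] canc[OF r2(1)] canc[OF r2(2)] nz1 nz2 nz3 nz4 k by blast
qed

lemma types_iso:
  fixes A :: "('i, 'k) hopf_data" and B :: "('j, 'k) hopf_data"
  assumes "(i, j) \<in> types A" "(i, j) \<in> types B"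
  shows "\<exists>f. hopf_map A B f \<and> bij_betw f (hspace A) (hspace B)"
proof -
  obtain \<pi> e u v where F: "normal_frame A m \<pi> G e u v (diag_act p \<gamma> i j) (bichar p \<omega>)" using typesD[OF assms(1)] .
  obtain \<pi>' e' u' v' where F': "normal_frame B m \<pi>' G e' u' v' (diag_act p \<gamma> i j) (bichar p \<omega>)" using typesD[OF assms(2)] .
  show ?thesis
    using hopf_iso_of_frames[of A m \<pi> G e u v _ _ B \<pi>' e' u' v'] F F' unfolding normal_frame_def normal_frame_axioms_def by blast
qed

lemma types_transport:
  fixes A :: "('i, 'k) hopf_data" and B :: "('j, 'k) hopf_data"
  assumes "(i, j) \<in> types A" "fd_hopf_algebra B" "hopf_map A B f" "bij_betw f (hspace A) (hspace B)"
  shows "(i, j) \<in> types B"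
proof -
  obtain \<pi> e u v where F: "normal_frame A m \<pi> G e u v (diag_act p \<gamma> i j) (bichar p \<omega>)" using typesD[OF assms(1)] .
  then have C: "cocycle_frame A m \<pi> G e u v (diag_act p \<gamma> i j) (bichar p \<omega>)" and um: "hpow A u m = hunit A"
    by (simp_all add: normal_frame_def normal_frame_axioms_def)
  from cocycle_frame.transport[OF C assms(2-4), of m] obtain \<pi>' where
    "cocycle_frame B m \<pi>' G (\<lambda>x. f (e x)) (f u) (f v) (diag_act p \<gamma> i j) (bichar p \<omega>)" "hpow B (f u) m = f (hpow A u m)" by blast
  moreover have "f (hunit A) = hunit B" using assms(3) by (simp add: hopf_map_def)
  ultimately show ?thesis using normal_frameI um unfolding types_def by fastforce
qed

lemma types_nonempty:
  assumes A: "fd_hopf_algebra A" and ext: "cocentral_extension (fun_hopf G) A (group_hopf (integer_mod_group m))"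
    and nc: "\<not> hopf_cocommutative A"
  shows "\<exists>i j. i < m \<and> j < m \<and> (i, j) \<in> types A"
proof -
  have fG: "finite (carrier G)" by (simp add: carrier_integer_mod_group)
  obtain \<iota> q where *: "hopf_map (fun_hopf G) A \<iota>" "inj_on \<iota> (hspace (fun_hopf G))"
     "hopf_map A (group_hopf (integer_mod_group m)) q" "q ` hspace A = hspace (group_hopf (integer_mod_group m))"
     "cocentral A (group_hopf (integer_mod_group m)) q"
     "\<iota> ` hspace (fun_hopf G) = {a \<in> hspace A. tens_map (index A) (index A) (\<lambda>b. b) q (hcomult A a) = a \<otimes>\<^sub>k hunit (group_hopf (integer_mod_group m))}"
    using ext unfolding cocentral_extension_def by blast
  from pre_frame_of_extension[OF A group_Zp2 fG m0 *]
  obtain \<pi> e where "pre_frame A m \<pi> G e" by blast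
  then obtain u v \<alpha> where "hopf_frame A m \<pi> G e u v \<alpha>" using pre_frame.frame_exists by blast
  from diagonalise[OF this] obtain \<phi> i j where "i < m" "j < m" "hopf_frame A m \<pi> G (\<lambda>x. e (\<phi> x)) u v (diag_act p \<gamma> i j)" by blast
  then show ?thesis using types_normalise nc by blast
qed

end

section \<open>Hopf algebras given by structure constants\<close>

text \<open>\<open>enc\<close> separates the convenient labels \<open>J\<close> of the basis from
  the index type of the algebra, which is \<open>nat\<close> in the classification. Here only
  supports are prescribed; the axioms are the premises of \<open>hopf_algebra\<close>.\<close>

locale basis_data =
  fixes J :: "'g set" and enc :: "'g \<Rightarrow> 'i"
    and mt :: "'g \<Rightarrow> 'g \<Rightarrow> 'i \<Rightarrow> 'k::field" and un :: "'i \<Rightarrow> 'k"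
    and dl :: "'g \<Rightarrow> 'i \<times> 'i \<Rightarrow> 'k" and ep :: "'g \<Rightarrow> 'k"
  assumes finJ [simp]: "finite J" and inj_enc: "inj_on enc J"
    and mt_closed [simp]: "g \<in> J \<Longrightarrow> h \<in> J \<Longrightarrow> mt g h \<in> fspace (enc ` J)"
    and un_closed [simp]: "un \<in> fspace (enc ` J)"
    and dl_closed [simp]: "g \<in> J \<Longrightarrow> dl g \<in> fspace (enc ` J \<times> enc ` J)"
begin

definition A :: "('i, 'k) hopf_data" where
  "A = \<lparr> index = enc ` J,
     hmult = (\<lambda>t. \<Sum>g\<in>J. \<Sum>h\<in>J. t (enc g, enc h) \<bullet> mt g h),
     hunit = un,
     hcomult = (\<lambda>a. \<Sum>g\<in>J. a (enc g) \<bullet> dl g),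
     hcounit = (\<lambda>a. \<Sum>g\<in>J. a (enc g) * ep g) \<rparr>"

abbreviation X where "X \<equiv> enc ` J"

abbreviation b :: "'g \<Rightarrow> 'i \<Rightarrow> 'k" where "b g \<equiv> basis_vec (enc g)"

lemma A_simps [simp]: "index A = enc ` J" "hunit A = un"
  by (simp_all add: A_def)

lemma enc_eq [simp]: "g \<in> J \<Longrightarrow> h \<in> J \<Longrightarrow> enc g = enc h \<longleftrightarrow> g = h"
  using inj_enc by (simp add: inj_on_eq_iff)

lemma mult_lin: "linear_map (index A \<times> index A) (index A) (hmult A)"
  unfolding A_def by (rule linear_mapI) (simp_all add: sum.distrib smul_sum smul_apply)

lemma comult_lin: "linear_map (index A) (index A \<times> index A) (hcomult A)"
  unfolding A_def by (rule linear_mapI) (simp_all add: sum.distrib smul_sum smul_apply)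

lemma counit_lin: "linear_form (index A) (hcounit A)"
  by (simp add: A_def linear_form_iff sum.distrib distrib_right sum_distrib_left smul_apply mult.assoc)

lemma hmult_b: "g \<in> J \<Longrightarrow> h \<in> J \<Longrightarrow> hmult A (b g \<otimes>\<^sub>k b h) = mt g h"
proof -
  assume gh: "g \<in> J" "h \<in> J"
  have "hmult A (b g \<otimes>\<^sub>k b h) = (\<Sum>g'\<in>J. \<Sum>h'\<in>J. if h' = h then (if g' = g then mt g h else 0) else 0)"
    unfolding A_def hopf_data.simps by (intro sum.cong refl) (use gh in \<open>auto simp: tens_apply basis_vec_def\<close>)
  then show ?thesis using gh by simp
qed

lemma hcomult_b: "g \<in> J \<Longrightarrow> hcomult A (b g) = dl g"
proof -
  assume g: "g \<in> J"
  have "hcomult A (b g) = (\<Sum>g'\<in>J. if g' = g then dl g else 0)"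
    unfolding A_def hopf_data.simps by (intro sum.cong refl) (use g in \<open>auto simp: basis_vec_def\<close>)
  then show ?thesis using g by simp
qed

lemma hcounit_b: "g \<in> J \<Longrightarrow> hcounit A (b g) = ep g"
proof -
  assume g: "g \<in> J"
  have "hcounit A (b g) = (\<Sum>g'\<in>J. if g' = g then ep g else 0)"
    unfolding A_def hopf_data.simps by (intro sum.cong refl) (use g in \<open>auto simp: basis_vec_def\<close>)
  then show ?thesis using g by simp
qed

lemma b_ext:
  fixes h h' :: "('i \<Rightarrow> 'k) \<Rightarrow> ('z \<Rightarrow> 'k)"
  assumes "\<And>a c. a \<in> fspace X \<Longrightarrow> c \<in> fspace X \<Longrightarrow> h (a + c) = h a + h c" "\<And>c a. a \<in> fspace X \<Longrightarrow> h (c \<bullet> a) = c \<bullet> h a"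
    and "\<And>a c. a \<in> fspace X \<Longrightarrow> c \<in> fspace X \<Longrightarrow> h' (a + c) = h' a + h' c" "\<And>c a. a \<in> fspace X \<Longrightarrow> h' (c \<bullet> a) = c \<bullet> h' a"
    and eq: "\<And>g. g \<in> J \<Longrightarrow> h (b g) = h' (b g)" and a: "a \<in> fspace X"
  shows "h a = h' a"
proof -
  have "linear_map X UNIV h" "linear_map X UNIV h'"
    using assms(1-4) by (auto intro!: linear_mapI simp: fspace_def)
  from this[THEN linear_map_expansion, OF _ a]
  have "h a = (\<Sum>x\<in>X. a x \<bullet> h (basis_vec x))" "h' a = (\<Sum>x\<in>X. a x \<bullet> h' (basis_vec x))" by simp_all
  moreover have "(\<Sum>x\<in>X. a x \<bullet> h (basis_vec x)) = (\<Sum>x\<in>X. a x \<bullet> h' (basis_vec x))"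
    using eq by (intro sum.cong refl) auto
  ultimately show ?thesis by simp
qed

abbreviation mul (infixl \<open>\<star>\<close> 78) where "a \<star> c \<equiv> hmul A a c"

lemma mul_closed [simp]: "a \<star> c \<in> fspace X"
  unfolding hmul_def using linear_mapD(1)[OF mult_lin] by simp

lemma hmult_mul: "a \<in> fspace X \<Longrightarrow> c \<in> fspace X \<Longrightarrow> hmult A (a \<otimes>\<^sub>k c) = a \<star> c"
  by (simp add: hmul_def)

lemma mul_simps [simp]:
  "(a + d) \<star> c = a \<star> c + d \<star> c" "c \<star> (a + d) = c \<star> a + c \<star> d"
  "(x \<bullet> a) \<star> c = x \<bullet> (a \<star> c)" "c \<star> (x \<bullet> a) = x \<bullet> (c \<star> a)"
  "0 \<star> c = 0" "c \<star> 0 = 0"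
  using mult_lin by (simp_all add: hmul_def linear_mapD[OF mult_lin])

lemma mul_sum_left: "(\<Sum>x\<in>I. f x) \<star> c = (\<Sum>x\<in>I. f x \<star> c)"
  by (rule additive_sum[of "\<lambda>a. a \<star> c"]) simp_all

lemma mul_sum_right: "c \<star> (\<Sum>x\<in>I. f x) = (\<Sum>x\<in>I. c \<star> f x)"
  by (rule additive_sum[of "\<lambda>a. c \<star> a"]) simp_all

lemma mul_b: "g \<in> J \<Longrightarrow> h \<in> J \<Longrightarrow> b g \<star> b h = mt g h"
  by (simp add: hmult_b flip: hmult_mul)

lemma comult_simps [simp]:
  "a \<in> fspace X \<Longrightarrow> c \<in> fspace X \<Longrightarrow> hcomult A (a + c) = hcomult A a + hcomult A c"
  "a \<in> fspace X \<Longrightarrow> hcomult A (x \<bullet> a) = x \<bullet> hcomult A a"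
  "hcomult A 0 = 0" "a \<in> fspace X \<Longrightarrow> hcomult A a \<in> fspace (X \<times> X)"
  using linear_mapD[OF comult_lin] by simp_all

lemma counit_simps [simp]:
  "a \<in> fspace X \<Longrightarrow> c \<in> fspace X \<Longrightarrow> hcounit A (a + c) = hcounit A a + hcounit A c"
  "a \<in> fspace X \<Longrightarrow> hcounit A (x \<bullet> a) = x * hcounit A a"
  "hcounit A 0 = 0"
  using linear_formD[OF counit_lin] by simp_all

lemma tens_map_b:
  assumes "g \<in> J" "h \<in> J" shows "tens_map X X f k (b g \<otimes>\<^sub>k b h) = f (b g) \<otimes>\<^sub>k k (b h)"
proof -
  have "tens_map X X f k (b g \<otimes>\<^sub>k b h) = (\<Sum>x\<in>X. \<Sum>y\<in>X. if y = enc h then (if x = enc g then f (b g) \<otimes>\<^sub>k k (b h) else 0) else 0)"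
    unfolding tens_map_apply by (intro sum.cong refl) (auto simp: tens_apply basis_vec_def)
  then show ?thesis using assms by simp
qed

lemma mul2_b:
  assumes "g \<in> J" "h \<in> J" "g' \<in> J" "h' \<in> J" shows "hmul2 A (b g \<otimes>\<^sub>k b h) (b g' \<otimes>\<^sub>k b h') = mt g g' \<otimes>\<^sub>k mt h h'"
  using assms by (simp add: hmul2_def tens_map_tens[OF mult_lin mult_lin, simplified] hmult_b)

lemma hmul2_simps [simp]:
  "hmul2 A (a + a') c = hmul2 A a c + hmul2 A a' c" "hmul2 A c (a + a') = hmul2 A c a + hmul2 A c a'"
  "hmul2 A (x \<bullet> a) c = x \<bullet> hmul2 A a c" "hmul2 A c (x \<bullet> a) = x \<bullet> hmul2 A c a"
  "hmul2 A 0 c = 0" "hmul2 A c 0 = 0"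
  by (simp_all add: hmul2_def)

lemma hmul2_sum: "hmul2 A (\<Sum>x\<in>I. f x) c = (\<Sum>x\<in>I. hmul2 A (f x) c)" "hmul2 A c (\<Sum>x\<in>I. f x) = (\<Sum>x\<in>I. hmul2 A c (f x))"
  by (rule additive_sum[of "\<lambda>a. hmul2 A a c"]; simp) (rule additive_sum[of "\<lambda>a. hmul2 A c a"]; simp)

lemma comult_sum: "(\<And>x. x \<in> I \<Longrightarrow> f x \<in> fspace X) \<Longrightarrow> hcomult A (\<Sum>x\<in>I. f x) = (\<Sum>x\<in>I. hcomult A (f x))"
  by (rule linear_map_sum[OF comult_lin]) simp

lemma counit_sum: "(\<And>x. x \<in> I \<Longrightarrow> f x \<in> fspace X) \<Longrightarrow> hcounit A (\<Sum>x\<in>I. f x) = (\<Sum>x\<in>I. hcounit A (f x))"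
  by (rule linear_form_sum[OF counit_lin]) simp

lemma tens_assoc_simps [simp]:
  "tens_assoc (t + s) = tens_assoc t + tens_assoc s" "tens_assoc (c \<bullet> t) = c \<bullet> tens_assoc t"
  "tens_assoc 0 = 0" "tens_assoc ((a \<otimes>\<^sub>k a') \<otimes>\<^sub>k a'') = a \<otimes>\<^sub>k (a' \<otimes>\<^sub>k a'')"
  by (auto simp: tens_assoc_def smul_def fun_eq_iff tens_def)

lemma tens_assoc_sum: "tens_assoc (\<Sum>x\<in>I. f x) = (\<Sum>x\<in>I. tens_assoc (f x))"
  by (rule additive_sum[of "\<lambda>t. tens_assoc t"]) (simp_all add: tens_assoc_def fun_eq_iff)

text \<open>All axioms are multilinear, so they need only be checked on basis vectors;
  \<open>s\<close> lists the values of the antipode there.\<close>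

theorem hopf_algebra:
  assumes assoc: "\<And>g h k. g \<in> J \<Longrightarrow> h \<in> J \<Longrightarrow> k \<in> J \<Longrightarrow> mt g h \<star> b k = b g \<star> mt h k"
    and unit: "\<And>g. g \<in> J \<Longrightarrow> un \<star> b g = b g" "\<And>g. g \<in> J \<Longrightarrow> b g \<star> un = b g"
    and coassoc: "\<And>g. g \<in> J \<Longrightarrow> tens_assoc (tens_map X X (hcomult A) (\<lambda>b. b) (dl g)) = tens_map X X (\<lambda>b. b) (hcomult A) (dl g)"
    and counit: "\<And>g. g \<in> J \<Longrightarrow> slice_left X (\<lambda>i. hcounit A (basis_vec i)) (dl g) = b g"
      "\<And>g. g \<in> J \<Longrightarrow> slice_right X (\<lambda>i. hcounit A (basis_vec i)) (dl g) = b g"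
    and mult: "\<And>g h. g \<in> J \<Longrightarrow> h \<in> J \<Longrightarrow> hcomult A (mt g h) = hmul2 A (dl g) (dl h)"
    and comult_un: "hcomult A un = un \<otimes>\<^sub>k un"
    and counit_mt: "\<And>g h. g \<in> J \<Longrightarrow> h \<in> J \<Longrightarrow> hcounit A (mt g h) = ep g * ep h"
    and counit_un: "hcounit A un = 1"
    and s_closed: "\<And>g. g \<in> J \<Longrightarrow> s g \<in> fspace X"
    and anti: "\<And>g. g \<in> J \<Longrightarrow> hmult A (tens_map X X (\<lambda>a. \<Sum>g\<in>J. a (enc g) \<bullet> s g) (\<lambda>b. b) (dl g)) = ep g \<bullet> un"
      "\<And>g. g \<in> J \<Longrightarrow> hmult A (tens_map X X (\<lambda>b. b) (\<lambda>a. \<Sum>g\<in>J. a (enc g) \<bullet> s g) (dl g)) = ep g \<bullet> un"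
  shows "fd_hopf_algebra A"
proof -
  define S where "S a = (\<Sum>g\<in>J. a (enc g) \<bullet> s g)" for a :: "'i \<Rightarrow> 'k"
  have Sl: "linear_map X X S"
    unfolding S_def by (rule linear_mapI) (auto simp: s_closed sum.distrib smul_sum smul_apply)
  have tm: "tens_map X X f k t \<in> fspace (X \<times> X)" if "\<And>a. a \<in> fspace X \<Longrightarrow> f a \<in> fspace X" "\<And>a. a \<in> fspace X \<Longrightarrow> k a \<in> fspace X" for f k t
    unfolding tens_map_apply by (intro fspace_sum fspace_closed that) auto
  have assoc': "a \<star> c \<star> d = a \<star> (c \<star> d)" if a: "a \<in> fspace X" and c: "c \<in> fspace X" and d: "d \<in> fspace X" for a c d
  proof (rule b_ext[of "\<lambda>a. a \<star> c \<star> d" "\<lambda>a. a \<star> (c \<star> d)", OF _ _ _ _ _ a])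
    fix g assume g: "g \<in> J"
    show "b g \<star> c \<star> d = b g \<star> (c \<star> d)"
    proof (rule b_ext[of "\<lambda>c. b g \<star> c \<star> d" "\<lambda>c. b g \<star> (c \<star> d)", OF _ _ _ _ _ c])
      fix h assume h: "h \<in> J"
      show "b g \<star> b h \<star> d = b g \<star> (b h \<star> d)"
        by (rule b_ext[of "\<lambda>d. b g \<star> b h \<star> d" "\<lambda>d. b g \<star> (b h \<star> d)", OF _ _ _ _ _ d]) (simp_all add: mul_b assoc g h)
    qed simp_all
  qed simp_all
  have alg: "fd_algebra A"
  proof
    show "hunit A \<in> hspace A" by (simp add: hspace_def)
    show "linear_map (index A \<times> index A) (index A) (hmult A)" by (rule mult_lin)
    fix a c d assume "a \<in> hspace A" "c \<in> hspace A" "d \<in> hspace A"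
    then show "hmult A (hmult A (a \<otimes>\<^sub>k c) \<otimes>\<^sub>k d) = hmult A (a \<otimes>\<^sub>k hmult A (c \<otimes>\<^sub>k d))"
      by (simp add: hspace_def hmult_mul assoc')
  next
    fix a assume "a \<in> hspace A"
    then have a: "a \<in> fspace X" by (simp add: hspace_def)
    have "un \<star> a = a" by (rule b_ext[of "\<lambda>a. un \<star> a" "\<lambda>a. a", OF _ _ _ _ _ a]) (simp_all add: unit)
    then show "hmult A (hunit A \<otimes>\<^sub>k a) = a" using a by (simp add: hmult_mul)
    have "a \<star> un = a" by (rule b_ext[of "\<lambda>a. a \<star> un" "\<lambda>a. a", OF _ _ _ _ _ a]) (simp_all add: unit)
    then show "hmult A (a \<otimes>\<^sub>k hunit A) = a" using a by (simp add: hmult_mul)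
  qed simp
  have coalg: "fd_coalgebra A"
  proof
    show "linear_map (index A) (index A \<times> index A) (hcomult A)" by (rule comult_lin)
    show "linear_form (index A) (hcounit A)" by (rule counit_lin)
    fix a assume "a \<in> hspace A"
    then have a: "a \<in> fspace X" by (simp add: hspace_def)
    show "tens_assoc (tens_map (index A) (index A) (hcomult A) (\<lambda>b. b) (hcomult A a)) = tens_map (index A) (index A) (\<lambda>b. b) (hcomult A) (hcomult A a)"
      unfolding A_simps
      by (rule b_ext[of "\<lambda>a. tens_assoc (tens_map X X (hcomult A) (\<lambda>b. b) (hcomult A a))" "\<lambda>a. tens_map X X (\<lambda>b. b) (hcomult A) (hcomult A a)", OF _ _ _ _ _ a])
        (simp_all add: hcomult_b coassoc)
    have "slice_left X (\<lambda>i. hcounit A (basis_vec i)) (hcomult A a) = a"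
      by (rule b_ext[of "\<lambda>a. slice_left X (\<lambda>i. hcounit A (basis_vec i)) (hcomult A a)" "\<lambda>a. a", OF _ _ _ _ _ a]) (simp_all add: hcomult_b counit)
    then show "(\<lambda>j. \<Sum>i\<in>index A. hcounit A (basis_vec i) * hcomult A a (i, j)) = a" by (simp add: slice_left_def)
    have "slice_right X (\<lambda>i. hcounit A (basis_vec i)) (hcomult A a) = a"
      by (rule b_ext[of "\<lambda>a. slice_right X (\<lambda>i. hcounit A (basis_vec i)) (hcomult A a)" "\<lambda>a. a", OF _ _ _ _ _ a]) (simp_all add: hcomult_b counit)
    then show "(\<lambda>i. \<Sum>j\<in>index A. hcomult A a (i, j) * hcounit A (basis_vec j)) = a" by (simp add: slice_right_def)
  qed simp
  interpret fd_algebra A by (rule alg)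
  interpret fd_coalgebra A by (rule coalg)
  show ?thesis
  proof
    fix a c assume "a \<in> hspace A" "c \<in> hspace A"
    then have a: "a \<in> fspace X" and c: "c \<in> fspace X" by (simp_all add: hspace_def)
    have "hcomult A (a \<star> c) = hmul2 A (hcomult A a) (hcomult A c)"
    proof (rule b_ext[of "\<lambda>a. hcomult A (a \<star> c)" "\<lambda>a. hmul2 A (hcomult A a) (hcomult A c)", OF _ _ _ _ _ a])
      fix g assume g: "g \<in> J"
      show "hcomult A (b g \<star> c) = hmul2 A (hcomult A (b g)) (hcomult A c)"
        by (rule b_ext[of "\<lambda>c. hcomult A (b g \<star> c)" "\<lambda>c. hmul2 A (hcomult A (b g)) (hcomult A c)", OF _ _ _ _ _ c])
          (simp_all add: mul_b hcomult_b mult g)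
    qed simp_all
    then show "hcomult A (hmult A (a \<otimes>\<^sub>k c)) = tens_map (index A \<times> index A) (index A \<times> index A) (hmult A) (hmult A) (tens_mid_flip (hcomult A a \<otimes>\<^sub>k hcomult A c))"
      using a c by (simp add: hmult_mul hmul2_def)
    \<comment> \<open>Scalars are again viewed as functions on the one-point type, to fit
      \<open>b_ext\<close>.\<close>
    have "(\<lambda>_::unit. hcounit A (a \<star> c)) = (\<lambda>_. hcounit A a * hcounit A c)"
    proof (rule b_ext[of "\<lambda>a (_::unit). hcounit A (a \<star> c)" "\<lambda>a _. hcounit A a * hcounit A c", OF _ _ _ _ _ a])
      fix g assume g: "g \<in> J"
      show "(\<lambda>_::unit. hcounit A (b g \<star> c)) = (\<lambda>_. hcounit A (b g) * hcounit A c)"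
        by (rule b_ext[of "\<lambda>c (_::unit). hcounit A (b g \<star> c)" "\<lambda>c _. hcounit A (b g) * hcounit A c", OF _ _ _ _ _ c])
          (simp_all add: mul_b hcounit_b counit_mt g fun_eq_iff smul_apply algebra_simps)
    qed (simp_all add: fun_eq_iff smul_apply algebra_simps)
    then show "hcounit A (hmult A (a \<otimes>\<^sub>k c)) = hcounit A a * hcounit A c" using a c by (simp add: hmult_mul fun_eq_iff)
  next
    show "hcomult A (hunit A) = hunit A \<otimes>\<^sub>k hunit A" "hcounit A (hunit A) = 1" by (simp_all add: comult_un counit_un)
    have "hmult A (tens_map X X S (\<lambda>b. b) (hcomult A a)) = hcounit A a \<bullet> un" "hmult A (tens_map X X (\<lambda>b. b) S (hcomult A a)) = hcounit A a \<bullet> un"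
      if a: "a \<in> fspace X" for a
    proof -
      note [simp] = linear_mapD(2,3)[OF mult_lin, simplified] tm linear_mapD(1)[OF Sl]
      show "hmult A (tens_map X X S (\<lambda>b. b) (hcomult A a)) = hcounit A a \<bullet> un"
        by (rule b_ext[of "\<lambda>a. hmult A (tens_map X X S (\<lambda>b. b) (hcomult A a))" "\<lambda>a. hcounit A a \<bullet> un", OF _ _ _ _ _ a])
          (simp_all add: hcomult_b hcounit_b anti[folded S_def])
      show "hmult A (tens_map X X (\<lambda>b. b) S (hcomult A a)) = hcounit A a \<bullet> un"
        by (rule b_ext[of "\<lambda>a. hmult A (tens_map X X (\<lambda>b. b) S (hcomult A a))" "\<lambda>a. hcounit A a \<bullet> un", OF _ _ _ _ _ a])
          (simp_all add: hcomult_b hcounit_b anti[folded S_def])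
    qed
    then show "\<exists>S. is_antipode A S"
      by (intro exI[of _ S]) (simp add: is_antipode_def Sl hspace_def smul_def)
  qed
qed

end

section \<open>The models\<close>

definition ad :: "nat \<Rightarrow> int \<times> int \<Rightarrow> int \<times> int \<Rightarrow> int \<times> int" where
  "ad p x y = ((fst x + fst y) mod int p, (snd x + snd y) mod int p)"

text \<open>Differences are used because the legs of the coproduct at \<open>x\<close> are labelled
  by \<open>w\<close> and by \<open>x\<close> minus \<open>w\<close>.\<close>

definition sb :: "nat \<Rightarrow> int \<times> int \<Rightarrow> int \<times> int \<Rightarrow> int \<times> int" where
  "sb p x y = ((fst x - fst y) mod int p, (snd x - snd y) mod int p)"

text \<open>\<open>basis_vec (to_nat (x, n))\<close> plays the role of \<open>e x\<close> times the \<open>n\<close>-th power of \<open>u\<close>; \<open>ac n\<close> is the conjugation action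
  and \<open>cf n\<close> the cocycle of that power.\<close>

locale model_data = odd_data p m \<gamma> \<omega> for p m :: nat and \<gamma> :: int and \<omega> :: "'k::{alg_closed_field, field_char_0}" +
  fixes i j :: nat
  assumes nd: "\<not> m dvd i + j"
begin

abbreviation H where "H \<equiv> carrier G"

abbreviation add (infixl \<open>\<oplus>\<^sub>p\<close> 65) where "x \<oplus>\<^sub>p y \<equiv> ad p x y"
abbreviation sub (infixl \<open>\<ominus>\<^sub>p\<close> 65) where "x \<ominus>\<^sub>p y \<equiv> sb p x y"

definition ac where "ac n = diag_act p \<gamma> (i * n) (j * n)"

text \<open>Exponent obtained by multiplying the bicharacter over the first \<open>n\<close> points
  of an orbit, where the two coordinates involved are scaled by \<gamma>^i and \<gamma>^j.\<close>

definition N :: "nat \<Rightarrow> int" where "N n = (\<Sum>k<n. \<gamma> ^ ((i + j) * k))"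

definition cf :: "nat \<Rightarrow> int \<times> int \<Rightarrow> int \<times> int \<Rightarrow> 'k" where "cf n w z = cpow p \<omega> (N n * (snd w * fst z))"

lemma m_gt_1: "m > 1" using nd m0 by (cases "m = 1") auto

lemma H_closed [simp]: "ac n x \<in> H" "x \<oplus>\<^sub>p y \<in> H" "x \<ominus>\<^sub>p y \<in> H" "(0, 0) \<in> H"
  unfolding carrier_G by (simp_all add: ac_def diag_act_def ad_def sb_def)

lemma finH [simp]: "finite H" by (simp add: carrier_integer_mod_group)

lemma sub_simps [simp]:
  "x \<in> H \<Longrightarrow> x \<ominus>\<^sub>p (0, 0) = x" "x \<ominus>\<^sub>p x = (0, 0)"
  "z \<in> H \<Longrightarrow> (z \<oplus>\<^sub>p w) \<ominus>\<^sub>p w = z" "x \<in> H \<Longrightarrow> (x \<ominus>\<^sub>p w) \<oplus>\<^sub>p w = x"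
  "w \<in> H \<Longrightarrow> x \<ominus>\<^sub>p (x \<ominus>\<^sub>p w) = w" "x \<ominus>\<^sub>p (z \<oplus>\<^sub>p w) = x \<ominus>\<^sub>p w \<ominus>\<^sub>p z"
  "x \<in> H \<Longrightarrow> (0, 0) \<oplus>\<^sub>p x = x"
proof -
  have "(a - (b + c) mod int p) mod int p = ((a - c) mod int p - b) mod int p" for a b c
    unfolding mod_diff_left_eq mod_diff_right_eq by (rule arg_cong[of _ _ "\<lambda>t. t mod int p"]) linarith
  then show "x \<ominus>\<^sub>p (z \<oplus>\<^sub>p w) = x \<ominus>\<^sub>p w \<ominus>\<^sub>p z"
    unfolding ad_def sb_def fst_conv snd_conv prod.inject by blast
qed (simp_all add: carrier_G ad_def sb_def mod_diff_left_eq mod_diff_right_eq mod_add_left_eq prod_eq_iff del: carrier_DirProd)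

lemma sub_eq_iff:
  assumes "x \<in> H" "y \<in> H" "w \<in> H"
  shows "x \<ominus>\<^sub>p w = y \<ominus>\<^sub>p w \<longleftrightarrow> x = y" "x \<ominus>\<^sub>p w = (0, 0) \<longleftrightarrow> x = w" "(0, 0) = x \<ominus>\<^sub>p w \<longleftrightarrow> x = w"
proof -
  have 1: "x \<ominus>\<^sub>p w = y \<ominus>\<^sub>p w \<longleftrightarrow> x = y" if "x \<in> H" "y \<in> H" for x y
    using sub_simps(4)[OF that(1), of w] sub_simps(4)[OF that(2), of w] by metis
  show "x \<ominus>\<^sub>p w = y \<ominus>\<^sub>p w \<longleftrightarrow> x = y" by (rule 1[OF assms(1,2)])
  show "x \<ominus>\<^sub>p w = (0, 0) \<longleftrightarrow> x = w"
    using 1[OF assms(1,3)] sub_simps(2)[of w] by simp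
  then show "(0, 0) = x \<ominus>\<^sub>p w \<longleftrightarrow> x = w" by (simp only: eq_commute[of "(0, 0)"])
qed

lemma ac_ac [simp]: "ac n (ac k x) = ac (n + k) x"
  by (simp add: ac_def diag_act_def mod_simps power_add algebra_simps)

lemma ac_mod: "ac (n mod m) x = ac n x"
proof -
  have "[\<gamma> ^ (t * (n mod m)) = \<gamma> ^ (t * n)] (mod int p)" for t
    unfolding \<gamma>_power_cong by (intro cong_mult cong_refl) (simp add: cong_def)
  then have "[\<gamma> ^ (t * (n mod m)) * z = \<gamma> ^ (t * n) * z] (mod int p)" for t z by (intro cong_mult cong_refl)
  then show ?thesis by (simp add: ac_def diag_act_def cong_def)
qed

lemma ac_0 [simp]: "x \<in> H \<Longrightarrow> ac 0 x = x"
  unfolding carrier_G by (simp add: ac_def diag_act_def)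

lemma ac_zero [simp]: "ac n (0, 0) = (0, 0)"
  by (simp add: ac_def diag_act_def)

lemma ac_sub: "ac n (x \<ominus>\<^sub>p y) = ac n x \<ominus>\<^sub>p ac n y"
  by (simp add: ac_def diag_act_def sb_def mod_simps algebra_simps)

text \<open>The degree of the inverse of u^n; the additional reduction modulo \<open>m\<close>
  matters for \<open>n = 0\<close>, where \<open>m - n\<close> is not a valid degree.\<close>

lemma ac_inv: "x \<in> H \<Longrightarrow> n \<le> m \<Longrightarrow> ac ((m - n) mod m + n) x = x" "x \<in> H \<Longrightarrow> n \<le> m \<Longrightarrow> ac (n + (m - n) mod m) x = x"
proof -
  assume x: "x \<in> H" "n \<le> m"
  have "((m - n) mod m + n) mod m = 0" using x by (simp add: mod_simps)
  then show "ac ((m - n) mod m + n) x = x" using x ac_mod[of "(m - n) mod m + n" x] by simp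
  then show "ac (n + (m - n) mod m) x = x" by (simp add: add.commute)
qed

lemma ac_eq_iff: "x \<in> H \<Longrightarrow> y \<in> H \<Longrightarrow> ac n x = ac n y \<longleftrightarrow> x = y"
proof
  assume xy: "x \<in> H" "y \<in> H" "ac n x = ac n y"
  have "ac (n mod m) x = ac (n mod m) y" using xy by (simp add: ac_mod)
  then have "ac (m - n mod m) (ac (n mod m) x) = ac (m - n mod m) (ac (n mod m) y)" by simp
  then have "ac m x = ac m y" using m0 by simp
  then show "x = y" using xy ac_mod[of m x] ac_mod[of m y] by simp
qed simp

lemma \<omega>_nz: "\<omega> \<noteq> 0" using \<omega> by (auto simp: zero_power)

lemma cf_nz [simp]: "cf n w z \<noteq> 0" by (simp add: cf_def cpow_def \<omega>_nz)

lemma cf_simps [simp]: "cf n (0, 0) z = 1" "cf n w (0, 0) = 1" "cf 0 w z = 1"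
  by (simp_all add: cf_def N_def)

lemma cf_add: "cf n (z \<oplus>\<^sub>p w) v = cf n z v * cf n w v"
  unfolding cf_def cpow_add[OF \<omega>(2) p_pos, symmetric]
proof (rule cpow_cong)
  have "(N n * (((snd z + snd w) mod int p) * fst v)) mod int p = (N n * ((snd z + snd w) * fst v)) mod int p"
    by (metis mod_mult_left_eq mod_mult_right_eq)
  then show "(N n * (snd (z \<oplus>\<^sub>p w) * fst v)) mod int p = (N n * (snd z * fst v) + N n * (snd w * fst v)) mod int p"
    by (simp add: ad_def algebra_simps)
qed

lemma cf_sub_right: "cf n w (x \<ominus>\<^sub>p y) * cf n w y = cf n w x"
  unfolding cf_def cpow_add[OF \<omega>(2) p_pos, symmetric]
proof (rule cpow_cong)
  have "(N n * (snd w * ((fst x - fst y) mod int p))) mod int p = (N n * (snd w * (fst x - fst y))) mod int p"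
    by (metis mod_mult_right_eq)
  then have "(N n * (snd w * ((fst x - fst y) mod int p)) + N n * (snd w * fst y)) mod int p = (N n * (snd w * (fst x - fst y)) + N n * (snd w * fst y)) mod int p"
    by (rule mod_add_cong) simp
  then show "(N n * (snd w * fst (x \<ominus>\<^sub>p y)) + N n * (snd w * fst y)) mod int p = (N n * (snd w * fst x)) mod int p"
    by (simp add: sb_def algebra_simps)
qed

lemma N_add: "N (n + k) = N n + \<gamma> ^ ((i + j) * n) * N k"
  by (induction k) (simp_all add: N_def power_add algebra_simps)

text \<open>This is the consistency of u^m = 1. By \<open>nd\<close> the sum \<open>N m\<close>
  vanishes modulo p, so the cocycle of u^n depends only on the residue of n.\<close>

lemma cf_mod: "cf (n mod m) w z = cf n w z"
proof -
  have m: "int p dvd N m" using sum_pow_dvd[OF nd] by (simp add: N_def)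
  have km: "int p dvd N (m * k)" for k
  proof (induction k)
    case (Suc k)
    then show ?case using m by (simp add: N_add)
  qed (simp add: N_def)
  have "N n = N (m * (n div m)) + \<gamma> ^ ((i + j) * (m * (n div m))) * N (n mod m)"
    using N_add[of "m * (n div m)" "n mod m"] by simp
  moreover have "[N (m * (n div m)) + \<gamma> ^ ((i + j) * (m * (n div m))) * N (n mod m) = 0 + 1 * N (n mod m)] (mod int p)"
  proof (intro cong_add cong_mult cong_refl)
    show "[N (m * (n div m)) = 0] (mod int p)" using km by (simp add: cong_0_iff)
    show "[\<gamma> ^ ((i + j) * (m * (n div m))) = 1] (mod int p)" using \<gamma>_power_cong[of "(i + j) * (m * (n div m))" 0] by (simp add: cong_0_iff)
  qed
  ultimately have "[N n = N (n mod m)] (mod int p)" by simp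
  then have "[N n * (snd w * fst z) = N (n mod m) * (snd w * fst z)] (mod int p)" by (intro cong_mult cong_refl)
  then show ?thesis unfolding cf_def by (intro cpow_cong) (simp add: cong_def)
qed

text \<open>Relates the cocycles of u^n, u^k and u^(n+k), which is what compatibility of product and
  coproduct amounts to on basis vectors.\<close>

lemma cf_ac: "cf n w z * cf k (ac n w) (ac n z) = cf ((n + k) mod m) w z"
  unfolding cf_mod unfolding cf_def cpow_add[OF \<omega>(2) p_pos, symmetric]
proof (rule cpow_cong)
  have "[N k * ((\<gamma> ^ (j * n) * snd w mod int p) * (\<gamma> ^ (i * n) * fst z mod int p)) = N k * ((\<gamma> ^ (j * n) * snd w) * (\<gamma> ^ (i * n) * fst z))] (mod int p)"
    by (intro cong_mult cong_refl) (simp_all add: cong_def)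
  then have "[N n * (snd w * fst z) + N k * (snd (ac n w) * fst (ac n z)) = N n * (snd w * fst z) + N k * ((\<gamma> ^ (j * n) * snd w) * (\<gamma> ^ (i * n) * fst z))] (mod int p)"
    by (intro cong_add cong_refl) (simp add: ac_def diag_act_def)
  then show "(N n * (snd w * fst z) + N k * (snd (ac n w) * fst (ac n z))) mod int p = (N (n + k) * (snd w * fst z)) mod int p"
    unfolding N_add by (simp add: cong_def power_add algebra_simps)
qed

lemma sum_sub: 
  assumes "x \<in> H" shows "(\<Sum>w\<in>H. f (x \<ominus>\<^sub>p w)) = (\<Sum>w\<in>H. f w)"
  by (rule sum.reindex_bij_witness[of _ "\<lambda>w. x \<ominus>\<^sub>p w" "\<lambda>w. x \<ominus>\<^sub>p w"]) (use assms in \<open>simp_all del: carrier_DirProd\<close>)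

lemma sum_shift_right: "w \<in> H \<Longrightarrow> (\<Sum>x\<in>H. f x (x \<ominus>\<^sub>p w)) = (\<Sum>z\<in>H. f (z \<oplus>\<^sub>p w) z)"
  by (rule sum.reindex_bij_witness[of _ "\<lambda>z. z \<oplus>\<^sub>p w" "\<lambda>x. x \<ominus>\<^sub>p w"]) (simp_all del: carrier_DirProd)

definition J :: "((int \<times> int) \<times> nat) set" where "J = H \<times> {..<m}"

abbreviation bb :: "int \<times> int \<Rightarrow> nat \<Rightarrow> nat \<Rightarrow> 'k" where "bb x n \<equiv> basis_vec (to_nat (x, n))"

definition mt :: "(int \<times> int) \<times> nat \<Rightarrow> (int \<times> int) \<times> nat \<Rightarrow> nat \<Rightarrow> 'k" where
  "mt g h = (if fst h = ac (snd g) (fst g) then bb (fst g) ((snd g + snd h) mod m) else 0)"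

definition un :: "nat \<Rightarrow> 'k" where "un = (\<Sum>x\<in>H. bb x 0)"

definition dl :: "(int \<times> int) \<times> nat \<Rightarrow> nat \<times> nat \<Rightarrow> 'k" where
  "dl g = (\<Sum>w\<in>H. cf (snd g) w (fst g \<ominus>\<^sub>p w) \<bullet> (bb w (snd g) \<otimes>\<^sub>k bb (fst g \<ominus>\<^sub>p w) (snd g)))"

definition ep :: "(int \<times> int) \<times> nat \<Rightarrow> 'k" where "ep g = (if fst g = (0, 0) then 1 else 0)"

lemma in_J: "(x, n) \<in> J \<longleftrightarrow> x \<in> H \<and> n < m"
  by (auto simp: J_def simp del: carrier_DirProd)

lemma bb_closed [simp]: "x \<in> H \<Longrightarrow> n < m \<Longrightarrow> bb x n \<in> fspace (to_nat ` J)"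
  by (intro fspace_closed(5) imageI) (simp add: in_J del: carrier_DirProd)

sublocale B: basis_data J to_nat mt un dl ep
proof
  show "finite J" by (simp add: J_def del: carrier_DirProd)
  show "inj_on to_nat J" by simp
  show "un \<in> fspace (to_nat ` J)" unfolding un_def by (intro fspace_sum) (use m0 in \<open>simp del: carrier_DirProd\<close>)
  fix g h assume "g \<in> J"
  then have g: "fst g \<in> H" "snd g < m" by (auto simp: J_def simp del: carrier_DirProd)
  then show "mt g h \<in> fspace (to_nat ` J)" by (simp add: mt_def del: carrier_DirProd)
  show "dl g \<in> fspace (to_nat ` J \<times> to_nat ` J)"
    unfolding dl_def by (intro fspace_sum fspace_closed) (use g in \<open>simp_all add: in_J del: carrier_DirProd\<close>)
qed

abbreviation model where "model \<equiv> B.A"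

lemma bb_mul: "x \<in> H \<Longrightarrow> n < m \<Longrightarrow> y \<in> H \<Longrightarrow> k < m \<Longrightarrow> B.mul (bb x n) (bb y k) = (if y = ac n x then bb x ((n + k) mod m) else 0)"
  using B.mul_b[of "(x, n)" "(y, k)"] by (simp add: in_J mt_def del: carrier_DirProd)

lemma D_bb: "x \<in> H \<Longrightarrow> n < m \<Longrightarrow> hcomult model (bb x n) = (\<Sum>w\<in>H. cf n w (x \<ominus>\<^sub>p w) \<bullet> (bb w n \<otimes>\<^sub>k bb (x \<ominus>\<^sub>p w) n))"
  using B.hcomult_b[of "(x, n)"] by (simp add: in_J dl_def del: carrier_DirProd)

lemma eps_bb: "x \<in> H \<Longrightarrow> n < m \<Longrightarrow> hcounit model (bb x n) = (if x = (0, 0) then 1 else 0)"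
  using B.hcounit_b[of "(x, n)"] by (simp add: in_J ep_def del: carrier_DirProd)

lemma tens_map_bb: "x \<in> H \<Longrightarrow> n < m \<Longrightarrow> y \<in> H \<Longrightarrow> k < m \<Longrightarrow> tens_map (to_nat ` J) (to_nat ` J) f g (bb x n \<otimes>\<^sub>k bb y k) = f (bb x n) \<otimes>\<^sub>k g (bb y k)"
  using B.tens_map_b[of "(x, n)" "(y, k)" f g] by (simp add: in_J del: carrier_DirProd)

lemma un_mul: "B.mul un a = (\<Sum>x\<in>H. B.mul (bb x 0) a)" "B.mul a un = (\<Sum>x\<in>H. B.mul a (bb x 0))"
  unfolding B.mul_sum_left[of "\<lambda>x. bb x 0" H a, symmetric] B.mul_sum_right[of a "\<lambda>x. bb x 0" H, symmetric]
  by (simp_all only: un_def[symmetric])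

lemma comult_un: "hcomult model un = (\<Sum>x\<in>H. hcomult model (bb x 0))"
proof -
  have "hcomult model (\<Sum>x\<in>H. bb x 0) = (\<Sum>x\<in>H. hcomult model (bb x 0))"
    by (rule B.comult_sum) (use m0 in \<open>simp del: carrier_DirProd\<close>)
  then show ?thesis by (simp only: un_def[symmetric])
qed

lemma counit_un: "hcounit model un = (\<Sum>x\<in>H. hcounit model (bb x 0))"
proof -
  have "hcounit model (\<Sum>x\<in>H. bb x 0) = (\<Sum>x\<in>H. hcounit model (bb x 0))"
    by (rule B.counit_sum) (use m0 in \<open>simp del: carrier_DirProd\<close>)
  then show ?thesis by (simp only: un_def[symmetric])
qed

text \<open>The antipode on the basis, found by solving its equation term by term: the scalar
  cancels the coefficient of the legs w and -w, and \<open>ac\<close> makes the idempotents match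
  after inverting the power of u.\<close>

definition sg :: "(int \<times> int) \<times> nat \<Rightarrow> nat \<Rightarrow> 'k" where
  "sg g = (1 / cf (snd g) (fst g) ((0, 0) \<ominus>\<^sub>p fst g)) \<bullet> bb (ac (snd g) ((0, 0) \<ominus>\<^sub>p fst g)) ((m - snd g) mod m)"

theorem model_hopf: "fd_hopf_algebra model"
proof (rule B.hopf_algebra[of sg])
  note [simp del] = carrier_DirProd
  have m1: "0 < m" by (rule m0)
  define S where "S a = (\<Sum>g\<in>J. a (to_nat g) \<bullet> sg g)" for a :: "nat \<Rightarrow> 'k"
  have S_eq: "(\<lambda>a. \<Sum>g\<in>J. a (to_nat g) \<bullet> sg g) = S" by (rule ext) (simp add: S_def)
  have S_bb: "S (bb x n) = sg (x, n)" if "x \<in> H" "n < m" for x n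
  proof -
    have "S (bb x n) = (\<Sum>g\<in>J. if g = (x, n) then sg (x, n) else 0)"
      unfolding S_def by (intro sum.cong refl) (auto simp: basis_vec_def)
    then show ?thesis using that B.finJ by (simp add: in_J)
  qed
  have sg_closed: "sg (x, n) \<in> fspace (to_nat ` J)" if "x \<in> H" "n < m" for x n
    using that m1 by (simp add: sg_def)
  fix g assume g0: "g \<in> J"
  obtain x n where g: "g = (x, n)" "x \<in> H" "n < m" using g0 by (cases g) (auto simp: in_J)
  show "sg g \<in> fspace (to_nat ` J)" using g sg_closed by simp
  show "B.mul un (B.b g) = B.b g"
  proof -
    have "B.mul un (bb x n) = (\<Sum>y\<in>H. if y = x then bb x n else 0)"
      unfolding un_mul by (intro sum.cong refl) (use g m1 in \<open>auto simp: bb_mul\<close>)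
    then show ?thesis using g by simp
  qed
  show "B.mul (B.b g) un = B.b g"
  proof -
    have "B.mul (bb x n) un = (\<Sum>y\<in>H. if y = ac n x then bb x n else 0)"
      unfolding un_mul by (intro sum.cong refl) (use g m1 in \<open>auto simp: bb_mul\<close>)
    then show ?thesis using g by simp
  qed
  show "tens_assoc (tens_map (to_nat ` J) (to_nat ` J) (hcomult model) (\<lambda>b. b) (dl g)) = tens_map (to_nat ` J) (to_nat ` J) (\<lambda>b. b) (hcomult model) (dl g)"
  proof -
    have "tens_assoc (tens_map (to_nat ` J) (to_nat ` J) (hcomult model) (\<lambda>b. b) (dl g))
      = (\<Sum>y\<in>H. \<Sum>w\<in>H. (cf n y (x \<ominus>\<^sub>p y) * cf n w (y \<ominus>\<^sub>p w)) \<bullet> (bb w n \<otimes>\<^sub>k (bb (y \<ominus>\<^sub>p w) n \<otimes>\<^sub>k bb (x \<ominus>\<^sub>p y) n)))"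
      using g by (simp add: dl_def tens_map_sum tens_map_bb D_bb B.tens_assoc_sum tens_sum_left smul_sum)
    also have "\<dots> = (\<Sum>w\<in>H. \<Sum>y\<in>H. (cf n y (x \<ominus>\<^sub>p y) * cf n w (y \<ominus>\<^sub>p w)) \<bullet> (bb w n \<otimes>\<^sub>k (bb (y \<ominus>\<^sub>p w) n \<otimes>\<^sub>k bb (x \<ominus>\<^sub>p y) n)))"
      by (rule sum.swap)
    also have "\<dots> = (\<Sum>w\<in>H. \<Sum>z\<in>H. (cf n w (x \<ominus>\<^sub>p w) * cf n z (x \<ominus>\<^sub>p w \<ominus>\<^sub>p z)) \<bullet> (bb w n \<otimes>\<^sub>k (bb z n \<otimes>\<^sub>k bb (x \<ominus>\<^sub>p w \<ominus>\<^sub>p z) n)))"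
    proof (rule sum.cong[OF refl])
      fix w assume w: "w \<in> H"
      have "(\<Sum>y\<in>H. (cf n y (x \<ominus>\<^sub>p y) * cf n w (y \<ominus>\<^sub>p w)) \<bullet> (bb w n \<otimes>\<^sub>k (bb (y \<ominus>\<^sub>p w) n \<otimes>\<^sub>k bb (x \<ominus>\<^sub>p y) n)))
        = (\<Sum>z\<in>H. (cf n (z \<oplus>\<^sub>p w) (x \<ominus>\<^sub>p (z \<oplus>\<^sub>p w)) * cf n w z) \<bullet> (bb w n \<otimes>\<^sub>k (bb z n \<otimes>\<^sub>k bb (x \<ominus>\<^sub>p (z \<oplus>\<^sub>p w)) n)))"
        by (rule sum_shift_right[OF w, of "\<lambda>y z. (cf n y (x \<ominus>\<^sub>p y) * cf n w z) \<bullet> (bb w n \<otimes>\<^sub>k (bb z n \<otimes>\<^sub>k bb (x \<ominus>\<^sub>p y) n))"])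
      also have "\<dots> = (\<Sum>z\<in>H. (cf n w (x \<ominus>\<^sub>p w) * cf n z (x \<ominus>\<^sub>p w \<ominus>\<^sub>p z)) \<bullet> (bb w n \<otimes>\<^sub>k (bb z n \<otimes>\<^sub>k bb (x \<ominus>\<^sub>p w \<ominus>\<^sub>p z) n)))"
      proof (rule sum.cong[OF refl])
        fix z assume z: "z \<in> H"
        \<comment> \<open>Coassociativity reduces to multiplicativity of \<open>cf n\<close> in each
          argument.\<close>
        have "cf n (z \<oplus>\<^sub>p w) (x \<ominus>\<^sub>p (z \<oplus>\<^sub>p w)) * cf n w z = cf n w (x \<ominus>\<^sub>p w) * cf n z (x \<ominus>\<^sub>p w \<ominus>\<^sub>p z)"
          unfolding sub_simps(6) cf_add mult.assoc cf_sub_right by (rule mult.commute)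
        then show "(cf n (z \<oplus>\<^sub>p w) (x \<ominus>\<^sub>p (z \<oplus>\<^sub>p w)) * cf n w z) \<bullet> (bb w n \<otimes>\<^sub>k (bb z n \<otimes>\<^sub>k bb (x \<ominus>\<^sub>p (z \<oplus>\<^sub>p w)) n))
          = (cf n w (x \<ominus>\<^sub>p w) * cf n z (x \<ominus>\<^sub>p w \<ominus>\<^sub>p z)) \<bullet> (bb w n \<otimes>\<^sub>k (bb z n \<otimes>\<^sub>k bb (x \<ominus>\<^sub>p w \<ominus>\<^sub>p z) n))"
          by (simp only: sub_simps(6))
      qed
      finally show "(\<Sum>y\<in>H. (cf n y (x \<ominus>\<^sub>p y) * cf n w (y \<ominus>\<^sub>p w)) \<bullet> (bb w n \<otimes>\<^sub>k (bb (y \<ominus>\<^sub>p w) n \<otimes>\<^sub>k bb (x \<ominus>\<^sub>p y) n)))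
        = (\<Sum>z\<in>H. (cf n w (x \<ominus>\<^sub>p w) * cf n z (x \<ominus>\<^sub>p w \<ominus>\<^sub>p z)) \<bullet> (bb w n \<otimes>\<^sub>k (bb z n \<otimes>\<^sub>k bb (x \<ominus>\<^sub>p w \<ominus>\<^sub>p z) n)))" .
    qed
    also have "\<dots> = tens_map (to_nat ` J) (to_nat ` J) (\<lambda>b. b) (hcomult model) (dl g)"
      using g by (simp add: dl_def tens_map_sum tens_map_bb D_bb tens_sum_right smul_sum)
    finally show ?thesis .
  qed
  let ?\<phi> = "\<lambda>i. hcounit model (basis_vec i)"
  have pair: "pairing (to_nat ` J) ?\<phi> (bb y n) = (if y = (0, 0) then 1 else 0)" if "y \<in> H" for y
    using that g B.finJ by (subst pairing_basis_vec) (simp_all add: in_J eps_bb)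
  have sl: "slice_left (to_nat ` J) \<phi> (dl g) = B.b g" "slice_right (to_nat ` J) \<phi> (dl g) = B.b g"
    if pair: "\<And>y. y \<in> H \<Longrightarrow> pairing (to_nat ` J) \<phi> (bb y n) = (if y = (0, 0) then 1 else 0)" for \<phi> :: "nat \<Rightarrow> 'k"
  proof -
    have "slice_left (to_nat ` J) \<phi> (dl g) = (\<Sum>w\<in>H. if w = (0, 0) then bb x n else 0)"
      unfolding dl_def slice_left_sum by (intro sum.cong refl) (use g in \<open>auto simp: pair\<close>)
    then show "slice_left (to_nat ` J) \<phi> (dl g) = B.b g" using g by simp
    have "slice_right (to_nat ` J) \<phi> (dl g) = (\<Sum>w\<in>H. if w = x then bb x n else 0)"
      unfolding dl_def slice_right_sum by (intro sum.cong refl) (use g in \<open>auto simp: pair sub_eq_iff\<close>)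
    then show "slice_right (to_nat ` J) \<phi> (dl g) = B.b g" using g by simp
  qed
  show "slice_left (to_nat ` J) ?\<phi> (dl g) = B.b g" "slice_right (to_nat ` J) ?\<phi> (dl g) = B.b g"
    by (rule sl[OF pair]; assumption)+
  have hm: "hmult model (\<Sum>w\<in>H. c w \<bullet> (f w \<otimes>\<^sub>k k w)) = (\<Sum>w\<in>H. c w \<bullet> B.mul (f w) (k w))"
    if "\<And>w. w \<in> H \<Longrightarrow> f w \<in> fspace (to_nat ` J)" "\<And>w. w \<in> H \<Longrightarrow> k w \<in> fspace (to_nat ` J)" for c f k
    using that by (simp add: linear_map_sum[OF B.mult_lin] linear_mapD(3)[OF B.mult_lin] B.hmult_mul)
  have neg: "x \<ominus>\<^sub>p w = (0, 0) \<ominus>\<^sub>p w \<longleftrightarrow> x = (0, 0)" if "w \<in> H" for w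
    using that g by (simp add: sub_eq_iff)
  show "hmult model (tens_map (to_nat ` J) (to_nat ` J) (\<lambda>a. \<Sum>g\<in>J. a (to_nat g) \<bullet> sg g) (\<lambda>b. b) (dl g)) = ep g \<bullet> un"
  proof -
    have "hmult model (tens_map (to_nat ` J) (to_nat ` J) S (\<lambda>b. b) (dl g)) = (\<Sum>w\<in>H. cf n w (x \<ominus>\<^sub>p w) \<bullet> B.mul (sg (w, n)) (bb (x \<ominus>\<^sub>p w) n))"
      using g by (simp add: dl_def tens_map_sum tens_map_bb S_bb hm sg_closed)
    also have "\<dots> = (\<Sum>w\<in>H. if x = (0, 0) then bb (ac n ((0, 0) \<ominus>\<^sub>p w)) 0 else 0)"
    proof (rule sum.cong[OF refl])
      fix w assume w: "w \<in> H"
      have "((m - n) mod m + n) mod m = 0" using g by (simp add: mod_simps)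
      then show "cf n w (x \<ominus>\<^sub>p w) \<bullet> B.mul (sg (w, n)) (bb (x \<ominus>\<^sub>p w) n) = (if x = (0, 0) then bb (ac n ((0, 0) \<ominus>\<^sub>p w)) 0 else 0)"
        using g w m1 neg[OF w] by (auto simp: sg_def bb_mul ac_inv)
    qed
    also have "\<dots> = (if x = (0, 0) then un else 0)"
    proof -
      have "(\<Sum>w\<in>H. bb (ac n ((0, 0) \<ominus>\<^sub>p w)) 0) = (\<Sum>w\<in>H. bb (ac n w) 0)" by (rule sum_sub[of "(0, 0)" "\<lambda>w. bb (ac n w) 0"]) simp
      also have "\<dots> = un" unfolding un_def
        by (rule sum.reindex_bij_witness[of _ "ac ((m - n) mod m)" "ac n"]) (use g in \<open>simp_all add: ac_inv\<close>)
      finally show ?thesis by simp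
    qed
    finally show ?thesis unfolding S_eq using g by (simp add: ep_def)
  qed
  show "hmult model (tens_map (to_nat ` J) (to_nat ` J) (\<lambda>b. b) (\<lambda>a. \<Sum>g\<in>J. a (to_nat g) \<bullet> sg g) (dl g)) = ep g \<bullet> un"
  proof -
    have "hmult model (tens_map (to_nat ` J) (to_nat ` J) (\<lambda>b. b) S (dl g)) = (\<Sum>w\<in>H. cf n w (x \<ominus>\<^sub>p w) \<bullet> B.mul (bb w n) (sg (x \<ominus>\<^sub>p w, n)))"
      using g by (simp add: dl_def tens_map_sum tens_map_bb S_bb hm sg_closed)
    also have "\<dots> = (\<Sum>w\<in>H. if x = (0, 0) then bb w 0 else 0)"
    proof (rule sum.cong[OF refl])
      fix w assume w: "w \<in> H"
      have mm: "(n + (m - n) mod m) mod m = 0" using g by (simp add: mod_simps)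
      \<comment> \<open>By bimultiplicativity both sides are inverse to
        \<open>cf n w w\<close>.\<close>
      have c: "cf n w ((0, 0) \<ominus>\<^sub>p w) = cf n ((0, 0) \<ominus>\<^sub>p w) w"
      proof -
        have "cf n w ((0, 0) \<ominus>\<^sub>p w) * cf n w w = 1" using cf_sub_right[of n w "(0, 0)" w] by simp
        moreover have "cf n ((0, 0) \<ominus>\<^sub>p w) w * cf n w w = 1" using cf_add[of n "(0, 0) \<ominus>\<^sub>p w" w w] by simp
        ultimately show ?thesis by (metis cf_nz mult_cancel_right)
      qed
      have e: "ac n ((0, 0) \<ominus>\<^sub>p (x \<ominus>\<^sub>p w)) = ac n w \<longleftrightarrow> x = (0, 0)"
      proof -
        have "ac n ((0, 0) \<ominus>\<^sub>p (x \<ominus>\<^sub>p w)) = ac n w \<longleftrightarrow> (0, 0) \<ominus>\<^sub>p (x \<ominus>\<^sub>p w) = w" using w by (simp add: ac_eq_iff)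
        also have "\<dots> \<longleftrightarrow> (0, 0) \<ominus>\<^sub>p (x \<ominus>\<^sub>p w) = (0, 0) \<ominus>\<^sub>p ((0, 0) \<ominus>\<^sub>p w)" using w by simp
        also have "\<dots> \<longleftrightarrow> x \<ominus>\<^sub>p w = (0, 0) \<ominus>\<^sub>p w" by (metis sub_simps(5) H_closed(3))
        finally show ?thesis using neg[OF w] by simp
      qed
      show "cf n w (x \<ominus>\<^sub>p w) \<bullet> B.mul (bb w n) (sg (x \<ominus>\<^sub>p w, n)) = (if x = (0, 0) then bb w 0 else 0)"
        using g w m1 mm by (auto simp: sg_def bb_mul e c)
    qed
    also have "\<dots> = (if x = (0, 0) then un else 0)" by (simp add: un_def)
    finally show ?thesis unfolding S_eq using g by (simp add: ep_def)
  qed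
  fix h assume h0: "h \<in> J"
  obtain y k where h: "h = (y, k)" "y \<in> H" "k < m" using h0 by (cases h) (auto simp: in_J)
  have nk: "(n + k) mod m < m" using m1 by simp
  show "hcounit model (mt g h) = ep g * ep h"
    using g h nk by (auto simp: mt_def ep_def eps_bb ac_eq_iff[of _ "(0, 0)", simplified])
  show "hcomult model (mt g h) = hmul2 model (dl g) (dl h)"
  proof -
    have "hmul2 model (dl g) (dl h) = (\<Sum>w\<in>H. \<Sum>v\<in>H. if v = ac n w then (if y = ac n x then cf ((n + k) mod m) w (x \<ominus>\<^sub>p w) \<bullet> (bb w ((n + k) mod m) \<otimes>\<^sub>k bb (x \<ominus>\<^sub>p w) ((n + k) mod m)) else 0) else 0)"
      unfolding dl_def[of g] dl_def[of h] B.hmul2_sum(1) unfolding B.hmul2_sum(2)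
    proof (intro sum.cong refl)
      fix w v assume wv: "w \<in> H" "v \<in> H"
      have e: "y \<ominus>\<^sub>p ac n w = ac n (x \<ominus>\<^sub>p w) \<longleftrightarrow> y = ac n x" using g h wv by (simp add: ac_sub sub_eq_iff)
      \<comment> \<open>The coefficient of a product of coproducts equals that of the coproduct of
        the product, by \<open>cf_ac\<close>.\<close>
      have c: "cf n w (x \<ominus>\<^sub>p w) * cf k (ac n w) (ac n x \<ominus>\<^sub>p ac n w) = cf ((n + k) mod m) w (x \<ominus>\<^sub>p w)"
        using cf_ac[of n w "x \<ominus>\<^sub>p w" k] by (simp add: ac_sub)
      have "hmul2 model (bb w n \<otimes>\<^sub>k bb (x \<ominus>\<^sub>p w) n) (bb v k \<otimes>\<^sub>k bb (y \<ominus>\<^sub>p v) k) = mt (w, n) (v, k) \<otimes>\<^sub>k mt (x \<ominus>\<^sub>p w, n) (y \<ominus>\<^sub>p v, k)"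
        using B.mul2_b[of "(w, n)" "(x \<ominus>\<^sub>p w, n)" "(v, k)" "(y \<ominus>\<^sub>p v, k)"] wv g h by (simp add: in_J)
      then show "hmul2 model (cf (snd g) w (fst g \<ominus>\<^sub>p w) \<bullet> (bb w (snd g) \<otimes>\<^sub>k bb (fst g \<ominus>\<^sub>p w) (snd g))) (cf (snd h) v (fst h \<ominus>\<^sub>p v) \<bullet> (bb v (snd h) \<otimes>\<^sub>k bb (fst h \<ominus>\<^sub>p v) (snd h)))
        = (if v = ac n w then (if y = ac n x then cf ((n + k) mod m) w (x \<ominus>\<^sub>p w) \<bullet> (bb w ((n + k) mod m) \<otimes>\<^sub>k bb (x \<ominus>\<^sub>p w) ((n + k) mod m)) else 0) else 0)"
        using g h e c by (auto simp: mt_def mult.commute)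
    qed
    also have "\<dots> = (if y = ac n x then (\<Sum>w\<in>H. cf ((n + k) mod m) w (x \<ominus>\<^sub>p w) \<bullet> (bb w ((n + k) mod m) \<otimes>\<^sub>k bb (x \<ominus>\<^sub>p w) ((n + k) mod m))) else 0)"
      by simp
    also have "\<dots> = hcomult model (mt g h)" using g h nk by (simp add: mt_def D_bb)
    finally show ?thesis ..
  qed
  fix l assume l0: "l \<in> J"
  obtain z s where l: "l = (z, s)" "z \<in> H" "s < m" using l0 by (cases l) (auto simp: in_J)
  show "B.mul (mt g h) (B.b l) = B.mul (B.b g) (mt h l)"
    using g h l nk m1 by (auto simp: mt_def bb_mul ac_mod mod_simps add_ac)
next
  note [simp del] = carrier_DirProd
  have m1: "0 < m" by (rule m0)
  have "hcomult model un = (\<Sum>x\<in>H. \<Sum>w\<in>H. bb w 0 \<otimes>\<^sub>k bb (x \<ominus>\<^sub>p w) 0)"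
    using m1 by (simp add: comult_un D_bb)
  also have "\<dots> = (\<Sum>w\<in>H. \<Sum>x\<in>H. bb w 0 \<otimes>\<^sub>k bb (x \<ominus>\<^sub>p w) 0)" by (rule sum.swap)
  also have "\<dots> = (\<Sum>w\<in>H. \<Sum>z\<in>H. bb w 0 \<otimes>\<^sub>k bb z 0)"
  proof (rule sum.cong[OF refl])
    fix w assume "w \<in> H"
    then show "(\<Sum>x\<in>H. bb w 0 \<otimes>\<^sub>k bb (x \<ominus>\<^sub>p w) 0) = (\<Sum>z\<in>H. bb w 0 \<otimes>\<^sub>k bb z 0)"
      by (rule sum_shift_right[of _ "\<lambda>_ z. bb w 0 \<otimes>\<^sub>k bb z 0"])
  qed
  finally show "hcomult model un = un \<otimes>\<^sub>k un" by (simp add: un_def tens_sum_left tens_sum_right) (rule sum.swap)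
  have "hcounit model un = (\<Sum>x\<in>H. if x = (0, 0) then 1 else 0)"
    using m1 by (simp add: counit_un eps_bb)
  then show "hcounit model un = 1" by simp
qed

end

section \<open>The models as cocentral extensions\<close>

context model_data
begin

abbreviation Z :: "(int, 'k) hopf_data" where "Z \<equiv> group_hopf (integer_mod_group m)"
abbreviation F :: "(int \<times> int, 'k) hopf_data" where "F \<equiv> fun_hopf G"

text \<open>Applies the counit of the function algebra to the coefficient of each power of
  u.\<close>

definition quot :: "(nat \<Rightarrow> 'k) \<Rightarrow> int \<Rightarrow> 'k" where
  "quot a = (\<lambda>l. if l \<in> {0..<int m} then a (to_nat ((0, 0) :: int \<times> int, nat l)) else 0)"

definition incl :: "(int \<times> int \<Rightarrow> 'k) \<Rightarrow> nat \<Rightarrow> 'k" where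
  "incl f = (\<Sum>x\<in>H. f x \<bullet> bb x 0)"

lemma carrier_Z: "carrier (integer_mod_group m) = {0..<int m}"
  using m0 by (simp add: carrier_integer_mod_group)

lemma quot_simps [simp]:
  "quot (a + c) = quot a + quot c" "quot (x \<bullet> a) = x \<bullet> quot a" "quot 0 = 0" "quot a \<in> fspace {0..<int m}"
  by (auto simp: quot_def fspace_def smul_def fun_eq_iff)

lemma quot_bb: "x \<in> H \<Longrightarrow> n < m \<Longrightarrow> quot (bb x n) = (if x = (0, 0) then basis_vec (int n) else 0)"
  by (auto simp: quot_def basis_vec_def fun_eq_iff)

lemma quot_linear: "linear_map (to_nat ` J) {0..<int m} quot"
  by (rule linear_mapI) simp_all

lemma Z_mult_simps [simp]:
  "hmult Z (t + s) = hmult Z t + hmult Z s" "hmult Z (c \<bullet> t) = c \<bullet> hmult Z t" "hmult Z 0 = 0"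
  by (simp_all add: group_hopf_def fun_eq_iff case_prod_beta sum.distrib smul_apply sum_distrib_left)

lemma Z_mult_basis:
  assumes "n < m" "k < m"
  shows "hmult Z (basis_vec (int n) \<otimes>\<^sub>k basis_vec (int k)) = basis_vec (int ((n + k) mod m))"
proof
  fix z :: int
  let ?S = "{(x, y) \<in> {0..<int m} \<times> {0..<int m}. (x + y) mod int m = z}"
  have fS: "finite ?S" by (rule finite_subset[of _ "{0..<int m} \<times> {0..<int m}"]) auto
  have "hmult Z (basis_vec (int n) \<otimes>\<^sub>k basis_vec (int k)) z = (\<Sum>s\<in>?S. (basis_vec (int n) \<otimes>\<^sub>k basis_vec (int k)) s)"
    by (simp add: group_hopf_def carrier_Z case_prod_beta)
  also have "\<dots> = (\<Sum>s\<in>?S. if s = (int n, int k) then 1 else 0)"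
    by (intro sum.cong refl) (auto simp: tens_def basis_vec_def split: if_splits)
  also have "\<dots> = (if (int n, int k) \<in> ?S then 1 else 0)" using fS by simp
  also have "\<dots> = basis_vec (int ((n + k) mod m)) z" using assms by (auto simp: basis_vec_def zmod_int)
  finally show "hmult Z (basis_vec (int n) \<otimes>\<^sub>k basis_vec (int k)) z = basis_vec (int ((n + k) mod m)) z" .
qed

lemma Z_comult_simps [simp]:
  "hcomult Z (a + c) = hcomult Z a + hcomult Z c" "hcomult Z (x \<bullet> a) = x \<bullet> hcomult Z a" "hcomult Z 0 = 0"
  "hcomult Z (basis_vec l) = basis_vec l \<otimes>\<^sub>k basis_vec l"
  by (auto simp: group_hopf_def fun_eq_iff smul_apply tens_def basis_vec_def)

lemma b_cases: "g \<in> J \<Longrightarrow> \<exists>x n. g = (x, n) \<and> x \<in> H \<and> n < m"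
  by (cases g) (auto simp: in_J simp del: carrier_DirProd)

lemma quot_map: "hopf_map model Z quot"
proof -
  note [simp del] = carrier_DirProd
  have mult: "quot (B.mul a c) = hmult Z (quot a \<otimes>\<^sub>k quot c)" if a: "a \<in> fspace (to_nat ` J)" and c: "c \<in> fspace (to_nat ` J)" for a c
  proof (rule B.b_ext[of "\<lambda>a. quot (B.mul a c)" "\<lambda>a. hmult Z (quot a \<otimes>\<^sub>k quot c)", OF _ _ _ _ _ a])
    fix g assume "g \<in> J"
    then obtain x n where g: "g = (x, n)" "x \<in> H" "n < m" using b_cases by blast
    show "quot (B.mul (B.b g) c) = hmult Z (quot (B.b g) \<otimes>\<^sub>k quot c)"
    proof (rule B.b_ext[of "\<lambda>c. quot (B.mul (B.b g) c)" "\<lambda>c. hmult Z (quot (B.b g) \<otimes>\<^sub>k quot c)", OF _ _ _ _ _ c])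
      fix h assume "h \<in> J"
      then obtain y k where h: "h = (y, k)" "y \<in> H" "k < m" using b_cases by blast
      have "(n + k) mod m < m" using m0 by simp
      then show "quot (B.mul (B.b g) (B.b h)) = hmult Z (quot (B.b g) \<otimes>\<^sub>k quot (B.b h))"
        using g h ac_eq_iff[OF g(2), of "(0, 0)" n] by (auto simp: bb_mul quot_bb Z_mult_basis)
    qed simp_all
  qed simp_all
  have comult: "hcomult Z (quot a) = tens_map (to_nat ` J) (to_nat ` J) quot quot (hcomult model a)" if a: "a \<in> fspace (to_nat ` J)" for a
  proof (rule B.b_ext[of "\<lambda>a. hcomult Z (quot a)" "\<lambda>a. tens_map (to_nat ` J) (to_nat ` J) quot quot (hcomult model a)", OF _ _ _ _ _ a])
    fix g assume "g \<in> J"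
    then obtain x n where g: "g = (x, n)" "x \<in> H" "n < m" using b_cases by blast
    have "tens_map (to_nat ` J) (to_nat ` J) quot quot (hcomult model (bb x n))
      = (\<Sum>w\<in>H. if w = (0, 0) then quot (bb (0, 0) n) \<otimes>\<^sub>k quot (bb x n) else 0)"
      unfolding D_bb[OF g(2,3)] tens_map_sum by (intro sum.cong refl) (use g in \<open>auto simp: tens_map_bb quot_bb[of _ n]\<close>)
    then show "hcomult Z (quot (B.b g)) = tens_map (to_nat ` J) (to_nat ` J) quot quot (hcomult model (B.b g))"
      using g by (simp add: quot_bb)
  qed simp_all
  have unit: "quot un = hunit Z"
  proof -
    have "quot un = (\<Sum>x\<in>H. quot (bb x 0))" unfolding un_def by (rule additive_sum[of quot]) simp_all
    also have "\<dots> = (\<Sum>x\<in>H. if x = (0, 0) then basis_vec 0 else 0)" by (intro sum.cong refl) (use m0 in \<open>simp add: quot_bb\<close>)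
    finally show ?thesis by (simp add: group_hopf_def)
  qed
  have counit: "hcounit Z (quot a) = hcounit model a" if a: "a \<in> fspace (to_nat ` J)" for a
  proof -
    have "(\<lambda>_::unit. hcounit Z (quot a)) = (\<lambda>_. hcounit model a)"
    proof (rule B.b_ext[of "\<lambda>a (_::unit). hcounit Z (quot a)" "\<lambda>a _. hcounit model a", OF _ _ _ _ _ a])
      fix g assume "g \<in> J"
      then obtain x n where g: "g = (x, n)" "x \<in> H" "n < m" using b_cases by blast
      have "(\<Sum>l\<in>{0..<int m}. basis_vec (int n) l) = (1 :: 'k)"
        using g by (simp add: basis_vec_def)
      then show "(\<lambda>_::unit. hcounit Z (quot (B.b g))) = (\<lambda>_. hcounit model (B.b g))"
        using g by (simp add: quot_bb eps_bb group_hopf_def carrier_Z)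
    qed (simp_all add: group_hopf_def fun_eq_iff smul_apply sum.distrib sum_distrib_left)
    then show ?thesis by (simp add: fun_eq_iff)
  qed
  have iZ: "index Z = {0..<int m}" by (simp add: group_hopf_def carrier_Z)
  show ?thesis
    unfolding hopf_map_def using quot_linear mult comult unit counit
    by (simp add: iZ hspace_def B.hmult_mul)
qed

lemma incl_simps [simp]:
  "incl (a + c) = incl a + incl c" "incl (x \<bullet> a) = x \<bullet> incl a" "incl 0 = 0" "incl a \<in> fspace (to_nat ` J)"
proof -
  show "incl a \<in> fspace (to_nat ` J)" unfolding incl_def by (intro fspace_sum fspace_closed) (use m0 in \<open>simp_all add: in_J del: carrier_DirProd\<close>)
qed (simp_all add: incl_def sum.distrib smul_sum smul_apply del: carrier_DirProd)

lemma incl_basis: "x \<in> H \<Longrightarrow> incl (basis_vec x) = bb x 0"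
proof -
  assume x: "x \<in> H"
  have "incl (basis_vec x) = (\<Sum>y\<in>H. if y = x then bb x 0 else 0)"
    unfolding incl_def by (intro sum.cong refl) (auto simp: basis_vec_def[of x])
  then show ?thesis using x by (simp del: carrier_DirProd)
qed

lemma incl_coord: fixes n :: nat shows "x \<in> H \<Longrightarrow> incl f (to_nat (x, n)) = (if n = 0 then f x else 0)"
proof -
  assume x: "x \<in> H"
  have "incl f (to_nat (x, n)) = (\<Sum>y\<in>H. if y = x then (if n = 0 then f x else 0) else 0)"
    unfolding incl_def sum_fun_apply by (intro sum.cong refl) (auto simp: basis_vec_def smul_apply)
  then show ?thesis using x by (simp del: carrier_DirProd)
qed

lemma F_simps: "index F = H" "hspace F = fspace H" "hunit F = (\<lambda>x. if x \<in> H then 1 else 0)"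
  "hmult F t = (\<lambda>x. t (x, x))" "hcounit F f = f (0, 0)"
  "hcomult F f = (\<lambda>(x, y). if x \<in> H \<and> y \<in> H then f (x \<oplus>\<^sub>p y) else 0)"
  by (simp_all add: fun_hopf_def hspace_def ad_def mult_Zp2 fun_eq_iff del: carrier_DirProd mult_DirProd)

lemma incl_map: "hopf_map F model incl"
  unfolding hopf_map_def F_simps
proof (intro conjI ballI)
  note [simp del] = carrier_DirProd
  have m1: "0 < m" by (rule m0)
  show "linear_map H (index model) incl" by (rule linear_mapI) simp_all
  have "incl (\<lambda>x. if x \<in> H then 1 else 0) = un" unfolding incl_def un_def by (intro sum.cong refl) simp
  then show "incl (\<lambda>x. if x \<in> H then 1 else 0) = hunit model" by simp
  fix f :: "int \<times> int \<Rightarrow> 'k" assume f: "f \<in> fspace H"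
  have "hcounit model (incl f) = (\<Sum>x\<in>H. if x = (0, 0) then f (0, 0) else 0)"
  proof -
    have "hcounit model (incl f) = (\<Sum>x\<in>H. f x * (if x = (0, 0) then 1 else 0))"
      unfolding incl_def using m1 by (subst B.counit_sum) (simp_all add: eps_bb)
    also have "\<dots> = (\<Sum>x\<in>H. if x = (0, 0) then f (0, 0) else 0)" by (intro sum.cong refl) auto
    finally show ?thesis .
  qed
  then show "hcounit model (incl f) = f (0, 0)" by simp
  have "hcomult model (incl f) = (\<Sum>x\<in>H. \<Sum>w\<in>H. f x \<bullet> (bb w 0 \<otimes>\<^sub>k bb (x \<ominus>\<^sub>p w) 0))"
    unfolding incl_def using m1 by (subst B.comult_sum) (auto intro!: sum.cong simp: D_bb smul_sum)
  also have "\<dots> = (\<Sum>w\<in>H. \<Sum>x\<in>H. f x \<bullet> (bb w 0 \<otimes>\<^sub>k bb (x \<ominus>\<^sub>p w) 0))" by (rule sum.swap)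
  also have "\<dots> = (\<Sum>w\<in>H. \<Sum>z\<in>H. f (z \<oplus>\<^sub>p w) \<bullet> (bb w 0 \<otimes>\<^sub>k bb z 0))"
  proof (rule sum.cong[OF refl])
    fix w assume "w \<in> H"
    then show "(\<Sum>x\<in>H. f x \<bullet> (bb w 0 \<otimes>\<^sub>k bb (x \<ominus>\<^sub>p w) 0)) = (\<Sum>z\<in>H. f (z \<oplus>\<^sub>p w) \<bullet> (bb w 0 \<otimes>\<^sub>k bb z 0))"
      by (rule sum_shift_right[of _ "\<lambda>x z. f x \<bullet> (bb w 0 \<otimes>\<^sub>k bb z 0)"])
  qed
  also have "\<dots> = tens_map H H incl incl (\<lambda>(x, y). if x \<in> H \<and> y \<in> H then f (x \<oplus>\<^sub>p y) else 0)"
    unfolding tens_map_apply by (intro sum.cong refl) (simp add: incl_basis ad_def add.commute)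
  finally show "hcomult model (incl f) = tens_map H H incl incl (\<lambda>(x, y). if x \<in> H \<and> y \<in> H then f (x \<oplus>\<^sub>p y) else 0)" .
  fix g :: "int \<times> int \<Rightarrow> 'k" assume "g \<in> fspace H"
  have "B.mul (incl f) (incl g) = (\<Sum>x\<in>H. \<Sum>y\<in>H. if y = x then (f x * g x) \<bullet> bb x 0 else 0)"
    unfolding incl_def B.mul_sum_left unfolding B.mul_sum_right
    by (intro sum.cong refl) (use m1 in \<open>auto simp: bb_mul mult.commute\<close>)
  also have "\<dots> = incl (\<lambda>x. f x * g x)" by (simp add: incl_def)
  finally show "incl (\<lambda>x. (f \<otimes>\<^sub>k g) (x, x)) = hmult model (incl f \<otimes>\<^sub>k incl g)"
    by (simp add: tens_apply B.hmult_mul)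
qed

lemma incl_inj: "inj_on incl (hspace F)"
  unfolding F_simps
proof (rule inj_onI, rule ext)
  fix f g x assume fg: "f \<in> fspace H" "g \<in> fspace H" "incl f = incl g"
  show "f x = g x"
  proof (cases "x \<in> H")
    case True
    then show ?thesis using incl_coord[OF True, of f 0] incl_coord[OF True, of g 0] fg(3) by simp
  next
    case False
    then show ?thesis using fg by (cases x) (simp add: fspace_def del: carrier_DirProd)
  qed
qed

lemma quot_surj: "quot ` hspace model = hspace Z"
proof -
  note [simp del] = carrier_DirProd
  have hZ: "hspace Z = fspace {0..<int m}" by (simp add: hspace_def group_hopf_def carrier_Z)
  have "c \<in> quot ` fspace (to_nat ` J)" if c: "c \<in> fspace {0..<int m}" for c
  proof -
    have "c = (\<Sum>l\<in>{0..<int m}. c l \<bullet> basis_vec l)" by (rule basis_expansion) (use c in auto)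
    also have "\<dots> = (\<Sum>l\<in>{0..<int m}. quot (c l \<bullet> bb (0, 0) (nat l)))"
      by (intro sum.cong refl) (simp add: quot_bb nat_less_iff)
    also have "\<dots> = quot (\<Sum>l\<in>{0..<int m}. c l \<bullet> bb (0, 0) (nat l))"
      by (rule additive_sum[of quot, symmetric]) simp_all
    finally have "c = quot (\<Sum>l\<in>{0..<int m}. c l \<bullet> bb (0, 0) (nat l))" .
    moreover have "(\<Sum>l\<in>{0..<int m}. c l \<bullet> bb (0, 0) (nat l)) \<in> fspace (to_nat ` J)"
      by (intro fspace_sum fspace_closed(3) bb_closed) (auto simp: nat_less_iff)
    ultimately show ?thesis by blast
  qed
  moreover have "hspace model = fspace (to_nat ` J)" by (simp add: hspace_def)
  ultimately show ?thesis unfolding hZ by auto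
qed

text \<open>On either side the quotient map keeps only the term whose corresponding leg is at the
  identity of the group, and there the cocycle is 1.\<close>

lemma quot_cocentral: "cocentral model Z quot"
  unfolding cocentral_def hspace_def B.A_simps
proof
  note [simp del] = carrier_DirProd
  fix a :: "nat \<Rightarrow> 'k" assume a: "a \<in> fspace (to_nat ` J)"
  show "tens_map (to_nat ` J) (to_nat ` J) quot (\<lambda>b. b) (hcomult model a) = tens_map (to_nat ` J) (to_nat ` J) quot (\<lambda>b. b) (tens_flip (hcomult model a))"
  proof (rule B.b_ext[of "\<lambda>a. tens_map (to_nat ` J) (to_nat ` J) quot (\<lambda>b. b) (hcomult model a)" "\<lambda>a. tens_map (to_nat ` J) (to_nat ` J) quot (\<lambda>b. b) (tens_flip (hcomult model a))", OF _ _ _ _ _ a])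
    fix g assume "g \<in> J"
    then obtain x n where g: "g = (x, n)" "x \<in> H" "n < m" using b_cases by blast
    have "tens_map (to_nat ` J) (to_nat ` J) quot (\<lambda>b. b) (hcomult model (bb x n)) = (\<Sum>w\<in>H. if w = (0, 0) then basis_vec (int n) \<otimes>\<^sub>k bb x n else 0)"
      unfolding D_bb[OF g(2,3)] tens_map_sum by (intro sum.cong refl) (use g in \<open>auto simp: tens_map_bb quot_bb\<close>)
    moreover have "tens_map (to_nat ` J) (to_nat ` J) quot (\<lambda>b. b) (tens_flip (hcomult model (bb x n))) = (\<Sum>w\<in>H. if w = x then basis_vec (int n) \<otimes>\<^sub>k bb x n else 0)"
      unfolding D_bb[OF g(2,3)] tens_flip_sum tens_map_sum by (intro sum.cong refl) (use g in \<open>auto simp: tens_map_bb quot_bb sub_eq_iff\<close>)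
    ultimately show "tens_map (to_nat ` J) (to_nat ` J) quot (\<lambda>b. b) (hcomult model (B.b g)) = tens_map (to_nat ` J) (to_nat ` J) quot (\<lambda>b. b) (tens_flip (hcomult model (B.b g)))"
      using g by simp
  qed simp_all
qed

lemma coinvariants: "incl ` hspace F = {a \<in> hspace model. tens_map (index model) (index model) (\<lambda>b. b) quot (hcomult model a) = a \<otimes>\<^sub>k hunit Z}"
proof -
  note [simp del] = carrier_DirProd
  \<comment> \<open>The coaction tags the coordinate at (x, n) with the group element n; comparison
    with a \<otimes> 1 therefore leaves exactly the coordinates with n = 0.\<close>
  have E: "tens_map (to_nat ` J) (to_nat ` J) (\<lambda>b. b) quot (hcomult model a) (to_nat (x, n), l) = (if l = int n then a (to_nat (x, n)) else 0)"
    if a: "a \<in> fspace (to_nat ` J)" and x: "x \<in> H" and n: "n < m" for a x n l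
  proof -
    have "(\<lambda>_::unit. tens_map (to_nat ` J) (to_nat ` J) (\<lambda>b. b) quot (hcomult model a) (to_nat (x, n), l)) = (\<lambda>_. if l = int n then a (to_nat (x, n)) else 0)"
    proof (rule B.b_ext[of "\<lambda>a (_::unit). tens_map (to_nat ` J) (to_nat ` J) (\<lambda>b. b) quot (hcomult model a) (to_nat (x, n), l)" "\<lambda>a _. if l = int n then a (to_nat (x, n)) else 0", OF _ _ _ _ _ a])
      fix g assume "g \<in> J"
      then obtain y k where g: "g = (y, k)" "y \<in> H" "k < m" using b_cases by blast
      have "tens_map (to_nat ` J) (to_nat ` J) (\<lambda>b. b) quot (hcomult model (bb y k)) = (\<Sum>w\<in>H. if w = y then bb y k \<otimes>\<^sub>k basis_vec (int k) else 0)"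
        unfolding D_bb[OF g(2,3)] tens_map_sum by (intro sum.cong refl) (use g in \<open>auto simp: tens_map_bb quot_bb sub_eq_iff\<close>)
      then show "(\<lambda>_::unit. tens_map (to_nat ` J) (to_nat ` J) (\<lambda>b. b) quot (hcomult model (B.b g)) (to_nat (x, n), l)) = (\<lambda>_. if l = int n then B.b g (to_nat (x, n)) else 0)"
        using g by (auto simp: tens_apply basis_vec_def)
    qed (simp_all add: fun_eq_iff smul_apply)
    then show ?thesis by (simp add: fun_eq_iff)
  qed
  show ?thesis unfolding hspace_def B.A_simps F_simps
  proof (intro equalityI subsetI)
    fix a assume "a \<in> incl ` fspace H"
    then obtain f where f: "f \<in> fspace H" "a = incl f" by blast
    have a: "a \<in> fspace (to_nat ` J)" using f by simp
    have "tens_map (to_nat ` J) (to_nat ` J) (\<lambda>b. b) quot (hcomult model a) = a \<otimes>\<^sub>k hunit Z"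
    proof
      fix z :: "nat \<times> int"
      obtain s l where z: "z = (s, l)" by (cases z)
      show "tens_map (to_nat ` J) (to_nat ` J) (\<lambda>b. b) quot (hcomult model a) z = (a \<otimes>\<^sub>k hunit Z) z"
      proof (cases "s \<in> to_nat ` J")
        case True
        then obtain x n where s: "s = to_nat (x, n)" "x \<in> H" "n < m" by (auto simp: in_J dest!: b_cases)
        show ?thesis unfolding z s(1) E[OF a s(2,3)]
          using f s(2) by (auto simp: tens_apply group_hopf_def basis_vec_def incl_coord)
      next
        case False
        then have "a s = 0" using a by (simp add: fspace_def)
        moreover have "tens_map (to_nat ` J) (to_nat ` J) (\<lambda>b. b) quot (hcomult model a) (s, l) = 0"
          unfolding tens_map_apply sum_fun_apply smul_apply tens_apply
          using False by (auto simp: basis_vec_def intro!: sum.neutral)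
        ultimately show ?thesis by (simp add: z tens_apply)
      qed
    qed
    then show "a \<in> {a \<in> fspace (to_nat ` J). tens_map (to_nat ` J) (to_nat ` J) (\<lambda>b. b) quot (hcomult model a) = a \<otimes>\<^sub>k hunit Z}" using a by simp
  next
    fix a assume "a \<in> {a \<in> fspace (to_nat ` J). tens_map (to_nat ` J) (to_nat ` J) (\<lambda>b. b) quot (hcomult model a) = a \<otimes>\<^sub>k hunit Z}"
    then have a: "a \<in> fspace (to_nat ` J)" and eq: "tens_map (to_nat ` J) (to_nat ` J) (\<lambda>b. b) quot (hcomult model a) = a \<otimes>\<^sub>k hunit Z" by simp_all
    define f where "f x = (if x \<in> H then a (to_nat (x, 0 :: nat)) else 0)" for x :: "int \<times> int"
    have "a = incl f"
    proof
      fix s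
      show "a s = incl f s"
      proof (cases "s \<in> to_nat ` J")
        case True
        then obtain x n where s: "s = to_nat (x, n)" "x \<in> H" "n < m" by (auto simp: in_J dest!: b_cases)
        show ?thesis using E[OF a s(2,3), of "int n"] eq s(2)
          by (auto simp: s(1) incl_coord f_def tens_apply group_hopf_def basis_vec_def split: if_splits)
      next
        case False
        then show ?thesis using a incl_simps(4)[of f] by (simp add: fspace_def)
      qed
    qed
    moreover have "f \<in> fspace H" by (simp add: f_def fspace_def)
    ultimately show "a \<in> incl ` fspace H" by blast
  qed
qed

theorem model_extension: "cocentral_extension F model Z"
  unfolding cocentral_extension_def
proof (intro exI conjI)
  show "\<forall>b\<in>hspace F. quot (incl b) = (\<lambda>j. hcounit F b * hunit Z j)"
  proof
    note [simp del] = carrier_DirProd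
    fix b :: "int \<times> int \<Rightarrow> 'k"
    have "quot (incl b) = (\<Sum>x\<in>H. quot (b x \<bullet> bb x 0))" unfolding incl_def by (rule additive_sum[of quot]) simp_all
    also have "\<dots> = (\<Sum>x\<in>H. if x = (0, 0) then b (0, 0) \<bullet> basis_vec 0 else 0)"
      by (intro sum.cong refl) (use m0 in \<open>auto simp: quot_bb\<close>)
    finally show "quot (incl b) = (\<lambda>j. hcounit F b * hunit Z j)"
      unfolding F_simps by (simp add: group_hopf_def smul_def)
  qed
qed (rule incl_map incl_inj quot_map quot_surj quot_cocentral coinvariants)+

lemma not_dvd_cases: "\<not> m dvd i \<or> \<not> m dvd j"
  using nd by auto

text \<open>Since m does not divide i + j, it misses i or j, so the action moves a generator x. For
  such x the product of e_x and e_x u depends on the order: it is e_x u or 0.\<close>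

lemma model_noncommutative: "\<not> hopf_commutative model"
proof
  note [simp del] = carrier_DirProd
  assume c: "hopf_commutative model"
  have comm: "B.mul (bb x 0) (bb x 1) = B.mul (bb x 1) (bb x 0)" if "x \<in> H" for x
    using c that m_gt_1 by (auto simp: hopf_commutative_def hspace_def B.hmult_mul)
  have fixed: "ac 1 x = x" if x: "x \<in> H" for x
  proof (rule ccontr)
    assume ne: "ac 1 x \<noteq> x"
    have "bb x 1 = B.mul (bb x 0) (bb x 1)" using x m_gt_1 by (simp add: bb_mul del: One_nat_def)
    also have "\<dots> = B.mul (bb x 1) (bb x 0)" by (rule comm[OF x])
    also have "\<dots> = 0" using x m_gt_1 ne by (simp add: bb_mul del: One_nat_def)
    finally have "bb x 1 (to_nat (x, 1 :: nat)) = 0" by simp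
    then show False by (simp add: basis_vec_def)
  qed
  have "(1, 0) \<in> H" "(0, 1) \<in> H" unfolding carrier_G using p_gt_1 by simp_all
  then have "\<gamma> ^ i mod int p = 1" "\<gamma> ^ j mod int p = 1"
    using fixed[of "(1, 0)"] fixed[of "(0, 1)"] by (simp_all add: ac_def diag_act_def)
  then show False using \<gamma> not_dvd_cases by simp
qed

text \<open>In the coproduct of the degree 1 basis vector at (1, 1) the legs (0, 1) and (1, 0) have
  coefficient \<open>\<omega>\<close>, in the opposite order 1.\<close>

lemma model_noncocommutative: "\<not> hopf_cocommutative model"
proof
  note [simp del] = carrier_DirProd
  assume c: "hopf_cocommutative model"
  have gens: "(1, 0) \<in> H" "(0, 1) \<in> H" "(1, 1) \<in> H" unfolding carrier_G using p_gt_1 by simp_all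
  have coord: "hcomult model (bb x n) (to_nat (w, n), to_nat (z, n)) = (if z = x \<ominus>\<^sub>p w then cf n w z else 0)"
    if "x \<in> H" "n < m" "w \<in> H" "z \<in> H" for x w z n
  proof -
    have "hcomult model (bb x n) (to_nat (w, n), to_nat (z, n)) = (\<Sum>v\<in>H. if v = w then (if z = x \<ominus>\<^sub>p w then cf n w z else 0) else 0)"
      unfolding D_bb[OF that(1,2)] sum_fun_apply
      by (intro sum.cong refl) (auto simp: smul_apply tens_apply basis_vec_def)
    then show ?thesis using that by simp
  qed
  let ?t = "hcomult model (bb (1, 1) 1)"
  have "tens_flip ?t = ?t" using c gens m_gt_1 by (auto simp: hopf_cocommutative_def hspace_def)
  then have "tens_flip ?t (to_nat ((0, 1) :: int \<times> int, 1 :: nat), to_nat ((1, 0) :: int \<times> int, 1 :: nat)) = ?t (to_nat ((0, 1) :: int \<times> int, 1 :: nat), to_nat ((1, 0) :: int \<times> int, 1 :: nat))" by simp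
  moreover have "(1, 1) \<ominus>\<^sub>p (1, 0) = (0, 1)" "(1, 1) \<ominus>\<^sub>p (0, 1) = (1, 0)" using p_gt_1 by (simp_all add: sb_def)
  moreover have "?t (to_nat ((0, 1) :: int \<times> int, 1 :: nat), to_nat ((1, 0) :: int \<times> int, 1 :: nat)) = (if (1, 0) = (1, 1) \<ominus>\<^sub>p (0, 1) then cf 1 (0, 1) (1, 0) else 0)"
    by (rule coord[OF gens(3) m_gt_1 gens(2,1)])
  moreover have "?t (to_nat ((1, 0) :: int \<times> int, 1 :: nat), to_nat ((0, 1) :: int \<times> int, 1 :: nat)) = (if (0, 1) = (1, 1) \<ominus>\<^sub>p (1, 0) then cf 1 (1, 0) (0, 1) else 0)"
    by (rule coord[OF gens(3) m_gt_1 gens(1,2)])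
  ultimately have "cf 1 (1, 0) (0, 1) = cf 1 (0, 1) (1, 0)"
    by (simp only: tens_flip_def case_prod_conv simp_thms if_True)
  then have "cpow p \<omega> 1 = 1" by (simp add: cf_def N_def)
  then show False using cpow_\<omega>_eq_1[of 1] p_gt_1 by simp
qed

text \<open>The sum of all basis vectors of degree 1 is a unit, inverse to the sum in degree m - 1;
  its m-th power is 1 and its cocycle is the bicharacter, so the model is in normal form by
  construction.\<close>

theorem model_types: "(i, j) \<in> types model"
proof -
  note [simp del] = carrier_DirProd
  have m1: "0 < m" "1 < m" "m - 1 < m" using m_gt_1 by simp_all
  define \<pi> where "\<pi> l s = quot (basis_vec s) (l mod int m)" for l and s :: nat
  define e where "e x = incl (basis_vec x)" for x
  have "pre_frame model m \<pi> G e"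
    unfolding \<pi>_def e_def
    by (rule pre_frame_of_extension[OF model_hopf group_Zp2 finH m0 incl_map incl_inj quot_map quot_surj quot_cocentral coinvariants])
  then interpret PF: pre_frame model m \<pi> G e .
  have e_bb: "e x = bb x 0" if "x \<in> H" for x using that by (simp add: e_def incl_basis)
  define u where "u = (\<Sum>x\<in>H. bb x 1)"
  define v where "v = (\<Sum>x\<in>H. bb x (m - 1))"
  have bV: "bb x n \<in> PF.V" if "x \<in> H" "n < m" for x n using that by simp
  have pair: "pairing (to_nat ` J) (\<pi> 1) (bb y 1) = (if y = (0, 0) then 1 else 0)" if "y \<in> H" for y
  proof -
    have "pairing (to_nat ` J) (\<pi> 1) (bb y 1) = \<pi> 1 (to_nat (y, 1 :: nat))"
      by (rule pairing_basis_vec) (use that m1 B.finJ in \<open>simp_all add: in_J\<close>)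
    also have "\<dots> = quot (bb y 1) (1 mod int m)" by (simp add: \<pi>_def)
    also have "quot (bb y 1) = (if y = (0, 0) then basis_vec (int 1) else 0)" by (rule quot_bb[OF that m1(2)])
    also have "\<dots> (1 mod int m) = (if y = (0, 0) then 1 else 0)" using m1 by (simp add: basis_vec_def)
    finally show ?thesis .
  qed
  have u_V: "u \<in> PF.V" unfolding u_def by (intro fspace_sum bV m1)
  have P_bb: "PF.P 1 (bb x 1) = bb x 1" if x: "x \<in> H" for x
  proof -
    have "PF.P 1 (bb x 1) = slice_right (to_nat ` J) (\<pi> 1) (hcomult model (bb x 1))"
      using x m1 by (simp add: PF.R_def hdelta_def)
    also have "\<dots> = (\<Sum>w\<in>H. if w = x then bb x 1 else 0)"
      unfolding D_bb[OF x m1(2)] slice_right_sum by (intro sum.cong refl) (use x in \<open>auto simp: pair[unfolded One_nat_def] sub_eq_iff\<close>)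
    finally show ?thesis using x by simp
  qed
  have u_piece: "u \<in> PF.piece 1"
    using u_V P_bb by (simp add: PF.piece_def u_def PF.R_sum del: One_nat_def)
  have bm: "(1 + (m - 1)) mod m = 0" "(m - 1 + 1) mod m = 0" using m1 by simp_all
  have uv: "B.mul u v = un"
  proof -
    have "B.mul u v = (\<Sum>x\<in>H. \<Sum>y\<in>H. if y = ac 1 x then bb x 0 else 0)"
      unfolding u_def v_def B.mul_sum_left unfolding B.mul_sum_right
      by (intro sum.cong refl) (use m1 bm in \<open>simp add: bb_mul del: One_nat_def\<close>)
    then show ?thesis by (simp add: un_def)
  qed
  have vu: "B.mul v u = un"
  proof -
    have "B.mul v u = (\<Sum>x\<in>H. \<Sum>y\<in>H. if y = ac (m - 1) x then bb x 0 else 0)"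
      unfolding u_def v_def B.mul_sum_left unfolding B.mul_sum_right
      by (intro sum.cong refl) (use m1 bm in \<open>simp add: bb_mul del: One_nat_def\<close>)
    then show ?thesis by (simp add: un_def)
  qed
  have ac1: "ac 1 = diag_act p \<gamma> i j" by (simp add: ac_def)
  have eu: "B.mul (e x) u = bb x 1" if x: "x \<in> H" for x
  proof -
    have "B.mul (e x) u = (\<Sum>y\<in>H. if y = x then bb x 1 else 0)"
      unfolding e_bb[OF x] u_def B.mul_sum_right by (intro sum.cong refl) (use x m1 in \<open>simp add: bb_mul del: One_nat_def\<close>)
    then show ?thesis using x by simp
  qed
  have ue: "B.mul u (e (ac 1 x)) = bb x 1" if x: "x \<in> H" for x
  proof -
    have "B.mul u (e (ac 1 x)) = (\<Sum>y\<in>H. if y = x then bb x 1 else 0)"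
      unfolding e_bb[OF H_closed(1)] u_def B.mul_sum_left
      by (intro sum.cong refl) (use x m1 in \<open>auto simp: bb_mul ac_eq_iff simp del: One_nat_def\<close>)
    then show ?thesis using x by simp
  qed
  interpret HF: hopf_frame model m \<pi> G e u v "diag_act p \<gamma> i j"
  proof unfold_locales
    show "v \<in> PF.V" unfolding v_def by (intro fspace_sum bV m1)
    show "diag_act p \<gamma> i j x \<in> H" for x by (rule diag_closed)
    show "B.mul (e x) u = B.mul u (e (diag_act p \<gamma> i j x))" if "x \<in> H" for x
      using eu[OF that] ue[OF that] by (simp add: ac1 del: One_nat_def)
  qed (use u_piece uv vu in simp_all)
  have bas: "HF.bas y 1 = bb y 1" if "y \<in> H" for y by (simp only: HF.bas_def PF.pow_one(2)[OF u_V] eu[OF that])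
  have cf1: "cf 1 w z = bichar p \<omega> w z" for w z by (simp add: cf_def N_def bichar_def)
  have "hdelta model u = (\<Sum>x\<in>H. \<Sum>w\<in>H. cf 1 w (x \<ominus>\<^sub>p w) \<bullet> (bb w 1 \<otimes>\<^sub>k bb (x \<ominus>\<^sub>p w) 1))"
    unfolding u_def PF.D_sum by (intro sum.cong refl) (use m1 in \<open>simp add: hdelta_def D_bb del: One_nat_def\<close>)
  also have "\<dots> = (\<Sum>w\<in>H. \<Sum>x\<in>H. cf 1 w (x \<ominus>\<^sub>p w) \<bullet> (bb w 1 \<otimes>\<^sub>k bb (x \<ominus>\<^sub>p w) 1))" by (rule sum.swap)
  also have "\<dots> = (\<Sum>w\<in>H. \<Sum>z\<in>H. bichar p \<omega> w z \<bullet> (HF.bas w 1 \<otimes>\<^sub>k HF.bas z 1))"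
  proof (rule sum.cong[OF refl])
    fix w assume w: "w \<in> H"
    have "(\<Sum>x\<in>H. cf 1 w (x \<ominus>\<^sub>p w) \<bullet> (bb w 1 \<otimes>\<^sub>k bb (x \<ominus>\<^sub>p w) 1)) = (\<Sum>z\<in>H. cf 1 w z \<bullet> (bb w 1 \<otimes>\<^sub>k bb z 1))"
      by (rule sum_shift_right[OF w, of "\<lambda>_ z. cf 1 w z \<bullet> (bb w 1 \<otimes>\<^sub>k bb z 1)"])
    then show "(\<Sum>x\<in>H. cf 1 w (x \<ominus>\<^sub>p w) \<bullet> (bb w 1 \<otimes>\<^sub>k bb (x \<ominus>\<^sub>p w) 1)) = (\<Sum>z\<in>H. bichar p \<omega> w z \<bullet> (HF.bas w 1 \<otimes>\<^sub>k HF.bas z 1))"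
      using w by (simp add: cf1 bas del: One_nat_def)
  qed
  finally have Du: "hdelta model u = (\<Sum>w\<in>H. \<Sum>z\<in>H. bichar p \<omega> w z \<bullet> (HF.bas w 1 \<otimes>\<^sub>k HF.bas z 1))" .
  have C: "cocycle_frame model m \<pi> G e u v (diag_act p \<gamma> i j) (bichar p \<omega>)"
    by unfold_locales (rule Du)
  have up: "hpow model u n = (\<Sum>x\<in>H. bb x (n mod m))" for n
  proof (induction n)
    \<comment> \<open>The power 0 is the unit, which is the sum of the basis vectors of degree
      0.\<close>
    case 0 show ?case by (simp only: hpow.simps B.A_simps mod_0 un_def[symmetric])
  next
    case (Suc n)
    have "hpow model u (Suc n) = (\<Sum>x\<in>H. \<Sum>y\<in>H. if y = ac (n mod m) x then bb x (Suc n mod m) else 0)"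
      unfolding hpow.simps Suc unfolding u_def B.mul_sum_left unfolding B.mul_sum_right
      by (intro sum.cong refl) (use m1 in \<open>simp add: bb_mul mod_simps\<close>)
    then show ?case by simp
  qed
  have "hpow model u m = hunit model" unfolding up by (simp only: B.A_simps mod_self un_def[symmetric])
  from normal_frameI[OF C this] show ?thesis unfolding types_def by blast
qed

end

section \<open>Counting the types\<close>

text \<open>If fixed points are counted twice, every fibre {x, \<tau> x} of \<open>K\<close> has
  weight 2.\<close>

lemma two_card_image_involution:
  assumes "finite S" and \<tau>: "\<And>x. x \<in> S \<Longrightarrow> \<tau> x \<in> S"
    and K: "\<And>x y. x \<in> S \<Longrightarrow> y \<in> S \<Longrightarrow> K x = K y \<longleftrightarrow> y = x \<or> y = \<tau> x"
  shows "2 * card (K ` S) = card S + card {x \<in> S. \<tau> x = x}"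
proof -
  let ?g = "\<lambda>x. 1 + (if \<tau> x = x then 1 else 0 :: nat)"
  have "card S + card {x \<in> S. \<tau> x = x} = sum ?g S"
    unfolding sum.distrib using assms(1) by (simp add: sum.inter_filter[symmetric])
  also have "\<dots> = (\<Sum>z\<in>K ` S. \<Sum>x | x \<in> S \<and> K x = z. ?g x)" by (rule sum.image_gen[OF assms(1)])
  also have "\<dots> = (\<Sum>z\<in>K ` S. 2)"
  proof (rule sum.cong[OF refl])
    fix z assume "z \<in> K ` S"
    then obtain x where x: "x \<in> S" "z = K x" by blast
    have "y \<in> S \<and> K y = z \<longleftrightarrow> y = x \<or> y = \<tau> x" for y using K[OF x(1), of y] \<tau>[OF x(1)] x by metis
    then have fib: "{y. y \<in> S \<and> K y = z} = {x, \<tau> x}" by blast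
    \<comment> \<open>\<open>\<tau>\<close> is an involution because the relation K x = K y is
      symmetric.\<close>
    have "\<tau> x \<noteq> x \<Longrightarrow> \<tau> (\<tau> x) = x" using K[OF \<tau>[OF x(1)] x(1)] K[OF x(1) \<tau>[OF x(1)]] by metis
    then show "(\<Sum>x | x \<in> S \<and> K x = z. ?g x) = 2" unfolding fib by (cases "\<tau> x = x") auto
  qed
  finally show ?thesis by simp
qed

text \<open>Equivalence of exponent pairs: the common unit factor changes the generator of \<int>_m,
  the exchange renumbers the eigenvectors.\<close>

definition proportional :: "nat \<Rightarrow> nat \<times> nat \<Rightarrow> nat \<times> nat \<Rightarrow> bool" where
  "proportional m = (\<lambda>(i, j) (i', j'). \<exists>k. coprime k m \<and>
     ([i' = i * k] (mod m) \<and> [j' = j * k] (mod m) \<or> [i' = j * k] (mod m) \<and> [j' = i * k] (mod m)))"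

lemma cong_mult_cancel_modulus:
  fixes d :: nat
  assumes "d \<noteq> 0" shows "[d * a = d * b] (mod (d * n)) \<longleftrightarrow> [a = b] (mod n)"
  using assms by (simp add: cong_def mod_mult_mult1)

text \<open>Common factors \<open>q\<close> are removed until one entry is prime to
  \<open>q\<close>; this happens before \<open>r\<close> steps because otherwise q^r would divide
  the sum.\<close>

lemma prime_power_extract:
  fixes q :: nat
  assumes "prime q" "\<not> q ^ r dvd i + j"
  shows "\<exists>s i1 j1. s < r \<and> i = q ^ s * i1 \<and> j = q ^ s * j1 \<and> (\<not> q dvd i1 \<or> \<not> q dvd j1)"
  using assms(2)
proof (induction r arbitrary: i j)
  case 0 then show ?case by simp
next
  case (Suc r)
  show ?case
  proof (cases "q dvd i \<and> q dvd j")
    case False then show ?thesis by (intro exI[of _ 0] exI[of _ i] exI[of _ j]) auto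
  next
    case True
    then obtain i' j' where ij: "i = q * i'" "j = q * j'" by (auto elim!: dvdE)
    have "\<not> q ^ r dvd i' + j'" using Suc.prems assms(1) by (auto simp: ij distrib_left[symmetric] prime_gt_0_nat)
    from Suc.IH[OF this] obtain s i1 j1 where "s < r" "i' = q ^ s * i1" "j' = q ^ s * j1" "\<not> q dvd i1 \<or> \<not> q dvd j1" by blast
    then show ?thesis unfolding ij by (intro exI[of _ "Suc s"] exI[of _ i1] exI[of _ j1]) auto
  qed
qed

locale odd_prime_power =
  fixes q r :: nat
  assumes q: "prime q" "odd q"
begin

definition reps :: "(nat \<times> nat) set" where
  "reps = Sigma {..<r} (\<lambda>s. {..<q ^ (r - s)} - {q ^ (r - s) - 1})"

definition rep_type :: "nat \<times> nat \<Rightarrow> nat \<times> nat" where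
  "rep_type = (\<lambda>(s, c). (q ^ s, q ^ s * c))"

lemma q_pos: "q > 0" using q(1) by (rule prime_gt_0_nat)

lemma reps_iff: "(s, c) \<in> reps \<longleftrightarrow> s < r \<and> c < q ^ (r - s) \<and> \<not> q ^ (r - s) dvd c + 1"
proof -
  have "c = q ^ (r - s) - 1 \<longleftrightarrow> q ^ (r - s) dvd c + 1" if "c < q ^ (r - s)"
  proof
    assume "c = q ^ (r - s) - 1" then have "c + 1 = q ^ (r - s)" using that by linarith
    then show "q ^ (r - s) dvd c + 1" by simp
  next
    assume "q ^ (r - s) dvd c + 1" then have "q ^ (r - s) \<le> c + 1" by (rule dvd_imp_le) simp
    then show "c = q ^ (r - s) - 1" using that by simp
  qed
  then show ?thesis by (auto simp: reps_def)
qed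

lemma split_power: "s < r \<Longrightarrow> q ^ r = q ^ s * q ^ (r - s)" by (simp flip: power_add)

lemma coprime_q_power: "\<not> q dvd x \<Longrightarrow> coprime x (q ^ n)"
  using prime_imp_coprime[OF q(1), of x] by (simp add: coprime_commute)

lemma rep_type_good:
  assumes "(s, c) \<in> reps" shows "\<not> q ^ r dvd q ^ s + q ^ s * c"
proof -
  have e: "q ^ s + q ^ s * c = q ^ s * (c + 1)" by simp
  have s: "s < r" "\<not> q ^ (r - s) dvd c + 1" using assms by (simp_all add: reps_iff)
  have "q ^ s \<noteq> 0" using q_pos by simp
  then show ?thesis using s(2) unfolding e split_power[OF s(1)] by (metis dvd_times_left_cancel_iff)
qed

lemma proportional_swap: "proportional m (i, j) x \<longleftrightarrow> proportional m (j, i) x"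
  unfolding proportional_def by (auto split: prod.splits)

text \<open>Multiplication by the inverse of the unit part of an entry with least q-adic valuation
  turns this entry into q^s; if it is the second one, the pair is exchanged beforehand.\<close>

lemma proportional_rep:
  assumes "\<not> q ^ r dvd i + j"
  shows "\<exists>x\<in>reps. proportional (q ^ r) (i, j) (rep_type x)"
proof -
  have main: "\<exists>x\<in>reps. proportional (q ^ r) (i, j) (rep_type x)"
    if nd: "\<not> q ^ r dvd i + j" and s: "s < r" and ij: "i = q ^ s * i1" "j = q ^ s * j1" and i1: "\<not> q dvd i1" for s i j i1 j1
  proof -
    let ?n = "q ^ (r - s)"
    obtain k where k: "[i1 * k = 1] (mod q ^ r)" using cong_solve_coprime_nat[OF coprime_q_power[OF i1]] by auto
    then have "coprime (i1 * k) (q ^ r)" by (metis coprime_1_left cong_imp_coprime cong_sym)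
    then have ck: "coprime k (q ^ r)" by (simp only: coprime_mult_left_iff)
    have "[i1 * k = 1] (mod ?n)" using k by (rule cong_dvd_modulus_nat) (simp add: le_imp_power_dvd)
    then have a: "[q ^ s = i * k] (mod q ^ r)"
      unfolding ij split_power[OF s] using q_pos cong_mult_cancel_modulus[of "q ^ s" 1 "i1 * k" ?n] by (simp add: mult.assoc cong_sym)
    let ?c = "(j1 * k) mod ?n"
    have b: "[q ^ s * ?c = j * k] (mod q ^ r)"
      unfolding ij split_power[OF s] using q_pos cong_mult_cancel_modulus[of "q ^ s" ?c "j1 * k" ?n] by (simp add: mult.assoc)
    have P: "proportional (q ^ r) (i, j) (rep_type (s, ?c))" unfolding proportional_def rep_type_def using ck a b by auto
    \<comment> \<open>The sum of the two entries is multiplied by the unit \<open>k\<close>, so the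
      condition on i + j survives and excludes the residue -1.\<close>
    have "[q ^ s + q ^ s * ?c = (i + j) * k] (mod q ^ r)" using cong_add[OF a b] by (simp add: distrib_right)
    then have "q ^ r dvd q ^ s + q ^ s * ?c \<longleftrightarrow> q ^ r dvd (i + j) * k" by (rule cong_dvd_iff)
    then have "\<not> q ^ r dvd q ^ s * (?c + 1)" using nd ck by (simp add: coprime_dvd_mult_left_iff coprime_commute)
    then have "\<not> ?n dvd ?c + 1" unfolding split_power[OF s] by (meson mult_dvd_mono dvd_refl)
    then have "(s, ?c) \<in> reps" using s q_pos by (simp add: reps_iff)
    then show ?thesis using P by blast
  qed
  obtain s i1 j1 where *: "s < r" "i = q ^ s * i1" "j = q ^ s * j1" "\<not> q dvd i1 \<or> \<not> q dvd j1"
    using prime_power_extract[OF q(1) assms] by blast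
  show ?thesis
  proof (cases "q dvd i1")
    case False then show ?thesis using main[OF assms *(1-3)] by blast
  next
    case True
    then have "\<not> q dvd j1" using *(4) by blast
    then show ?thesis using main[OF _ *(1) *(3) *(2)] assms proportional_swap by (simp add: add.commute)
  qed
qed

text \<open>q^s is recovered as the common q-part of the pair. Modulo q^(r-s), comparing entries
  then gives k = 1 without exchange, and c k = 1 together with c' = k after an exchange.\<close>

lemma proportional_reps:
  assumes x: "(s, c) \<in> reps" and y: "(s', c') \<in> reps"
  shows "proportional (q ^ r) (rep_type (s, c)) (rep_type (s', c')) \<longleftrightarrow> s' = s \<and> (c' = c \<or> [c * c' = 1] (mod q ^ (r - s)))"
proof
  let ?n = "q ^ (r - s)"
  note sx = x[unfolded reps_iff] and sy = y[unfolded reps_iff]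
  have qs: "q ^ s dvd q ^ s' \<Longrightarrow> s \<le> s'" "q ^ s' dvd q ^ s \<Longrightarrow> s' \<le> s"
    using prime_gt_1_nat[OF q(1)] by (simp_all add: power_dvd_imp_le)
  have ds: "q ^ s dvd q ^ r" "q ^ s' dvd q ^ r" using sx sy by (simp_all add: le_imp_power_dvd)
  have cancel: "[q ^ s * a = q ^ s * b] (mod q ^ r) \<longleftrightarrow> [a = b] (mod ?n)" for a b
    using cong_mult_cancel_modulus[of "q ^ s" a b ?n] q_pos sx by (metis split_power power_not_zero not_gr0)
  assume "proportional (q ^ r) (rep_type (s, c)) (rep_type (s', c'))"
  then obtain k where k: "coprime k (q ^ r)"
    and alt: "[q ^ s' = q ^ s * k] (mod q ^ r) \<and> [q ^ s' * c' = q ^ s * c * k] (mod q ^ r)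
      \<or> [q ^ s' = q ^ s * c * k] (mod q ^ r) \<and> [q ^ s' * c' = q ^ s * k] (mod q ^ r)"
    unfolding proportional_def rep_type_def by auto
  have ck: "coprime (q ^ s') k" using k sy by (metis coprime_commute coprime_power_right_iff coprime_power_left_iff gr_implies_not0 gr0I power_0 coprime_1_left)
  have "q ^ s dvd q ^ s'" using alt
  proof (elim disjE conjE)
    assume "[q ^ s' = q ^ s * k] (mod q ^ r)"
    from cong_dvd_modulus_nat[OF this ds(1)] show ?thesis by (simp add: cong_dvd_iff)
  next
    assume "[q ^ s' = q ^ s * c * k] (mod q ^ r)"
    from cong_dvd_modulus_nat[OF this ds(1)] show ?thesis by (simp add: cong_dvd_iff mult.assoc)
  qed
  moreover have "q ^ s' dvd q ^ s * k" using alt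
  proof (elim disjE conjE)
    assume "[q ^ s' = q ^ s * k] (mod q ^ r)"
    from cong_dvd_modulus_nat[OF this ds(2)] show ?thesis by (metis cong_dvd_iff dvd_refl)
  next
    assume "[q ^ s' * c' = q ^ s * k] (mod q ^ r)"
    from cong_dvd_modulus_nat[OF this ds(2)] show ?thesis by (metis cong_dvd_iff dvd_triv_left)
  qed
  then have "q ^ s' dvd q ^ s" using ck by (simp add: coprime_dvd_mult_left_iff)
  ultimately have ss: "s' = s" using qs by simp
  from alt have "c' = c \<or> [c * c' = 1] (mod ?n)"
  proof (elim disjE conjE)
    assume a: "[q ^ s' = q ^ s * k] (mod q ^ r)" "[q ^ s' * c' = q ^ s * c * k] (mod q ^ r)"
    have "[1 = k] (mod ?n)" using a(1) cancel[of 1 k] by (simp add: ss)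
    moreover have "[c' = c * k] (mod ?n)" using a(2) cancel[of c' "c * k"] by (simp add: ss mult.assoc)
    ultimately have "[c' = c * 1] (mod ?n)" by (meson cong_trans cong_sym cong_scalar_left)
    then have "c' = c" using sx sy ss by (simp add: cong_def)
    then show ?thesis ..
  next
    assume a: "[q ^ s' = q ^ s * c * k] (mod q ^ r)" "[q ^ s' * c' = q ^ s * k] (mod q ^ r)"
    have "[1 = c * k] (mod ?n)" using a(1) cancel[of 1 "c * k"] by (simp add: ss mult.assoc)
    moreover have "[c' = k] (mod ?n)" using a(2) cancel[of c' k] by (simp add: ss)
    ultimately have "[c * c' = 1] (mod ?n)" by (meson cong_trans cong_sym cong_scalar_left)
    then show ?thesis ..
  qed
  with ss show "s' = s \<and> (c' = c \<or> [c * c' = 1] (mod ?n))" by blast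
next
  let ?n = "q ^ (r - s)"
  note sx = x[unfolded reps_iff]
  have cancel: "[q ^ s * a = q ^ s * b] (mod q ^ r) \<longleftrightarrow> [a = b] (mod ?n)" for a b
    using cong_mult_cancel_modulus[of "q ^ s" a b ?n] q_pos sx by (metis split_power power_not_zero not_gr0)
  assume "s' = s \<and> (c' = c \<or> [c * c' = 1] (mod ?n))"
  then have ss: "s' = s" and "c' = c \<or> [c * c' = 1] (mod ?n)" by auto
  from this(2) show "proportional (q ^ r) (rep_type (s, c)) (rep_type (s', c'))"
  proof
    assume "c' = c" then show ?thesis unfolding proportional_def rep_type_def ss by (auto intro!: exI[of _ 1])
  next
    assume e: "[c * c' = 1] (mod ?n)"
    then have "coprime (c * c') ?n" by (metis coprime_1_left cong_imp_coprime cong_sym)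
    then have "coprime c' (q ^ r)" using sx by simp
    moreover have "[q ^ s = q ^ s * c * c'] (mod q ^ r)" using e cancel[of 1 "c * c'"] by (simp add: mult.assoc cong_sym)
    ultimately show ?thesis unfolding proportional_def rep_type_def ss by auto
  qed
qed

text \<open>An exchange of entries replaces a unit \<open>c\<close> by its inverse; a non-unit is
  equivalent to no other representative and is declared fixed.\<close>

definition inv_rep :: "nat \<times> nat \<Rightarrow> nat \<times> nat" where
  "inv_rep = (\<lambda>(s, c). (s, if q dvd c then c else SOME d. d < q ^ (r - s) \<and> [c * d = 1] (mod q ^ (r - s))))"

lemma inv_rep_cases:
  assumes x: "(s, c) \<in> reps" and nd: "\<not> q dvd c"
  obtains d where "inv_rep (s, c) = (s, d)" "d < q ^ (r - s)" "[c * d = 1] (mod q ^ (r - s))"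
proof -
  let ?n = "q ^ (r - s)"
  obtain k where k: "[c * k = 1] (mod ?n)" using cong_solve_coprime_nat[OF coprime_q_power[OF nd]] by auto
  have "\<exists>d. d < ?n \<and> [c * d = 1] (mod ?n)"
    using k q_pos by (intro exI[of _ "k mod ?n"]) (simp add: cong_def mod_mult_right_eq)
  from someI_ex[OF this] show ?thesis using nd that by (simp add: inv_rep_def)
qed

lemma inv_rep_closed:
  assumes "x \<in> reps" shows "inv_rep x \<in> reps"
proof (cases x)
  case (Pair s c)
  let ?n = "q ^ (r - s)"
  note x = assms[unfolded Pair]
  show ?thesis
  proof (cases "q dvd c")
    case True then show ?thesis using x by (simp add: Pair inv_rep_def)
  next
    case False
    then obtain d where d: "inv_rep (s, c) = (s, d)" "d < ?n" "[c * d = 1] (mod ?n)" using inv_rep_cases[OF x] by blast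
    \<comment> \<open>Multiplication by \<open>c\<close> takes d + 1 to c + 1, so inversion respects
      the exclusion of the residue -1.\<close>
    have "[c * (d + 1) = c + 1] (mod ?n)" using cong_add[OF d(3) cong_refl[of c]] by (simp add: add.commute)
    then have "?n dvd c * (d + 1) \<longleftrightarrow> ?n dvd c + 1" by (rule cong_dvd_iff)
    then have "\<not> ?n dvd d + 1" using x by (auto simp: reps_iff simp del: mult_Suc_right)
    then show ?thesis using x d by (simp add: reps_iff Pair)
  qed
qed

lemma proportional_reps_inv:
  assumes x: "x \<in> reps" and y: "y \<in> reps"
  shows "proportional (q ^ r) (rep_type x) (rep_type y) \<longleftrightarrow> y = x \<or> y = inv_rep x"
proof (cases x; cases y)
  fix s c s' c' assume xy: "x = (s, c)" "y = (s', c')"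
  let ?n = "q ^ (r - s)"
  note x' = x[unfolded xy] and y' = y[unfolded xy]
  show ?thesis
  proof (cases "q dvd c")
    case True
    have "\<not> [c * c' = 1] (mod ?n)"
    proof
      assume "[c * c' = 1] (mod ?n)"
      then have "[c * c' = 1] (mod q)" by (rule cong_dvd_modulus_nat) (use x' in \<open>simp add: reps_iff\<close>)
      then show False using True q(1) by (metis cong_dvd_iff dvd_mult2 nat_dvd_1_iff_1 not_prime_1)
    qed
    then show ?thesis unfolding xy proportional_reps[OF x' y'] using True by (auto simp: inv_rep_def)
  next
    case False
    then obtain d where d: "inv_rep (s, c) = (s, d)" "d < ?n" "[c * d = 1] (mod ?n)" using inv_rep_cases[OF x'] by blast
    have "[c * c' = 1] (mod ?n) \<longleftrightarrow> c' = d" if "s' = s"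
    proof
      assume "[c * c' = 1] (mod ?n)"
      then have "[c * c' = c * d] (mod ?n)" using d(3) cong_sym cong_trans by blast
      moreover have "coprime c ?n" by (rule coprime_q_power[OF False])
      ultimately have "[c' = d] (mod ?n)" by (simp add: cong_mult_lcancel_nat)
      then show "c' = d" using d(2) y' that by (simp add: cong_def reps_iff)
    qed (use d in simp)
    then show ?thesis unfolding xy proportional_reps[OF x' y'] d(1) by auto
  qed
qed

text \<open>A unit equal to its inverse satisfies (c - 1)(c + 1) = 0. The odd prime \<open>q\<close>
  cannot divide both factors, so one of them is coprime to the modulus and the other is divisible by
  it; c = -1 is excluded in \<open>reps\<close>.\<close>

lemma inv_rep_fixed:
  assumes x: "(s, c) \<in> reps" shows "inv_rep (s, c) = (s, c) \<longleftrightarrow> q dvd c \<or> c = 1"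
proof (cases "q dvd c")
  case True then show ?thesis by (simp add: inv_rep_def)
next
  case False
  let ?n = "q ^ (r - s)"
  note sx = x[unfolded reps_iff]
  obtain d where d: "inv_rep (s, c) = (s, d)" "d < ?n" "[c * d = 1] (mod ?n)" using inv_rep_cases[OF x False] by blast
  have n1: "?n > 1" using sx by (intro one_less_power prime_gt_1_nat q(1)) simp
  show ?thesis
  proof
    assume "inv_rep (s, c) = (s, c)"
    then have "[c * c = 1] (mod ?n)" using d by simp
    then have "[int c * int c = 1] (mod int ?n)" by (metis cong_int_iff of_nat_1 of_nat_mult)
    then have "int ?n dvd int c * int c - 1" by (simp add: cong_iff_dvd_diff)
    then have dv: "int (q ^ (r - s)) dvd (int c - 1) * (int c + 1)" by (simp add: algebra_simps)
    have pc: "int q dvd y" if "\<not> coprime y (int ?n)" for y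
      using prime_imp_coprime[of "int q" y] that q(1) by (auto simp: coprime_commute[of y])
    have "coprime (int c - 1) (int ?n) \<or> coprime (int c + 1) (int ?n)"
    proof (rule ccontr)
      assume "\<not> ?thesis"
      then have "int q dvd int c - 1" "int q dvd int c + 1"
        using pc by blast+
      then have "int q dvd (int c + 1) - (int c - 1)" by (rule dvd_diff[rotated])
      then have "int q dvd 2" by simp
      then have "q dvd 2" by (metis int_dvd_int_iff of_nat_numeral)
      then show False using q by (metis primes_dvd_imp_eq two_is_prime_nat even_numeral dvd_refl)
    qed
    then have "int ?n dvd int c + 1 \<or> int ?n dvd int c - 1"
      using dv by (metis coprime_commute coprime_dvd_mult_left_iff coprime_dvd_mult_right_iff)
    moreover have "\<not> int ?n dvd int c + 1" using sx by (metis int_dvd_int_iff of_nat_1 of_nat_add)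
    ultimately have "[int c = int 1] (mod int ?n)" by (simp add: cong_iff_dvd_diff)
    then have "[c = 1] (mod ?n)" by (simp only: cong_int_iff)
    then show "q dvd c \<or> c = 1" using sx n1 by (simp add: cong_def)
  next
    assume "q dvd c \<or> c = 1"
    then have "c = 1" using False by simp
    then have "[d = 1] (mod ?n)" using d(3) by simp
    then have "d = 1" using d(2) n1 by (metis cong_def mod_less)
    then show "inv_rep (s, c) = (s, c)" using d(1) \<open>c = 1\<close> by simp
  qed
qed

lemma finite_reps: "finite reps" by (auto simp: reps_def)

lemma card_reps_fixed:
  "card reps + card {x \<in> reps. inv_rep x = x} = (\<Sum>i=1..r. q ^ i + q ^ (i - 1))"
proof -
  have q1: "q > 1" by (rule prime_gt_1_nat[OF q(1)])
  have cr: "card reps = (\<Sum>s<r. q ^ (r - s) - 1)"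
    unfolding reps_def using q_pos by (subst card_SigmaI) (auto simp: card_Diff_subset)
  have fx: "{x \<in> reps. inv_rep x = x} = Sigma {..<r} (\<lambda>s. insert 1 {c \<in> {..<q ^ (r - s)}. q dvd c})" (is "_ = ?R")
  proof -
    have "x \<in> reps \<and> inv_rep x = x \<longleftrightarrow> x \<in> ?R" for x
    proof (cases x)
      case (Pair s c)
      let ?n = "q ^ (r - s)"
      \<comment> \<open>Multiples of \<open>q\<close> and c = 1 avoid the residue -1, since
        \<open>q\<close> divides neither 1 nor 2.\<close>
      have *: "\<not> ?n dvd c + 1" "c < ?n" if s: "s < r" and c: "c = 1 \<or> (c < ?n \<and> q dvd c)"
      proof -
        have qn: "q dvd ?n" using s by simp
        show "\<not> ?n dvd c + 1"
        proof
          assume "?n dvd c + 1"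
          then have d: "q dvd c + 1" using qn dvd_trans by blast
          show False using c
          proof
            assume "c = 1"
            then have "q dvd 2" using d by (simp add: numeral_2_eq_2)
            then show False using q by (metis primes_dvd_imp_eq two_is_prime_nat even_numeral dvd_refl)
          next
            assume "c < ?n \<and> q dvd c"
            then have "q dvd 1" using d by (metis dvd_add_right_iff)
            then show False using q1 by simp
          qed
        qed
        show "c < ?n" using c q1 s one_less_power[of q "r - s"] by auto
      qed
      have "x \<in> reps \<and> inv_rep x = x \<longleftrightarrow> (s, c) \<in> reps \<and> (q dvd c \<or> c = 1)"
        using inv_rep_fixed[of s c] Pair by auto
      also have "\<dots> \<longleftrightarrow> x \<in> ?R" unfolding Pair reps_iff using * by auto
      finally show ?thesis .
    qed
    then show ?thesis by blast
  qed
  have "card {c \<in> {..<q ^ (r - s)}. q dvd c} = q ^ (r - s - 1)" if "s < r" for s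
  proof -
    have e: "q ^ (r - s) = q * q ^ (r - s - 1)" using that by (simp flip: power_Suc add: Suc_diff_Suc)
    have "{c \<in> {..<q ^ (r - s)}. q dvd c} = (\<lambda>d. q * d) ` {..<q ^ (r - s - 1)}"
      unfolding e using q_pos by (auto elim!: dvdE)
    moreover have "inj_on (\<lambda>d. q * d) {..<q ^ (r - s - 1)}" using q_pos by (simp add: inj_on_def)
    ultimately show ?thesis by (simp add: card_image)
  qed
  moreover have one: "1 \<notin> {c \<in> {..<q ^ (r - s)}. q dvd c}" for s using q1 by simp
  ultimately have "card {x \<in> reps. inv_rep x = x} = (\<Sum>s<r. q ^ (r - s - 1) + 1)"
    unfolding fx by (subst card_SigmaI) (auto simp del: mem_Collect_eq)
  then have "card reps + card {x \<in> reps. inv_rep x = x} = (\<Sum>s<r. (q ^ (r - s) - 1) + (q ^ (r - s - 1) + 1))"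
    unfolding cr sum.distrib by simp
  \<comment> \<open>The excluded residue -1 and the additional fixed point 1 cancel.\<close>
  also have "\<dots> = (\<Sum>s<r. q ^ (r - s) + q ^ (r - s - 1))" using q_pos by (intro sum.cong) (auto simp: Suc_le_eq)
  also have "\<dots> = (\<Sum>i=1..r. q ^ i + q ^ (i - 1))"
    by (rule sum.reindex_bij_witness[of _ "\<lambda>i. r - i" "\<lambda>s. r - s"]) auto
  finally show ?thesis .
qed

end

lemma hopf_iso_rel_equiv: "equiv {A. fd_hopf_algebra A} (hopf_iso_rel :: (('i, 'k::field) hopf_data \<times> ('i, 'k) hopf_data) set)"
proof (rule equivI)
  show "hopf_iso_rel \<subseteq> {A. fd_hopf_algebra A} \<times> {A :: ('i, 'k) hopf_data. fd_hopf_algebra A}"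
    by (auto simp: hopf_iso_rel_def)
  show "refl_on {A. fd_hopf_algebra A} (hopf_iso_rel :: (('i, 'k) hopf_data \<times> ('i, 'k) hopf_data) set)"
  proof (rule refl_onI)
    fix A :: "('i, 'k) hopf_data" assume "A \<in> {A. fd_hopf_algebra A}"
    then have A: "fd_hopf_algebra A" by simp
    then interpret fd_hopf_algebra A .
    have "hopf_map A A (\<lambda>a. a)"
      unfolding hopf_map_def linear_map_def
      using finite_index comult_linear by (simp add: tens_map_id hspace_def linear_map_def)
    then show "(A, A) \<in> hopf_iso_rel" using A by (auto simp: hopf_iso_rel_def intro!: exI[of _ "\<lambda>a. a"] simp: bij_betw_def inj_on_def)
  qed
  show "sym (hopf_iso_rel :: (('i, 'k) hopf_data \<times> ('i, 'k) hopf_data) set)"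
    by (rule symI) (auto simp: hopf_iso_rel_def intro: hopf_map_inverse bij_betw_inv_into)
  show "trans (hopf_iso_rel :: (('i, 'k) hopf_data \<times> ('i, 'k) hopf_data) set)"
  proof (rule transI)
    fix A B C :: "('i, 'k) hopf_data"
    assume "(A, B) \<in> hopf_iso_rel" "(B, C) \<in> hopf_iso_rel"
    then obtain f g where fg: "hopf_map A B f" "bij_betw f (hspace A) (hspace B)"
      "hopf_map B C g" "bij_betw g (hspace B) (hspace C)"
      and h: "fd_hopf_algebra A" "fd_hopf_algebra B" "fd_hopf_algebra C"
      by (auto simp: hopf_iso_rel_def)
    have "bij_betw (\<lambda>a. g (f a)) (hspace A) (hspace C)" using bij_betw_trans[OF fg(2,4)] by (simp add: comp_def)
    then show "(A, C) \<in> hopf_iso_rel"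
      using hopf_map_comp[OF h(1,2) fg(1,3)] h unfolding hopf_iso_rel_def by blast
  qed
qed

context odd_data
begin

text \<open>An isomorphism carries types along, and types of one algebra are proportional.
  Conversely, powers of the unit and an exchange of coordinates give \<open>A\<close> the type of
  \<open>B\<close>, and a common type yields an isomorphism.\<close>

lemma types_iso_iff:
  fixes A B :: "('i, 'k) hopf_data"
  assumes \<zeta>: "\<zeta> ^ m = (1 :: 'k)" "\<And>j. \<zeta> ^ j = 1 \<longleftrightarrow> m dvd j"
    and A: "fd_hopf_algebra A" "\<not> hopf_cocommutative A" "x \<in> types A"
    and B: "fd_hopf_algebra B" "y \<in> types B"
  shows "(A, B) \<in> hopf_iso_rel \<longleftrightarrow> proportional m x y"
proof -
  obtain i j i' j' where xy: "x = (i, j)" "y = (i', j')" by (metis surj_pair)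
  show ?thesis
  proof
    assume "(A, B) \<in> hopf_iso_rel"
    then obtain f where "hopf_map A B f" "bij_betw f (hspace A) (hspace B)" by (auto simp: hopf_iso_rel_def)
    then have "(i, j) \<in> types B" using types_transport A(3) B(1) xy by blast
    then show "proportional m x y" using types_unique[OF \<zeta>] B(2) unfolding proportional_def xy by simp
  next
    assume "proportional m x y"
    then obtain k where k: "coprime k m"
      "[i * k = i'] (mod m) \<and> [j * k = j'] (mod m) \<or> [j * k = i'] (mod m) \<and> [i * k = j'] (mod m)"
      unfolding proportional_def xy by (auto simp: cong_sym_eq)
    have "(i * k, j * k) \<in> types A" "(j * k, i * k) \<in> types A"
      using types_power[OF _ A(2) k(1)] types_swap[OF _ A(2)] A(3) xy by blast+
    then have "(i', j') \<in> types A" using types_cong k(2) by blast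
    then show "(A, B) \<in> hopf_iso_rel" using types_iso[of i' j' A B] A(1) B xy unfolding hopf_iso_rel_def by blast
  qed
qed

end

theorem theorem5p16:
  fixes p q r :: nat
    and \<H> :: "(nat, 'k::{alg_closed_field, field_char_0}) hopf_data set"
  assumes "prime p" and "odd p" and "prime q" and "odd q" and "r \<ge> 1"
    and "q ^ r dvd p - 1"
  defines "\<H> \<equiv> {A. fd_hopf_algebra A
      \<and> cocentral_extension (fun_hopf (integer_mod_group p \<times>\<times> integer_mod_group p)) A
           (group_hopf (integer_mod_group (q ^ r)))
      \<and> \<not> hopf_commutative A \<and> \<not> hopf_cocommutative A}"
  shows "finite (\<H> // hopf_iso_rel)
    \<and> real (card (\<H> // hopf_iso_rel)) = 1 / 2 * (\<Sum>i=1..r. (real q ^ i + real q ^ (i - 1)))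
    \<and> 1 / 2 * (\<Sum>i=1..r. (real q ^ i + real q ^ (i - 1)))
        = (real q + 1) * (real q ^ r - 1) / (2 * (real q - 1))"
proof -
  let ?m = "q ^ r"
  have p1: "p > 1" by (rule prime_gt_1_nat[OF \<open>prime p\<close>])
  have q1: "q > 1" by (rule prime_gt_1_nat[OF \<open>prime q\<close>])
  \<comment> \<open>A primitive root \<open>g\<close> modulo p raised to the power d = (p - 1) / m
    has order m; this is the \<gamma> of \<open>odd_data\<close>.\<close>
  obtain d where d: "p - 1 = d * ?m" using \<open>q ^ r dvd p - 1\<close> by (metis dvd_div_mult_self)
  have d0: "d > 0" using d p1 by (metis gr0I mult_0 zero_less_diff less_numeral_extra(3))
  obtain g where "residue_primroot p g" using prime_primitive_root_exists[OF p1 \<open>prime p\<close>] by blast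
  then have g: "ord p g = p - 1" using \<open>prime p\<close> by (simp add: residue_primroot_def totient_prime)
  have \<gamma>: "int (g ^ d) ^ k mod int p = 1 \<longleftrightarrow> ?m dvd k" for k
  proof -
    have "int (g ^ d) ^ k mod int p = 1 \<longleftrightarrow> [g ^ (d * k) = 1] (mod p)"
      using p1 by (simp add: cong_def power_mult flip: of_nat_power zmod_int)
    also have "\<dots> \<longleftrightarrow> p - 1 dvd d * k" unfolding ord_divides g ..
    also have "\<dots> \<longleftrightarrow> ?m dvd k" unfolding d using d0 by simp
    finally show ?thesis .
  qed
  have "coprime ?m p"
  proof -
    have "coprime (d * ?m) p" unfolding d[symmetric] using p1 coprime_diff_one_left_nat[of p] by simp
    then show ?thesis by (simp only: coprime_mult_left_iff)
  qed
  moreover obtain \<omega> :: 'k where \<omega>: "\<omega> \<noteq> 1" "\<omega> ^ p = 1" using primitive_root_prime[OF \<open>prime p\<close>] by blast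
  ultimately interpret D: odd_data p ?m "int (g ^ d)" \<omega>
    using \<open>prime p\<close> q1 \<gamma> by unfold_locales auto
  obtain \<zeta> :: 'k where \<zeta>: "\<zeta> ^ ?m = 1" "\<And>j. \<zeta> ^ j = 1 \<longleftrightarrow> ?m dvd j"
    using primitive_root_prime_power[OF \<open>prime q\<close> \<open>r \<ge> 1\<close>] by blast
  interpret Q: odd_prime_power q r using \<open>prime q\<close> \<open>odd q\<close> by unfold_locales
  have model: "\<exists>A\<in>\<H>. x \<in> D.types A" if nd: "\<not> ?m dvd fst x + snd x" for x
  proof -
    interpret M: model_data p ?m "int (g ^ d)" \<omega> "fst x" "snd x" using nd by unfold_locales
    have "M.model \<in> \<H>"
      unfolding \<H>_def using M.model_hopf M.model_extension M.model_noncommutative M.model_noncocommutative by blast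
    then show ?thesis using M.model_types by auto
  qed
  have "\<exists>A\<in>\<H>. Q.rep_type x \<in> D.types A" if "x \<in> Q.reps" for x
    using that Q.rep_type_good by (intro model) (cases x, simp add: Q.rep_type_def)
  \<comment> \<open>One algebra is chosen for each representative; \<open>K\<close> below is its
    isomorphism class.\<close>
  then obtain M where M: "x \<in> Q.reps \<Longrightarrow> M x \<in> \<H> \<and> Q.rep_type x \<in> D.types (M x)" for x
    by metis
  define K where "K x = hopf_iso_rel `` {M x}" for x
  have hopf: "fd_hopf_algebra A" "\<not> hopf_cocommutative A" if "A \<in> \<H>" for A using that by (simp_all add: \<H>_def)
  note eqv = hopf_iso_rel_equiv[where 'i = nat and 'k = 'k]
  \<comment> \<open>Every algebra has a type, every type is proportional to a representative, and
    the algebra chosen for that representative lies in the same class.\<close>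
  have "\<H> // hopf_iso_rel = K ` Q.reps"
  proof (intro equalityI subsetI)
    fix X assume "X \<in> \<H> // hopf_iso_rel"
    then obtain A where A: "A \<in> \<H>" "X = hopf_iso_rel `` {A}" by (auto elim: quotientE)
    obtain i j where ij: "(i, j) \<in> D.types A" using D.types_nonempty[of A] A(1) by (auto simp: \<H>_def)
    obtain x where x: "x \<in> Q.reps" "proportional ?m (i, j) (Q.rep_type x)"
      using Q.proportional_rep[OF D.types_not_dvd[OF ij hopf(2)[OF A(1)]]] by blast
    have "(A, M x) \<in> hopf_iso_rel"
      using D.types_iso_iff[OF \<zeta>, of A "(i, j)" "M x"] hopf A(1) ij x M[OF x(1)] by blast
    then have "X = K x" unfolding A(2) K_def by (rule equiv_class_eq[OF eqv])
    then show "X \<in> K ` Q.reps" using x(1) by blast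
  next
    fix X assume "X \<in> K ` Q.reps"
    then show "X \<in> \<H> // hopf_iso_rel" using M unfolding K_def by (auto intro: quotientI)
  qed
  moreover have "2 * card (K ` Q.reps) = card Q.reps + card {x \<in> Q.reps. Q.inv_rep x = x}"
  proof (rule two_card_image_involution[OF Q.finite_reps Q.inv_rep_closed])
    fix x y assume x: "x \<in> Q.reps" and y: "y \<in> Q.reps"
    have "K x = K y \<longleftrightarrow> (M x, M y) \<in> hopf_iso_rel"
      unfolding K_def using M[OF x] M[OF y] hopf by (intro eq_equiv_class_iff[OF eqv]) auto
    also have "\<dots> \<longleftrightarrow> proportional ?m (Q.rep_type x) (Q.rep_type y)"
      using M[OF x] M[OF y] hopf by (intro D.types_iso_iff[OF \<zeta>]) auto
    also have "\<dots> \<longleftrightarrow> y = x \<or> y = Q.inv_rep x" by (rule Q.proportional_reps_inv[OF x y])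
    finally show "K x = K y \<longleftrightarrow> y = x \<or> y = Q.inv_rep x" .
  qed
  ultimately have fin: "finite (\<H> // hopf_iso_rel)"
    and card: "2 * card (\<H> // hopf_iso_rel) = (\<Sum>i=1..r. q ^ i + q ^ (i - 1))"
    using Q.finite_reps Q.card_reps_fixed by auto
  have "real (card (\<H> // hopf_iso_rel)) = 1 / 2 * (\<Sum>i=1..r. real q ^ i + real q ^ (i - 1))"
    using arg_cong[OF card, of real] by simp
  \<comment> \<open>Telescoping: (q - 1)(q^i + q^(i-1)) = (q + 1)(q^i - q^(i-1)).\<close>
  moreover have closed: "(\<Sum>i=1..n. real q ^ i + real q ^ (i - 1)) * (real q - 1) = (real q + 1) * (real q ^ n - 1)" for n
    by (induction n) (simp_all add: algebra_simps)
  moreover have "1 / 2 * (\<Sum>i=1..r. real q ^ i + real q ^ (i - 1)) = (real q + 1) * (real q ^ r - 1) / (2 * (real q - 1))"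
    unfolding closed[of r, symmetric] using q1 by (simp add: divide_simps del: One_nat_def)
  ultimately show ?thesis using fin by blast
qed

end
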